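(* Let $(\mathcal{T},\otimes,\mathbb{1})$ be a rigidly-compactly generated tensor triangulated category which satisfies the detection property and admits a model. Let $t\in\mathcal{T}$ be an object such that $\mathrm{Supp}(t)\subseteq\mathrm{Spc}(\mathcal{T}^c)$ is a noetherian subspace. Then the local-to-global principle holds for $t$.
   Context: $\mathcal{T}^c$ is the subcategory of compact (= rigid) objects of $\mathcal{T}$ and $\mathrm{Spc}(\mathcal{T}^c)$ is its Balmer spectrum, a spectral space, with its usual topology. A space is noetherian if its open subsets satisfy the ascending chain condition. A subset of $\mathrm{Spc}(\mathcal{T}^c)$ is Thomason if it is a union of closed subsets with quasi-compact complement. Rickard idempotents: for a Thomason subset $Y$, let $\mathcal{T}^c_Y$ be the corresponding thick tensor ideal of compact objects (those whose Balmer support is contained in $Y$). There is an exact triangle $\Gamma_Y\mathbb{1}\to\mathbb{1}\to L_{Y^c}\mathbb{1}\to\Sigma\Gamma_Y\mathbb{1}$ with $\Gamma_Y\mathbb{1}\in \mathrm{Loc}\langle\mathcal{T}^c_Y\rangle$ and $L_{Y^c}\mathbb{1}\in \mathrm{Loc}\langle\mathcal{T}^c_Y\rangle^{\perp}$, where $\mathrm{Loc}\langle -\rangle$ is the generated localizing subcategory. A subset $Z\subseteq\mathrm{Spc}(\mathcal{T}^c)$ is weakly visible if $Z=Y_1\cap Y_2^c$ for Thomason subsets $Y_1,Y_2$; then $g(Z):=\Gamma_{Y_1}\mathbb{1}\otimes L_{Y_2^c}\mathbb{1}$ (independent of the choice up to isomorphism). Tensor triangular support: $\mathrm{Supp}(t)=\{\mathfrak{p}\in\mathrm{Spc}(\mathcal{T}^c)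 : t\otimes g(W)\neq 0 \text{ for every weakly visible } W \text{ containing } \mathfrak{p}\}$. Detection property: $\mathrm{Supp}(t)=\emptyset$ implies $t=0$, for every $t\in\mathcal{T}$. "Admits a model" means: $\mathcal{T}$ is the homotopy category of a stable monoidal model category or of a stable monoidal $\infty$-category, or it is the underlying category of a strong stable monoidal derivator. Local-to-global principle for $t$: for every cover $\{W_i\}_{i\in I}$ of $\mathrm{Spc}(\mathcal{T}^c)$ by weakly visible subsets, $t\in\mathrm{Locid}\langle t\otimes g(W_i): i\in I\rangle$, where $\mathrm{Locid}\langle -\rangle$ denotes the generated localizing tensor ideal. *)

theory Defs
  imports "HOL-Analysis.Analysis" "HOL-Algebra.FiniteProduct"
begin

unbundle cardinal_syntax

section \<open>Universe of discourse\<close>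

text \<open>
  The triangulated category is large, with small hom-sets and coproducts indexed by small sets.
  As usual this is expressed relative to a universe: \<open>U\<close> is a set of (strongly) inaccessible
  cardinality, and a set (of any type) is small if it is of strictly smaller cardinality. Every small
  set is then in bijection with a small subset of \<open>U\<close>, so that coproducts and
  diagrams may be indexed by small subsets of \<open>U\<close>.
\<close>

definition universe :: "'u set \<Rightarrow> bool" where
  "universe U \<longleftrightarrow> natLeq <o |U| \<and> regularCard |U| \<and> (\<forall>A\<subseteq>U. |A| <o |U| \<longrightarrow> |Pow A| <o |U| )"

definition small :: "'u set \<Rightarrow> 'b set \<Rightarrow> bool" where
  "small U A \<longleftrightarrow> |A| <o |U|"


section \<open>Categories\<close>

record ('o, 'm) precat =
  Ob :: "'o set"
  Arr :: "'m set"
  Dom :: "'m \<Rightarrow> 'o"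
  Cod :: "'m \<Rightarrow> 'o"
  Ide :: "'o \<Rightarrow> 'm"
  Comp :: "'m \<Rightarrow> 'm \<Rightarrow> 'm"  (infixl "\<cdot>\<index>" 70)

definition Hom :: "('o, 'm, 'z) precat_scheme \<Rightarrow> 'o \<Rightarrow> 'o \<Rightarrow> 'm set" where
  "Hom C x y = {f \<in> Arr C. Dom C f = x \<and> Cod C f = y}"

definition is_category :: "('o, 'm, 'z) precat_scheme \<Rightarrow> bool" where
  "is_category C \<longleftrightarrow>
    (\<forall>f\<in>Arr C. Dom C f \<in> Ob C \<and> Cod C f \<in> Ob C) \<and>
    (\<forall>x\<in>Ob C. Ide C x \<in> Hom C x x) \<and>
    (\<forall>f\<in>Arr C. \<forall>g\<in>Arr C. Cod C f = Dom C g \<longrightarrow> g \<cdot>\<^bsub>C\<^esub> f \<in> Hom C (Dom C f) (Cod C g)) \<and>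
    (\<forall>f\<in>Arr C. f \<cdot>\<^bsub>C\<^esub> Ide C (Dom C f) = f \<and> Ide C (Cod C f) \<cdot>\<^bsub>C\<^esub> f = f) \<and>
    (\<forall>f\<in>Arr C. \<forall>g\<in>Arr C. \<forall>h\<in>Arr C. Cod C f = Dom C g \<longrightarrow> Cod C g = Dom C h \<longrightarrow>
      h \<cdot>\<^bsub>C\<^esub> (g \<cdot>\<^bsub>C\<^esub> f) = (h \<cdot>\<^bsub>C\<^esub> g) \<cdot>\<^bsub>C\<^esub> f)"

definition op_cat :: "('o, 'm, 'z) precat_scheme \<Rightarrow> ('o, 'm, 'z) precat_scheme" where
  "op_cat C = C\<lparr>Dom := Cod C, Cod := Dom C, Comp := (\<lambda>g f. f \<cdot>\<^bsub>C\<^esub> g)\<rparr>"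

definition full_subcat :: "('o, 'm, 'z) precat_scheme \<Rightarrow> 'o set \<Rightarrow> ('o, 'm, 'z) precat_scheme" where
  "full_subcat C A = C\<lparr>Ob := A, Arr := {f \<in> Arr C. Dom C f \<in> A \<and> Cod C f \<in> A}\<rparr>"

definition is_inverse :: "('o, 'm, 'z) precat_scheme \<Rightarrow> 'm \<Rightarrow> 'm \<Rightarrow> bool" where
  "is_inverse C f g \<longleftrightarrow> f \<in> Arr C \<and> g \<in> Hom C (Cod C f) (Dom C f) \<and>
    g \<cdot>\<^bsub>C\<^esub> f = Ide C (Dom C f) \<and> f \<cdot>\<^bsub>C\<^esub> g = Ide C (Cod C f)"

definition iso_arr :: "('o, 'm, 'z) precat_scheme \<Rightarrow> 'm \<Rightarrow> bool" where
  "iso_arr C f \<longleftrightarrow> (\<exists>g. is_inverse C f g)"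

definition inv_arr :: "('o, 'm, 'z) precat_scheme \<Rightarrow> 'm \<Rightarrow> 'm" where
  "inv_arr C f = (THE g. is_inverse C f g)"

definition isomorphic :: "('o, 'm, 'z) precat_scheme \<Rightarrow> 'o \<Rightarrow> 'o \<Rightarrow> bool" where
  "isomorphic C x y \<longleftrightarrow> (\<exists>f\<in>Hom C x y. iso_arr C f)"

definition initial_ob :: "('o, 'm, 'z) precat_scheme \<Rightarrow> 'o \<Rightarrow> bool" where
  "initial_ob C z \<longleftrightarrow> z \<in> Ob C \<and> (\<forall>x\<in>Ob C. \<exists>!f. f \<in> Hom C z x)"

definition zero_ob :: "('o, 'm, 'z) precat_scheme \<Rightarrow> 'o \<Rightarrow> bool" where
  "zero_ob C z \<longleftrightarrow> initial_ob C z \<and> initial_ob (op_cat C) z"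

definition zero_arr :: "('o, 'm, 'z) precat_scheme \<Rightarrow> 'm \<Rightarrow> bool" where
  "zero_arr C f \<longleftrightarrow> (\<exists>z a b. zero_ob C z \<and> a \<in> Hom C (Dom C f) z \<and> b \<in> Hom C z (Cod C f) \<and>
    f = b \<cdot>\<^bsub>C\<^esub> a)"

definition is_retract :: "('o, 'm, 'z) precat_scheme \<Rightarrow> 'o \<Rightarrow> 'o \<Rightarrow> bool" where
  "is_retract C x y \<longleftrightarrow> (\<exists>i\<in>Hom C x y. \<exists>r\<in>Hom C y x. r \<cdot>\<^bsub>C\<^esub> i = Ide C x)"

definition is_pushout :: "('o, 'm, 'z) precat_scheme \<Rightarrow> 'm \<Rightarrow> 'm \<Rightarrow> 'm \<Rightarrow> 'm \<Rightarrow> bool" where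
  \<comment> \<open>\<open>p\<close> is opposite to \<open>g\<close> and \<open>q\<close> is opposite to \<open>f\<close>\<close>
  "is_pushout C f g p q \<longleftrightarrow>
    f \<in> Arr C \<and> g \<in> Arr C \<and> p \<in> Arr C \<and> q \<in> Arr C \<and>
    Dom C f = Dom C g \<and> Dom C p = Cod C f \<and> Dom C q = Cod C g \<and> Cod C p = Cod C q \<and>
    p \<cdot>\<^bsub>C\<^esub> f = q \<cdot>\<^bsub>C\<^esub> g \<and>
    (\<forall>y\<in>Ob C. \<forall>u\<in>Hom C (Cod C f) y. \<forall>v\<in>Hom C (Cod C g) y. u \<cdot>\<^bsub>C\<^esub> f = v \<cdot>\<^bsub>C\<^esub> g \<longrightarrow>
      (\<exists>!h. h \<in> Hom C (Cod C p) y \<and> h \<cdot>\<^bsub>C\<^esub> p = u \<and> h \<cdot>\<^bsub>C\<^esub> q = v))"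

definition is_coproduct ::
  "('o, 'm, 'z) precat_scheme \<Rightarrow> 'i set \<Rightarrow> ('i \<Rightarrow> 'o) \<Rightarrow> 'o \<Rightarrow> ('i \<Rightarrow> 'm) \<Rightarrow> bool" where
  "is_coproduct C I x s \<iota> \<longleftrightarrow>
    s \<in> Ob C \<and> (\<forall>i\<in>I. x i \<in> Ob C \<and> \<iota> i \<in> Hom C (x i) s) \<and>
    (\<forall>y\<in>Ob C. \<forall>f. (\<forall>i\<in>I. f i \<in> Hom C (x i) y) \<longrightarrow>
      (\<exists>!g. g \<in> Hom C s y \<and> (\<forall>i\<in>I. g \<cdot>\<^bsub>C\<^esub> \<iota> i = f i)))"

record ('o, 'm, 'p, 'n) fn =
  FO :: "'o \<Rightarrow> 'p"
  FA :: "'m \<Rightarrow> 'n"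

definition is_functor ::
  "('o, 'm, 'z) precat_scheme \<Rightarrow> ('p, 'n, 'y) precat_scheme \<Rightarrow> ('o, 'm, 'p, 'n) fn \<Rightarrow> bool" where
  "is_functor C D F \<longleftrightarrow>
    (\<forall>x\<in>Ob C. FO F x \<in> Ob D \<and> FA F (Ide C x) = Ide D (FO F x)) \<and>
    (\<forall>f\<in>Arr C. FA F f \<in> Hom D (FO F (Dom C f)) (FO F (Cod C f))) \<and>
    (\<forall>f\<in>Arr C. \<forall>g\<in>Arr C. Cod C f = Dom C g \<longrightarrow> FA F (g \<cdot>\<^bsub>C\<^esub> f) = FA F g \<cdot>\<^bsub>D\<^esub> FA F f)"

definition fn_id :: "('o, 'm, 'o, 'm) fn" where
  "fn_id = \<lparr>FO = id, FA = id\<rparr>"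

definition fn_comp :: "('p, 'n, 'q, 'k) fn \<Rightarrow> ('o, 'm, 'p, 'n) fn \<Rightarrow> ('o, 'm, 'q, 'k) fn" where
  "fn_comp G F = \<lparr>FO = FO G \<circ> FO F, FA = FA G \<circ> FA F\<rparr>"

definition fn_const :: "('p, 'n, 'y) precat_scheme \<Rightarrow> 'p \<Rightarrow> ('o, 'm, 'p, 'n) fn" where
  "fn_const D k = \<lparr>FO = (\<lambda>_. k), FA = (\<lambda>_. Ide D k)\<rparr>"

definition fn_agree ::
  "('o, 'm, 'z) precat_scheme \<Rightarrow> ('o, 'm, 'p, 'n) fn \<Rightarrow> ('o, 'm, 'p, 'n) fn \<Rightarrow> bool" where
  "fn_agree C F G \<longleftrightarrow> (\<forall>x\<in>Ob C. FO F x = FO G x) \<and> (\<forall>f\<in>Arr C. FA F f = FA G f)"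

definition nat_trans ::
  "('o, 'm, 'z) precat_scheme \<Rightarrow> ('p, 'n, 'y) precat_scheme \<Rightarrow>
    ('o, 'm, 'p, 'n) fn \<Rightarrow> ('o, 'm, 'p, 'n) fn \<Rightarrow> ('o \<Rightarrow> 'n) \<Rightarrow> bool" where
  "nat_trans C D F G \<tau> \<longleftrightarrow>
    (\<forall>x\<in>Ob C. \<tau> x \<in> Hom D (FO F x) (FO G x)) \<and>
    (\<forall>f\<in>Arr C. \<tau> (Cod C f) \<cdot>\<^bsub>D\<^esub> FA F f = FA G f \<cdot>\<^bsub>D\<^esub> \<tau> (Dom C f))"

definition nat_iso ::
  "('o, 'm, 'z) precat_scheme \<Rightarrow> ('p, 'n, 'y) precat_scheme \<Rightarrow>
    ('o, 'm, 'p, 'n) fn \<Rightarrow> ('o, 'm, 'p, 'n) fn \<Rightarrow> ('o \<Rightarrow> 'n) \<Rightarrow> bool" where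
  "nat_iso C D F G \<tau> \<longleftrightarrow> nat_trans C D F G \<tau> \<and> (\<forall>x\<in>Ob C. iso_arr D (\<tau> x))"

definition is_equivalence ::
  "('o, 'm, 'z) precat_scheme \<Rightarrow> ('p, 'n, 'y) precat_scheme \<Rightarrow> ('o, 'm, 'p, 'n) fn \<Rightarrow> bool" where
  "is_equivalence C D F \<longleftrightarrow> is_functor C D F \<and>
    (\<forall>x\<in>Ob C. \<forall>y\<in>Ob C. bij_betw (FA F) (Hom C x y) (Hom D (FO F x) (FO F y))) \<and>
    (\<forall>y\<in>Ob D. \<exists>x\<in>Ob C. isomorphic D (FO F x) y)"

definition universal_arrow ::
  "('o, 'm, 'z) precat_scheme \<Rightarrow> ('p, 'n, 'y) precat_scheme \<Rightarrow> ('p, 'n, 'o, 'm) fn \<Rightarrow>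
    'o \<Rightarrow> 'p \<Rightarrow> 'm \<Rightarrow> bool" where
  \<comment> \<open>\<open>\<eta>\<close> from \<open>x\<close> to \<open>G l\<close> is a universal arrow from \<open>x\<close> to the functor \<open>G\<close> from \<open>D\<close> to \<open>C\<close>;
      thus \<open>G\<close> has a left adjoint iff every \<open>x\<close> admits such an arrow\<close>
  "universal_arrow C D G x l \<eta> \<longleftrightarrow> x \<in> Ob C \<and> l \<in> Ob D \<and> \<eta> \<in> Hom C x (FO G l) \<and>
    (\<forall>y\<in>Ob D. \<forall>f\<in>Hom C x (FO G y). \<exists>!g. g \<in> Hom D l y \<and> FA G g \<cdot>\<^bsub>C\<^esub> \<eta> = f)"

abbreviation couniversal_arrow ::
  "('o, 'm, 'z) precat_scheme \<Rightarrow> ('p, 'n, 'y) precat_scheme \<Rightarrow> ('p, 'n, 'o, 'm) fn \<Rightarrow>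
    'o \<Rightarrow> 'p \<Rightarrow> 'm \<Rightarrow> bool" where
  "couniversal_arrow C D G x r \<epsilon> \<equiv> universal_arrow (op_cat C) (op_cat D) G x r \<epsilon>"


section \<open>Monoidal categories\<close>

record ('o, 'm) moncat = "('o, 'm) precat" +
  TO :: "'o \<Rightarrow> 'o \<Rightarrow> 'o"  (infixl "\<boxtimes>\<index>" 75)
  TA :: "'m \<Rightarrow> 'm \<Rightarrow> 'm"  (infixl "\<boxdot>\<index>" 75)
  Unit :: 'o
  Assoc :: "'o \<Rightarrow> 'o \<Rightarrow> 'o \<Rightarrow> 'm"
  LUnit :: "'o \<Rightarrow> 'm"
  RUnit :: "'o \<Rightarrow> 'm"

definition is_monoidal :: "('o, 'm, 'z) moncat_scheme \<Rightarrow> bool" where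
  "is_monoidal C \<longleftrightarrow> is_category C \<and>
    Unit C \<in> Ob C \<and> (\<forall>x\<in>Ob C. \<forall>y\<in>Ob C. x \<boxtimes>\<^bsub>C\<^esub> y \<in> Ob C \<and>
      Ide C x \<boxdot>\<^bsub>C\<^esub> Ide C y = Ide C (x \<boxtimes>\<^bsub>C\<^esub> y)) \<and>
    (\<forall>f\<in>Arr C. \<forall>g\<in>Arr C.
      f \<boxdot>\<^bsub>C\<^esub> g \<in> Hom C (Dom C f \<boxtimes>\<^bsub>C\<^esub> Dom C g) (Cod C f \<boxtimes>\<^bsub>C\<^esub> Cod C g)) \<and>
    (\<forall>f\<in>Arr C. \<forall>f'\<in>Arr C. \<forall>g\<in>Arr C. \<forall>g'\<in>Arr C.
      Cod C f = Dom C f' \<longrightarrow> Cod C g = Dom C g' \<longrightarrow>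
      (f' \<cdot>\<^bsub>C\<^esub> f) \<boxdot>\<^bsub>C\<^esub> (g' \<cdot>\<^bsub>C\<^esub> g) = (f' \<boxdot>\<^bsub>C\<^esub> g') \<cdot>\<^bsub>C\<^esub> (f \<boxdot>\<^bsub>C\<^esub> g)) \<and>
    (\<forall>x\<in>Ob C. \<forall>y\<in>Ob C. \<forall>z\<in>Ob C. iso_arr C (Assoc C x y z) \<and>
      Assoc C x y z \<in> Hom C ((x \<boxtimes>\<^bsub>C\<^esub> y) \<boxtimes>\<^bsub>C\<^esub> z) (x \<boxtimes>\<^bsub>C\<^esub> (y \<boxtimes>\<^bsub>C\<^esub> z))) \<and>
    (\<forall>f\<in>Arr C. \<forall>g\<in>Arr C. \<forall>h\<in>Arr C.
      Assoc C (Cod C f) (Cod C g) (Cod C h) \<cdot>\<^bsub>C\<^esub> ((f \<boxdot>\<^bsub>C\<^esub> g) \<boxdot>\<^bsub>C\<^esub> h) =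
      (f \<boxdot>\<^bsub>C\<^esub> (g \<boxdot>\<^bsub>C\<^esub> h)) \<cdot>\<^bsub>C\<^esub> Assoc C (Dom C f) (Dom C g) (Dom C h)) \<and>
    (\<forall>x\<in>Ob C. LUnit C x \<in> Hom C (Unit C \<boxtimes>\<^bsub>C\<^esub> x) x \<and> iso_arr C (LUnit C x) \<and>
      RUnit C x \<in> Hom C (x \<boxtimes>\<^bsub>C\<^esub> Unit C) x \<and> iso_arr C (RUnit C x)) \<and>
    (\<forall>f\<in>Arr C.
      LUnit C (Cod C f) \<cdot>\<^bsub>C\<^esub> (Ide C (Unit C) \<boxdot>\<^bsub>C\<^esub> f) = f \<cdot>\<^bsub>C\<^esub> LUnit C (Dom C f) \<and>
      RUnit C (Cod C f) \<cdot>\<^bsub>C\<^esub> (f \<boxdot>\<^bsub>C\<^esub> Ide C (Unit C)) = f \<cdot>\<^bsub>C\<^esub> RUnit C (Dom C f)) \<and>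
    (\<forall>w\<in>Ob C. \<forall>x\<in>Ob C. \<forall>y\<in>Ob C. \<forall>z\<in>Ob C.
      Assoc C w x (y \<boxtimes>\<^bsub>C\<^esub> z) \<cdot>\<^bsub>C\<^esub> Assoc C (w \<boxtimes>\<^bsub>C\<^esub> x) y z =
      (Ide C w \<boxdot>\<^bsub>C\<^esub> Assoc C x y z) \<cdot>\<^bsub>C\<^esub>
        (Assoc C w (x \<boxtimes>\<^bsub>C\<^esub> y) z \<cdot>\<^bsub>C\<^esub> (Assoc C w x y \<boxdot>\<^bsub>C\<^esub> Ide C z))) \<and>
    (\<forall>x\<in>Ob C. \<forall>y\<in>Ob C.
      (Ide C x \<boxdot>\<^bsub>C\<^esub> LUnit C y) \<cdot>\<^bsub>C\<^esub> Assoc C x (Unit C) y = RUnit C x \<boxdot>\<^bsub>C\<^esub> Ide C y)"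

definition tensor_l :: "('o, 'm, 'z) moncat_scheme \<Rightarrow> 'o \<Rightarrow> ('o, 'm, 'o, 'm) fn" where
  "tensor_l C a = \<lparr>FO = (\<lambda>x. a \<boxtimes>\<^bsub>C\<^esub> x), FA = (\<lambda>f. Ide C a \<boxdot>\<^bsub>C\<^esub> f)\<rparr>"

definition tensor_r :: "('o, 'm, 'z) moncat_scheme \<Rightarrow> 'o \<Rightarrow> ('o, 'm, 'o, 'm) fn" where
  "tensor_r C a = \<lparr>FO = (\<lambda>x. x \<boxtimes>\<^bsub>C\<^esub> a), FA = (\<lambda>f. f \<boxdot>\<^bsub>C\<^esub> Ide C a)\<rparr>"

definition biclosed :: "('o, 'm, 'z) moncat_scheme \<Rightarrow> bool" where
  "biclosed C \<longleftrightarrow> (\<forall>a\<in>Ob C. \<forall>b\<in>Ob C.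
    (\<exists>h e. couniversal_arrow C C (tensor_l C a) b h e) \<and>
    (\<exists>h e. couniversal_arrow C C (tensor_r C a) b h e))"

definition strong_monoidal ::
  "('o, 'm, 'z) moncat_scheme \<Rightarrow> ('p, 'n, 'y) moncat_scheme \<Rightarrow> ('o, 'm, 'p, 'n) fn \<Rightarrow>
    ('o \<Rightarrow> 'o \<Rightarrow> 'n) \<Rightarrow> 'n \<Rightarrow> bool" where
  "strong_monoidal C D F \<mu> \<epsilon> \<longleftrightarrow> is_functor C D F \<and>
    (\<forall>x\<in>Ob C. \<forall>y\<in>Ob C. \<mu> x y \<in> Hom D (FO F x \<boxtimes>\<^bsub>D\<^esub> FO F y) (FO F (x \<boxtimes>\<^bsub>C\<^esub> y)) \<and>
      iso_arr D (\<mu> x y)) \<and>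
    (\<forall>f\<in>Arr C. \<forall>g\<in>Arr C. \<mu> (Cod C f) (Cod C g) \<cdot>\<^bsub>D\<^esub> (FA F f \<boxdot>\<^bsub>D\<^esub> FA F g) =
      FA F (f \<boxdot>\<^bsub>C\<^esub> g) \<cdot>\<^bsub>D\<^esub> \<mu> (Dom C f) (Dom C g)) \<and>
    \<epsilon> \<in> Hom D (Unit D) (FO F (Unit C)) \<and> iso_arr D \<epsilon> \<and>
    (\<forall>x\<in>Ob C. \<forall>y\<in>Ob C. \<forall>z\<in>Ob C.
      FA F (Assoc C x y z) \<cdot>\<^bsub>D\<^esub> (\<mu> (x \<boxtimes>\<^bsub>C\<^esub> y) z \<cdot>\<^bsub>D\<^esub> (\<mu> x y \<boxdot>\<^bsub>D\<^esub> Ide D (FO F z))) =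
      \<mu> x (y \<boxtimes>\<^bsub>C\<^esub> z) \<cdot>\<^bsub>D\<^esub>
        ((Ide D (FO F x) \<boxdot>\<^bsub>D\<^esub> \<mu> y z) \<cdot>\<^bsub>D\<^esub> Assoc D (FO F x) (FO F y) (FO F z))) \<and>
    (\<forall>x\<in>Ob C.
      FA F (LUnit C x) \<cdot>\<^bsub>D\<^esub> (\<mu> (Unit C) x \<cdot>\<^bsub>D\<^esub> (\<epsilon> \<boxdot>\<^bsub>D\<^esub> Ide D (FO F x))) = LUnit D (FO F x) \<and>
      FA F (RUnit C x) \<cdot>\<^bsub>D\<^esub> (\<mu> x (Unit C) \<cdot>\<^bsub>D\<^esub> (Ide D (FO F x) \<boxdot>\<^bsub>D\<^esub> \<epsilon>)) = RUnit D (FO F x))"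


section \<open>Tensor triangulated categories\<close>

record ('o, 'm) ttcat = "('o, 'm) moncat" +
  Sym :: "'o \<Rightarrow> 'o \<Rightarrow> 'm"
  Zer :: "'o \<Rightarrow> 'o \<Rightarrow> 'm"
  Plus :: "'m \<Rightarrow> 'm \<Rightarrow> 'm"
  Shift :: "('o, 'm, 'o, 'm) fn"
  Tri :: "('m \<times> 'm \<times> 'm) set"

definition is_symmetric :: "('o, 'm, 'z) ttcat_scheme \<Rightarrow> bool" where
  "is_symmetric T \<longleftrightarrow>
    (\<forall>x\<in>Ob T. \<forall>y\<in>Ob T. Sym T x y \<in> Hom T (x \<boxtimes>\<^bsub>T\<^esub> y) (y \<boxtimes>\<^bsub>T\<^esub> x) \<and>
      Sym T y x \<cdot>\<^bsub>T\<^esub> Sym T x y = Ide T (x \<boxtimes>\<^bsub>T\<^esub> y)) \<and>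
    (\<forall>f\<in>Arr T. \<forall>g\<in>Arr T. Sym T (Cod T f) (Cod T g) \<cdot>\<^bsub>T\<^esub> (f \<boxdot>\<^bsub>T\<^esub> g) =
      (g \<boxdot>\<^bsub>T\<^esub> f) \<cdot>\<^bsub>T\<^esub> Sym T (Dom T f) (Dom T g)) \<and>
    (\<forall>x\<in>Ob T. \<forall>y\<in>Ob T. \<forall>z\<in>Ob T.
      Assoc T y z x \<cdot>\<^bsub>T\<^esub> (Sym T x (y \<boxtimes>\<^bsub>T\<^esub> z) \<cdot>\<^bsub>T\<^esub> Assoc T x y z) =
      (Ide T y \<boxdot>\<^bsub>T\<^esub> Sym T x z) \<cdot>\<^bsub>T\<^esub> (Assoc T y x z \<cdot>\<^bsub>T\<^esub> (Sym T x y \<boxdot>\<^bsub>T\<^esub> Ide T z)))"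

definition hom_group :: "('o, 'm, 'z) ttcat_scheme \<Rightarrow> 'o \<Rightarrow> 'o \<Rightarrow> 'm monoid" where
  "hom_group T x y = \<lparr>carrier = Hom T x y, mult = Plus T, one = Zer T x y\<rparr>"

definition neg_arr :: "('o, 'm, 'z) ttcat_scheme \<Rightarrow> 'm \<Rightarrow> 'm" where
  "neg_arr T f = inv\<^bsub>hom_group T (Dom T f) (Cod T f)\<^esub> f"

definition is_additive :: "('o, 'm, 'z) ttcat_scheme \<Rightarrow> bool" where
  "is_additive T \<longleftrightarrow>
    (\<forall>x\<in>Ob T. \<forall>y\<in>Ob T. comm_group (hom_group T x y)) \<and>
    (\<forall>x\<in>Ob T. \<forall>y\<in>Ob T. \<forall>z\<in>Ob T.
      \<forall>f\<in>Hom T x y. \<forall>f'\<in>Hom T x y. \<forall>g\<in>Hom T y z. \<forall>g'\<in>Hom T y z.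
      g \<cdot>\<^bsub>T\<^esub> Plus T f f' = Plus T (g \<cdot>\<^bsub>T\<^esub> f) (g \<cdot>\<^bsub>T\<^esub> f') \<and>
      Plus T g g' \<cdot>\<^bsub>T\<^esub> f = Plus T (g \<cdot>\<^bsub>T\<^esub> f) (g' \<cdot>\<^bsub>T\<^esub> f)) \<and>
    (\<exists>z. zero_ob T z) \<and>
    (\<forall>x\<in>Ob T. \<forall>y\<in>Ob T. \<exists>s\<in>Ob T. \<exists>i\<in>Hom T x s. \<exists>j\<in>Hom T y s. \<exists>p\<in>Hom T s x. \<exists>q\<in>Hom T s y.
      p \<cdot>\<^bsub>T\<^esub> i = Ide T x \<and> q \<cdot>\<^bsub>T\<^esub> j = Ide T y \<and> q \<cdot>\<^bsub>T\<^esub> i = Zer T x y \<and> p \<cdot>\<^bsub>T\<^esub> j = Zer T y x \<and>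
      Plus T (i \<cdot>\<^bsub>T\<^esub> p) (j \<cdot>\<^bsub>T\<^esub> q) = Ide T s)"

definition additive_endo :: "('o, 'm, 'z) ttcat_scheme \<Rightarrow> ('o, 'm, 'o, 'm) fn \<Rightarrow> bool" where
  "additive_endo T F \<longleftrightarrow> is_functor T T F \<and>
    (\<forall>x\<in>Ob T. \<forall>y\<in>Ob T. \<forall>f\<in>Hom T x y. \<forall>f'\<in>Hom T x y.
      FA F (Plus T f f') = Plus T (FA F f) (FA F f'))"

definition cand_triangle :: "('o, 'm, 'z) ttcat_scheme \<Rightarrow> 'm \<Rightarrow> 'm \<Rightarrow> 'm \<Rightarrow> bool" where
  "cand_triangle T f g h \<longleftrightarrow> f \<in> Arr T \<and> g \<in> Arr T \<and> h \<in> Arr T \<and>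
    Dom T g = Cod T f \<and> Dom T h = Cod T g \<and> Cod T h = FO (Shift T) (Dom T f)"

definition is_triangulated :: "('o, 'm, 'z) ttcat_scheme \<Rightarrow> bool" where
  "is_triangulated T \<longleftrightarrow> is_category T \<and> is_additive T \<and>
    is_equivalence T T (Shift T) \<and> additive_endo T (Shift T) \<and>
    (\<forall>f g h. (f, g, h) \<in> Tri T \<longrightarrow> cand_triangle T f g h) \<and>
    \<comment> \<open>TR1\<close>
    (\<forall>f g h f' g' h' a b c. (f, g, h) \<in> Tri T \<longrightarrow> cand_triangle T f' g' h' \<longrightarrow>
      iso_arr T a \<and> a \<in> Hom T (Dom T f) (Dom T f') \<longrightarrow>
      iso_arr T b \<and> b \<in> Hom T (Cod T f) (Cod T f') \<longrightarrow>
      iso_arr T c \<and> c \<in> Hom T (Cod T g) (Cod T g') \<longrightarrow>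
      b \<cdot>\<^bsub>T\<^esub> f = f' \<cdot>\<^bsub>T\<^esub> a \<longrightarrow> c \<cdot>\<^bsub>T\<^esub> g = g' \<cdot>\<^bsub>T\<^esub> b \<longrightarrow> FA (Shift T) a \<cdot>\<^bsub>T\<^esub> h = h' \<cdot>\<^bsub>T\<^esub> c \<longrightarrow>
      (f', g', h') \<in> Tri T) \<and>
    (\<forall>x\<in>Ob T. \<forall>z. zero_ob T z \<longrightarrow> (Ide T x, Zer T x z, Zer T z (FO (Shift T) x)) \<in> Tri T) \<and>
    (\<forall>f\<in>Arr T. \<exists>g h. (f, g, h) \<in> Tri T) \<and>
    \<comment> \<open>TR2\<close>
    (\<forall>f g h. cand_triangle T f g h \<longrightarrow>
      ((f, g, h) \<in> Tri T \<longleftrightarrow> (g, h, neg_arr T (FA (Shift T) f)) \<in> Tri T)) \<and>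
    \<comment> \<open>TR3\<close>
    (\<forall>f g h f' g' h' a b. (f, g, h) \<in> Tri T \<longrightarrow> (f', g', h') \<in> Tri T \<longrightarrow>
      a \<in> Hom T (Dom T f) (Dom T f') \<longrightarrow> b \<in> Hom T (Cod T f) (Cod T f') \<longrightarrow>
      b \<cdot>\<^bsub>T\<^esub> f = f' \<cdot>\<^bsub>T\<^esub> a \<longrightarrow>
      (\<exists>c\<in>Hom T (Cod T g) (Cod T g').
        c \<cdot>\<^bsub>T\<^esub> g = g' \<cdot>\<^bsub>T\<^esub> b \<and> FA (Shift T) a \<cdot>\<^bsub>T\<^esub> h = h' \<cdot>\<^bsub>T\<^esub> c)) \<and>
    \<comment> \<open>TR4 (octahedral axiom)\<close>
    (\<forall>f i i' g j j' k k'. Cod T f = Dom T g \<longrightarrow>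
      (f, i, i') \<in> Tri T \<longrightarrow> (g, j, j') \<in> Tri T \<longrightarrow> (g \<cdot>\<^bsub>T\<^esub> f, k, k') \<in> Tri T \<longrightarrow>
      (\<exists>p\<in>Hom T (Cod T i) (Cod T k). \<exists>q\<in>Hom T (Cod T k) (Cod T j).
        (p, q, FA (Shift T) i \<cdot>\<^bsub>T\<^esub> j') \<in> Tri T \<and>
        p \<cdot>\<^bsub>T\<^esub> i = k \<cdot>\<^bsub>T\<^esub> g \<and> k' \<cdot>\<^bsub>T\<^esub> p = i' \<and> q \<cdot>\<^bsub>T\<^esub> k = j \<and>
        j' \<cdot>\<^bsub>T\<^esub> q = FA (Shift T) f \<cdot>\<^bsub>T\<^esub> k'))"

definition exact_endo :: "('o, 'm, 'z) ttcat_scheme \<Rightarrow> ('o, 'm, 'o, 'm) fn \<Rightarrow> bool" where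
  "exact_endo T F \<longleftrightarrow> additive_endo T F \<and>
    (\<exists>\<phi>. nat_iso T T (fn_comp F (Shift T)) (fn_comp (Shift T) F) \<phi> \<and>
      (\<forall>f g h. (f, g, h) \<in> Tri T \<longrightarrow> (FA F f, FA F g, \<phi> (Dom T f) \<cdot>\<^bsub>T\<^esub> FA F h) \<in> Tri T))"

definition tt_category :: "('o, 'm, 'z) ttcat_scheme \<Rightarrow> bool" where
  "tt_category T \<longleftrightarrow> is_monoidal T \<and> is_symmetric T \<and> is_triangulated T \<and>
    (\<forall>a\<in>Ob T. exact_endo T (tensor_l T a) \<and> exact_endo T (tensor_r T a))"

definition tri_subcat :: "('o, 'm, 'z) ttcat_scheme \<Rightarrow> 'o set \<Rightarrow> bool" where
  "tri_subcat T S \<longleftrightarrow> S \<subseteq> Ob T \<and> (\<forall>z. zero_ob T z \<longrightarrow> z \<in> S) \<and>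
    (\<forall>x\<in>S. \<forall>y. isomorphic T x y \<longrightarrow> y \<in> S) \<and>
    (\<forall>x\<in>Ob T. FO (Shift T) x \<in> S \<longleftrightarrow> x \<in> S) \<and>
    (\<forall>f g h. (f, g, h) \<in> Tri T \<longrightarrow> Dom T f \<in> S \<longrightarrow> Cod T f \<in> S \<longrightarrow> Cod T g \<in> S)"

definition localizing :: "'u set \<Rightarrow> ('o, 'm, 'z) ttcat_scheme \<Rightarrow> 'o set \<Rightarrow> bool" where
  "localizing U T S \<longleftrightarrow> tri_subcat T S \<and>
    (\<forall>I x s \<iota>. I \<subseteq> U \<longrightarrow> small U I \<longrightarrow> (\<forall>i\<in>I. x i \<in> S) \<longrightarrow> is_coproduct T I x s \<iota> \<longrightarrow> s \<in> S)"

definition Loc :: "'u set \<Rightarrow> ('o, 'm, 'z) ttcat_scheme \<Rightarrow> 'o set \<Rightarrow> 'o set" where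
  "Loc U T A = \<Inter>{S. localizing U T S \<and> A \<subseteq> S}"

definition Locid :: "'u set \<Rightarrow> ('o, 'm, 'z) ttcat_scheme \<Rightarrow> 'o set \<Rightarrow> 'o set" where
  "Locid U T A = \<Inter>{S. localizing U T S \<and> (\<forall>a\<in>Ob T. \<forall>x\<in>S. a \<boxtimes>\<^bsub>T\<^esub> x \<in> S) \<and> A \<subseteq> S}"

definition right_orth :: "('o, 'm, 'z) ttcat_scheme \<Rightarrow> 'o set \<Rightarrow> 'o set" where
  "right_orth T S = {y \<in> Ob T. \<forall>x\<in>S. Hom T x y = {Zer T x y}}"

definition compact_ob :: "'u set \<Rightarrow> ('o, 'm, 'z) ttcat_scheme \<Rightarrow> 'o \<Rightarrow> bool" where
  \<comment> \<open>the canonical map from the direct sum of the groups \<open>Hom(c, x\<^sub>i)\<close> to \<open>Hom(c, \<Coprod>\<^sub>i x\<^sub>i)\<close>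
      is bijective\<close>
  "compact_ob U T c \<longleftrightarrow> c \<in> Ob T \<and>
    (\<forall>I x s \<iota>. I \<subseteq> U \<longrightarrow> small U I \<longrightarrow> is_coproduct T I x s \<iota> \<longrightarrow>
      bij_betw
        (\<lambda>f. finprod (hom_group T c s) (\<lambda>i. \<iota> i \<cdot>\<^bsub>T\<^esub> f i) {i \<in> I. f i \<noteq> Zer T c (x i)})
        {f \<in> (\<Pi>\<^sub>E i\<in>I. Hom T c (x i)). finite {i \<in> I. f i \<noteq> Zer T c (x i)}}
        (Hom T c s))"

definition compacts :: "'u set \<Rightarrow> ('o, 'm, 'z) ttcat_scheme \<Rightarrow> 'o set" where
  "compacts U T = {c. compact_ob U T c}"

definition rigid_ob :: "('o, 'm, 'z) ttcat_scheme \<Rightarrow> 'o \<Rightarrow> bool" where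
  "rigid_ob T x \<longleftrightarrow> x \<in> Ob T \<and>
    (\<exists>d\<in>Ob T. \<exists>\<eta>\<in>Hom T (Unit T) (x \<boxtimes>\<^bsub>T\<^esub> d). \<exists>\<epsilon>\<in>Hom T (d \<boxtimes>\<^bsub>T\<^esub> x) (Unit T).
      RUnit T x \<cdot>\<^bsub>T\<^esub> ((Ide T x \<boxdot>\<^bsub>T\<^esub> \<epsilon>) \<cdot>\<^bsub>T\<^esub> (Assoc T x d x \<cdot>\<^bsub>T\<^esub> (\<eta> \<boxdot>\<^bsub>T\<^esub> Ide T x))) = LUnit T x \<and>
      LUnit T d \<cdot>\<^bsub>T\<^esub> ((\<epsilon> \<boxdot>\<^bsub>T\<^esub> Ide T d) \<cdot>\<^bsub>T\<^esub>
        (inv_arr T (Assoc T d x d) \<cdot>\<^bsub>T\<^esub> (Ide T d \<boxdot>\<^bsub>T\<^esub> \<eta>))) = RUnit T d)"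

definition rigidly_compactly_generated :: "'u set \<Rightarrow> ('o, 'm, 'z) ttcat_scheme \<Rightarrow> bool" where
  "rigidly_compactly_generated U T \<longleftrightarrow> tt_category T \<and> biclosed T \<and>
    (\<forall>x\<in>Ob T. \<forall>y\<in>Ob T. small U (Hom T x y)) \<and>
    (\<forall>I x. I \<subseteq> U \<longrightarrow> small U I \<longrightarrow> (\<forall>i\<in>I. x i \<in> Ob T) \<longrightarrow> (\<exists>s \<iota>. is_coproduct T I x s \<iota>)) \<and>
    (\<exists>G. G \<subseteq> compacts U T \<and> small U G \<and> Loc U T G = Ob T) \<and>
    compacts U T = {x. rigid_ob T x}"


section \<open>The Balmer spectrum\<close>

definition thick_ideal :: "'u set \<Rightarrow> ('o, 'm, 'z) ttcat_scheme \<Rightarrow> 'o set \<Rightarrow> bool" where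
  "thick_ideal U T J \<longleftrightarrow> J \<subseteq> compacts U T \<and> tri_subcat T J \<and>
    (\<forall>x y. y \<in> J \<longrightarrow> x \<in> compacts U T \<longrightarrow> is_retract T x y \<longrightarrow> x \<in> J) \<and>
    (\<forall>a\<in>compacts U T. \<forall>x\<in>J. a \<boxtimes>\<^bsub>T\<^esub> x \<in> J)"

definition primes :: "'u set \<Rightarrow> ('o, 'm, 'z) ttcat_scheme \<Rightarrow> 'o set set" where
  "primes U T = {P. thick_ideal U T P \<and> P \<noteq> compacts U T \<and>
    (\<forall>a\<in>compacts U T. \<forall>b\<in>compacts U T. a \<boxtimes>\<^bsub>T\<^esub> b \<in> P \<longrightarrow> a \<in> P \<or> b \<in> P)}"

definition supp :: "'u set \<Rightarrow> ('o, 'm, 'z) ttcat_scheme \<Rightarrow> 'o \<Rightarrow> 'o set set" where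
  "supp U T a = {P \<in> primes U T. a \<notin> P}"

definition Spc :: "'u set \<Rightarrow> ('o, 'm, 'z) ttcat_scheme \<Rightarrow> 'o set topology" where
  "Spc U T = topology_generated_by {primes U T - supp U T a | a. a \<in> compacts U T}"

definition thomason :: "'a topology \<Rightarrow> 'a set \<Rightarrow> bool" where
  "thomason X Y \<longleftrightarrow>
    (\<exists>\<C>. (\<forall>C\<in>\<C>. closedin X C \<and> compactin X (topspace X - C)) \<and> Y = \<Union>\<C>)"

definition noetherian_space :: "'a topology \<Rightarrow> bool" where
  "noetherian_space X \<longleftrightarrow>
    (\<forall>V :: nat \<Rightarrow> 'a set. (\<forall>n. openin X (V n) \<and> V n \<subseteq> V (Suc n)) \<longrightarrow> (\<exists>N. \<forall>n\<ge>N. V n = V N))"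


section \<open>Rickard idempotents and tensor triangular support\<close>

definition compacts_on :: "'u set \<Rightarrow> ('o, 'm, 'z) ttcat_scheme \<Rightarrow> 'o set set \<Rightarrow> 'o set" where
  "compacts_on U T Y = {a \<in> compacts U T. supp U T a \<subseteq> Y}"

definition rickard_triangle ::
  "'u set \<Rightarrow> ('o, 'm, 'z) ttcat_scheme \<Rightarrow> 'o set set \<Rightarrow> 'm \<times> 'm \<times> 'm \<Rightarrow> bool" where
  "rickard_triangle U T Y = (\<lambda>(f, g, h). (f, g, h) \<in> Tri T \<and> Cod T f = Unit T \<and>
    Dom T f \<in> Loc U T (compacts_on U T Y) \<and>
    Cod T g \<in> right_orth T (Loc U T (compacts_on U T Y)))"

text \<open>
  Rickard triangles and the objects \<open>g(W)\<close> are unique up to isomorphism; a choice is made here.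
  Note that \<open>RickL U T Y\<close> stands for \<open>L\<^bsub>Y\<^sup>c\<^esub>\<one>\<close>.
\<close>

definition RickG :: "'u set \<Rightarrow> ('o, 'm, 'z) ttcat_scheme \<Rightarrow> 'o set set \<Rightarrow> 'o" where
  "RickG U T Y = Dom T (fst (SOME t. rickard_triangle U T Y t))"

definition RickL :: "'u set \<Rightarrow> ('o, 'm, 'z) ttcat_scheme \<Rightarrow> 'o set set \<Rightarrow> 'o" where
  "RickL U T Y = Cod T (fst (snd (SOME t. rickard_triangle U T Y t)))"

definition weakly_visible :: "'u set \<Rightarrow> ('o, 'm, 'z) ttcat_scheme \<Rightarrow> 'o set set \<Rightarrow> bool" where
  "weakly_visible U T Z \<longleftrightarrow> (\<exists>Y1 Y2. thomason (Spc U T) Y1 \<and> thomason (Spc U T) Y2 \<and>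
    Z = Y1 \<inter> (topspace (Spc U T) - Y2))"

definition vis_idem :: "'u set \<Rightarrow> ('o, 'm, 'z) ttcat_scheme \<Rightarrow> 'o set set \<Rightarrow> 'o" where
  \<comment> \<open>the object \<open>g(Z)\<close>\<close>
  "vis_idem U T Z = (SOME w. \<exists>Y1 Y2. thomason (Spc U T) Y1 \<and> thomason (Spc U T) Y2 \<and>
    Z = Y1 \<inter> (topspace (Spc U T) - Y2) \<and> w = RickG U T Y1 \<boxtimes>\<^bsub>T\<^esub> RickL U T Y2)"

definition Supp :: "'u set \<Rightarrow> ('o, 'm, 'z) ttcat_scheme \<Rightarrow> 'o \<Rightarrow> 'o set set" where
  "Supp U T t = {P \<in> topspace (Spc U T).
    \<forall>W. weakly_visible U T W \<longrightarrow> P \<in> W \<longrightarrow> \<not> zero_ob T (t \<boxtimes>\<^bsub>T\<^esub> vis_idem U T W)}"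

definition detection_property :: "'u set \<Rightarrow> ('o, 'm, 'z) ttcat_scheme \<Rightarrow> bool" where
  "detection_property U T \<longleftrightarrow> (\<forall>t\<in>Ob T. Supp U T t = {} \<longrightarrow> zero_ob T t)"

definition local_to_global :: "'u set \<Rightarrow> ('o, 'm, 'z) ttcat_scheme \<Rightarrow> 'o \<Rightarrow> bool" where
  \<comment> \<open>a cover is given by its set of members; repetitions in an indexed cover are immaterial\<close>
  "local_to_global U T t \<longleftrightarrow> (\<forall>\<W>. (\<forall>W\<in>\<W>. weakly_visible U T W) \<longrightarrow> \<Union>\<W> = topspace (Spc U T) \<longrightarrow>
    t \<in> Locid U T {t \<boxtimes>\<^bsub>T\<^esub> vis_idem U T W | W. W \<in> \<W>})"


section \<open>Stable monoidal model categories\<close>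

definition small_cat :: "'u set \<Rightarrow> ('u, 'u) precat \<Rightarrow> bool" where
  "small_cat U J \<longleftrightarrow> is_category J \<and> Ob J \<subseteq> U \<and> Arr J \<subseteq> U \<and> small U (Ob J) \<and> small U (Arr J)"

definition is_colimit ::
  "('i, 'j, 'y) precat_scheme \<Rightarrow> ('o, 'm, 'z) precat_scheme \<Rightarrow> ('i, 'j, 'o, 'm) fn \<Rightarrow>
    'o \<Rightarrow> ('i \<Rightarrow> 'm) \<Rightarrow> bool" where
  "is_colimit J C d s \<iota> \<longleftrightarrow> s \<in> Ob C \<and> nat_trans J C d (fn_const C s) \<iota> \<and>
    (\<forall>y\<in>Ob C. \<forall>f. nat_trans J C d (fn_const C y) f \<longrightarrow>
      (\<exists>!g. g \<in> Hom C s y \<and> (\<forall>i\<in>Ob J. g \<cdot>\<^bsub>C\<^esub> \<iota> i = f i)))"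

definition cocomplete :: "'u set \<Rightarrow> ('o, 'm, 'z) precat_scheme \<Rightarrow> bool" where
  "cocomplete U C \<longleftrightarrow>
    (\<forall>J d. small_cat U J \<longrightarrow> is_functor J C d \<longrightarrow> (\<exists>s \<iota>. is_colimit J C d s \<iota>))"

record ('o, 'm) modelcat = "('o, 'm) moncat" +
  Weq :: "'m set"
  Cofib :: "'m set"
  Fibr :: "'m set"

definition arr_retract :: "('o, 'm, 'z) precat_scheme \<Rightarrow> 'm \<Rightarrow> 'm \<Rightarrow> bool" where
  "arr_retract C f g \<longleftrightarrow> f \<in> Arr C \<and> g \<in> Arr C \<and>
    (\<exists>i\<in>Hom C (Dom C f) (Dom C g). \<exists>r\<in>Hom C (Dom C g) (Dom C f).
     \<exists>j\<in>Hom C (Cod C f) (Cod C g). \<exists>s\<in>Hom C (Cod C g) (Cod C f).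
      r \<cdot>\<^bsub>C\<^esub> i = Ide C (Dom C f) \<and> s \<cdot>\<^bsub>C\<^esub> j = Ide C (Cod C f) \<and>
      g \<cdot>\<^bsub>C\<^esub> i = j \<cdot>\<^bsub>C\<^esub> f \<and> f \<cdot>\<^bsub>C\<^esub> r = s \<cdot>\<^bsub>C\<^esub> g)"

definition retract_closed_subcat :: "('o, 'm, 'z) precat_scheme \<Rightarrow> 'm set \<Rightarrow> bool" where
  "retract_closed_subcat C S \<longleftrightarrow> S \<subseteq> Arr C \<and> (\<forall>x\<in>Ob C. Ide C x \<in> S) \<and>
    (\<forall>f\<in>S. \<forall>g\<in>S. Cod C f = Dom C g \<longrightarrow> g \<cdot>\<^bsub>C\<^esub> f \<in> S) \<and>
    (\<forall>f g. g \<in> S \<longrightarrow> arr_retract C f g \<longrightarrow> f \<in> S)"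

definition is_model_category :: "'u set \<Rightarrow> ('o, 'm, 'z) modelcat_scheme \<Rightarrow> bool" where
  "is_model_category U M \<longleftrightarrow> is_category M \<and> cocomplete U M \<and> cocomplete U (op_cat M) \<and>
    retract_closed_subcat M (Weq M) \<and> retract_closed_subcat M (Cofib M) \<and>
    retract_closed_subcat M (Fibr M) \<and>
    (\<forall>f\<in>Arr M. \<forall>g\<in>Arr M. Cod M f = Dom M g \<longrightarrow> g \<cdot>\<^bsub>M\<^esub> f \<in> Weq M \<longrightarrow> (f \<in> Weq M \<longleftrightarrow> g \<in> Weq M)) \<and>
    (\<forall>i\<in>Cofib M. \<forall>p\<in>Fibr M. i \<in> Weq M \<or> p \<in> Weq M \<longrightarrow>
      (\<forall>u\<in>Hom M (Dom M i) (Dom M p). \<forall>v\<in>Hom M (Cod M i) (Cod M p). p \<cdot>\<^bsub>M\<^esub> u = v \<cdot>\<^bsub>M\<^esub> i \<longrightarrow>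
        (\<exists>h\<in>Hom M (Cod M i) (Dom M p). h \<cdot>\<^bsub>M\<^esub> i = u \<and> p \<cdot>\<^bsub>M\<^esub> h = v))) \<and>
    (\<forall>f\<in>Arr M.
      (\<exists>i\<in>Cofib M. \<exists>p\<in>Fibr M \<inter> Weq M. Dom M i = Dom M f \<and> Cod M i = Dom M p \<and> p \<cdot>\<^bsub>M\<^esub> i = f) \<and>
      (\<exists>i\<in>Cofib M \<inter> Weq M. \<exists>p\<in>Fibr M. Dom M i = Dom M f \<and> Cod M i = Dom M p \<and> p \<cdot>\<^bsub>M\<^esub> i = f))"

definition cofibrant :: "('o, 'm, 'z) modelcat_scheme \<Rightarrow> 'o \<Rightarrow> bool" where
  "cofibrant M x \<longleftrightarrow> x \<in> Ob M \<and> (\<forall>z f. initial_ob M z \<longrightarrow> f \<in> Hom M z x \<longrightarrow> f \<in> Cofib M)"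

definition is_monoidal_model_category :: "'u set \<Rightarrow> ('o, 'm, 'z) modelcat_scheme \<Rightarrow> bool" where
  "is_monoidal_model_category U M \<longleftrightarrow> is_model_category U M \<and> is_monoidal M \<and> biclosed M \<and>
    \<comment> \<open>pushout-product axiom\<close>
    (\<forall>f\<in>Cofib M. \<forall>g\<in>Cofib M. \<forall>p q h.
      is_pushout M (f \<boxdot>\<^bsub>M\<^esub> Ide M (Dom M g)) (Ide M (Dom M f) \<boxdot>\<^bsub>M\<^esub> g) p q \<longrightarrow>
      h \<in> Hom M (Cod M p) (Cod M f \<boxtimes>\<^bsub>M\<^esub> Cod M g) \<longrightarrow>
      h \<cdot>\<^bsub>M\<^esub> p = Ide M (Cod M f) \<boxdot>\<^bsub>M\<^esub> g \<longrightarrow> h \<cdot>\<^bsub>M\<^esub> q = f \<boxdot>\<^bsub>M\<^esub> Ide M (Cod M g) \<longrightarrow>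
      h \<in> Cofib M \<and> (f \<in> Weq M \<or> g \<in> Weq M \<longrightarrow> h \<in> Weq M)) \<and>
    \<comment> \<open>unit axiom\<close>
    (\<forall>q\<in>Weq M. cofibrant M (Dom M q) \<longrightarrow> Cod M q = Unit M \<longrightarrow> (\<forall>x. cofibrant M x \<longrightarrow>
      q \<boxdot>\<^bsub>M\<^esub> Ide M x \<in> Weq M \<and> Ide M x \<boxdot>\<^bsub>M\<^esub> q \<in> Weq M))"

text \<open>
  The homotopy category is the category of fractions: arrows are composable strings of arrows
  \<open>Inl f\<close> and formal inverses \<open>Inr w\<close> of weak equivalences, listed in diagrammatic order and taken
  modulo the congruence \<open>zz_eq\<close>.
\<close>

fun zigzag :: "('o, 'm, 'z) modelcat_scheme \<Rightarrow> 'o \<Rightarrow> ('m + 'm) list \<Rightarrow> 'o \<Rightarrow> bool" where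
  "zigzag M x [] y \<longleftrightarrow> x \<in> Ob M \<and> x = y"
| "zigzag M x (Inl f # l) y \<longleftrightarrow> f \<in> Arr M \<and> Dom M f = x \<and> zigzag M (Cod M f) l y"
| "zigzag M x (Inr w # l) y \<longleftrightarrow> w \<in> Weq M \<and> Cod M w = x \<and> zigzag M (Dom M w) l y"

inductive zz_eq ::
  "('o, 'm, 'z) modelcat_scheme \<Rightarrow> 'o \<Rightarrow> 'o \<Rightarrow> ('m + 'm) list \<Rightarrow> ('m + 'm) list \<Rightarrow> bool"
  for M where
  zz_refl: "zigzag M x l y \<Longrightarrow> zz_eq M x y l l"
| zz_sym: "zz_eq M x y l l' \<Longrightarrow> zz_eq M x y l' l"
| zz_trans: "zz_eq M x y l l' \<Longrightarrow> zz_eq M x y l' l'' \<Longrightarrow> zz_eq M x y l l''"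
| zz_cong: "zigzag M x k x' \<Longrightarrow> zz_eq M x' y' l l' \<Longrightarrow> zigzag M y' k' y \<Longrightarrow>
    zz_eq M x y (k @ l @ k') (k @ l' @ k')"
| zz_ide: "x \<in> Ob M \<Longrightarrow> zz_eq M x x [Inl (Ide M x)] []"
| zz_comp: "f \<in> Arr M \<Longrightarrow> g \<in> Arr M \<Longrightarrow> Cod M f = Dom M g \<Longrightarrow>
    zz_eq M (Dom M f) (Cod M g) [Inl f, Inl g] [Inl (g \<cdot>\<^bsub>M\<^esub> f)]"
| zz_inv_r: "w \<in> Weq M \<Longrightarrow> zz_eq M (Dom M w) (Dom M w) [Inl w, Inr w] []"
| zz_inv_l: "w \<in> Weq M \<Longrightarrow> zz_eq M (Cod M w) (Cod M w) [Inr w, Inl w] []"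

type_synonym ('o, 'm) ho_arr = "'o \<times> ('m + 'm) list set \<times> 'o"

definition ho_class ::
  "('o, 'm, 'z) modelcat_scheme \<Rightarrow> 'o \<Rightarrow> 'o \<Rightarrow> ('m + 'm) list \<Rightarrow> ('o, 'm) ho_arr" where
  "ho_class M x y l = (x, {l'. zz_eq M x y l l'}, y)"

definition Ho :: "('o, 'm, 'z) modelcat_scheme \<Rightarrow> ('o, ('o, 'm) ho_arr) precat" where
  "Ho M = \<lparr>Ob = Ob M,
    Arr = {ho_class M x y l | x y l. zigzag M x l y},
    Dom = (\<lambda>f. fst f), Cod = (\<lambda>f. snd (snd f)),
    Ide = (\<lambda>x. ho_class M x x []),
    Comp = (\<lambda>g f. (fst f,
      {l. \<exists>k\<in>fst (snd f). \<exists>k'\<in>fst (snd g). zz_eq M (fst f) (snd (snd g)) (k @ k') l},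
      snd (snd g)))\<rparr>"

definition ho_arr :: "('o, 'm, 'z) modelcat_scheme \<Rightarrow> 'm \<Rightarrow> ('o, 'm) ho_arr" where
  "ho_arr M f = ho_class M (Dom M f) (Cod M f) [Inl f]"

text \<open>
  A suspension datum on a cofibrant object \<open>x\<close> is a cofibration \<open>c\<close> from \<open>x\<close> to a cone on \<open>x\<close>
  together with its cokernel \<open>q\<close>. A suspension functor is the functor \<open>x \<mapsto> Cod q\<close> on the homotopy
  category; being determined up to unique natural isomorphism, it is not chosen but quantified over.
\<close>

definition susp_datum :: "('o, 'm, 'z) modelcat_scheme \<Rightarrow> 'm \<Rightarrow> 'm \<Rightarrow> bool" where
  "susp_datum M c q \<longleftrightarrow> c \<in> Cofib M \<and> cofibrant M (Dom M c) \<and>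
    (\<forall>z k. zero_ob M z \<longrightarrow> k \<in> Hom M (Cod M c) z \<longrightarrow> k \<in> Weq M) \<and>
    (\<exists>k j. zero_ob M (Cod M k) \<and> is_pushout M c k q j)"

definition is_suspension ::
  "('o, 'm, 'z) modelcat_scheme \<Rightarrow> ('o, ('o, 'm) ho_arr, 'o, ('o, 'm) ho_arr) fn \<Rightarrow>
    ('m \<Rightarrow> 'm \<Rightarrow> ('o, 'm) ho_arr) \<Rightarrow> bool" where
  "is_suspension M S s \<longleftrightarrow> is_functor (Ho M) (Ho M) S \<and>
    (\<forall>c q. susp_datum M c q \<longrightarrow>
      s c q \<in> Hom (Ho M) (Cod M q) (FO S (Dom M c)) \<and> iso_arr (Ho M) (s c q)) \<and>
    (\<forall>c q c' q' a b d. susp_datum M c q \<longrightarrow> susp_datum M c' q' \<longrightarrow>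
      a \<in> Hom M (Dom M c) (Dom M c') \<longrightarrow> b \<in> Hom M (Cod M c) (Cod M c') \<longrightarrow>
      d \<in> Hom M (Cod M q) (Cod M q') \<longrightarrow> b \<cdot>\<^bsub>M\<^esub> c = c' \<cdot>\<^bsub>M\<^esub> a \<longrightarrow> d \<cdot>\<^bsub>M\<^esub> q = q' \<cdot>\<^bsub>M\<^esub> b \<longrightarrow>
      s c' q' \<cdot>\<^bsub>Ho M\<^esub> ho_arr M d = FA S (ho_arr M a) \<cdot>\<^bsub>Ho M\<^esub> s c q)"

definition is_stable_model_category :: "'u set \<Rightarrow> ('o, 'm, 'z) modelcat_scheme \<Rightarrow> bool" where
  "is_stable_model_category U M \<longleftrightarrow> is_model_category U M \<and> (\<exists>z. zero_ob M z) \<and>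
    (\<exists>S s. is_suspension M S s \<and> is_equivalence (Ho M) (Ho M) S)"

text \<open>
  \<open>T\<close> is, up to equivalence of monoidal triangulated categories, the homotopy category of \<open>M\<close>. In the
  triangulated structure on \<open>Ho M\<close>, the triangle on an arrow \<open>f\<close> between cofibrant objects is given
  by its mapping cone, the pushout of \<open>f\<close> along a cone \<open>c\<close>; the derived tensor product is the tensor
  product of cofibrant objects, with the unit replaced cofibrantly.
\<close>

definition model_category_models ::
  "'u set \<Rightarrow> ('o, 'm, 'z) modelcat_scheme \<Rightarrow> ('p, 'n, 'y) ttcat_scheme \<Rightarrow> bool" where
  "model_category_models U M T \<longleftrightarrow>
    is_monoidal_model_category U M \<and> is_stable_model_category U M \<and>
    (\<exists>F. is_equivalence (Ho M) T F \<and>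
      \<comment> \<open>exactness\<close>
      (\<exists>S s \<phi>. is_suspension M S s \<and> nat_iso (Ho M) T (fn_comp F S) (fn_comp (Shift T) F) \<phi> \<and>
        (\<forall>f c q i j \<delta>. f \<in> Arr M \<longrightarrow> cofibrant M (Dom M f) \<longrightarrow> cofibrant M (Cod M f) \<longrightarrow>
          susp_datum M c q \<longrightarrow> is_pushout M f c i j \<longrightarrow>
          \<delta> \<in> Hom M (Cod M i) (Cod M q) \<longrightarrow> zero_arr M (\<delta> \<cdot>\<^bsub>M\<^esub> i) \<longrightarrow> \<delta> \<cdot>\<^bsub>M\<^esub> j = q \<longrightarrow>
          (FA F (ho_arr M f), FA F (ho_arr M i),
            \<phi> (Dom M f) \<cdot>\<^bsub>T\<^esub> FA F (s c q \<cdot>\<^bsub>Ho M\<^esub> ho_arr M \<delta>)) \<in> Tri T)) \<and>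
      \<comment> \<open>monoidality\<close>
      (\<exists>\<mu> \<epsilon>.
        (\<forall>x y. cofibrant M x \<longrightarrow> cofibrant M y \<longrightarrow> iso_arr T (\<mu> x y) \<and>
          \<mu> x y \<in> Hom T (FO F x \<boxtimes>\<^bsub>T\<^esub> FO F y) (FO F (x \<boxtimes>\<^bsub>M\<^esub> y))) \<and>
        (\<forall>f\<in>Arr M. \<forall>g\<in>Arr M. cofibrant M (Dom M f) \<longrightarrow> cofibrant M (Cod M f) \<longrightarrow>
          cofibrant M (Dom M g) \<longrightarrow> cofibrant M (Cod M g) \<longrightarrow>
          \<mu> (Cod M f) (Cod M g) \<cdot>\<^bsub>T\<^esub> (FA F (ho_arr M f) \<boxdot>\<^bsub>T\<^esub> FA F (ho_arr M g)) =
          FA F (ho_arr M (f \<boxdot>\<^bsub>M\<^esub> g)) \<cdot>\<^bsub>T\<^esub> \<mu> (Dom M f) (Dom M g)) \<and>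
        (\<forall>x y z. cofibrant M x \<longrightarrow> cofibrant M y \<longrightarrow> cofibrant M z \<longrightarrow>
          FA F (ho_arr M (Assoc M x y z)) \<cdot>\<^bsub>T\<^esub>
            (\<mu> (x \<boxtimes>\<^bsub>M\<^esub> y) z \<cdot>\<^bsub>T\<^esub> (\<mu> x y \<boxdot>\<^bsub>T\<^esub> Ide T (FO F z))) =
          \<mu> x (y \<boxtimes>\<^bsub>M\<^esub> z) \<cdot>\<^bsub>T\<^esub>
            ((Ide T (FO F x) \<boxdot>\<^bsub>T\<^esub> \<mu> y z) \<cdot>\<^bsub>T\<^esub> Assoc T (FO F x) (FO F y) (FO F z))) \<and>
        \<epsilon> \<in> Hom T (Unit T) (FO F (Unit M)) \<and> iso_arr T \<epsilon> \<and>
        (\<forall>x q. cofibrant M x \<longrightarrow> q \<in> Weq M \<longrightarrow> cofibrant M (Dom M q) \<longrightarrow> Cod M q = Unit M \<longrightarrow>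
          FA F (ho_arr M (LUnit M x \<cdot>\<^bsub>M\<^esub> (q \<boxdot>\<^bsub>M\<^esub> Ide M x))) \<cdot>\<^bsub>T\<^esub> \<mu> (Dom M q) x =
          LUnit T (FO F x) \<cdot>\<^bsub>T\<^esub>
            ((inv_arr T \<epsilon> \<cdot>\<^bsub>T\<^esub> FA F (ho_arr M q)) \<boxdot>\<^bsub>T\<^esub> Ide T (FO F x)) \<and>
          FA F (ho_arr M (RUnit M x \<cdot>\<^bsub>M\<^esub> (Ide M x \<boxdot>\<^bsub>M\<^esub> q))) \<cdot>\<^bsub>T\<^esub> \<mu> x (Dom M q) =
          RUnit T (FO F x) \<cdot>\<^bsub>T\<^esub>
            (Ide T (FO F x) \<boxdot>\<^bsub>T\<^esub> (inv_arr T \<epsilon> \<cdot>\<^bsub>T\<^esub> FA F (ho_arr M q))))))"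


section \<open>Stable monoidal infinity-categories\<close>

text \<open>
  Simplicial sets. A monotone map from \<open>[m]\<close> to \<open>[n]\<close> is the list of its \<open>m + 1\<close> values;
  \<open>act X n \<theta>\<close> is the induced map from the \<open>n\<close>-simplices to the \<open>m\<close>-simplices.
\<close>

record 's sset =
  Sx :: "nat \<Rightarrow> 's set"
  act :: "nat \<Rightarrow> nat list \<Rightarrow> 's \<Rightarrow> 's"

definition ops :: "nat \<Rightarrow> nat \<Rightarrow> nat list set" where
  "ops n m = {\<theta>. length \<theta> = Suc m \<and> sorted \<theta> \<and> set \<theta> \<subseteq> {..n}}"

definition op_id :: "nat \<Rightarrow> nat list" where
  "op_id n = [0..<Suc n]"

definition op_comp :: "'a list \<Rightarrow> nat list \<Rightarrow> 'a list" where
  "op_comp \<theta> \<phi> = map ((!) \<theta>) \<phi>"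

definition is_sset :: "('s, 'z) sset_scheme \<Rightarrow> bool" where
  "is_sset X \<longleftrightarrow>
    (\<forall>n m. \<forall>\<theta>\<in>ops n m. \<forall>x\<in>Sx X n. act X n \<theta> x \<in> Sx X m) \<and>
    (\<forall>n. \<forall>x\<in>Sx X n. act X n (op_id n) x = x) \<and>
    (\<forall>n m k. \<forall>\<theta>\<in>ops n m. \<forall>\<phi>\<in>ops m k. \<forall>x\<in>Sx X n.
      act X n (op_comp \<theta> \<phi>) x = act X m \<phi> (act X n \<theta> x))"

text \<open>
  The nerve of a poset has as \<open>m\<close>-simplices the weakly increasing lists of length \<open>m + 1\<close>. All
  diagrams needed below are simplicial maps from a subcomplex \<open>S\<close> of such a nerve to \<open>X\<close>.
\<close>

definition mono_lists :: "'p set \<Rightarrow> ('p \<Rightarrow> 'p \<Rightarrow> bool) \<Rightarrow> 'p list set" where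
  "mono_lists A r = {l. l \<noteq> [] \<and> set l \<subseteq> A \<and> sorted_wrt r l}"

definition smap :: "'p list set \<Rightarrow> ('s, 'z) sset_scheme \<Rightarrow> ('p list \<Rightarrow> 's) \<Rightarrow> bool" where
  "smap S X f \<longleftrightarrow> (\<forall>l\<in>S. f l \<in> Sx X (length l - 1) \<and>
    (\<forall>m. \<forall>\<phi>\<in>ops (length l - 1) m. f (op_comp l \<phi>) = act X (length l - 1) \<phi> (f l)))"

abbreviation std_simplex :: "nat \<Rightarrow> nat list set" where
  "std_simplex n \<equiv> mono_lists {..n} (\<le>)"

definition bd_simplex :: "nat \<Rightarrow> nat list set" where
  \<comment> \<open>the boundary of the \<open>n\<close>-simplex\<close>
  "bd_simplex n = {l \<in> std_simplex n. \<not> {..n} \<subseteq> set l}"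

definition horn :: "nat \<Rightarrow> nat \<Rightarrow> nat list set" where
  "horn n k = {l \<in> std_simplex n. \<not> {..n} - {k} \<subseteq> set l}"

definition fills :: "('s, 'z) sset_scheme \<Rightarrow> nat \<Rightarrow> nat list set \<Rightarrow> (nat list \<Rightarrow> 's) \<Rightarrow> 's \<Rightarrow> bool" where
  "fills X n S f x \<longleftrightarrow> x \<in> Sx X n \<and> (\<forall>l\<in>S. act X n l x = f l)"

definition is_quasicat :: "('s, 'z) sset_scheme \<Rightarrow> bool" where
  "is_quasicat X \<longleftrightarrow> is_sset X \<and>
    (\<forall>n k f. 0 < k \<longrightarrow> k < n \<longrightarrow> smap (horn n k) X f \<longrightarrow> (\<exists>x. fills X n (horn n k) f x))"

abbreviation esrc :: "('s, 'z) sset_scheme \<Rightarrow> 's \<Rightarrow> 's" where "esrc X e \<equiv> act X 1 [0] e"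
abbreviation etgt :: "('s, 'z) sset_scheme \<Rightarrow> 's \<Rightarrow> 's" where "etgt X e \<equiv> act X 1 [1] e"
abbreviation eide :: "('s, 'z) sset_scheme \<Rightarrow> 's \<Rightarrow> 's" where "eide X x \<equiv> act X 0 [0, 0] x"

definition comp_triangle :: "('s, 'z) sset_scheme \<Rightarrow> 's \<Rightarrow> 's \<Rightarrow> 's \<Rightarrow> bool" where
  \<comment> \<open>some 2-simplex exhibits \<open>h\<close> as a composite of \<open>f\<close> followed by \<open>g\<close>\<close>
  "comp_triangle X f g h \<longleftrightarrow>
    (\<exists>\<sigma>\<in>Sx X 2. act X 2 [0, 1] \<sigma> = f \<and> act X 2 [1, 2] \<sigma> = g \<and> act X 2 [0, 2] \<sigma> = h)"

definition ecls :: "('s, 'z) sset_scheme \<Rightarrow> 's \<Rightarrow> 's set" where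
  \<comment> \<open>the homotopy class of an edge\<close>
  "ecls X f = {g. comp_triangle X f (eide X (etgt X f)) g}"

definition hcat :: "('s, 'z) sset_scheme \<Rightarrow> ('s, 's set) precat" where
  \<comment> \<open>the homotopy category of a quasi-category\<close>
  "hcat X = \<lparr>Ob = Sx X 0, Arr = ecls X ` Sx X 1,
    Dom = (\<lambda>A. esrc X (SOME f. f \<in> A)), Cod = (\<lambda>A. etgt X (SOME f. f \<in> A)),
    Ide = (\<lambda>x. ecls X (eide X x)),
    Comp = (\<lambda>B A. {h. \<exists>f\<in>A. \<exists>g\<in>B. comp_triangle X f g h})\<rparr>"

definition qc_initial :: "('s, 'z) sset_scheme \<Rightarrow> 's \<Rightarrow> bool" where
  "qc_initial X x \<longleftrightarrow> x \<in> Sx X 0 \<and>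
    (\<forall>n\<ge>1. \<forall>f. smap (bd_simplex n) X f \<longrightarrow> f [0] = x \<longrightarrow> (\<exists>y. fills X n (bd_simplex n) f y))"

definition qc_terminal :: "('s, 'z) sset_scheme \<Rightarrow> 's \<Rightarrow> bool" where
  "qc_terminal X x \<longleftrightarrow> x \<in> Sx X 0 \<and>
    (\<forall>n\<ge>1. \<forall>f. smap (bd_simplex n) X f \<longrightarrow> f [n] = x \<longrightarrow> (\<exists>y. fills X n (bd_simplex n) f y))"

definition qc_zero :: "('s, 'z) sset_scheme \<Rightarrow> 's \<Rightarrow> bool" where
  "qc_zero X x \<longleftrightarrow> qc_initial X x \<and> qc_terminal X x"

fun join_le :: "('a \<Rightarrow> 'a \<Rightarrow> bool) \<Rightarrow> ('b \<Rightarrow> 'b \<Rightarrow> bool) \<Rightarrow> 'a + 'b \<Rightarrow> 'a + 'b \<Rightarrow> bool" where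
  "join_le r s (Inl a) (Inl a') \<longleftrightarrow> r a a'"
| "join_le r s (Inl a) (Inr b) \<longleftrightarrow> True"
| "join_le r s (Inr b) (Inl a) \<longleftrightarrow> False"
| "join_le r s (Inr b) (Inr b') \<longleftrightarrow> s b b'"

fun prod_le :: "nat \<times> nat \<Rightarrow> nat \<times> nat \<Rightarrow> bool" where
  "prod_le (i, j) (i', j') \<longleftrightarrow> i \<le> i' \<and> j \<le> j'"

definition sq :: "(nat \<times> nat) set" where "sq = {0, 1} \<times> {0, 1}"
definition rect :: "(nat \<times> nat) set" where "rect = {0, 1} \<times> {0, 1, 2}"

text \<open>
  A square is a pushout if it is a colimit cone on its restriction \<open>K\<close> to the span: every map from the
  join of \<open>K\<close> with the boundary of an \<open>n\<close>-simplex (\<open>n \<ge> 1\<close>) which extends the given cone at the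
  vertex \<open>0\<close> extends to the join with the \<open>n\<close>-simplex.
\<close>

definition qc_pushout :: "('s, 'z) sset_scheme \<Rightarrow> ((nat \<times> nat) list \<Rightarrow> 's) \<Rightarrow> bool" where
  "qc_pushout X q \<longleftrightarrow> smap (mono_lists sq prod_le) X q \<and>
    (\<forall>(n::nat) f. 1 \<le> n \<longrightarrow> (
      let A = mono_lists (Inl ` (sq - {(1, 1)}) \<union> Inr ` {..n}) (join_le prod_le (\<le>));
          B = {l \<in> A. \<not> Inr ` {..n} \<subseteq> set l} in
      smap B X f \<longrightarrow>
      (\<forall>l\<in>A. set l \<subseteq> range Inl \<union> {Inr 0} \<longrightarrow> f l = q (map (case_sum id (\<lambda>_. (1, 1))) l)) \<longrightarrow>
      (\<exists>h. smap A X h \<and> (\<forall>l\<in>B. h l = f l))))"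

definition qc_pullback :: "('s, 'z) sset_scheme \<Rightarrow> ((nat \<times> nat) list \<Rightarrow> 's) \<Rightarrow> bool" where
  "qc_pullback X q \<longleftrightarrow> smap (mono_lists sq prod_le) X q \<and>
    (\<forall>(n::nat) f. 1 \<le> n \<longrightarrow> (
      let A = mono_lists (Inl ` {..n} \<union> Inr ` (sq - {(0, 0)})) (join_le (\<le>) prod_le);
          B = {l \<in> A. \<not> Inl ` {..n} \<subseteq> set l} in
      smap B X f \<longrightarrow>
      (\<forall>l\<in>A. set l \<subseteq> {Inl n} \<union> range Inr \<longrightarrow> f l = q (map (case_sum (\<lambda>_. (0, 0)) id) l)) \<longrightarrow>
      (\<exists>h. smap A X h \<and> (\<forall>l\<in>B. h l = f l))))"

definition is_stable_quasicat :: "('s, 'z) sset_scheme \<Rightarrow> bool" where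
  "is_stable_quasicat X \<longleftrightarrow> is_quasicat X \<and> (\<exists>z. qc_zero X z) \<and>
    (\<forall>e\<in>Sx X 1.
      (\<exists>q. qc_pushout X q \<and> q [(0, 0), (0, 1)] = e \<and> qc_zero X (q [(1, 0)])) \<and>
      (\<exists>q. qc_pullback X q \<and> q [(0, 1), (1, 1)] = e \<and> qc_zero X (q [(1, 0)]))) \<and>
    (\<forall>q. smap (mono_lists sq prod_le) X q \<longrightarrow> qc_zero X (q [(1, 0)]) \<longrightarrow>
      (qc_pushout X q \<longleftrightarrow> qc_pullback X q))"

text \<open>
  A monoidal infinity-category is a coCartesian fibration \<open>p\<close> from \<open>X\<close> to the nerve of \<open>\<Delta>\<^sup>o\<^sup>p\<close> that
  satisfies the Segal condition. A map to the nerve of a category is determined by its values on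
  vertices and edges: \<open>lv x\<close> is the \<open>n\<close> with \<open>p(x) = [n]\<close>, and \<open>lab e\<close> is the monotone map
  from \<open>[lv y]\<close> to \<open>[lv x]\<close> for an edge \<open>e\<close> from \<open>x\<close> to \<open>y\<close>. As the target is
  a nerve, \<open>p\<close> is an inner fibration iff \<open>X\<close> is a quasi-category.
\<close>

record 's moninf = "'s sset" +
  lv :: "'s \<Rightarrow> nat"
  lab :: "'s \<Rightarrow> nat list"

definition is_labelling :: "('s, 'z) moninf_scheme \<Rightarrow> bool" where
  "is_labelling X \<longleftrightarrow>
    (\<forall>e\<in>Sx X 1. lab X e \<in> ops (lv X (esrc X e)) (lv X (etgt X e))) \<and>
    (\<forall>x\<in>Sx X 0. lab X (eide X x) = op_id (lv X x)) \<and>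
    (\<forall>\<sigma>\<in>Sx X 2. lab X (act X 2 [0, 2] \<sigma>) = op_comp (lab X (act X 2 [0, 1] \<sigma>)) (lab X (act X 2 [1, 2] \<sigma>)))"

definition nerve_simplex :: "nat \<Rightarrow> (nat \<Rightarrow> nat) \<Rightarrow> (nat \<Rightarrow> nat \<Rightarrow> nat list) \<Rightarrow> bool" where
  \<comment> \<open>\<open>(b, \<beta>)\<close> is an \<open>n\<close>-simplex of the nerve of \<open>\<Delta>\<^sup>o\<^sup>p\<close>\<close>
  "nerve_simplex n b \<beta> \<longleftrightarrow>
    (\<forall>i j. i \<le> j \<longrightarrow> j \<le> n \<longrightarrow> \<beta> i j \<in> ops (b i) (b j)) \<and> (\<forall>i\<le>n. \<beta> i i = op_id (b i)) \<and>
    (\<forall>i j k. i \<le> j \<longrightarrow> j \<le> k \<longrightarrow> k \<le> n \<longrightarrow> \<beta> i k = op_comp (\<beta> i j) (\<beta> j k))"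

definition cocartesian_edge :: "('s, 'z) moninf_scheme \<Rightarrow> 's \<Rightarrow> bool" where
  "cocartesian_edge X e \<longleftrightarrow> e \<in> Sx X 1 \<and>
    (\<forall>n\<ge>2. \<forall>f b \<beta>. smap (horn n 0) X f \<longrightarrow> f [0, 1] = e \<longrightarrow> nerve_simplex n b \<beta> \<longrightarrow>
      (\<forall>i\<le>n. lv X (f [i]) = b i) \<longrightarrow>
      (\<forall>i j. i \<le> j \<longrightarrow> j \<le> n \<longrightarrow> [i, j] \<in> horn n 0 \<longrightarrow> lab X (f [i, j]) = \<beta> i j) \<longrightarrow>
      (\<exists>x. fills X n (horn n 0) f x \<and>
        (\<forall>i j. i \<le> j \<longrightarrow> j \<le> n \<longrightarrow> lab X (act X n [i, j] x) = \<beta> i j)))"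

text \<open>
  Segal condition: the functor from the fibre over \<open>[n]\<close> to the \<open>n\<close>-fold power of the
  fibre over \<open>[1]\<close>, given by coCartesian transport along the inclusions \<open>{i, i + 1}\<close>, is an
  equivalence. The first clause is essential surjectivity. The second is full faithfulness: with
  \<open>S = {0, \<dots>, n - 1}\<close> discrete, it says that the coCartesian edges \<open>e i\<close> out of \<open>y\<close> form a
  limit cone relative to \<open>p\<close>, i.e. that mapping spaces into \<open>y\<close> in the fibre over \<open>[n]\<close> are products of
  the mapping spaces over \<open>{i, i + 1}\<close> into the targets of the \<open>e i\<close>.
\<close>

definition segal :: "('s, 'z) moninf_scheme \<Rightarrow> nat \<Rightarrow> bool" where
  "segal X n \<longleftrightarrow>
    (\<forall>x. (\<forall>i<n. x i \<in> Sx X 0 \<and> lv X (x i) = 1) \<longrightarrow>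
      (\<exists>y\<in>Sx X 0. lv X y = n \<and> (\<exists>e. \<forall>i<n. cocartesian_edge X (e i) \<and>
        esrc X (e i) = y \<and> etgt X (e i) = x i \<and> lab X (e i) = [i, Suc i]))) \<and>
    (\<forall>y e. y \<in> Sx X 0 \<longrightarrow> lv X y = n \<longrightarrow>
      (\<forall>i<n. cocartesian_edge X (e i) \<and> esrc X (e i) = y \<and> lab X (e i) = [i, Suc i]) \<longrightarrow>
      (\<forall>(k::nat) f. 1 \<le> k \<longrightarrow> (
        let A = mono_lists (Inl ` {..k} \<union> Inr ` {..<n}) (join_le (\<le>) (=));
            B = {l \<in> A. \<not> Inl ` {..k} \<subseteq> set l} in
        smap B X f \<longrightarrow> f [Inl k] = y \<longrightarrow> (\<forall>s<n. f [Inl k, Inr s] = e s) \<longrightarrow>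
        (\<forall>i j. i \<le> j \<longrightarrow> j \<le> k \<longrightarrow> [Inl i, Inl j] \<in> B \<longrightarrow> lab X (f [Inl i, Inl j]) = op_id n) \<longrightarrow>
        (\<forall>i\<le>k. \<forall>s<n. lab X (f [Inl i, Inr s]) = [s, Suc s]) \<longrightarrow>
        (\<exists>h. smap A X h \<and> (\<forall>l\<in>B. h l = f l) \<and>
          (\<forall>i j. i \<le> j \<longrightarrow> j \<le> k \<longrightarrow> lab X (h [Inl i, Inl j]) = op_id n)))))"

definition is_monoidal_quasicat :: "('s, 'z) moninf_scheme \<Rightarrow> bool" where
  "is_monoidal_quasicat X \<longleftrightarrow> is_quasicat X \<and> is_labelling X \<and>
    (\<forall>x\<in>Sx X 0. \<forall>m. \<forall>\<theta>\<in>ops (lv X x) m.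
      \<exists>e. cocartesian_edge X e \<and> esrc X e = x \<and> lab X e = \<theta>) \<and>
    (\<forall>n. segal X n)"

definition underlying_qc :: "('s, 'z) moninf_scheme \<Rightarrow> 's sset" where
  \<comment> \<open>the fibre over \<open>[1]\<close>\<close>
  "underlying_qc X =
    \<lparr>Sx = (\<lambda>n. {x \<in> Sx X n. \<forall>i j. i \<le> j \<longrightarrow> j \<le> n \<longrightarrow> lab X (act X n [i, j] x) = op_id 1}),
     act = act X\<rparr>"

text \<open>
  A tensor triple \<open>(e1, e2, m)\<close> consists of coCartesian edges from an object over \<open>[2]\<close> to \<open>a\<close>,
  \<open>b\<close> and \<open>c\<close> over the inclusions of \<open>{0, 1}\<close>, \<open>{1, 2}\<close> and \<open>{0, 2}\<close>. It exhibits \<open>c\<close> as the tensor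
  product of \<open>a\<close> and \<open>b\<close>. Likewise a unit edge exhibits its target as the unit object.
\<close>

definition tensor_triple :: "('s, 'z) moninf_scheme \<Rightarrow> 's \<times> 's \<times> 's \<Rightarrow> bool" where
  "tensor_triple X = (\<lambda>(e1, e2, m).
    cocartesian_edge X e1 \<and> cocartesian_edge X e2 \<and> cocartesian_edge X m \<and>
    lv X (esrc X e1) = 2 \<and> esrc X e2 = esrc X e1 \<and> esrc X m = esrc X e1 \<and>
    lab X e1 = [0, 1] \<and> lab X e2 = [1, 2] \<and> lab X m = [0, 2])"

definition unit_edge :: "('s, 'z) moninf_scheme \<Rightarrow> 's \<Rightarrow> bool" where
  "unit_edge X v \<longleftrightarrow> cocartesian_edge X v \<and> lv X (esrc X v) = 0 \<and> lab X v = [0, 0]"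

text \<open>
  Exactness of the tensor product in each variable: it preserves zero objects and pushouts. For the
  latter, let \<open>R j\<close>, for \<open>j = 0, 1, 2\<close>, be the coCartesian transport of a square \<open>R j|\<^sub>0\<close> (the same
  for all \<open>j\<close>) in the fibre over \<open>[2]\<close> along the inclusions of \<open>{0, 1}\<close>, \<open>{1, 2}\<close> and \<open>{0, 2}\<close>.
  If one of \<open>R 0|\<^sub>1\<close>, \<open>R 1|\<^sub>1\<close> is constant and the other a pushout, then their tensor product \<open>R 2|\<^sub>1\<close>
  is a pushout.
\<close>

definition cube_le :: "nat \<times> (nat \<times> nat) \<Rightarrow> nat \<times> (nat \<times> nat) \<Rightarrow> bool" where
  "cube_le p q \<longleftrightarrow> fst p \<le> fst q \<and> prod_le (snd p) (snd q)"

definition qc_constant :: "('s, 'z) sset_scheme \<Rightarrow> ((nat \<times> nat) list \<Rightarrow> 's) \<Rightarrow> bool" where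
  "qc_constant X q \<longleftrightarrow>
    (\<exists>a\<in>Sx X 0. \<forall>l\<in>mono_lists sq prod_le. q l = act X 0 (replicate (length l) 0) a)"

definition biexact_tensor :: "('s, 'z) moninf_scheme \<Rightarrow> bool" where
  "biexact_tensor X \<longleftrightarrow>
    (\<forall>e1 e2 m. tensor_triple X (e1, e2, m) \<longrightarrow>
      qc_zero (underlying_qc X) (etgt X e1) \<or> qc_zero (underlying_qc X) (etgt X e2) \<longrightarrow>
      qc_zero (underlying_qc X) (etgt X m)) \<and>
    (\<forall>R :: nat \<Rightarrow> (nat \<times> (nat \<times> nat)) list \<Rightarrow> 's.
      (\<forall>j<3. smap (mono_lists ({0, 1} \<times> sq) cube_le) X (R j) \<and>
        (\<forall>l\<in>mono_lists sq prod_le. R j (map (Pair 0) l) = R 0 (map (Pair 0) l)) \<and>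
        (\<forall>a\<in>sq. \<forall>b\<in>sq. prod_le a b \<longrightarrow> lab X (R j [(0, a), (0, b)]) = op_id 2 \<and>
          lab X (R j [(1, a), (1, b)]) = op_id 1) \<and>
        (\<forall>a\<in>sq. cocartesian_edge X (R j [(0, a), (1, a)]) \<and>
          lab X (R j [(0, a), (1, a)]) = [[0, 1], [1, 2], [0, 2]] ! j)) \<longrightarrow>
      (let Q = (\<lambda>j l. R j (map (Pair 1) l)); C = underlying_qc X in
        qc_constant C (Q 0) \<and> qc_pushout C (Q 1) \<or> qc_pushout C (Q 0) \<and> qc_constant C (Q 1) \<longrightarrow>
        qc_pushout C (Q 2)))"

definition is_stable_monoidal_quasicat :: "('s, 'z) moninf_scheme \<Rightarrow> bool" where
  "is_stable_monoidal_quasicat X \<longleftrightarrow>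
    is_monoidal_quasicat X \<and> is_stable_quasicat (underlying_qc X) \<and> biexact_tensor X"

definition qc_susp_square :: "('s, 'z) sset_scheme \<Rightarrow> ((nat \<times> nat) list \<Rightarrow> 's) \<Rightarrow> bool" where
  "qc_susp_square X q \<longleftrightarrow> qc_pushout X q \<and> qc_zero X (q [(0, 1)]) \<and> qc_zero X (q [(1, 0)])"

text \<open>
  \<open>T\<close> is, up to equivalence of monoidal triangulated categories, the homotopy category of the underlying
  infinity-category \<open>C\<close> of \<open>X\<close>. A pushout square \<open>q\<close> with zero objects off the diagonal
  identifies its last vertex with the suspension of its first one (\<open>\<sigma> q\<close>). The distinguished
  triangles are given by diagrams \<open>r\<close> of shape \<open>[1] \<times> [2]\<close> formed by two pushout squares, with zero
  objects at \<open>(1, 0)\<close> and \<open>(0, 2)\<close>.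
\<close>

definition quasicat_models :: "('s, 'z) moninf_scheme \<Rightarrow> ('p, 'n, 'y) ttcat_scheme \<Rightarrow> bool" where
  "quasicat_models X T \<longleftrightarrow> is_stable_monoidal_quasicat X \<and>
    (let C = underlying_qc X; H = hcat X in
    \<exists>F. is_equivalence (hcat C) T F \<and>
      \<comment> \<open>exactness\<close>
      (\<exists>\<sigma>.
        (\<forall>q. qc_susp_square C q \<longrightarrow> iso_arr T (\<sigma> q) \<and>
          \<sigma> q \<in> Hom T (FO F (q [(1, 1)])) (FO (Shift T) (FO F (q [(0, 0)])))) \<and>
        (\<forall>k. smap (mono_lists ({0, 1} \<times> sq) cube_le) C k \<longrightarrow>
          (let q = (\<lambda>l. k (map (Pair 0) l)); q' = (\<lambda>l. k (map (Pair 1) l)) in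
          qc_susp_square C q \<longrightarrow> qc_susp_square C q' \<longrightarrow>
          \<sigma> q' \<cdot>\<^bsub>T\<^esub> FA F (ecls C (k [(0, (1, 1)), (1, (1, 1))])) =
          FA (Shift T) (FA F (ecls C (k [(0, (0, 0)), (1, (0, 0))]))) \<cdot>\<^bsub>T\<^esub> \<sigma> q)) \<and>
        (\<forall>r. smap (mono_lists rect prod_le) C r \<longrightarrow> qc_pushout C r \<longrightarrow>
          qc_pushout C (\<lambda>l. r (map (\<lambda>(i, j). (i, j + 1)) l)) \<longrightarrow>
          qc_zero C (r [(1, 0)]) \<longrightarrow> qc_zero C (r [(0, 2)]) \<longrightarrow>
          (FA F (ecls C (r [(0, 0), (0, 1)])), FA F (ecls C (r [(0, 1), (1, 1)])),
            \<sigma> (\<lambda>l. r (map (\<lambda>(i, j). (i, 2 * j)) l)) \<cdot>\<^bsub>T\<^esub> FA F (ecls C (r [(1, 1), (1, 2)]))) \<in> Tri T)) \<and>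
      \<comment> \<open>monoidality\<close>
      (\<exists>\<mu> \<epsilon>.
        (\<forall>e1 e2 m. tensor_triple X (e1, e2, m) \<longrightarrow> iso_arr T (\<mu> (e1, e2, m)) \<and>
          \<mu> (e1, e2, m) \<in>
            Hom T (FO F (etgt X e1) \<boxtimes>\<^bsub>T\<^esub> FO F (etgt X e2)) (FO F (etgt X m))) \<and>
        (\<forall>e1 e2 m e1' e2' m' k f g h.
          tensor_triple X (e1, e2, m) \<longrightarrow> tensor_triple X (e1', e2', m') \<longrightarrow>
          k \<in> Sx X 1 \<longrightarrow> esrc X k = esrc X m \<longrightarrow> etgt X k = esrc X m' \<longrightarrow> lab X k = op_id 2 \<longrightarrow>
          f \<in> Sx C 1 \<longrightarrow> esrc X f = etgt X e1 \<longrightarrow> etgt X f = etgt X e1' \<longrightarrow>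
          g \<in> Sx C 1 \<longrightarrow> esrc X g = etgt X e2 \<longrightarrow> etgt X g = etgt X e2' \<longrightarrow>
          h \<in> Sx C 1 \<longrightarrow> esrc X h = etgt X m \<longrightarrow> etgt X h = etgt X m' \<longrightarrow>
          ecls X e1' \<cdot>\<^bsub>H\<^esub> ecls X k = ecls X f \<cdot>\<^bsub>H\<^esub> ecls X e1 \<longrightarrow>
          ecls X e2' \<cdot>\<^bsub>H\<^esub> ecls X k = ecls X g \<cdot>\<^bsub>H\<^esub> ecls X e2 \<longrightarrow>
          ecls X m' \<cdot>\<^bsub>H\<^esub> ecls X k = ecls X h \<cdot>\<^bsub>H\<^esub> ecls X m \<longrightarrow>
          \<mu> (e1', e2', m') \<cdot>\<^bsub>T\<^esub> (FA F (ecls C f) \<boxdot>\<^bsub>T\<^esub> FA F (ecls C g)) =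
          FA F (ecls C h) \<cdot>\<^bsub>T\<^esub> \<mu> (e1, e2, m)) \<and>
        \<comment> \<open>Associativity: \<open>k\<^sub>S\<close> are coCartesian edges from an object over \<open>[3]\<close>, for the four subsets
            \<open>S\<close> of \<open>{0, 1, 2, 3}\<close> with three elements; the triples \<open>p\<close>, \<open>q\<close>, \<open>r\<close>, \<open>s\<close> start at the
            targets of \<open>k\<^sub>0\<^sub>1\<^sub>2\<close>, \<open>k\<^sub>1\<^sub>2\<^sub>3\<close>, \<open>k\<^sub>0\<^sub>1\<^sub>3\<close> and \<open>k\<^sub>0\<^sub>2\<^sub>3\<close>.\<close>
        (\<forall>k012 k123 k013 k023 p1 p2 p3 q1 q2 q3 r1 r2 r3 s1 s2 s3.
          (\<forall>k\<in>{k012, k123, k013, k023}. cocartesian_edge X k \<and> esrc X k = esrc X k012) \<longrightarrow>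
          lv X (esrc X k012) = 3 \<longrightarrow> lab X k012 = [0, 1, 2] \<longrightarrow> lab X k123 = [1, 2, 3] \<longrightarrow>
          lab X k013 = [0, 1, 3] \<longrightarrow> lab X k023 = [0, 2, 3] \<longrightarrow>
          tensor_triple X (p1, p2, p3) \<longrightarrow> esrc X p3 = etgt X k012 \<longrightarrow>
          tensor_triple X (q1, q2, q3) \<longrightarrow> esrc X q3 = etgt X k123 \<longrightarrow>
          tensor_triple X (r1, r2, r3) \<longrightarrow> esrc X r3 = etgt X k013 \<longrightarrow>
          tensor_triple X (s1, s2, s3) \<longrightarrow> esrc X s3 = etgt X k023 \<longrightarrow>
          ecls X p1 \<cdot>\<^bsub>H\<^esub> ecls X k012 = ecls X r1 \<cdot>\<^bsub>H\<^esub> ecls X k013 \<longrightarrow>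
          ecls X p2 \<cdot>\<^bsub>H\<^esub> ecls X k012 = ecls X q1 \<cdot>\<^bsub>H\<^esub> ecls X k123 \<longrightarrow>
          ecls X q2 \<cdot>\<^bsub>H\<^esub> ecls X k123 = ecls X s2 \<cdot>\<^bsub>H\<^esub> ecls X k023 \<longrightarrow>
          ecls X p3 \<cdot>\<^bsub>H\<^esub> ecls X k012 = ecls X s1 \<cdot>\<^bsub>H\<^esub> ecls X k023 \<longrightarrow>
          ecls X q3 \<cdot>\<^bsub>H\<^esub> ecls X k123 = ecls X r2 \<cdot>\<^bsub>H\<^esub> ecls X k013 \<longrightarrow>
          ecls X r3 \<cdot>\<^bsub>H\<^esub> ecls X k013 = ecls X s3 \<cdot>\<^bsub>H\<^esub> ecls X k023 \<longrightarrow>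
          (let a = FO F (etgt X p1); b = FO F (etgt X p2); c = FO F (etgt X q2) in
          \<mu> (s1, s2, s3) \<cdot>\<^bsub>T\<^esub> (\<mu> (p1, p2, p3) \<boxdot>\<^bsub>T\<^esub> Ide T c) =
          \<mu> (r1, r2, r3) \<cdot>\<^bsub>T\<^esub> ((Ide T a \<boxdot>\<^bsub>T\<^esub> \<mu> (q1, q2, q3)) \<cdot>\<^bsub>T\<^esub> Assoc T a b c))) \<and>
        (\<forall>v. unit_edge X v \<longrightarrow> \<epsilon> v \<in> Hom T (Unit T) (FO F (etgt X v)) \<and> iso_arr T (\<epsilon> v)) \<and>
        (\<forall>v v' k h. unit_edge X v \<longrightarrow> unit_edge X v' \<longrightarrow>
          k \<in> Sx X 1 \<longrightarrow> esrc X k = esrc X v \<longrightarrow> etgt X k = esrc X v' \<longrightarrow>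
          h \<in> Sx C 1 \<longrightarrow> esrc X h = etgt X v \<longrightarrow> etgt X h = etgt X v' \<longrightarrow>
          ecls X v' \<cdot>\<^bsub>H\<^esub> ecls X k = ecls X h \<cdot>\<^bsub>H\<^esub> ecls X v \<longrightarrow>
          \<epsilon> v' = FA F (ecls C h) \<cdot>\<^bsub>T\<^esub> \<epsilon> v) \<and>
        \<comment> \<open>Units: \<open>k\<close> is a coCartesian edge from \<open>a\<close> over \<open>[1]\<close> to an object over \<open>[2]\<close> which
            inserts the unit, given by \<open>j\<close> followed by \<open>v\<close>, to the left or to the right of \<open>a\<close>.\<close>
        (\<forall>a k e1 e2 m j v. a \<in> Sx C 0 \<longrightarrow> tensor_triple X (e1, e2, m) \<longrightarrow> unit_edge X v \<longrightarrow>
          cocartesian_edge X k \<longrightarrow> esrc X k = a \<longrightarrow> etgt X k = esrc X m \<longrightarrow>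
          cocartesian_edge X j \<longrightarrow> esrc X j = a \<longrightarrow> etgt X j = esrc X v \<longrightarrow>
          ecls X m \<cdot>\<^bsub>H\<^esub> ecls X k = Ide H a \<longrightarrow>
          (lab X k = [0, 0, 1] \<longrightarrow> lab X j = [0] \<longrightarrow>
            ecls X e1 \<cdot>\<^bsub>H\<^esub> ecls X k = ecls X v \<cdot>\<^bsub>H\<^esub> ecls X j \<longrightarrow> ecls X e2 \<cdot>\<^bsub>H\<^esub> ecls X k = Ide H a \<longrightarrow>
            \<mu> (e1, e2, m) \<cdot>\<^bsub>T\<^esub> (\<epsilon> v \<boxdot>\<^bsub>T\<^esub> Ide T (FO F a)) = LUnit T (FO F a)) \<and>
          (lab X k = [0, 1, 1] \<longrightarrow> lab X j = [1] \<longrightarrow>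
            ecls X e2 \<cdot>\<^bsub>H\<^esub> ecls X k = ecls X v \<cdot>\<^bsub>H\<^esub> ecls X j \<longrightarrow> ecls X e1 \<cdot>\<^bsub>H\<^esub> ecls X k = Ide H a \<longrightarrow>
            \<mu> (e1, e2, m) \<cdot>\<^bsub>T\<^esub> (Ide T (FO F a) \<boxdot>\<^bsub>T\<^esub> \<epsilon> v) = RUnit T (FO F a)))))"



section \<open>Strong stable monoidal derivators\<close>

text \<open>
  A prederivator is a strict 2-functor, contravariant on functors, from small categories to
  categories. Here \<open>Pull D J K u\<close> is \<open>u\<^sup>*\<close> from \<open>D(K)\<close> to \<open>D(J)\<close>, for a functor \<open>u\<close> from \<open>J\<close> to \<open>K\<close>, and
  \<open>Pull2 D J K u v \<alpha>\<close> is \<open>\<alpha>\<^sup>*\<close> from \<open>u\<^sup>*\<close> to \<open>v\<^sup>*\<close>. In a monoidal prederivator the \<open>D(J)\<close> are monoidal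
  categories and the \<open>u\<^sup>*\<close> are strong monoidal with structure maps \<open>PMu\<close> and \<open>PEps\<close>.
\<close>

record ('u, 'o, 'm) derivator =
  DC :: "('u, 'u) precat \<Rightarrow> ('o, 'm) moncat"
  Pull :: "('u, 'u) precat \<Rightarrow> ('u, 'u) precat \<Rightarrow> ('u, 'u, 'u, 'u) fn \<Rightarrow> ('o, 'm, 'o, 'm) fn"
  Pull2 :: "('u, 'u) precat \<Rightarrow> ('u, 'u) precat \<Rightarrow> ('u, 'u, 'u, 'u) fn \<Rightarrow> ('u, 'u, 'u, 'u) fn \<Rightarrow>
    ('u \<Rightarrow> 'u) \<Rightarrow> 'o \<Rightarrow> 'm"
  PMu :: "('u, 'u) precat \<Rightarrow> ('u, 'u) precat \<Rightarrow> ('u, 'u, 'u, 'u) fn \<Rightarrow> 'o \<Rightarrow> 'o \<Rightarrow> 'm"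
  PEps :: "('u, 'u) precat \<Rightarrow> ('u, 'u) precat \<Rightarrow> ('u, 'u, 'u, 'u) fn \<Rightarrow> 'm"

text \<open>
  Functors are functions whose values outside the source are irrelevant, whence the formulation of the
  identity and composition laws up to agreement.
\<close>

definition is_prederivator :: "'u set \<Rightarrow> ('u, 'o, 'm) derivator \<Rightarrow> bool" where
  "is_prederivator U D \<longleftrightarrow>
    (\<forall>J. small_cat U J \<longrightarrow> is_category (DC D J)) \<and>
    (\<forall>J K u. small_cat U J \<longrightarrow> small_cat U K \<longrightarrow> is_functor J K u \<longrightarrow>
      is_functor (DC D K) (DC D J) (Pull D J K u)) \<and>
    (\<forall>J u. small_cat U J \<longrightarrow> is_functor J J u \<longrightarrow> fn_agree J u fn_id \<longrightarrow>
      fn_agree (DC D J) (Pull D J J u) fn_id) \<and>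
    (\<forall>I J K u v w. small_cat U I \<longrightarrow> small_cat U J \<longrightarrow> small_cat U K \<longrightarrow>
      is_functor I J u \<longrightarrow> is_functor J K v \<longrightarrow> is_functor I K w \<longrightarrow> fn_agree I w (fn_comp v u) \<longrightarrow>
      fn_agree (DC D K) (Pull D I K w) (fn_comp (Pull D I J u) (Pull D J K v))) \<and>
    (\<forall>J K u v \<alpha>. small_cat U J \<longrightarrow> small_cat U K \<longrightarrow> is_functor J K u \<longrightarrow> is_functor J K v \<longrightarrow>
      nat_trans J K u v \<alpha> \<longrightarrow>
      nat_trans (DC D K) (DC D J) (Pull D J K u) (Pull D J K v) (Pull2 D J K u v \<alpha>)) \<and>
    (\<forall>J K u v \<alpha>. small_cat U J \<longrightarrow> small_cat U K \<longrightarrow> is_functor J K u \<longrightarrow> is_functor J K v \<longrightarrow>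
      fn_agree J u v \<longrightarrow> (\<forall>j\<in>Ob J. \<alpha> j = Ide K (FO u j)) \<longrightarrow>
      (\<forall>x\<in>Ob (DC D K). Pull2 D J K u v \<alpha> x = Ide (DC D J) (FO (Pull D J K u) x))) \<and>
    (\<forall>J K u v w \<alpha> \<beta> \<gamma>. small_cat U J \<longrightarrow> small_cat U K \<longrightarrow>
      is_functor J K u \<longrightarrow> is_functor J K v \<longrightarrow> is_functor J K w \<longrightarrow>
      nat_trans J K u v \<alpha> \<longrightarrow> nat_trans J K v w \<beta> \<longrightarrow> (\<forall>j\<in>Ob J. \<gamma> j = \<beta> j \<cdot>\<^bsub>K\<^esub> \<alpha> j) \<longrightarrow>
      (\<forall>x\<in>Ob (DC D K).
        Pull2 D J K u w \<gamma> x = Pull2 D J K v w \<beta> x \<cdot>\<^bsub>DC D J\<^esub> Pull2 D J K u v \<alpha> x)) \<and>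
    (\<forall>I J K w u v \<alpha>. small_cat U I \<longrightarrow> small_cat U J \<longrightarrow> small_cat U K \<longrightarrow>
      is_functor I J w \<longrightarrow> is_functor J K u \<longrightarrow> is_functor J K v \<longrightarrow> nat_trans J K u v \<alpha> \<longrightarrow>
      (\<forall>x\<in>Ob (DC D K). Pull2 D I K (fn_comp u w) (fn_comp v w) (\<lambda>i. \<alpha> (FO w i)) x =
        FA (Pull D I J w) (Pull2 D J K u v \<alpha> x))) \<and>
    (\<forall>I J K w u v \<alpha>. small_cat U I \<longrightarrow> small_cat U J \<longrightarrow> small_cat U K \<longrightarrow>
      is_functor I J u \<longrightarrow> is_functor I J v \<longrightarrow> is_functor J K w \<longrightarrow> nat_trans I J u v \<alpha> \<longrightarrow>
      (\<forall>x\<in>Ob (DC D K). Pull2 D I K (fn_comp w u) (fn_comp w v) (\<lambda>i. FA w (\<alpha> i)) x =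
        Pull2 D I J u v \<alpha> (FO (Pull D J K w) x)))"

text \<open>
  Shapes have to be categories with objects and arrows in \<open>U\<close>. Comma categories and products are therefore
  only specified up to isomorphism; subposets of \<open>\<nat> \<times> \<nat>\<close> are coded in \<open>U\<close>.
\<close>

definition enc :: "'u set \<Rightarrow> nat \<Rightarrow> 'u" where
  "enc U = (SOME e. inj e \<and> range e \<subseteq> U)"

definition pob :: "'u set \<Rightarrow> nat \<times> nat \<Rightarrow> 'u" where
  "pob U a = enc U (prod_encode a)"

definition pob_dec :: "'u set \<Rightarrow> 'u \<Rightarrow> nat \<times> nat" where
  "pob_dec U x = prod_decode (inv_into UNIV (enc U) x)"

definition par :: "'u set \<Rightarrow> nat \<times> nat \<Rightarrow> nat \<times> nat \<Rightarrow> 'u" where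
  "par U a b = enc U (prod_encode (prod_encode a, prod_encode b))"

definition par_src :: "'u set \<Rightarrow> 'u \<Rightarrow> nat \<times> nat" where
  "par_src U f = prod_decode (fst (prod_decode (inv_into UNIV (enc U) f)))"

definition par_tgt :: "'u set \<Rightarrow> 'u \<Rightarrow> nat \<times> nat" where
  "par_tgt U f = prod_decode (snd (prod_decode (inv_into UNIV (enc U) f)))"

definition poset_cat :: "'u set \<Rightarrow> (nat \<times> nat) set \<Rightarrow> ('u, 'u) precat" where
  "poset_cat U A = \<lparr>Ob = pob U ` A, Arr = {par U a b | a b. a \<in> A \<and> b \<in> A \<and> prod_le a b},
    Dom = (\<lambda>f. pob U (par_src U f)), Cod = (\<lambda>f. pob U (par_tgt U f)),
    Ide = (\<lambda>x. par U (pob_dec U x) (pob_dec U x)),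
    Comp = (\<lambda>g f. par U (par_src U f) (par_tgt U g))\<rparr>"

definition poset_fn :: "'u set \<Rightarrow> (nat \<times> nat \<Rightarrow> nat \<times> nat) \<Rightarrow> ('u, 'u, 'u, 'u) fn" where
  "poset_fn U m = \<lparr>FO = (\<lambda>x. pob U (m (pob_dec U x))),
    FA = (\<lambda>f. par U (m (par_src U f)) (m (par_tgt U f)))\<rparr>"

abbreviation pt :: "'u set \<Rightarrow> ('u, 'u) precat" where
  "pt U \<equiv> poset_cat U {(0, 0)}"

abbreviation interval_cat :: "'u set \<Rightarrow> ('u, 'u) precat" where
  "interval_cat U \<equiv> poset_cat U {(0, 0), (0, 1)}"

definition to_pt :: "'u set \<Rightarrow> ('u, 'u, 'u, 'u) fn" where
  "to_pt U = fn_const (pt U) (pob U (0, 0))"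

definition at_ob :: "'u set \<Rightarrow> ('u, 'o, 'm) derivator \<Rightarrow> ('u, 'u) precat \<Rightarrow> 'u \<Rightarrow> ('o, 'm, 'o, 'm) fn" where
  \<comment> \<open>evaluation at an object \<open>k\<close> of \<open>K\<close>\<close>
  "at_ob U D K k = Pull D (pt U) K (fn_const K k)"

definition at_arr :: "'u set \<Rightarrow> ('u, 'o, 'm) derivator \<Rightarrow> ('u, 'u) precat \<Rightarrow> 'u \<Rightarrow> 'o \<Rightarrow> 'm" where
  \<comment> \<open>evaluation of an object of \<open>D(K)\<close> at an arrow \<open>f\<close> of \<open>K\<close>\<close>
  "at_arr U D K f = Pull2 D (pt U) K (fn_const K (Dom K f)) (fn_const K (Cod K f)) (\<lambda>_. f)"

definition is_product_cat ::
  "('u, 'u) precat \<Rightarrow> ('u, 'u) precat \<Rightarrow> ('u, 'u) precat \<Rightarrow>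
    ('u, 'u, 'u, 'u) fn \<Rightarrow> ('u, 'u, 'u, 'u) fn \<Rightarrow> bool" where
  "is_product_cat J K P p q \<longleftrightarrow> is_functor P J p \<and> is_functor P K q \<and>
    bij_betw (\<lambda>x. (FO p x, FO q x)) (Ob P) (Ob J \<times> Ob K) \<and>
    bij_betw (\<lambda>f. (FA p f, FA q f)) (Arr P) (Arr J \<times> Arr K)"

definition is_comma_over ::
  "('u, 'u) precat \<Rightarrow> ('u, 'u) precat \<Rightarrow> ('u, 'u, 'u, 'u) fn \<Rightarrow> 'u \<Rightarrow>
    ('u, 'u) precat \<Rightarrow> ('u, 'u, 'u, 'u) fn \<Rightarrow> ('u \<Rightarrow> 'u) \<Rightarrow> bool" where
  \<comment> \<open>\<open>C\<close> with the projection \<open>p\<close> to \<open>J\<close> is the category of pairs of an object \<open>j\<close> of \<open>J\<close> and an arrow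
      from \<open>u(j)\<close> to \<open>k\<close>\<close>
  "is_comma_over J K u k C p \<alpha> \<longleftrightarrow> is_functor C J p \<and>
    nat_trans C K (fn_comp u p) (fn_const K k) \<alpha> \<and>
    bij_betw (\<lambda>c. (FO p c, \<alpha> c)) (Ob C) {(j, a). j \<in> Ob J \<and> a \<in> Hom K (FO u j) k} \<and>
    (\<forall>c\<in>Ob C. \<forall>c'\<in>Ob C. bij_betw (FA p) (Hom C c c')
      {f \<in> Hom J (FO p c) (FO p c'). \<alpha> c' \<cdot>\<^bsub>K\<^esub> FA u f = \<alpha> c})"

definition is_comma_under ::
  "('u, 'u) precat \<Rightarrow> ('u, 'u) precat \<Rightarrow> ('u, 'u, 'u, 'u) fn \<Rightarrow> 'u \<Rightarrow>
    ('u, 'u) precat \<Rightarrow> ('u, 'u, 'u, 'u) fn \<Rightarrow> ('u \<Rightarrow> 'u) \<Rightarrow> bool" where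
  "is_comma_under J K u k C p \<alpha> \<longleftrightarrow> is_functor C J p \<and>
    nat_trans C K (fn_const K k) (fn_comp u p) \<alpha> \<and>
    bij_betw (\<lambda>c. (FO p c, \<alpha> c)) (Ob C) {(j, a). j \<in> Ob J \<and> a \<in> Hom K k (FO u j)} \<and>
    (\<forall>c\<in>Ob C. \<forall>c'\<in>Ob C. bij_betw (FA p) (Hom C c c')
      {f \<in> Hom J (FO p c) (FO p c'). FA u f \<cdot>\<^bsub>K\<^esub> \<alpha> c = \<alpha> c'})"

text \<open>
  Der4 asks for the canonical map from \<open>\<pi>\<^sub>! p\<^sup>* x\<close> to \<open>k\<^sup>* u\<^sub>! x\<close> to be an isomorphism, where \<open>\<pi>\<close> is the
  functor from the comma category to the point. Given a universal arrow \<open>\<eta>\<close> from \<open>x\<close> to \<open>u\<^sup>* l\<close>, so that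
  \<open>l = u\<^sub>! x\<close>, this means that the arrow from \<open>p\<^sup>* x\<close> to \<open>\<pi>\<^sup>* k\<^sup>* l\<close> formed from \<open>p\<^sup>* \<eta>\<close> and \<open>\<alpha>\<^sup>*\<close>
  is again universal.
\<close>

definition is_derivator :: "'u set \<Rightarrow> ('u, 'o, 'm) derivator \<Rightarrow> bool" where
  "is_derivator U D \<longleftrightarrow> is_prederivator U D \<and>
    \<comment> \<open>Der1\<close>
    (\<forall>J I A. small_cat U J \<longrightarrow> I \<subseteq> U \<longrightarrow> (\<Union>i\<in>I. A i) = Ob J \<longrightarrow> disjoint_family_on A I \<longrightarrow>
      (\<forall>f\<in>Arr J. \<forall>i\<in>I. Dom J f \<in> A i \<longleftrightarrow> Cod J f \<in> A i) \<longrightarrow>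
      (\<forall>x\<in>Ob (DC D J). \<forall>y\<in>Ob (DC D J).
        bij_betw (\<lambda>h. \<lambda>i\<in>I. FA (Pull D (full_subcat J (A i)) J fn_id) h)
          (Hom (DC D J) x y)
          (\<Pi>\<^sub>E i\<in>I. Hom (DC D (full_subcat J (A i)))
            (FO (Pull D (full_subcat J (A i)) J fn_id) x)
            (FO (Pull D (full_subcat J (A i)) J fn_id) y))) \<and>
      (\<forall>z. (\<forall>i\<in>I. z i \<in> Ob (DC D (full_subcat J (A i)))) \<longrightarrow>
        (\<exists>x\<in>Ob (DC D J). \<forall>i\<in>I. isomorphic (DC D (full_subcat J (A i)))
          (FO (Pull D (full_subcat J (A i)) J fn_id) x) (z i)))) \<and>
    \<comment> \<open>Der2\<close>
    (\<forall>J. small_cat U J \<longrightarrow> (\<forall>f\<in>Arr (DC D J).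
      (\<forall>j\<in>Ob J. iso_arr (DC D (pt U)) (FA (at_ob U D J j) f)) \<longrightarrow> iso_arr (DC D J) f)) \<and>
    \<comment> \<open>Der3\<close>
    (\<forall>J K u. small_cat U J \<longrightarrow> small_cat U K \<longrightarrow> is_functor J K u \<longrightarrow> (\<forall>x\<in>Ob (DC D J).
      (\<exists>l \<eta>. universal_arrow (DC D J) (DC D K) (Pull D J K u) x l \<eta>) \<and>
      (\<exists>r \<epsilon>. couniversal_arrow (DC D J) (DC D K) (Pull D J K u) x r \<epsilon>))) \<and>
    \<comment> \<open>Der4\<close>
    (\<forall>J K u k C p \<alpha> x l \<eta>. small_cat U J \<longrightarrow> small_cat U K \<longrightarrow> is_functor J K u \<longrightarrow> k \<in> Ob K \<longrightarrow>
      small_cat U C \<longrightarrow> is_comma_over J K u k C p \<alpha> \<longrightarrow>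
      universal_arrow (DC D J) (DC D K) (Pull D J K u) x l \<eta> \<longrightarrow>
      universal_arrow (DC D C) (DC D (pt U)) (Pull D C (pt U) (to_pt U))
        (FO (Pull D C J p) x) (FO (at_ob U D K k) l)
        (Pull2 D C K (fn_comp u p) (fn_const K k) \<alpha> l \<cdot>\<^bsub>DC D C\<^esub> FA (Pull D C J p) \<eta>)) \<and>
    (\<forall>J K u k C p \<alpha> x r \<epsilon>. small_cat U J \<longrightarrow> small_cat U K \<longrightarrow> is_functor J K u \<longrightarrow> k \<in> Ob K \<longrightarrow>
      small_cat U C \<longrightarrow> is_comma_under J K u k C p \<alpha> \<longrightarrow>
      couniversal_arrow (DC D J) (DC D K) (Pull D J K u) x r \<epsilon> \<longrightarrow>
      couniversal_arrow (DC D C) (DC D (pt U)) (Pull D C (pt U) (to_pt U))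
        (FO (Pull D C J p) x) (FO (at_ob U D K k) r)
        (FA (Pull D C J p) \<epsilon> \<cdot>\<^bsub>DC D C\<^esub> Pull2 D C K (fn_const K k) (fn_comp u p) \<alpha> r))"

definition is_strong_derivator :: "'u set \<Rightarrow> ('u, 'o, 'm) derivator \<Rightarrow> bool" where
  \<comment> \<open>the functor from \<open>D(J \<times> [1])\<close> to the arrow category of \<open>D(J)\<close> is full and essentially
      surjective; \<open>i\<^sub>0\<close>, \<open>i\<^sub>1\<close> are the inclusions of \<open>J\<close> and \<open>\<alpha>\<close> the canonical transformation\<close>
  "is_strong_derivator U D \<longleftrightarrow> is_derivator U D \<and>
    (\<forall>J P p q i0 i1 \<alpha>. small_cat U J \<longrightarrow> small_cat U P \<longrightarrow>
      is_product_cat J (interval_cat U) P p q \<longrightarrow> is_functor J P i0 \<longrightarrow> is_functor J P i1 \<longrightarrow>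
      fn_agree J (fn_comp p i0) fn_id \<longrightarrow>
      fn_agree J (fn_comp q i0) (fn_const (interval_cat U) (pob U (0, 0))) \<longrightarrow>
      fn_agree J (fn_comp p i1) fn_id \<longrightarrow>
      fn_agree J (fn_comp q i1) (fn_const (interval_cat U) (pob U (0, 1))) \<longrightarrow>
      nat_trans J P i0 i1 \<alpha> \<longrightarrow>
      (\<forall>j\<in>Ob J. FA p (\<alpha> j) = Ide J j \<and> FA q (\<alpha> j) = par U (0, 0) (0, 1)) \<longrightarrow>
      (let E = DC D J; i0' = Pull D J P i0; i1' = Pull D J P i1; \<alpha>' = Pull2 D J P i0 i1 \<alpha> in
      (\<forall>f\<in>Arr E. \<exists>z\<in>Ob (DC D P).
        \<exists>a\<in>Hom E (FO i0' z) (Dom E f). \<exists>b\<in>Hom E (FO i1' z) (Cod E f).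
          iso_arr E a \<and> iso_arr E b \<and> b \<cdot>\<^bsub>E\<^esub> \<alpha>' z = f \<cdot>\<^bsub>E\<^esub> a) \<and>
      (\<forall>z\<in>Ob (DC D P). \<forall>z'\<in>Ob (DC D P).
        \<forall>a\<in>Hom E (FO i0' z) (FO i0' z'). \<forall>b\<in>Hom E (FO i1' z) (FO i1' z').
          b \<cdot>\<^bsub>E\<^esub> \<alpha>' z = \<alpha>' z' \<cdot>\<^bsub>E\<^esub> a \<longrightarrow>
          (\<exists>h\<in>Hom (DC D P) z z'. FA i0' h = a \<and> FA i1' h = b))))"

definition der_cocartesian :: "'u set \<Rightarrow> ('u, 'o, 'm) derivator \<Rightarrow> 'o \<Rightarrow> bool" where
  \<comment> \<open>the counit from \<open>i\<^sub>! i\<^sup>* x\<close> to \<open>x\<close> is invertible, for \<open>i\<close> the inclusion of the span into the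
      square\<close>
  "der_cocartesian U D x \<longleftrightarrow>
    (let J = poset_cat U (sq - {(1, 1)}); K = poset_cat U sq; y = FO (Pull D J K fn_id) x in
      universal_arrow (DC D J) (DC D K) (Pull D J K fn_id) y x (Ide (DC D J) y))"

definition der_cartesian :: "'u set \<Rightarrow> ('u, 'o, 'm) derivator \<Rightarrow> 'o \<Rightarrow> bool" where
  "der_cartesian U D x \<longleftrightarrow>
    (let J = poset_cat U (sq - {(0, 0)}); K = poset_cat U sq; y = FO (Pull D J K fn_id) x in
      couniversal_arrow (DC D J) (DC D K) (Pull D J K fn_id) y x (Ide (DC D J) y))"

definition is_stable_derivator :: "'u set \<Rightarrow> ('u, 'o, 'm) derivator \<Rightarrow> bool" where
  "is_stable_derivator U D \<longleftrightarrow> is_derivator U D \<and> (\<exists>z. zero_ob (DC D (pt U)) z) \<and>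
    (\<forall>x\<in>Ob (DC D (poset_cat U sq)). der_cocartesian U D x \<longleftrightarrow> der_cartesian U D x)"

text \<open>
  The tensor product of a monoidal derivator preserves left Kan extensions in each variable, in terms of
  the external product of \<open>D(J)\<close> and \<open>D(I)\<close> with values in \<open>D(J \<times> I)\<close>: if \<open>l = u\<^sub>! x\<close> for a functor
  \<open>u\<close> from \<open>J\<close> to \<open>K\<close>, then the external product of \<open>l\<close> and \<open>y\<close> is \<open>w\<^sub>!\<close> of the external product of \<open>x\<close>
  and \<open>y\<close>, for \<open>w = u \<times> I\<close>.
\<close>

definition is_monoidal_derivator :: "'u set \<Rightarrow> ('u, 'o, 'm) derivator \<Rightarrow> bool" where
  "is_monoidal_derivator U D \<longleftrightarrow> is_derivator U D \<and>
    (\<forall>J. small_cat U J \<longrightarrow> is_monoidal (DC D J)) \<and>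
    (\<forall>J K u. small_cat U J \<longrightarrow> small_cat U K \<longrightarrow> is_functor J K u \<longrightarrow>
      strong_monoidal (DC D K) (DC D J) (Pull D J K u) (PMu D J K u) (PEps D J K u)) \<and>
    (\<forall>J u. small_cat U J \<longrightarrow> is_functor J J u \<longrightarrow> fn_agree J u fn_id \<longrightarrow>
      PEps D J J u = Ide (DC D J) (Unit (DC D J)) \<and>
      (\<forall>x\<in>Ob (DC D J). \<forall>y\<in>Ob (DC D J). PMu D J J u x y = Ide (DC D J) (x \<boxtimes>\<^bsub>DC D J\<^esub> y))) \<and>
    (\<forall>I J K u v w. small_cat U I \<longrightarrow> small_cat U J \<longrightarrow> small_cat U K \<longrightarrow>
      is_functor I J u \<longrightarrow> is_functor J K v \<longrightarrow> is_functor I K w \<longrightarrow> fn_agree I w (fn_comp v u) \<longrightarrow>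
      PEps D I K w = FA (Pull D I J u) (PEps D J K v) \<cdot>\<^bsub>DC D I\<^esub> PEps D I J u \<and>
      (\<forall>x\<in>Ob (DC D K). \<forall>y\<in>Ob (DC D K). PMu D I K w x y =
        FA (Pull D I J u) (PMu D J K v x y) \<cdot>\<^bsub>DC D I\<^esub>
          PMu D I J u (FO (Pull D J K v) x) (FO (Pull D J K v) y))) \<and>
    (\<forall>J K u v \<alpha>. small_cat U J \<longrightarrow> small_cat U K \<longrightarrow> is_functor J K u \<longrightarrow> is_functor J K v \<longrightarrow>
      nat_trans J K u v \<alpha> \<longrightarrow>
      Pull2 D J K u v \<alpha> (Unit (DC D K)) \<cdot>\<^bsub>DC D J\<^esub> PEps D J K u = PEps D J K v \<and>
      (\<forall>x\<in>Ob (DC D K). \<forall>y\<in>Ob (DC D K).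
        Pull2 D J K u v \<alpha> (x \<boxtimes>\<^bsub>DC D K\<^esub> y) \<cdot>\<^bsub>DC D J\<^esub> PMu D J K u x y =
        PMu D J K v x y \<cdot>\<^bsub>DC D J\<^esub> (Pull2 D J K u v \<alpha> x \<boxdot>\<^bsub>DC D J\<^esub> Pull2 D J K u v \<alpha> y))) \<and>
    (\<forall>J K I u P p q Q p' q' w x l \<eta> y.
      small_cat U J \<longrightarrow> small_cat U K \<longrightarrow> small_cat U I \<longrightarrow> small_cat U P \<longrightarrow> small_cat U Q \<longrightarrow>
      is_functor J K u \<longrightarrow> is_product_cat J I P p q \<longrightarrow> is_product_cat K I Q p' q' \<longrightarrow>
      is_functor P Q w \<longrightarrow> fn_agree P (fn_comp p' w) (fn_comp u p) \<longrightarrow> fn_agree P (fn_comp q' w) q \<longrightarrow>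
      universal_arrow (DC D J) (DC D K) (Pull D J K u) x l \<eta> \<longrightarrow> y \<in> Ob (DC D I) \<longrightarrow>
      (let E = DC D P; x' = FO (Pull D P J p) x; y' = FO (Pull D P I q) y; \<eta>' = FA (Pull D P J p) \<eta>;
           l'' = FO (Pull D Q K p') l; y'' = FO (Pull D Q I q') y in
        universal_arrow E (DC D Q) (Pull D P Q w) (x' \<boxtimes>\<^bsub>E\<^esub> y') (l'' \<boxtimes>\<^bsub>DC D Q\<^esub> y'')
          (PMu D P Q w l'' y'' \<cdot>\<^bsub>E\<^esub> (\<eta>' \<boxdot>\<^bsub>E\<^esub> Ide E y')) \<and>
        universal_arrow E (DC D Q) (Pull D P Q w) (y' \<boxtimes>\<^bsub>E\<^esub> x') (y'' \<boxtimes>\<^bsub>DC D Q\<^esub> l'')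
          (PMu D P Q w y'' l'' \<cdot>\<^bsub>E\<^esub> (Ide E y' \<boxdot>\<^bsub>E\<^esub> \<eta>'))))"

definition der_susp_square :: "'u set \<Rightarrow> ('u, 'o, 'm) derivator \<Rightarrow> 'o \<Rightarrow> bool" where
  "der_susp_square U D x \<longleftrightarrow> x \<in> Ob (DC D (poset_cat U sq)) \<and> der_cocartesian U D x \<and>
    (\<forall>a\<in>{(0, 1), (1, 0)}. zero_ob (DC D (pt U)) (FO (at_ob U D (poset_cat U sq) (pob U a)) x))"

text \<open>
  \<open>T\<close> is, up to equivalence of monoidal triangulated categories, the underlying category \<open>D([0])\<close>. The
  triangulated structure is described as for infinity-categories, with coherent diagrams in place of
  simplicial maps.
\<close>

definition derivator_models ::
  "'u set \<Rightarrow> ('u, 'o, 'm) derivator \<Rightarrow> ('p, 'n, 'y) ttcat_scheme \<Rightarrow> bool" where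
  "derivator_models U D T \<longleftrightarrow>
    is_strong_derivator U D \<and> is_stable_derivator U D \<and> is_monoidal_derivator U D \<and>
    (let S = poset_cat U sq; R = poset_cat U rect in
    \<exists>F. is_equivalence (DC D (pt U)) T F \<and>
      \<comment> \<open>exactness\<close>
      (\<exists>\<sigma>.
        (\<forall>x. der_susp_square U D x \<longrightarrow> iso_arr T (\<sigma> x) \<and>
          \<sigma> x \<in> Hom T (FO F (FO (at_ob U D S (pob U (1, 1))) x))
            (FO (Shift T) (FO F (FO (at_ob U D S (pob U (0, 0))) x)))) \<and>
        (\<forall>x x'. \<forall>f\<in>Hom (DC D S) x x'. der_susp_square U D x \<longrightarrow> der_susp_square U D x' \<longrightarrow>
          \<sigma> x' \<cdot>\<^bsub>T\<^esub> FA F (FA (at_ob U D S (pob U (1, 1))) f) =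
          FA (Shift T) (FA F (FA (at_ob U D S (pob U (0, 0))) f)) \<cdot>\<^bsub>T\<^esub> \<sigma> x) \<and>
        (\<forall>r\<in>Ob (DC D R).
          der_cocartesian U D (FO (Pull D S R fn_id) r) \<longrightarrow>
          der_cocartesian U D (FO (Pull D S R (poset_fn U (\<lambda>(i, j). (i, j + 1)))) r) \<longrightarrow>
          zero_ob (DC D (pt U)) (FO (at_ob U D R (pob U (1, 0))) r) \<longrightarrow>
          zero_ob (DC D (pt U)) (FO (at_ob U D R (pob U (0, 2))) r) \<longrightarrow>
          (FA F (at_arr U D R (par U (0, 0) (0, 1)) r), FA F (at_arr U D R (par U (0, 1) (1, 1)) r),
            \<sigma> (FO (Pull D S R (poset_fn U (\<lambda>(i, j). (i, 2 * j)))) r) \<cdot>\<^bsub>T\<^esub>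
              FA F (at_arr U D R (par U (1, 1) (1, 2)) r)) \<in> Tri T)) \<and>
      \<comment> \<open>monoidality\<close>
      (\<exists>\<mu> \<epsilon>. strong_monoidal (DC D (pt U)) T F \<mu> \<epsilon>))"


section \<open>Models\<close>

text \<open>
  The hypothesis that \<open>T\<close> admits a model is \<open>is_model_for U M T\<close> for a free variable \<open>M\<close> (and free type
  variables): HOL cannot quantify existentially over the types of the model.
\<close>

datatype ('u, 'o, 'm, 's, 'd, 'e) tt_model =
    Model_Category "('o, 'm) modelcat"
  | Infinity_Category "'s moninf"
  | Derivator "('u, 'd, 'e) derivator"

fun is_model_for ::
  "'u set \<Rightarrow> ('u, 'o, 'm, 's, 'd, 'e) tt_model \<Rightarrow> ('p, 'n, 'y) ttcat_scheme \<Rightarrow> bool" where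
  "is_model_for U (Model_Category M) T \<longleftrightarrow> model_category_models U M T"
| "is_model_for U (Infinity_Category X) T \<longleftrightarrow> quasicat_models X T"
| "is_model_for U (Derivator D) T \<longleftrightarrow> derivator_models U D T"

end

theory Submission
  imports Defs
begin

text \<open>
  Fix a localizing tensor ideal \<open>S\<close> that contains \<open>t \<otimes> g(W)\<close> for all members \<open>W\<close> of the cover. The
  compact objects \<open>a\<close> with \<open>t \<otimes> a \<in> S\<close> form a thick tensor ideal \<open>J\<close>; let \<open>Y\<close> be the union of their
  supports, a Thomason subset. Since thick tensor ideals are intersections of primes
  (\<open>thick_ideal_eq_Inter_primes\<close>), every compact object supported on \<open>Y\<close> belongs to \<open>J\<close>. Hence
  \<open>t \<otimes> \<Gamma>\<^sub>Y\<one> \<in> S\<close>, and it suffices to show that \<open>t \<otimes> L\<one> = 0\<close>, where \<open>\<Gamma>\<^sub>Y\<one> \<rightarrow> \<one> \<rightarrow> L\<one>\<close> is the Rickard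
  triangle of \<open>Y\<close>.

  If this fails, then by the detection property the support of \<open>t \<otimes> L\<one>\<close> has a point, and it lies in
  \<open>Z = Supp(t) - Y\<close>. As \<open>Supp(t)\<close> is noetherian, there is a compact object \<open>a\<close> for which \<open>supp(a)\<close>
  meets \<open>Z\<close> and \<open>Supp(t) - supp(a)\<close> is maximal. Replacing \<open>a\<close> by \<open>a \<otimes> b\<close> cannot shrink
  \<open>Supp(t) \<inter> supp(a)\<close> any further unless \<open>supp(a \<otimes> b)\<close> misses \<open>Z\<close>; so the points of \<open>supp(a) \<inter> Z\<close>
  contain the same compact objects, that is, \<open>supp(a) \<inter> Z\<close> is a single point \<open>Q\<close>. The object
  \<open>v = t \<otimes> a \<otimes> L\<one>\<close>, and everything obtained from it by tensoring, is therefore supported on \<open>{Q}\<close>.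
  Now \<open>Q\<close> lies in some member \<open>W = Y\<^sub>1 \<inter> Y\<^sub>2\<^sup>c\<close> of the cover. The parts of \<open>v\<close> away from \<open>Y\<^sub>1\<close> and on \<open>Y\<^sub>2\<close>
  have empty support, so they vanish by detection, and \<open>v\<close> is built from \<open>v \<otimes> g(W) \<in> S\<close>. It
  follows that \<open>t \<otimes> a \<in> S\<close>, so that \<open>a \<in> J\<close> and \<open>Q \<in> Y\<close>, contrary to the choice of \<open>Q\<close>.

  This uses only two facts on supports: a Rickard object \<open>L\<one>\<close> of \<open>Y\<close> has no support on \<open>Y\<close>
  (\<open>Supp_RickL\<close>), and objects of the localizing subcategory generated by the compact objects supported
  on \<open>Y\<close> have support in \<open>Y\<close> (\<open>Supp_Loc_compacts_on\<close>). Both rest on rigidity, by which the compact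
  objects supported on \<open>Y\<close> annihilate \<open>L\<one>\<close>.

  The remaining work is to develop the required part of tensor triangular geometry from the axioms. Three
  results carry it. First, a compact object in the localizing subcategory generated by a triangulated
  subcategory of compact objects is a retract of an object of the latter (Neeman, \<open>compact_in_Loc\<close>). With
  Zorn's lemma and rigidity it gives the description of thick ideals by primes; it also shows that the
  compact objects are essentially small (\<open>compacts_essentially_small\<close>). Second, Rickard triangles exist
  (\<open>ex_idempotent_triangle\<close>): with \<open>C\<close> the cone of the sum of all evaluations \<open>a\<^sup>* \<otimes> a \<rightarrow> \<one>\<close>, the
  object \<open>L\<one>\<close> is the homotopy colimit of the tensor powers of \<open>C\<close>. Third, such colimits are
  controlled by an explicit splitting (\<open>telescope_split\<close>, \<open>tower\<close>), which uses only the triangle that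
  defines a telescope and so avoids any functoriality of cones.
\<close>

section \<open>Additive categories\<close>

locale additive_category =
  fixes T :: "('o, 'm) ttcat" (structure)
  assumes category: "is_category T" and additive: "is_additive T"
begin

abbreviation "sub f g \<equiv> Plus T f (neg_arr T g)"

lemma Dom_in_Ob [simp]: "f \<in> Arr T \<Longrightarrow> Dom T f \<in> Ob T"
  and Cod_in_Ob [simp]: "f \<in> Arr T \<Longrightarrow> Cod T f \<in> Ob T"
  using category unfolding is_category_def by auto

lemma Hom_iff: "f \<in> Hom T x y \<longleftrightarrow> f \<in> Arr T \<and> Dom T f = x \<and> Cod T f = y"
  unfolding Hom_def by auto

lemma Ide_arr [simp]:
  assumes "x \<in> Ob T"
  shows "Ide T x \<in> Arr T" "Dom T (Ide T x) = x" "Cod T (Ide T x) = x"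
  using assms category unfolding is_category_def Hom_def by auto

lemma comp_arr [simp]:
  assumes "f \<in> Arr T" "g \<in> Arr T" "Cod T f = Dom T g"
  shows "g \<cdot> f \<in> Arr T" "Dom T (g \<cdot> f) = Dom T f" "Cod T (g \<cdot> f) = Cod T g"
  using assms category unfolding is_category_def Hom_def by auto

lemma comp_ide [simp]:
  "f \<in> Arr T \<Longrightarrow> Dom T f = x \<Longrightarrow> f \<cdot> Ide T x = f"
  "f \<in> Arr T \<Longrightarrow> Cod T f = x \<Longrightarrow> Ide T x \<cdot> f = f"
  using category unfolding is_category_def by auto

lemma comp_assoc [simp]:
  assumes "f \<in> Arr T" "g \<in> Arr T" "h \<in> Arr T" "Cod T f = Dom T g" "Cod T g = Dom T h"
  shows "(h \<cdot> g) \<cdot> f = h \<cdot> (g \<cdot> f)"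
  using assms category unfolding is_category_def by auto

lemma hom_group_simps [simp]:
  "carrier (hom_group T x y) = Hom T x y" "mult (hom_group T x y) = Plus T"
  "one (hom_group T x y) = Zer T x y"
  unfolding hom_group_def by auto

lemma hom_group: "x \<in> Ob T \<Longrightarrow> y \<in> Ob T \<Longrightarrow> comm_group (hom_group T x y)"
  using additive unfolding is_additive_def by auto

lemma Zer_arr [simp]:
  assumes "x \<in> Ob T" "y \<in> Ob T"
  shows "Zer T x y \<in> Arr T" "Dom T (Zer T x y) = x" "Cod T (Zer T x y) = y"
proof -
  interpret comm_group "hom_group T x y" using hom_group assms .
  have "Zer T x y \<in> Hom T x y" using one_closed by simp
  then show "Zer T x y \<in> Arr T" "Dom T (Zer T x y) = x" "Cod T (Zer T x y) = y"
    by (auto simp: Hom_iff)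
qed

lemma plus_arr [simp]:
  assumes "f \<in> Arr T" "g \<in> Arr T" "Dom T f = Dom T g" "Cod T f = Cod T g"
  shows "Plus T f g \<in> Arr T" "Dom T (Plus T f g) = Dom T g" "Cod T (Plus T f g) = Cod T g"
proof -
  interpret comm_group "hom_group T (Dom T f) (Cod T f)" using hom_group assms by simp
  have "Plus T f g \<in> Hom T (Dom T f) (Cod T f)"
    using m_closed[of f g] assms by (simp add: Hom_iff)
  then show "Plus T f g \<in> Arr T" "Dom T (Plus T f g) = Dom T g" "Cod T (Plus T f g) = Cod T g"
    using assms by (auto simp: Hom_iff)
qed

lemma neg_arr [simp]:
  assumes "f \<in> Arr T"
  shows "neg_arr T f \<in> Arr T" "Dom T (neg_arr T f) = Dom T f" "Cod T (neg_arr T f) = Cod T f"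
proof -
  interpret comm_group "hom_group T (Dom T f) (Cod T f)" using hom_group assms by simp
  have "neg_arr T f \<in> Hom T (Dom T f) (Cod T f)"
    using inv_closed[of f] assms by (simp add: Hom_iff neg_arr_def)
  then show "neg_arr T f \<in> Arr T" "Dom T (neg_arr T f) = Dom T f" "Cod T (neg_arr T f) = Cod T f"
    by (auto simp: Hom_iff)
qed

lemma plus_ac:
  assumes "f \<in> Arr T" "g \<in> Arr T" "h \<in> Arr T" "Dom T f = Dom T g" "Dom T g = Dom T h"
    "Cod T f = Cod T g" "Cod T g = Cod T h"
  shows "Plus T (Plus T f g) h = Plus T f (Plus T g h)"
    "Plus T f (Plus T g h) = Plus T g (Plus T f h)"
proof -
  interpret comm_group "hom_group T (Dom T h) (Cod T h)" using hom_group assms by simp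
  show "Plus T (Plus T f g) h = Plus T f (Plus T g h)"
    using m_assoc[of f g h] assms by (simp add: Hom_iff)
  show "Plus T f (Plus T g h) = Plus T g (Plus T f h)"
    using m_lcomm[of f g h] assms by (simp add: Hom_iff)
qed

lemma plus_comm:
  assumes "f \<in> Arr T" "g \<in> Arr T" "Dom T f = Dom T g" "Cod T f = Cod T g"
  shows "Plus T f g = Plus T g f"
proof -
  interpret comm_group "hom_group T (Dom T g) (Cod T g)" using hom_group assms by simp
  show ?thesis using m_comm[of f g] assms by (simp add: Hom_iff)
qed

lemma plus_zero [simp]:
  assumes "f \<in> Arr T" "Dom T f = x" "Cod T f = y"
  shows "Plus T f (Zer T x y) = f" "Plus T (Zer T x y) f = f"
proof -
  interpret comm_group "hom_group T x y" using hom_group assms by force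
  show "Plus T f (Zer T x y) = f" "Plus T (Zer T x y) f = f"
    using r_one[of f] l_one[of f] assms by (simp_all add: Hom_iff)
qed

lemma minus_self [simp]:
  assumes "f \<in> Arr T"
  shows "sub f f = Zer T (Dom T f) (Cod T f)" "Plus T (neg_arr T f) f = Zer T (Dom T f) (Cod T f)"
proof -
  interpret comm_group "hom_group T (Dom T f) (Cod T f)" using hom_group assms by simp
  show "sub f f = Zer T (Dom T f) (Cod T f)" "Plus T (neg_arr T f) f = Zer T (Dom T f) (Cod T f)"
    using l_inv[of f] r_inv[of f] assms by (simp_all add: Hom_iff neg_arr_def)
qed

lemma plus_left_cancel:
  assumes "f \<in> Arr T" "g \<in> Arr T" "h \<in> Arr T" "Dom T f = Dom T g" "Dom T g = Dom T h"
    "Cod T f = Cod T g" "Cod T g = Cod T h" "Plus T f g = Plus T f h"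
  shows "g = h"
proof -
  interpret comm_group "hom_group T (Dom T h) (Cod T h)" using hom_group assms by simp
  show ?thesis using Units_l_cancel[of f g h] Units_eq assms by (simp add: Hom_iff)
qed

lemma minus_plus_cancel [simp]:
  assumes "f \<in> Arr T" "g \<in> Arr T" "Dom T f = Dom T g" "Cod T f = Cod T g"
  shows "Plus T (sub f g) g = f" "Plus T g (sub f g) = f" "sub (Plus T f g) g = f"
    "sub (Plus T g f) g = f"
proof -
  have 1: "Plus T (sub f g) g = f" using assms by (simp add: plus_ac(1))
  have 2: "sub (Plus T f g) g = f" using assms by (simp add: plus_ac(1))
  have 3: "Plus T g (sub f g) = Plus T (sub f g) g" "Plus T g f = Plus T f g"
    by (rule plus_comm; use assms in simp)+
  show "Plus T (sub f g) g = f" "Plus T g (sub f g) = f" "sub (Plus T f g) g = f"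
    "sub (Plus T g f) g = f"
    using 1 2 3 by simp_all
qed

lemma minus_eq_zero:
  assumes "sub f g = Zer T x y" "f \<in> Arr T" "g \<in> Arr T" "Dom T f = x" "Cod T f = y"
    "Dom T g = x" "Cod T g = y"
  shows "f = g"
proof -
  have "Plus T (sub f g) g = f" using assms(2-) by simp
  then show ?thesis unfolding assms(1) using assms(2-) by simp
qed

lemma neg_unique:
  assumes "f \<in> Arr T" "g \<in> Arr T" "Dom T f = Dom T g" "Cod T f = Cod T g"
    "Plus T f g = Zer T (Dom T g) (Cod T g)"
  shows "g = neg_arr T f"
  by (rule plus_left_cancel[of f]) (use assms in auto)

lemma neg_neg [simp]: "f \<in> Arr T \<Longrightarrow> neg_arr T (neg_arr T f) = f"
  using neg_unique[of "neg_arr T f" f] by simp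

lemma neg_inject:
  assumes "f \<in> Arr T" "g \<in> Arr T" "neg_arr T f = neg_arr T g"
  shows "f = g"
  using neg_neg[OF assms(1)] neg_neg[OF assms(2)] unfolding assms(3) by (rule trans[OF sym])

lemma neg_zero [simp]: "x \<in> Ob T \<Longrightarrow> y \<in> Ob T \<Longrightarrow> neg_arr T (Zer T x y) = Zer T x y"
  using neg_unique[of "Zer T x y" "Zer T x y"] by simp

lemma neg_eq_zero:
  assumes "f \<in> Arr T" "neg_arr T f = Zer T (Dom T f) (Cod T f)"
  shows "f = Zer T (Dom T f) (Cod T f)"
  using neg_neg[OF assms(1)] assms by simp

lemma comp_plus [simp]:
  assumes "f \<in> Arr T" "f' \<in> Arr T" "g \<in> Arr T" "Dom T f = Dom T f'" "Cod T f = Cod T f'"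
    "Cod T f' = Dom T g"
  shows "g \<cdot> Plus T f f' = Plus T (g \<cdot> f) (g \<cdot> f')"
proof -
  have "\<forall>x\<in>Ob T. \<forall>y\<in>Ob T. \<forall>z\<in>Ob T.
      \<forall>f\<in>Hom T x y. \<forall>f'\<in>Hom T x y. \<forall>g\<in>Hom T y z. \<forall>g'\<in>Hom T y z.
      g \<cdot> Plus T f f' = Plus T (g \<cdot> f) (g \<cdot> f')"
    using additive unfolding is_additive_def by blast
  from this[THEN bspec[of _ _ "Dom T f"], THEN bspec[of _ _ "Dom T g"], THEN bspec[of _ _ "Cod T g"]]
  show ?thesis using assms by (force simp: Hom_iff)
qed

lemma plus_comp [simp]:
  assumes "f \<in> Arr T" "g' \<in> Arr T" "g \<in> Arr T" "Dom T g = Dom T g'" "Cod T g = Cod T g'"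
    "Cod T f = Dom T g'"
  shows "Plus T g g' \<cdot> f = Plus T (g \<cdot> f) (g' \<cdot> f)"
proof -
  have "\<forall>x\<in>Ob T. \<forall>y\<in>Ob T. \<forall>z\<in>Ob T.
      \<forall>f\<in>Hom T x y. \<forall>f'\<in>Hom T x y. \<forall>g\<in>Hom T y z. \<forall>g'\<in>Hom T y z.
      Plus T g g' \<cdot> f = Plus T (g \<cdot> f) (g' \<cdot> f)"
    using additive unfolding is_additive_def by blast
  from this[THEN bspec[of _ _ "Dom T f"], THEN bspec[of _ _ "Dom T g"], THEN bspec[of _ _ "Cod T g"]]
  show ?thesis using assms by (force simp: Hom_iff)
qed

lemma comp_zero [simp]:
  assumes "x \<in> Ob T" "y \<in> Ob T" "g \<in> Arr T"
  shows "y = Dom T g \<Longrightarrow> g \<cdot> Zer T x y = Zer T x (Cod T g)"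
    and "x = Cod T g \<Longrightarrow> Zer T x y \<cdot> g = Zer T (Dom T g) y"
proof -
  assume y: "y = Dom T g"
  let ?h = "g \<cdot> Zer T x y"
  have h: "?h \<in> Arr T" "Dom T ?h = x" "Cod T ?h = Cod T g" using assms y by auto
  have 1: "g \<cdot> Plus T (Zer T x y) (Zer T x y) = Plus T ?h ?h"
    using y assms by (intro comp_plus) auto
  have 2: "Plus T (Zer T x y) (Zer T x y) = Zer T x y" using assms by simp
  have "?h = Plus T ?h (Zer T x (Cod T g))" using h by simp
  then have "Plus T ?h ?h = Plus T ?h (Zer T x (Cod T g))"
    using 1[unfolded 2, symmetric] by (rule trans[rotated])
  then show "?h = Zer T x (Cod T g)"
    by (rule plus_left_cancel[rotated -1]) (use h assms in auto)
next
  assume x: "x = Cod T g"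
  let ?h = "Zer T x y \<cdot> g"
  have h: "?h \<in> Arr T" "Dom T ?h = Dom T g" "Cod T ?h = y" using assms x by auto
  have 1: "Plus T (Zer T x y) (Zer T x y) \<cdot> g = Plus T ?h ?h"
    using x assms by (intro plus_comp) auto
  have 2: "Plus T (Zer T x y) (Zer T x y) = Zer T x y" using assms by simp
  have "?h = Plus T ?h (Zer T (Dom T g) y)" using h by simp
  then have "Plus T ?h ?h = Plus T ?h (Zer T (Dom T g) y)"
    using 1[unfolded 2, symmetric] by (rule trans[rotated])
  then show "?h = Zer T (Dom T g) y"
    by (rule plus_left_cancel[rotated -1]) (use h assms in auto)
qed

lemma comp_neg [simp]:
  assumes "f \<in> Arr T" "g \<in> Arr T" "Cod T f = Dom T g"
  shows "g \<cdot> neg_arr T f = neg_arr T (g \<cdot> f)" "neg_arr T g \<cdot> f = neg_arr T (g \<cdot> f)"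
proof -
  have "Plus T (g \<cdot> f) (g \<cdot> neg_arr T f) = Zer T (Dom T f) (Cod T g)"
    using assms comp_plus[of f "neg_arr T f" g] by simp
  then show "g \<cdot> neg_arr T f = neg_arr T (g \<cdot> f)"
    using assms by (intro neg_unique) auto
  have "Plus T (g \<cdot> f) (neg_arr T g \<cdot> f) = Zer T (Dom T f) (Cod T g)"
    using assms plus_comp[of f "neg_arr T g" g] by simp
  then show "neg_arr T g \<cdot> f = neg_arr T (g \<cdot> f)"
    using assms by (intro neg_unique) auto
qed

lemma neg_plus:
  assumes "f \<in> Arr T" "g \<in> Arr T" "Dom T f = Dom T g" "Cod T f = Cod T g"
  shows "neg_arr T (Plus T f g) = Plus T (neg_arr T f) (neg_arr T g)"
proof -
  have "Plus T (neg_arr T f) (neg_arr T g) = neg_arr T (Plus T f g)"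
  proof (rule neg_unique)
    have "Plus T (Plus T f g) (Plus T (neg_arr T f) (neg_arr T g))
        = Plus T f (Plus T (neg_arr T f) (Plus T g (neg_arr T g)))"
      using assms by (simp add: plus_ac(1) plus_ac(2)[of g])
    also have "\<dots> = Zer T (Dom T (Plus T (neg_arr T f) (neg_arr T g))) (Cod T (Plus T (neg_arr T f) (neg_arr T g)))"
      using assms by (simp)
    finally show "Plus T (Plus T f g) (Plus T (neg_arr T f) (neg_arr T g)) = \<dots>" .
  qed (use assms in auto)
  then show ?thesis by simp
qed

subsection \<open>Zero objects\<close>

lemma initial_ob_op:
  "initial_ob (op_cat T) z \<longleftrightarrow> z \<in> Ob T \<and> (\<forall>x\<in>Ob T. \<exists>!f. f \<in> Hom T x z)"
  unfolding initial_ob_def op_cat_def Hom_def by (auto simp: conj_commute)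

lemma zero_ob_iff: "zero_ob T z \<longleftrightarrow> z \<in> Ob T \<and> Ide T z = Zer T z z"
proof
  assume z: "zero_ob T z"
  then have "z \<in> Ob T" "\<exists>!f. f \<in> Hom T z z" unfolding zero_ob_def initial_ob_def by auto
  moreover have "Ide T z \<in> Hom T z z" "Zer T z z \<in> Hom T z z"
    using \<open>z \<in> Ob T\<close> by (auto simp: Hom_iff)
  ultimately show "z \<in> Ob T \<and> Ide T z = Zer T z z" by blast
next
  assume z: "z \<in> Ob T \<and> Ide T z = Zer T z z"
  have 1: "f = Zer T z x" if "f \<in> Hom T z x" for f x
    using that z comp_ide(1)[of f z] by (auto simp: Hom_iff simp del: comp_ide)
  have 2: "f = Zer T x z" if "f \<in> Hom T x z" for f x
    using that z comp_ide(2)[of f z] by (auto simp: Hom_iff simp del: comp_ide)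
  have "\<exists>!f. f \<in> Hom T z x" "\<exists>!f. f \<in> Hom T x z" if "x \<in> Ob T" for x
    using 1 2 that z by (metis Hom_iff Zer_arr)+
  then show "zero_ob T z"
    unfolding zero_ob_def initial_ob_op using z by (auto simp: initial_ob_def)
qed

lemma zero_ob_in_Ob [simp]: "zero_ob T z \<Longrightarrow> z \<in> Ob T"
  by (simp add: zero_ob_iff)

lemma to_zero: 
  assumes "zero_ob T z" "f \<in> Arr T" "Cod T f = z"
  shows "f = Zer T (Dom T f) z"
  using assms comp_ide(2)[of f z] by (auto simp: zero_ob_iff simp del: comp_ide)

lemma from_zero: 
  assumes "zero_ob T z" "f \<in> Arr T" "Dom T f = z"
  shows "f = Zer T z (Cod T f)"
  using assms comp_ide(1)[of f z] by (auto simp: zero_ob_iff simp del: comp_ide)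

lemma ex_zero_ob: "\<exists>z. zero_ob T z"
  using additive unfolding is_additive_def by blast

subsection \<open>Isomorphisms\<close>

lemma is_inverse_iff: "is_inverse T f g \<longleftrightarrow> f \<in> Arr T \<and> g \<in> Arr T \<and> Dom T g = Cod T f \<and>
    Cod T g = Dom T f \<and> g \<cdot> f = Ide T (Dom T f) \<and> f \<cdot> g = Ide T (Cod T f)"
  unfolding is_inverse_def Hom_iff by auto

lemma iso_arrE:
  assumes "iso_arr T f"
  obtains g where "f \<in> Arr T" "g \<in> Arr T" "Dom T g = Cod T f" "Cod T g = Dom T f"
    "g \<cdot> f = Ide T (Dom T f)" "f \<cdot> g = Ide T (Cod T f)" "iso_arr T g"
  using assms unfolding iso_arr_def is_inverse_iff by force

lemma iso_arrI:
  assumes "f \<in> Arr T" "g \<in> Arr T" "Dom T g = Cod T f" "Cod T g = Dom T f"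
    "g \<cdot> f = Ide T (Dom T f)" "f \<cdot> g = Ide T (Cod T f)"
  shows "iso_arr T f"
  using assms unfolding iso_arr_def is_inverse_iff by blast

lemma iso_arr_is_arr: "iso_arr T f \<Longrightarrow> f \<in> Arr T"
  by (auto elim: iso_arrE)

lemma comp_reduce:
  assumes "g \<cdot> f = k" "f \<in> Arr T" "g \<in> Arr T" "w \<in> Arr T" "Cod T w = Dom T f" "Cod T f = Dom T g"
  shows "g \<cdot> (f \<cdot> w) = k \<cdot> w"
  using assms comp_assoc[of w f g] by simp

lemma iso_Ide: "x \<in> Ob T \<Longrightarrow> iso_arr T (Ide T x)"
  by (rule iso_arrI[of _ "Ide T x"]) auto

lemma iso_comp:
  assumes "iso_arr T f" "iso_arr T g" "Cod T f = Dom T g"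
  shows "iso_arr T (g \<cdot> f)"
proof -
  obtain f' where f: "f \<in> Arr T" "f' \<in> Arr T" "Dom T f' = Cod T f" "Cod T f' = Dom T f"
    "f' \<cdot> f = Ide T (Dom T f)" "f \<cdot> f' = Ide T (Cod T f)" using assms(1) by (rule iso_arrE)
  obtain g' where g: "g \<in> Arr T" "g' \<in> Arr T" "Dom T g' = Cod T g" "Cod T g' = Dom T g"
    "g' \<cdot> g = Ide T (Dom T g)" "g \<cdot> g' = Ide T (Cod T g)" using assms(2) by (rule iso_arrE)
  show ?thesis
    by (rule iso_arrI[of _ "f' \<cdot> g'"])
      (use f g assms(3) comp_reduce[OF f(6)] comp_reduce[OF g(5)] in auto)
qed

lemma iso_of_left_right_inverse:
  assumes "f \<in> Arr T" "g \<in> Arr T" "k \<in> Arr T" "Dom T g = Cod T f" "Cod T g = Dom T f"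
    "Dom T k = Cod T f" "Cod T k = Dom T f"
    "g \<cdot> f = Ide T (Dom T f)" "f \<cdot> k = Ide T (Cod T f)"
  shows "iso_arr T f"
proof -
  have "g = g \<cdot> (f \<cdot> k)" using assms by simp
  also have "\<dots> = k" using assms comp_reduce[OF assms(8), of k] by simp
  finally show ?thesis using assms by (intro iso_arrI[of f g]) auto
qed

lemma isomorphicI: "iso_arr T f \<Longrightarrow> isomorphic T (Dom T f) (Cod T f)"
  unfolding isomorphic_def using iso_arr_is_arr by (auto simp: Hom_iff)

lemma isomorphicE:
  assumes "isomorphic T x y"
  obtains f where "iso_arr T f" "f \<in> Arr T" "Dom T f = x" "Cod T f = y"
  using assms unfolding isomorphic_def by (auto simp: Hom_iff)

lemma isomorphic_in_Ob: "isomorphic T x y \<Longrightarrow> x \<in> Ob T \<and> y \<in> Ob T"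
  by (auto elim!: isomorphicE)

lemma isomorphic_refl: "x \<in> Ob T \<Longrightarrow> isomorphic T x x"
  using isomorphicI[OF iso_Ide, of x] by simp

lemma isomorphic_sym: "isomorphic T x y \<Longrightarrow> isomorphic T y x"
  by (metis isomorphicE isomorphicI iso_arrE)

lemma isomorphic_trans: "isomorphic T x y \<Longrightarrow> isomorphic T y z \<Longrightarrow> isomorphic T x z"
proof -
  assume "isomorphic T x y" "isomorphic T y z"
  then obtain f g where "iso_arr T f" "f \<in> Arr T" "Dom T f = x" "Cod T f = y"
    "iso_arr T g" "g \<in> Arr T" "Dom T g = y" "Cod T g = z"
    by (elim isomorphicE)
  then show "isomorphic T x z" using isomorphicI[OF iso_comp, of f g] by simp
qed

lemma is_retractE:
  assumes "is_retract T x y"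
  obtains i r where "i \<in> Arr T" "Dom T i = x" "Cod T i = y" "r \<in> Arr T" "Dom T r = y"
      "Cod T r = x" "r \<cdot> i = Ide T x"
  using assms unfolding is_retract_def by (auto simp: Hom_iff)

lemma is_retractI:
  assumes "i \<in> Arr T" "r \<in> Arr T" "Dom T r = Cod T i" "Cod T r = Dom T i" "r \<cdot> i = Ide T (Dom T i)"
  shows "is_retract T (Dom T i) (Cod T i)"
  unfolding is_retract_def by (rule bexI[of _ i], rule bexI[of _ r]) (use assms in \<open>auto simp: Hom_iff\<close>)

lemma zero_ob_retract:
  assumes "zero_ob T y" "is_retract T x y"
  shows "zero_ob T x"
proof -
  obtain i r where ir: "i \<in> Arr T" "Dom T i = x" "Cod T i = y" "r \<in> Arr T" "Dom T r = y"
      "Cod T r = x" "r \<cdot> i = Ide T x"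
    using assms(2) by (rule is_retractE)
  have i: "i = Zer T x y" using to_zero[OF assms(1), of i] ir by simp
  have xy: "x \<in> Ob T" "y \<in> Ob T" using ir by auto
  have "r \<cdot> Zer T x y = Zer T x x" using ir(4-6) xy by simp
  then show ?thesis using ir(7) xy unfolding zero_ob_iff i by simp
qed

lemma isomorphic_is_retract: "isomorphic T x y \<Longrightarrow> is_retract T x y"
proof -
  assume "isomorphic T x y"
  then obtain f where "iso_arr T f" "f \<in> Arr T" "Dom T f = x" "Cod T f = y" by (rule isomorphicE)
  then show "is_retract T x y" using is_retractI by (metis iso_arrE)
qed

lemma zero_ob_isomorphic: "zero_ob T x \<Longrightarrow> isomorphic T x y \<Longrightarrow> zero_ob T y"
  using isomorphic_is_retract isomorphic_sym zero_ob_retract by blast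

lemma isomorphic_zero_ob: 
  assumes "zero_ob T x" "zero_ob T y"
  shows "isomorphic T x y"
proof -
  have "x \<in> Ob T" "y \<in> Ob T" using assms by auto
  then have "iso_arr T (Zer T x y)"
    using assms by (intro iso_arrI[of _ "Zer T y x"]) (auto simp: zero_ob_iff)
  then show ?thesis using isomorphicI[of "Zer T x y"] \<open>x \<in> Ob T\<close> \<open>y \<in> Ob T\<close> by simp
qed

lemma is_retract_trans:
  assumes "is_retract T x y" "is_retract T y z"
  shows "is_retract T x z"
proof -
  obtain i r where 1: "i \<in> Arr T" "Dom T i = x" "Cod T i = y" "r \<in> Arr T" "Dom T r = y"
      "Cod T r = x" "r \<cdot> i = Ide T x" using assms(1) by (rule is_retractE)
  obtain j s where 2: "j \<in> Arr T" "Dom T j = y" "Cod T j = z" "s \<in> Arr T" "Dom T s = z"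
      "Cod T s = y" "s \<cdot> j = Ide T y" using assms(2) by (rule is_retractE)
  show ?thesis
    using 1 2 comp_reduce[OF 2(7), of i] is_retractI[of "j \<cdot> i" "r \<cdot> s"] by simp
qed

section \<open>Triangulated categories\<close>

lemma additive_endo_arr [simp]:
  assumes "additive_endo T F"
  shows "x \<in> Ob T \<Longrightarrow> FO F x \<in> Ob T" "x \<in> Ob T \<Longrightarrow> FA F (Ide T x) = Ide T (FO F x)"
    "f \<in> Arr T \<Longrightarrow> FA F f \<in> Arr T" "f \<in> Arr T \<Longrightarrow> Dom T (FA F f) = FO F (Dom T f)"
    "f \<in> Arr T \<Longrightarrow> Cod T (FA F f) = FO F (Cod T f)"
    "f \<in> Arr T \<Longrightarrow> g \<in> Arr T \<Longrightarrow> Cod T f = Dom T g \<Longrightarrow> FA F (g \<cdot> f) = FA F g \<cdot> FA F f"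
  using assms unfolding additive_endo_def is_functor_def Hom_iff by auto

lemma additive_endo_comp:
  assumes "additive_endo T F" "g \<cdot> f = k" "f \<in> Arr T" "g \<in> Arr T" "Cod T f = Dom T g"
  shows "FA F g \<cdot> FA F f = FA F k"
  using additive_endo_arr(6)[OF assms(1,3-5)] assms(2) by simp

lemma additive_endo_plus [simp]:
  assumes "additive_endo T F" "f \<in> Arr T" "g \<in> Arr T" "Dom T f = Dom T g" "Cod T f = Cod T g"
  shows "FA F (Plus T f g) = Plus T (FA F f) (FA F g)"
proof -
  have *: "\<forall>x\<in>Ob T. \<forall>y\<in>Ob T. \<forall>f\<in>Hom T x y. \<forall>f'\<in>Hom T x y.
      FA F (Plus T f f') = Plus T (FA F f) (FA F f')"
    using assms(1) unfolding additive_endo_def by blast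
  show ?thesis by (rule *[rule_format, of "Dom T g" "Cod T g"]) (use assms in \<open>auto simp: Hom_iff\<close>)
qed

lemma additive_endo_zero [simp]:
  assumes "additive_endo T F" "x \<in> Ob T" "y \<in> Ob T"
  shows "FA F (Zer T x y) = Zer T (FO F x) (FO F y)"
proof -
  let ?h = "FA F (Zer T x y)"
  have h: "?h \<in> Arr T" "Dom T ?h = FO F x" "Cod T ?h = FO F y" using assms by auto
  have "FA F (Plus T (Zer T x y) (Zer T x y)) = Plus T ?h ?h" by (rule additive_endo_plus) (use assms in auto)
  moreover have "Plus T (Zer T x y) (Zer T x y) = Zer T x y" using assms by simp
  ultimately have "Plus T ?h ?h = ?h" by metis
  also have "?h = Plus T ?h (Zer T (FO F x) (FO F y))" using h by simp
  finally have "Plus T ?h ?h = Plus T ?h (Zer T (FO F x) (FO F y))" .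
  then show ?thesis by (rule plus_left_cancel[rotated -1]) (use h assms in auto)
qed

lemma additive_endo_neg [simp]:
  assumes "additive_endo T F" "f \<in> Arr T"
  shows "FA F (neg_arr T f) = neg_arr T (FA F f)"
proof (rule neg_unique)
  have "Plus T (FA F f) (FA F (neg_arr T f)) = FA F (sub f f)"
    by (rule additive_endo_plus[symmetric]) (use assms in auto)
  then show "Plus T (FA F f) (FA F (neg_arr T f)) =
      Zer T (Dom T (FA F (neg_arr T f))) (Cod T (FA F (neg_arr T f)))"
    using assms by (simp del: additive_endo_plus)
qed (use assms in auto)

lemma additive_endo_iso:
  assumes "additive_endo T F" "iso_arr T f"
  shows "iso_arr T (FA F f)"
proof -
  obtain g where g: "f \<in> Arr T" "g \<in> Arr T" "Dom T g = Cod T f" "Cod T g = Dom T f"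
    "g \<cdot> f = Ide T (Dom T f)" "f \<cdot> g = Ide T (Cod T f)" using assms(2) by (rule iso_arrE)
  have "FA F g \<cdot> FA F f = Ide T (FO F (Dom T f))" "FA F f \<cdot> FA F g = Ide T (FO F (Cod T f))"
    using g additive_endo_comp[OF assms(1) g(5)] additive_endo_comp[OF assms(1) g(6)] assms(1)
    by simp_all
  then show ?thesis using g assms(1) by (intro iso_arrI[of _ "FA F g"]) auto
qed

lemma additive_endo_isomorphic:
  assumes "additive_endo T F" "isomorphic T x y"
  shows "isomorphic T (FO F x) (FO F y)"
  using assms(2)
proof (rule isomorphicE)
  fix f assume "iso_arr T f" "f \<in> Arr T" "Dom T f = x" "Cod T f = y"
  then show ?thesis using isomorphicI[OF additive_endo_iso[OF assms(1), of f]] assms(1) by simp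
qed

lemma additive_endo_zero_ob:
  assumes "additive_endo T F" "zero_ob T x"
  shows "zero_ob T (FO F x)"
  using assms additive_endo_arr(2)[OF assms(1), of x] by (auto simp: zero_ob_iff)

end

locale triangulated_category = additive_category +
  assumes triangulated: "is_triangulated T"
begin

abbreviation "Sh \<equiv> FO (Shift T)"
abbreviation "Sm \<equiv> FA (Shift T)"

lemma Shift_additive [simp]: "additive_endo T (Shift T)"
  using triangulated unfolding is_triangulated_def by auto

lemma Shift_faithful:
  assumes "f \<in> Arr T" "g \<in> Arr T" "Dom T f = Dom T g" "Cod T f = Cod T g" "Sm f = Sm g"
  shows "f = g"
proof -
  have "bij_betw Sm (Hom T (Dom T g) (Cod T g)) (Hom T (Sh (Dom T g)) (Sh (Cod T g)))"
    using triangulated assms(2) unfolding is_triangulated_def is_equivalence_def by simp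
  then show ?thesis using assms unfolding bij_betw_def inj_on_def by (auto simp: Hom_iff)
qed

lemma Shift_full:
  assumes "x \<in> Ob T" "y \<in> Ob T" "g \<in> Arr T" "Dom T g = Sh x" "Cod T g = Sh y"
  obtains f where "f \<in> Arr T" "Dom T f = x" "Cod T f = y" "g = Sm f"
proof -
  have "bij_betw Sm (Hom T x y) (Hom T (Sh x) (Sh y))"
    using triangulated assms(1,2) unfolding is_triangulated_def is_equivalence_def by simp
  then have "g \<in> Sm ` Hom T x y" using assms unfolding bij_betw_def by (auto simp: Hom_iff)
  then show ?thesis using that by (auto simp: Hom_iff)
qed

lemma desuspension:
  assumes "y \<in> Ob T" obtains x where "x \<in> Ob T" "isomorphic T (Sh x) y"
proof -
  have "\<forall>y\<in>Ob T. \<exists>x\<in>Ob T. isomorphic T (Sh x) y"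
    using triangulated unfolding is_triangulated_def is_equivalence_def by (elim conjE)
  then show ?thesis using that assms by blast
qed

lemma Shift_reflects_iso:
  assumes "f \<in> Arr T" "iso_arr T (Sm f)"
  shows "iso_arr T f"
proof -
  obtain g' where g: "g' \<in> Arr T" "Dom T g' = Cod T (Sm f)" "Cod T g' = Dom T (Sm f)"
    "g' \<cdot> Sm f = Ide T (Dom T (Sm f))" "Sm f \<cdot> g' = Ide T (Cod T (Sm f))"
    using assms(2) by (rule iso_arrE)
  obtain g where g': "g \<in> Arr T" "Dom T g = Cod T f" "Cod T g = Dom T f" "g' = Sm g"
    using Shift_full[of "Cod T f" "Dom T f" g'] g assms(1) by auto
  show ?thesis
  proof (rule iso_arrI[of f g])
    show "g \<cdot> f = Ide T (Dom T f)" by (rule Shift_faithful) (use g g' assms in auto)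
    show "f \<cdot> g = Ide T (Cod T f)" by (rule Shift_faithful) (use g g' assms in auto)
  qed (use g' assms in auto)
qed

lemma Shift_reflects_isomorphic:
  assumes "x \<in> Ob T" "y \<in> Ob T" "isomorphic T (Sh x) (Sh y)"
  shows "isomorphic T x y"
proof -
  obtain g where g: "iso_arr T g" "g \<in> Arr T" "Dom T g = Sh x" "Cod T g = Sh y"
    using assms(3) by (rule isomorphicE)
  then obtain f where "f \<in> Arr T" "Dom T f = x" "Cod T f = y" "g = Sm f"
    using Shift_full assms by metis
  then show ?thesis using Shift_reflects_iso[of f] isomorphicI[of f] g by auto
qed

lemma zero_ob_Shift_iff: 
  assumes x: "x \<in> Ob T" shows "zero_ob T (Sh x) \<longleftrightarrow> zero_ob T x"
proof
  assume z: "zero_ob T (Sh x)"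
  have "Sm (Ide T x) = Sm (Zer T x x)" using z x by (simp add: zero_ob_iff)
  then have "Ide T x = Zer T x x" by (rule Shift_faithful[rotated -1]) (use x in simp_all)
  then show "zero_ob T x" using x by (simp add: zero_ob_iff)
qed (rule additive_endo_zero_ob[OF Shift_additive])

lemma tri_arr:
  assumes "(f, g, h) \<in> Tri T"
  shows "f \<in> Arr T" "g \<in> Arr T" "h \<in> Arr T" "Dom T g = Cod T f" "Dom T h = Cod T g"
    "Cod T h = Sh (Dom T f)"
proof -
  have "\<forall>f g h. (f, g, h) \<in> Tri T \<longrightarrow> cand_triangle T f g h"
    using triangulated unfolding is_triangulated_def by (elim conjE)
  then have "cand_triangle T f g h" using assms by simp
  then show "f \<in> Arr T" "g \<in> Arr T" "h \<in> Arr T" "Dom T g = Cod T f" "Dom T h = Cod T g"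
    "Cod T h = Sh (Dom T f)" unfolding cand_triangle_def by simp_all
qed

lemma tri_iso:
  assumes "(f, g, h) \<in> Tri T" "cand_triangle T f' g' h'"
    "iso_arr T a" "Dom T a = Dom T f" "Cod T a = Dom T f'"
    "iso_arr T b" "Dom T b = Cod T f" "Cod T b = Cod T f'"
    "iso_arr T c" "Dom T c = Cod T g" "Cod T c = Cod T g'"
    "b \<cdot> f = f' \<cdot> a" "c \<cdot> g = g' \<cdot> b" "Sm a \<cdot> h = h' \<cdot> c"
  shows "(f', g', h') \<in> Tri T"
proof -
  have *: "\<forall>f g h f' g' h' a b c. (f, g, h) \<in> Tri T \<longrightarrow> cand_triangle T f' g' h' \<longrightarrow>
      iso_arr T a \<and> a \<in> Hom T (Dom T f) (Dom T f') \<longrightarrow>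
      iso_arr T b \<and> b \<in> Hom T (Cod T f) (Cod T f') \<longrightarrow>
      iso_arr T c \<and> c \<in> Hom T (Cod T g) (Cod T g') \<longrightarrow>
      b \<cdot> f = f' \<cdot> a \<longrightarrow> c \<cdot> g = g' \<cdot> b \<longrightarrow> Sm a \<cdot> h = h' \<cdot> c \<longrightarrow>
      (f', g', h') \<in> Tri T"
    using triangulated unfolding is_triangulated_def by (elim conjE)
  show ?thesis by (rule *[rule_format, of f g h f' g' h' a b c]) (use assms iso_arr_is_arr in \<open>auto simp: Hom_iff\<close>)
qed

lemma tri_id:
  assumes "x \<in> Ob T" "zero_ob T z"
  shows "(Ide T x, Zer T x z, Zer T z (Sh x)) \<in> Tri T"
proof -
  have *: "\<forall>x\<in>Ob T. \<forall>z. zero_ob T z \<longrightarrow> (Ide T x, Zer T x z, Zer T z (Sh x)) \<in> Tri T"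
    using triangulated unfolding is_triangulated_def by (elim conjE)
  then show ?thesis using assms by simp
qed

lemma ex_tri: "f \<in> Arr T \<Longrightarrow> \<exists>g h. (f, g, h) \<in> Tri T"
proof -
  have *: "\<forall>f\<in>Arr T. \<exists>g h. (f, g, h) \<in> Tri T"
    using triangulated unfolding is_triangulated_def by (elim conjE)
  show "f \<in> Arr T \<Longrightarrow> \<exists>g h. (f, g, h) \<in> Tri T" using * by simp
qed

lemma tri_rotate_iff:
  "cand_triangle T f g h \<Longrightarrow> (f, g, h) \<in> Tri T \<longleftrightarrow> (g, h, neg_arr T (Sm f)) \<in> Tri T"
proof -
  have *: "\<forall>f g h. cand_triangle T f g h \<longrightarrow>
      ((f, g, h) \<in> Tri T \<longleftrightarrow> (g, h, neg_arr T (Sm f)) \<in> Tri T)"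
    using triangulated unfolding is_triangulated_def by (elim conjE)
  show "cand_triangle T f g h \<Longrightarrow> (f, g, h) \<in> Tri T \<longleftrightarrow> (g, h, neg_arr T (Sm f)) \<in> Tri T"
    using * by simp
qed

lemma tri_rotate:
  assumes "(f, g, h) \<in> Tri T" shows "(g, h, neg_arr T (Sm f)) \<in> Tri T"
proof -
  have "cand_triangle T f g h" unfolding cand_triangle_def using tri_arr[OF assms] by simp
  then show ?thesis using tri_rotate_iff assms by blast
qed

lemma tri_morphism:
  assumes "(f, g, h) \<in> Tri T" "(f', g', h') \<in> Tri T"
    "a \<in> Arr T" "Dom T a = Dom T f" "Cod T a = Dom T f'"
    "b \<in> Arr T" "Dom T b = Cod T f" "Cod T b = Cod T f'" "b \<cdot> f = f' \<cdot> a"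
  obtains c where "c \<in> Arr T" "Dom T c = Cod T g" "Cod T c = Cod T g'"
    "c \<cdot> g = g' \<cdot> b" "Sm a \<cdot> h = h' \<cdot> c"
proof -
  have *: "\<forall>f g h f' g' h' a b. (f, g, h) \<in> Tri T \<longrightarrow> (f', g', h') \<in> Tri T \<longrightarrow>
      a \<in> Hom T (Dom T f) (Dom T f') \<longrightarrow> b \<in> Hom T (Cod T f) (Cod T f') \<longrightarrow>
      b \<cdot> f = f' \<cdot> a \<longrightarrow>
      (\<exists>c\<in>Hom T (Cod T g) (Cod T g'). c \<cdot> g = g' \<cdot> b \<and> Sm a \<cdot> h = h' \<cdot> c)"
    using triangulated unfolding is_triangulated_def by (elim conjE)
  have "\<exists>c\<in>Hom T (Cod T g) (Cod T g'). c \<cdot> g = g' \<cdot> b \<and> Sm a \<cdot> h = h' \<cdot> c"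
    by (rule *[rule_format, of f g h f' g' h' a b]) (use assms in \<open>auto simp: Hom_iff\<close>)
  then obtain c where "c \<in> Hom T (Cod T g) (Cod T g')" "c \<cdot> g = g' \<cdot> b" "Sm a \<cdot> h = h' \<cdot> c" by blast
  then show ?thesis by (intro that[of c]) (auto simp: Hom_iff)
qed

lemma octahedron:
  assumes "Cod T f = Dom T g" "(f, i, i') \<in> Tri T" "(g, j, j') \<in> Tri T" "(g \<cdot> f, k, k') \<in> Tri T"
  obtains p q where "p \<in> Arr T" "Dom T p = Cod T i" "Cod T p = Cod T k"
    "(p, q, Sm i \<cdot> j') \<in> Tri T" "Cod T q = Cod T j" "p \<cdot> i = k \<cdot> g" "k' \<cdot> p = i'"
proof -
  have *: "\<forall>f i i' g j j' k k'. Cod T f = Dom T g \<longrightarrow>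
      (f, i, i') \<in> Tri T \<longrightarrow> (g, j, j') \<in> Tri T \<longrightarrow> (g \<cdot> f, k, k') \<in> Tri T \<longrightarrow>
      (\<exists>p\<in>Hom T (Cod T i) (Cod T k). \<exists>q\<in>Hom T (Cod T k) (Cod T j).
        (p, q, Sm i \<cdot> j') \<in> Tri T \<and> p \<cdot> i = k \<cdot> g \<and> k' \<cdot> p = i' \<and> q \<cdot> k = j \<and>
        j' \<cdot> q = Sm f \<cdot> k')"
    using triangulated unfolding is_triangulated_def by (elim conjE)
  have "\<exists>p\<in>Hom T (Cod T i) (Cod T k). \<exists>q\<in>Hom T (Cod T k) (Cod T j).
        (p, q, Sm i \<cdot> j') \<in> Tri T \<and> p \<cdot> i = k \<cdot> g \<and> k' \<cdot> p = i' \<and> q \<cdot> k = j \<and>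
        j' \<cdot> q = Sm f \<cdot> k'"
    by (rule *[rule_format, of f g i i' j j' k k']) (use assms in auto)
  then obtain p q where "p \<in> Hom T (Cod T i) (Cod T k)" "q \<in> Hom T (Cod T k) (Cod T j)"
    "(p, q, Sm i \<cdot> j') \<in> Tri T" "p \<cdot> i = k \<cdot> g" "k' \<cdot> p = i'" by blast
  then show ?thesis by (intro that[of p q]) (auto simp: Hom_iff)
qed

lemma tri_comp_zero:
  assumes "(f, g, h) \<in> Tri T"
  shows "g \<cdot> f = Zer T (Dom T f) (Cod T g)"
    and "h \<cdot> g = Zer T (Cod T f) (Sh (Dom T f))"
    and "Sm f \<cdot> h = Zer T (Cod T g) (Sh (Cod T f))"
proof -
  have *: "g \<cdot> f = Zer T (Dom T f) (Cod T g)" if t: "(f, g, h) \<in> Tri T" for f g h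
  proof -
    note a = tri_arr[OF t]
    obtain z where z: "zero_ob T z" using ex_zero_ob by blast
    obtain c where c: "c \<in> Arr T" "Dom T c = Cod T (Zer T (Dom T f) z)" "Cod T c = Cod T g"
      "c \<cdot> Zer T (Dom T f) z = g \<cdot> f"
      using tri_morphism[OF tri_id[OF _ z, of "Dom T f"] t, of "Ide T (Dom T f)" f] a z by auto
    then have "g \<cdot> f = c \<cdot> Zer T (Dom T f) z" by simp
    also have "\<dots> = Zer T (Dom T f) (Cod T g)" using a z c(1-3) by simp
    finally show ?thesis .
  qed
  note a = tri_arr[OF assms]
  show "g \<cdot> f = Zer T (Dom T f) (Cod T g)" using *[OF assms] .
  show "h \<cdot> g = Zer T (Cod T f) (Sh (Dom T f))" using *[OF tri_rotate[OF assms]] a by simp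
  have "neg_arr T (Sm f) \<cdot> h = Zer T (Cod T g) (Sh (Cod T f))"
    using *[OF tri_rotate[OF tri_rotate[OF assms]]] a by simp
  then have "neg_arr T (Sm f \<cdot> h) = Zer T (Cod T g) (Sh (Cod T f))" using a by simp
  then show "Sm f \<cdot> h = Zer T (Cod T g) (Sh (Cod T f))"
    using neg_eq_zero[of "Sm f \<cdot> h"] a by simp
qed

lemma tri_lift:
  assumes t: "(f, g, h) \<in> Tri T" and u: "u \<in> Arr T" "Cod T u = Cod T f" and
    0: "g \<cdot> u = Zer T (Dom T u) (Cod T g)"
  obtains v where "v \<in> Arr T" "Dom T v = Dom T u" "Cod T v = Dom T f" "f \<cdot> v = u"
proof -
  note a = tri_arr[OF t]
  let ?c = "Dom T u"
  obtain z where z: "zero_ob T z" using ex_zero_ob by blast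
  then have zO: "z \<in> Ob T" by simp
  have cO: "?c \<in> Ob T" using u by simp
  have r: "(Zer T ?c z, Zer T z (Sh ?c), neg_arr T (Sm (Ide T ?c))) \<in> Tri T"
    using tri_rotate[OF tri_id[OF cO z]] .
  have "Zer T z (Cod T g) \<cdot> Zer T ?c z = g \<cdot> u" using 0 zO cO a by simp
  then obtain w where w: "w \<in> Arr T" "Dom T w = Sh ?c" "Cod T w = Sh (Dom T f)"
      "Sm u \<cdot> neg_arr T (Sm (Ide T ?c)) = neg_arr T (Sm f) \<cdot> w"
    using tri_morphism[OF r tri_rotate[OF t], of u "Zer T z (Cod T g)"] zO cO a u by auto
  have "Sm u \<cdot> neg_arr T (Sm (Ide T ?c)) = neg_arr T (Sm u)" using u by simp
  moreover have "neg_arr T (Sm f) \<cdot> w = neg_arr T (Sm f \<cdot> w)" using a w by simp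
  ultimately have "neg_arr T (Sm u) = neg_arr T (Sm f \<cdot> w)" using w(4) by (simp only:)
  then have e: "Sm u = Sm f \<cdot> w" by (rule neg_inject[rotated -1]) (use a u w in simp_all)
  obtain v where v: "v \<in> Arr T" "Dom T v = ?c" "Cod T v = Dom T f" "w = Sm v"
    using Shift_full[of ?c "Dom T f" w] w a cO by auto
  have "f \<cdot> v = u"
    by (rule Shift_faithful) (use e v a u in auto)
  then show ?thesis using that v by blast
qed

lemma tri_extend:
  assumes t: "(f, g, h) \<in> Tri T" and u: "u \<in> Arr T" "Dom T u = Cod T f" and
    0: "u \<cdot> f = Zer T (Dom T f) (Cod T u)"
  obtains v where "v \<in> Arr T" "Dom T v = Cod T g" "Cod T v = Cod T u" "v \<cdot> g = u"
proof -
  note a = tri_arr[OF t]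
  let ?c = "Cod T u"
  obtain z where z: "zero_ob T z" using ex_zero_ob by blast
  then have zO: "z \<in> Ob T" by simp
  have cO: "?c \<in> Ob T" using u by simp
  have z': "zero_ob T (Sh z)" using additive_endo_zero_ob[OF Shift_additive z] .
  have "(Ide T ?c, Zer T ?c (Sh z), Zer T (Sh z) (Sh ?c)) \<in> Tri T" using tri_id[OF cO z'] .
  moreover have "cand_triangle T (Zer T z ?c) (Ide T ?c) (Zer T ?c (Sh z))"
    unfolding cand_triangle_def using zO cO by simp
  ultimately have r: "(Zer T z ?c, Ide T ?c, Zer T ?c (Sh z)) \<in> Tri T"
    using tri_rotate_iff[of "Zer T z ?c"] zO cO by simp
  obtain v where "v \<in> Arr T" "Dom T v = Cod T g" "Cod T v = ?c" "v \<cdot> g = Ide T ?c \<cdot> u"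
    using tri_morphism[OF t r, of "Zer T (Dom T f) z" u] 0 zO cO a u by auto
  then show ?thesis using that u by simp
qed

lemma cone_of_iso:
  assumes t: "(f, g, h) \<in> Tri T" and "iso_arr T f"
  shows "zero_ob T (Cod T g)"
proof -
  note a = tri_arr[OF t]
  note c = tri_comp_zero[OF t]
  obtain k where k: "k \<in> Arr T" "Dom T k = Cod T f" "Cod T k = Dom T f"
    "k \<cdot> f = Ide T (Dom T f)" "f \<cdot> k = Ide T (Cod T f)" using assms(2) by (rule iso_arrE)
  have "g = (g \<cdot> f) \<cdot> k" using a k by simp
  also have "\<dots> = Zer T (Cod T f) (Cod T g)" unfolding c(1) using a k by simp
  finally have g0: "g = Zer T (Cod T f) (Cod T g)" .
  have kf: "Sm k \<cdot> Sm f = Ide T (Sh (Dom T f))"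
    using additive_endo_arr(6)[OF Shift_additive a(1) k(1)] k a by simp
  have "Sm k \<cdot> (Sm f \<cdot> h) = h"
    using comp_reduce[OF kf, of h] a k by simp
  then have h0: "h = Zer T (Cod T g) (Sh (Dom T f))" unfolding c(3) using a k by simp
  obtain v where v: "v \<in> Arr T" "Dom T v = Cod T g" "Cod T v = Dom T g" "g \<cdot> v = Ide T (Cod T g)"
    using tri_lift[OF tri_rotate[OF t], of "Ide T (Cod T g)"] h0 a by auto
  have "g \<cdot> v = Zer T (Cod T g) (Cod T g)"
    by (subst g0) (use a v in simp)
  then show ?thesis using v a by (simp add: zero_ob_iff)
qed

text \<open>
  The arrow \<open>h\<close> vanishes because \<open>f\<close> is a split monomorphism. So an endomorphism of the cone is
  determined by its composite with \<open>g\<close>, and \<open>g s\<close> is inverse to \<open>p'\<close>.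
\<close>

lemma cone_of_split:
  assumes t: "(f, g, h) \<in> Tri T"
    and r: "r \<in> Arr T" "Dom T r = Cod T f" "Cod T r = Dom T f" "r \<cdot> f = Ide T (Dom T f)"
    and p: "p \<in> Arr T" "Dom T p = Cod T f" 
    and s: "s \<in> Arr T" "Dom T s = Cod T p" "Cod T s = Cod T f" "p \<cdot> s = Ide T (Cod T p)"
    and sum: "Plus T (f \<cdot> r) (s \<cdot> p) = Ide T (Cod T f)"
    and p': "p' \<in> Arr T" "Dom T p' = Cod T g" "Cod T p' = Cod T p" "p' \<cdot> g = p"
  shows "iso_arr T p'"
proof -
  note a = tri_arr[OF t]
  note c = tri_comp_zero[OF t]
  have rf: "Sm r \<cdot> Sm f = Ide T (Sh (Dom T f))"
    using additive_endo_arr(6)[OF Shift_additive a(1) r(1)] r a by simp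
  have "Sm r \<cdot> (Sm f \<cdot> h) = h"
    using comp_reduce[OF rf, of h] a r by simp
  then have h0: "h = Zer T (Cod T g) (Sh (Dom T f))" unfolding c(3) using a r by simp
  have 1: "p' \<cdot> (g \<cdot> s) = Ide T (Cod T p')"
    using comp_reduce[OF p'(4), of s] p' a s by simp
  let ?q = "g \<cdot> s"
  have "g = g \<cdot> Plus T (f \<cdot> r) (s \<cdot> p)" using sum a by simp
  also have "\<dots> = Plus T (g \<cdot> (f \<cdot> r)) (g \<cdot> (s \<cdot> p))" using a r s p by (intro comp_plus) auto
  also have "\<dots> = g \<cdot> (s \<cdot> p)" using comp_reduce[OF c(1), of r] a r s p by simp
  also have "\<dots> = (?q \<cdot> p') \<cdot> g" using a s p p' by simp
  finally have gg: "(?q \<cdot> p') \<cdot> g = g" ..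
  have "sub (?q \<cdot> p') (Ide T (Cod T g)) \<cdot> g = sub ((?q \<cdot> p') \<cdot> g) (Ide T (Cod T g) \<cdot> g)"
    using a s p' by simp
  also have "\<dots> = Zer T (Cod T f) (Cod T g)" unfolding gg using a by simp
  finally have "sub (?q \<cdot> p') (Ide T (Cod T g)) \<cdot> g = Zer T (Cod T f) (Cod T g)" .
  then obtain v where v: "v \<in> Arr T" "Dom T v = Cod T h" "Cod T v = Cod T g"
      "v \<cdot> h = sub (?q \<cdot> p') (Ide T (Cod T g))"
    using tri_extend[OF tri_rotate[OF t], of "sub (?q \<cdot> p') (Ide T (Cod T g))"] a s p' by auto
  have z: "v \<cdot> h = Zer T (Cod T g) (Cod T g)" by (subst h0) (use v(1-3) a in simp)
  have "?q \<cdot> p' = Ide T (Cod T g)"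
    by (rule minus_eq_zero[OF trans[OF v(4)[symmetric] z]]) (use a s p' in simp_all)
  then show ?thesis using 1 a s p' by (intro iso_arrI[of _ ?q]) auto
qed

text \<open>
  The difference \<open>n = u - 1\<close> is killed by \<open>g\<close>, hence factors through \<open>h\<close>; as \<open>h n = 0\<close> too, it
  squares to zero and \<open>1 - n\<close> is inverse to \<open>u\<close>. This is what makes cones unique up to isomorphism.
\<close>

lemma cone_endo_invertible:
  assumes t: "(f, g, h) \<in> Tri T" and u: "u \<in> Arr T" "Dom T u = Cod T g" "Cod T u = Cod T g"
    "u \<cdot> g = g" "h \<cdot> u = h"
  shows "\<exists>k\<in>Arr T. Dom T k = Cod T g \<and> Cod T k = Cod T g \<and> k \<cdot> u = Ide T (Cod T g) \<and>
    u \<cdot> k = Ide T (Cod T g)"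
proof -
  note a = tri_arr[OF t]
  let ?e = "Ide T (Cod T g)"
  define n where "n = sub u ?e"
  have n: "n \<in> Arr T" "Dom T n = Cod T g" "Cod T n = Cod T g" unfolding n_def using a u(1-3) by auto
  have "n \<cdot> g = sub (u \<cdot> g) g" unfolding n_def using a u(1-3) by simp
  then have "n \<cdot> g = Zer T (Dom T g) (Cod T g)" unfolding u(4) using a by simp
  then obtain v where v: "v \<in> Arr T" "Dom T v = Cod T h" "Cod T v = Cod T g" "v \<cdot> h = n"
    using tri_extend[OF tri_rotate[OF t], of n] a n by auto
  have "h \<cdot> n = sub (h \<cdot> u) h" unfolding n_def using a u(1-3) by simp
  then have hn: "h \<cdot> n = Zer T (Cod T g) (Cod T h)" unfolding u(5) using a by simp
  have "n \<cdot> n = v \<cdot> (h \<cdot> n)"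
    by (rule comp_reduce[OF v(4), symmetric]) (use a v n in simp_all)
  then have nn: "n \<cdot> n = Zer T (Cod T g) (Cod T g)" unfolding hn using a v(1-3) by simp
  have u': "u = Plus T ?e n" unfolding n_def using a u(1-3) by simp
  have "sub ?e n \<cdot> u = ?e" "u \<cdot> sub ?e n = ?e"
    unfolding u' using n nn a by (simp_all add: plus_ac(1))
  then show ?thesis using n a by (intro bexI[of _ "sub ?e n"]) auto
qed

lemma cone_unique:
  assumes t: "(f, g, h) \<in> Tri T" and t': "(f, g', h') \<in> Tri T"
  shows "isomorphic T (Cod T g) (Cod T g')"
proof -
  note a = tri_arr[OF t] tri_arr[OF t']
  obtain c where c: "c \<in> Arr T" "Dom T c = Cod T g" "Cod T c = Cod T g'" "c \<cdot> g = g'"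
    "h = h' \<cdot> c"
    using tri_morphism[OF t t', of "Ide T (Dom T f)" "Ide T (Cod T f)"] a by auto
  obtain d where d: "d \<in> Arr T" "Dom T d = Cod T g'" "Cod T d = Cod T g" "d \<cdot> g' = g"
    "h' = h \<cdot> d"
    using tri_morphism[OF t' t, of "Ide T (Dom T f)" "Ide T (Cod T f)"] a by auto
  have 1: "(d \<cdot> c) \<cdot> g = g" using c(1-4) d(1-4) a by simp
  have "h \<cdot> (d \<cdot> c) = h' \<cdot> c"
    by (rule comp_reduce[OF d(5)[symmetric]]) (use c(1-3) d(1-3) a in simp_all)
  note 1 this[folded c(5)]
  then obtain k where k: "k \<in> Arr T" "Dom T k = Cod T g" "Cod T k = Cod T g"
    "k \<cdot> (d \<cdot> c) = Ide T (Cod T g)"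
    using cone_endo_invertible[OF t, of "d \<cdot> c"] c(1-3) d(1-3) by auto
  have 1: "(c \<cdot> d) \<cdot> g' = g'" using c(1-4) d(1-4) a by simp
  have "h' \<cdot> (c \<cdot> d) = h \<cdot> d"
    by (rule comp_reduce[OF c(5)[symmetric]]) (use c(1-3) d(1-3) a in simp_all)
  note 1 this[folded d(5)]
  then obtain l where l: "l \<in> Arr T" "Dom T l = Cod T g'" "Cod T l = Cod T g'"
    "(c \<cdot> d) \<cdot> l = Ide T (Cod T g')"
    using cone_endo_invertible[OF t', of "c \<cdot> d"] c(1-3) d(1-3) by auto
  have "iso_arr T c"
    by (rule iso_of_left_right_inverse[of c "k \<cdot> d" "d \<cdot> l"]) (use k l c(1-3) d(1-3) in auto)
  then show ?thesis using isomorphicI[of c] c(2,3) by simp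
qed

lemma cone_isomorphic:
  assumes t: "(f, g, h) \<in> Tri T" and t': "(f', g', h') \<in> Tri T"
    and a: "iso_arr T a" "Dom T a = Dom T f" "Cod T a = Dom T f'"
    and b: "iso_arr T b" "Dom T b = Cod T f" "Cod T b = Cod T f'" "b \<cdot> f = f' \<cdot> a"
  shows "isomorphic T (Cod T g) (Cod T g')"
proof -
  note ar = tri_arr[OF t] tri_arr[OF t']
  obtain b' where b': "b \<in> Arr T" "b' \<in> Arr T" "Dom T b' = Cod T b" "Cod T b' = Dom T b"
    "b' \<cdot> b = Ide T (Dom T b)" using b(1) by (rule iso_arrE)
  have aa: "a \<in> Arr T" using a iso_arr_is_arr by blast
  have "(f', g \<cdot> b', Sm a \<cdot> h) \<in> Tri T"
  proof (rule tri_iso[OF t, where a = a and b = b and c = "Ide T (Cod T g)"])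
    show "cand_triangle T f' (g \<cdot> b') (Sm a \<cdot> h)"
      unfolding cand_triangle_def using ar a b b' aa by simp
  qed (use ar a b b' aa iso_Ide in auto)
  then show ?thesis using cone_unique[OF _ t'] ar b b' by fastforce
qed

subsection \<open>Triangulated subcategories\<close>

lemma tri_subcatD:
  assumes "tri_subcat T S"
  shows "S \<subseteq> Ob T" "zero_ob T z \<Longrightarrow> z \<in> S" "x \<in> S \<Longrightarrow> isomorphic T x y \<Longrightarrow> y \<in> S"
    "x \<in> Ob T \<Longrightarrow> Sh x \<in> S \<longleftrightarrow> x \<in> S"
    "(f, g, h) \<in> Tri T \<Longrightarrow> Dom T f \<in> S \<Longrightarrow> Cod T f \<in> S \<Longrightarrow> Cod T g \<in> S"
  using assms unfolding tri_subcat_def by blast+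

lemma tri_subcat_fibre:
  assumes S: "tri_subcat T S" and t: "(f, g, h) \<in> Tri T" "Cod T f \<in> S" "Cod T g \<in> S"
  shows "Dom T f \<in> S"
proof -
  note a = tri_arr[OF t(1)]
  have "Sh (Dom T f) \<in> S" using tri_subcatD(5)[OF S tri_rotate[OF t(1)]] t a by simp
  then show ?thesis using tri_subcatD(4)[OF S, of "Dom T f"] a by simp
qed

lemma tri_subcat_middle:
  assumes S: "tri_subcat T S" and t: "(f, g, h) \<in> Tri T" "Dom T f \<in> S" "Cod T g \<in> S"
  shows "Cod T f \<in> S"
  using tri_subcat_fibre[OF S tri_rotate[OF t(1)]] t tri_arr[OF t(1)]
    tri_subcatD(4)[OF S, of "Dom T f"] by simp

text \<open>
  A biproduct is an extension of its two factors, by the triangle on the first inclusion.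
\<close>

lemma tri_subcat_biproduct:
  assumes S: "tri_subcat T S" and xy: "x \<in> S" "y \<in> S"
  obtains s i j p q where "s \<in> S" "i \<in> Hom T x s" "j \<in> Hom T y s" "p \<in> Hom T s x" "q \<in> Hom T s y"
      "p \<cdot> i = Ide T x" "q \<cdot> j = Ide T y" "q \<cdot> i = Zer T x y" "p \<cdot> j = Zer T y x"
proof -
  have xyO: "x \<in> Ob T" "y \<in> Ob T" using xy tri_subcatD(1)[OF S] by auto
  have "\<exists>s\<in>Ob T. \<exists>i\<in>Hom T x s. \<exists>j\<in>Hom T y s. \<exists>p\<in>Hom T s x. \<exists>q\<in>Hom T s y.
      p \<cdot> i = Ide T x \<and> q \<cdot> j = Ide T y \<and> q \<cdot> i = Zer T x y \<and> p \<cdot> j = Zer T y x \<and>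
      Plus T (i \<cdot> p) (j \<cdot> q) = Ide T s"
    using additive xyO unfolding is_additive_def by simp
  then obtain s i j p q where s: "s \<in> Ob T" "i \<in> Hom T x s" "j \<in> Hom T y s" "p \<in> Hom T s x"
      "q \<in> Hom T s y" "p \<cdot> i = Ide T x" "q \<cdot> j = Ide T y" "q \<cdot> i = Zer T x y" "p \<cdot> j = Zer T y x"
      "Plus T (i \<cdot> p) (j \<cdot> q) = Ide T s" by blast
  then have ar: "i \<in> Arr T" "j \<in> Arr T" "p \<in> Arr T" "q \<in> Arr T" "Dom T i = x" "Dom T j = y" "Dom T p = s"
    "Dom T q = s" "Cod T i = s" "Cod T j = s" "Cod T p = x" "Cod T q = y" by (auto simp: Hom_iff)
  obtain g h where t: "(i, g, h) \<in> Tri T" using ex_tri ar(1) by blast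
  note a = tri_arr[OF t]
  obtain q' where q': "q' \<in> Arr T" "Dom T q' = Cod T g" "Cod T q' = y" "q' \<cdot> g = q"
    using tri_extend[OF t, of q] ar s by auto
  have "iso_arr T q'"
    by (rule cone_of_split[OF t, of p q j]) (use ar s q' in auto)
  then have "isomorphic T y (Cod T g)" using isomorphicI[of q'] q' isomorphic_sym by auto
  then have "Cod T g \<in> S" using tri_subcatD(3)[OF S] xy by blast
  then have "s \<in> S" using tri_subcat_middle[OF S t] ar xy by simp
  then show ?thesis using that s by blast
qed

lemma tri_subcat_Ob: "tri_subcat T (Ob T)"
  unfolding tri_subcat_def using isomorphic_in_Ob tri_arr by auto

lemma tri_subcat_Inter:
  assumes "\<A> \<noteq> {}" "\<And>S. S \<in> \<A> \<Longrightarrow> tri_subcat T S"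
  shows "tri_subcat T (\<Inter>\<A>)"
  unfolding tri_subcat_def
proof (intro conjI ballI allI impI InterI)
  obtain S where "S \<in> \<A>" using assms(1) by blast
  then show "\<Inter>\<A> \<subseteq> Ob T" using tri_subcatD(1)[OF assms(2), of S] by blast
  show "z \<in> S" if "zero_ob T z" "S \<in> \<A>" for z S
    using tri_subcatD(2)[OF assms(2)] that by blast
  show "y \<in> S" if "x \<in> \<Inter>\<A>" "isomorphic T x y" "S \<in> \<A>" for x y S
    using tri_subcatD(3)[OF assms(2)] that by blast
  show "Sh x \<in> \<Inter>\<A> \<longleftrightarrow> x \<in> \<Inter>\<A>" if "x \<in> Ob T" for x
    using tri_subcatD(4)[OF assms(2) that] by blast
  show "Cod T g \<in> S" if "(f, g, h) \<in> Tri T" "Dom T f \<in> \<Inter>\<A>" "Cod T f \<in> \<Inter>\<A>" "S \<in> \<A>" for f g h S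
    using tri_subcatD(5)[OF assms(2) that(1)] that by blast
qed

end

section \<open>Coproducts and localizing subcategories\<close>

definition preserves_coproducts ::
  "('o, 'm, 'z) precat_scheme \<Rightarrow> ('o, 'm, 'o, 'm) fn \<Rightarrow> 'i set \<Rightarrow> bool" where
  "preserves_coproducts C F I \<longleftrightarrow> (\<forall>x s \<iota>. is_coproduct C I x s \<iota> \<longrightarrow>
    is_coproduct C I (\<lambda>i. FO F (x i)) (FO F s) (\<lambda>i. FA F (\<iota> i)))"

lemma universe_infinite: "universe U \<Longrightarrow> infinite U"
  unfolding universe_def using infinite_iff_natLeq_ordLeq ordLess_imp_ordLeq by blast

lemma small_nat: "universe U \<Longrightarrow> small U (UNIV :: nat set)"
  unfolding universe_def small_def using card_of_nat ordIso_ordLess_trans by blast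

lemma small_finite: "universe U \<Longrightarrow> finite A \<Longrightarrow> small U A"
  unfolding small_def using finite_ordLess_infinite[of "|A|" "|U|"] universe_infinite[of U]
  by (simp add: card_of_Well_order Field_card_of card_of_well_order_on)

lemma small_subset: "small U A \<Longrightarrow> B \<subseteq> A \<Longrightarrow> small U B"
  unfolding small_def using card_of_mono1 ordLeq_ordLess_trans by blast

lemma small_image: "small U A \<Longrightarrow> small U (f ` A)"
  unfolding small_def using card_of_image ordLeq_ordLess_trans by blast

text \<open>This is the place where the regularity of the cardinality of the universe enters.\<close>

lemma small_UN:
  assumes "universe U" "small U A" "\<And>a. a \<in> A \<Longrightarrow> small U (B a)"
  shows "small U (\<Union>a\<in>A. B a)"
proof -
  have "infinite U" "regularCard |U|" using assms(1) universe_infinite unfolding universe_def by auto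
  then have "Cinfinite |U|" "stable |U|"
    using regularCard_stable[of "|U|"] by (auto simp: cinfinite_def Field_card_of card_of_card_order_on)
  then show ?thesis
    using stable_UNION[of "|U|" A B] assms(2,3) unfolding small_def by blast
qed

lemma small_Un:
  assumes "universe U" "small U A" "small U B" shows "small U (A \<union> B)"
proof -
  have "small U (\<Union>b\<in>{True, False}. if b then A else B)"
    by (rule small_UN[OF assms(1) small_finite[OF assms(1)]]) (use assms(2,3) in auto)
  then show ?thesis by (simp add: Un_commute)
qed

lemma small_inj: 
  assumes "small U A" obtains e where "inj_on e A" "e ` A \<subseteq> U"
  using assms unfolding small_def by (metis card_of_ordLeq ordLess_imp_ordLeq)

context additive_category
begin

lemma coproduct_arr:
  assumes "is_coproduct T I x s \<iota>"
  shows "s \<in> Ob T" "i \<in> I \<Longrightarrow> x i \<in> Ob T" "i \<in> I \<Longrightarrow> \<iota> i \<in> Arr T" "i \<in> I \<Longrightarrow> Dom T (\<iota> i) = x i"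
    "i \<in> I \<Longrightarrow> Cod T (\<iota> i) = s"
  using assms unfolding is_coproduct_def by (auto simp: Hom_iff)

lemma coproduct_map:
  assumes "is_coproduct T I x s \<iota>" "y \<in> Ob T"
    "\<And>i. i \<in> I \<Longrightarrow> f i \<in> Arr T" "\<And>i. i \<in> I \<Longrightarrow> Dom T (f i) = x i" "\<And>i. i \<in> I \<Longrightarrow> Cod T (f i) = y"
  obtains g where "g \<in> Arr T" "Dom T g = s" "Cod T g = y" "\<And>i. i \<in> I \<Longrightarrow> g \<cdot> \<iota> i = f i"
proof -
  have "\<exists>!g. g \<in> Hom T s y \<and> (\<forall>i\<in>I. g \<cdot> \<iota> i = f i)"
    using assms(1) unfolding is_coproduct_def using assms(2-) by (simp add: Hom_iff)
  then obtain g where "g \<in> Hom T s y" "\<forall>i\<in>I. g \<cdot> \<iota> i = f i" by blast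
  then show ?thesis by (intro that[of g]) (auto simp: Hom_iff)
qed

lemma coproduct_eq:
  assumes c: "is_coproduct T I x s \<iota>" and g: "g \<in> Arr T" "Dom T g = s" "h \<in> Arr T" "Dom T h = s"
    "Cod T g = Cod T h" and eq: "\<And>i. i \<in> I \<Longrightarrow> g \<cdot> \<iota> i = h \<cdot> \<iota> i"
  shows "g = h"
proof -
  have "\<exists>!k. k \<in> Hom T s (Cod T h) \<and> (\<forall>i\<in>I. k \<cdot> \<iota> i = h \<cdot> \<iota> i)"
    using c unfolding is_coproduct_def using g coproduct_arr[OF c] by (simp add: Hom_iff)
  moreover have "g \<in> Hom T s (Cod T h)" "h \<in> Hom T s (Cod T h)" using g by (auto simp: Hom_iff)
  ultimately show ?thesis using eq by blast
qed

lemma coproduct_reindex: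
  assumes "is_coproduct T J x s \<iota>" "bij_betw e I J"
  shows "is_coproduct T I (\<lambda>i. x (e i)) s (\<lambda>i. \<iota> (e i))"
  unfolding is_coproduct_def
proof (intro conjI ballI allI impI)
  note c = coproduct_arr[OF assms(1)]
  have eJ: "e i \<in> J" if "i \<in> I" for i using that assms(2) unfolding bij_betw_def by blast
  show "s \<in> Ob T" "\<And>i. i \<in> I \<Longrightarrow> x (e i) \<in> Ob T" "\<And>i. i \<in> I \<Longrightarrow> \<iota> (e i) \<in> Hom T (x (e i)) s"
    using c eJ by (auto simp: Hom_iff)
  fix y f assume y: "y \<in> Ob T" and f: "\<forall>i\<in>I. f i \<in> Hom T (x (e i)) y"
  let ?d = "inv_into I e"
  have d: "?d j \<in> I" "e (?d j) = j" if "j \<in> J" for j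
    using that bij_betw_inv_into_right[OF assms(2)] bij_betwE[OF bij_betw_inv_into[OF assms(2)]] by auto
  obtain g where g: "g \<in> Arr T" "Dom T g = s" "Cod T g = y" "\<And>j. j \<in> J \<Longrightarrow> g \<cdot> \<iota> j = f (?d j)"
    using coproduct_map[OF assms(1) y, of "\<lambda>j. f (?d j)"] f d by (auto simp: Hom_iff)
  have "g \<cdot> \<iota> (e i) = f i" if "i \<in> I" for i
    using g(4)[OF eJ[OF that]] bij_betw_inv_into_left[OF assms(2) that] by simp
  moreover have "h = g" if h: "h \<in> Hom T s y \<and> (\<forall>i\<in>I. h \<cdot> \<iota> (e i) = f i)" for h
  proof (rule coproduct_eq[OF assms(1)])
    show "h \<cdot> \<iota> j = g \<cdot> \<iota> j" if "j \<in> J" for j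
      using h g(4)[OF that] d[OF that] by metis
  qed (use h g in \<open>auto simp: Hom_iff\<close>)
  ultimately show "\<exists>!g. g \<in> Hom T s y \<and> (\<forall>i\<in>I. g \<cdot> \<iota> (e i) = f i)"
    using g by (intro ex1I[of _ g]) (auto simp: Hom_iff)
qed

lemma coproduct_cong:
  assumes "is_coproduct T I x s \<iota>" "\<And>i. i \<in> I \<Longrightarrow> x i = x' i" "\<And>i. i \<in> I \<Longrightarrow> \<iota> i = \<iota>' i"
  shows "is_coproduct T I x' s \<iota>'"
  using assms unfolding is_coproduct_def by simp

end

text \<open>
  Coproducts are postulated for families indexed by subsets of \<open>U\<close>; as every small set embeds in \<open>U\<close>,
  they exist for all families indexed by a small set of any type.
\<close>

locale cocomplete_triangulated = triangulated_category T for T :: "('o, 'm) ttcat" (structure) +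
  fixes U :: "'u set"
  assumes universe: "universe U"
    and coproducts: "\<And>I x. I \<subseteq> U \<Longrightarrow> small U I \<Longrightarrow> \<forall>i\<in>I. x i \<in> Ob T \<Longrightarrow> \<exists>s \<iota>. is_coproduct T I x s \<iota>"
begin

lemma ex_coproduct:
  assumes "small U I" "\<And>i. i \<in> I \<Longrightarrow> x i \<in> Ob T"
  obtains s \<iota> where "is_coproduct T I x s \<iota>"
proof -
  obtain e where e: "inj_on e I" "e ` I \<subseteq> U" using small_inj[OF assms(1)] .
  have "\<exists>s \<iota>. is_coproduct T (e ` I) (\<lambda>j. x (inv_into I e j)) s \<iota>"
    by (rule coproducts) (use e small_image[OF assms(1), of e] assms(2) in auto)
  then obtain s \<iota> where "is_coproduct T (e ` I) (\<lambda>j. x (inv_into I e j)) s \<iota>" by blast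
  then have "is_coproduct T I (\<lambda>i. x (inv_into I e (e i))) s (\<lambda>i. \<iota> (e i))"
    by (rule coproduct_reindex) (use e in \<open>simp add: bij_betw_def\<close>)
  from coproduct_cong[OF this, of x "\<lambda>i. \<iota> (e i)"] show ?thesis using e(1) by (intro that) simp
qed

lemma localizing_tri: "localizing U T S \<Longrightarrow> tri_subcat T S"
  unfolding localizing_def by blast

lemma localizing_coproduct:
  assumes "localizing U T S" "small U I" "\<And>i. i \<in> I \<Longrightarrow> x i \<in> S" "is_coproduct T I x s \<iota>"
  shows "s \<in> S"
proof -
  obtain e where e: "inj_on e I" "e ` I \<subseteq> U" using small_inj[OF assms(2)] .
  let ?d = "inv_into I e"
  have "bij_betw ?d (e ` I) I" using e(1) by (simp add: bij_betw_inv_into inj_on_imp_bij_betw)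
  then have "is_coproduct T (e ` I) (\<lambda>j. x (?d j)) s (\<lambda>j. \<iota> (?d j))"
    using coproduct_reindex[OF assms(4)] by blast
  moreover have "\<forall>I x s \<iota>. I \<subseteq> U \<longrightarrow> small U I \<longrightarrow> (\<forall>i\<in>I. x i \<in> S) \<longrightarrow> is_coproduct T I x s \<iota> \<longrightarrow> s \<in> S"
    using assms(1) unfolding localizing_def by blast
  ultimately show ?thesis
    using e small_image[OF assms(2), of e] assms(3) by (metis inv_into_into)
qed

lemma localizing_Ob: "localizing U T (Ob T)"
  unfolding localizing_def is_coproduct_def using tri_subcat_Ob by blast

lemma localizing_Inter:
  assumes "\<A> \<noteq> {}" "\<And>S. S \<in> \<A> \<Longrightarrow> localizing U T S"
  shows "localizing U T (\<Inter>\<A>)"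
  unfolding localizing_def
proof (intro conjI allI impI InterI)
  show "tri_subcat T (\<Inter>\<A>)" using assms localizing_tri by (intro tri_subcat_Inter) auto
  fix I :: "'u set" and x s \<iota> S
  assume "I \<subseteq> U" "small U I" "\<forall>i\<in>I. x i \<in> \<Inter>\<A>" "is_coproduct T I x s \<iota>" "S \<in> \<A>"
  then show "s \<in> S" by (intro localizing_coproduct[OF assms(2), of S I x s \<iota>]) auto
qed

lemma localizing_Loc: "A \<subseteq> Ob T \<Longrightarrow> localizing U T (Loc U T A)"
  unfolding Loc_def using localizing_Ob by (intro localizing_Inter) auto

lemma Loc_incl: "A \<subseteq> Loc U T A"
  unfolding Loc_def by blast

lemma Loc_least: "localizing U T S \<Longrightarrow> A \<subseteq> S \<Longrightarrow> Loc U T A \<subseteq> S"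
  unfolding Loc_def by blast

lemma exact_endo_additive: "exact_endo T F \<Longrightarrow> additive_endo T F"
  unfolding exact_endo_def by blast

lemma exact_endo_Shift:
  assumes "exact_endo T F" "x \<in> Ob T" shows "isomorphic T (FO F (Sh x)) (Sh (FO F x))"
proof -
  obtain \<phi> where "nat_iso T T (fn_comp F (Shift T)) (fn_comp (Shift T) F) \<phi>"
    using assms(1) unfolding exact_endo_def by blast
  then have "iso_arr T (\<phi> x)" "\<phi> x \<in> Hom T (FO F (Sh x)) (Sh (FO F x))"
    using assms(2) unfolding nat_iso_def nat_trans_def fn_comp_def by auto
  then show ?thesis unfolding isomorphic_def by blast
qed

lemma exact_endo_tri:
  assumes "exact_endo T F" "(f, g, h) \<in> Tri T"
  obtains e where "iso_arr T e" "e \<in> Arr T" "Dom T e = FO F (Sh (Dom T f))" "Cod T e = Sh (FO F (Dom T f))"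
    "(FA F f, FA F g, e \<cdot> FA F h) \<in> Tri T"
proof -
  obtain \<phi> where p: "nat_iso T T (fn_comp F (Shift T)) (fn_comp (Shift T) F) \<phi>"
    "\<forall>f g h. (f, g, h) \<in> Tri T \<longrightarrow> (FA F f, FA F g, \<phi> (Dom T f) \<cdot> FA F h) \<in> Tri T"
    using assms(1) unfolding exact_endo_def by blast
  have "Dom T f \<in> Ob T" using tri_arr[OF assms(2)] by simp
  then have "iso_arr T (\<phi> (Dom T f))" "\<phi> (Dom T f) \<in> Hom T (FO F (Sh (Dom T f))) (Sh (FO F (Dom T f)))"
    using p(1) unfolding nat_iso_def nat_trans_def fn_comp_def by auto
  then show ?thesis using p(2) assms(2) by (intro that[of "\<phi> (Dom T f)"]) (auto simp: Hom_iff)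
qed

lemma tri_subcat_preimage:
  assumes F: "exact_endo T F" and S: "tri_subcat T S"
  shows "tri_subcat T {x \<in> Ob T. FO F x \<in> S}"
proof -
  note add = exact_endo_additive[OF F]
  show ?thesis unfolding tri_subcat_def
  proof (intro conjI ballI allI impI)
    show "{x \<in> Ob T. FO F x \<in> S} \<subseteq> Ob T" by blast
    show "z \<in> {x \<in> Ob T. FO F x \<in> S}" if "zero_ob T z" for z
      using additive_endo_zero_ob[OF add that] tri_subcatD(2)[OF S] that by auto
    show "y \<in> {x \<in> Ob T. FO F x \<in> S}" if "x \<in> {x \<in> Ob T. FO F x \<in> S}" "isomorphic T x y" for x y
      using tri_subcatD(3)[OF S _ additive_endo_isomorphic[OF add that(2)]] that isomorphic_in_Ob by auto
    show "Sh x \<in> {x \<in> Ob T. FO F x \<in> S} \<longleftrightarrow> x \<in> {x \<in> Ob T. FO F x \<in> S}" if "x \<in> Ob T" for x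
      using exact_endo_Shift[OF F that] tri_subcatD(3)[OF S] tri_subcatD(4)[OF S, of "FO F x"]
        isomorphic_sym that add by auto
    show "Cod T g \<in> {x \<in> Ob T. FO F x \<in> S}"
      if t: "(f, g, h) \<in> Tri T" and "Dom T f \<in> {x \<in> Ob T. FO F x \<in> S}" "Cod T f \<in> {x \<in> Ob T. FO F x \<in> S}" for f g h
    proof -
      obtain e where "(FA F f, FA F g, e \<cdot> FA F h) \<in> Tri T" using exact_endo_tri[OF F t] .
      from tri_subcatD(5)[OF S this] show ?thesis using that tri_arr[OF t] add by simp
    qed
  qed
qed

lemma localizing_preimage:
  assumes F: "exact_endo T F" "\<And>I :: 'u set. preserves_coproducts T F I" and S: "localizing U T S"
  shows "localizing U T {x \<in> Ob T. FO F x \<in> S}"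
  unfolding localizing_def
proof (intro conjI allI impI)
  show "tri_subcat T {x \<in> Ob T. FO F x \<in> S}" using tri_subcat_preimage F(1) localizing_tri[OF S] .
  fix I :: "'u set" and x s \<iota>
  assume I: "I \<subseteq> U" "small U I" "\<forall>i\<in>I. x i \<in> {x \<in> Ob T. FO F x \<in> S}" and c: "is_coproduct T I x s \<iota>"
  have "is_coproduct T I (\<lambda>i. FO F (x i)) (FO F s) (\<lambda>i. FA F (\<iota> i))"
    using F(2) c unfolding preserves_coproducts_def by blast
  from localizing_coproduct[OF S I(2) _ this] show "s \<in> {x \<in> Ob T. FO F x \<in> S}"
    using I(3) coproduct_arr(1)[OF c] by simp
qed

subsection \<open>Telescopes\<close>

text \<open>
  The map \<open>1 - shift\<close> on the coproduct of a sequence; its cone is the homotopy colimit.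
\<close>

lemma telescope_map:
  assumes c: "is_coproduct T (UNIV :: nat set) B A \<iota>"
    and j: "\<And>n. j n \<in> Arr T" "\<And>n. Dom T (j n) = B n" "\<And>n. Cod T (j n) = B (Suc n)"
  obtains \<phi> where "\<phi> \<in> Arr T" "Dom T \<phi> = A" "Cod T \<phi> = A" "\<And>n. \<phi> \<cdot> \<iota> n = sub (\<iota> n) (\<iota> (Suc n) \<cdot> j n)"
proof -
  note a = coproduct_arr[OF c, simplified]
  have "\<exists>\<phi>. \<phi> \<in> Arr T \<and> Dom T \<phi> = A \<and> Cod T \<phi> = A \<and> (\<forall>n. \<phi> \<cdot> \<iota> n = sub (\<iota> n) (\<iota> (Suc n) \<cdot> j n))"
    by (rule coproduct_map[OF c a(1), of "\<lambda>n. sub (\<iota> n) (\<iota> (Suc n) \<cdot> j n)"]) (use a j in auto)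
  then show ?thesis using that by blast
qed

lemma difference_identities:
  assumes "x \<in> Arr T" "d \<in> Arr T" "k \<in> Arr T" "Dom T x = a" "Dom T d = a" "Dom T k = a"
    "Cod T x = b" "Cod T d = b" "Cod T k = b"
  shows "Plus T (sub (sub x d) (sub k d)) k = x" "sub d (Plus T k d) = neg_arr T k"
    "sub (sub x k) (neg_arr T k) = x"
proof -
  have "sub (sub x d) (sub k d) = Plus T x (Plus T (neg_arr T d) (Plus T (neg_arr T k) d))"
    using assms by (simp add: neg_plus plus_ac(1))
  also have "\<dots> = Plus T x (Plus T (neg_arr T k) (Plus T (neg_arr T d) d))"
    using assms plus_ac(2)[of "neg_arr T d" "neg_arr T k" d] by simp
  also have "\<dots> = sub x k" using assms by simp
  finally show "Plus T (sub (sub x d) (sub k d)) k = x" using assms by simp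
  have "sub d (Plus T k d) = Plus T d (Plus T (neg_arr T k) (neg_arr T d))"
    using assms by (simp add: neg_plus)
  also have "\<dots> = Plus T (neg_arr T k) (sub d d)"
    by (rule plus_ac(2)) (use assms in simp_all)
  also have "\<dots> = neg_arr T k" using assms by simp
  finally show "sub d (Plus T k d) = neg_arr T k" .
  show "sub (sub x k) (neg_arr T k) = x" using assms by simp
qed

text \<open>
  If the transition maps of a sequence factor as \<open>s\<^sub>n\<^sub>+\<^sub>1 b\<^sub>n\<close> through a fixed object \<open>a\<close>, with \<open>b\<^sub>n s\<^sub>n = 1\<close>,
  then its homotopy colimit is \<open>a\<close>. The map \<open>1 - shift\<close> is a split monomorphism, with retraction
  \<open>r \<iota>\<^sub>n = \<iota>\<^sub>n - k\<^sub>n\<^sub>+\<^sub>1 b\<^sub>n\<close>, where \<open>k\<^sub>n\<close> is the sum of \<open>\<iota>\<^sub>j s\<^sub>j\<close> over \<open>j < n\<close>, and its cokernel is split by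
  \<open>\<iota>\<^sub>0 s\<^sub>0\<close>. Sequences of this kind are the telescope of an idempotent and the tower below after
  applying a functor that kills its transition maps.
\<close>

lemma telescope_split:
  assumes c: "is_coproduct T (UNIV :: nat set) B A \<iota>"
    and b: "\<And>n. b n \<in> Arr T" "\<And>n. Dom T (b n) = B n" "\<And>n. Cod T (b n) = a"
    and s: "\<And>n. s n \<in> Arr T" "\<And>n. Dom T (s n) = a" "\<And>n. Cod T (s n) = B n"
    and bs: "\<And>n. b n \<cdot> s n = Ide T a"
    and \<phi>: "\<phi> \<in> Arr T" "Dom T \<phi> = A" "Cod T \<phi> = A"
      "\<And>n. \<phi> \<cdot> \<iota> n = sub (\<iota> n) (\<iota> (Suc n) \<cdot> (s (Suc n) \<cdot> b n))"
    and t: "(\<phi>, g, h) \<in> Tri T"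
    and p: "p \<in> Arr T" "Dom T p = Cod T g" "Cod T p = a" "\<And>n. p \<cdot> (g \<cdot> \<iota> n) = b n"
  shows "iso_arr T p"
proof -
  note i = coproduct_arr[OF c, simplified]
  have aO: "a \<in> Ob T" using b by (metis Cod_in_Ob)
  note ta = tri_arr[OF t]
  \<comment> \<open>partial sums of the arrows \<open>\<iota>\<^sub>j s\<^sub>j\<close>\<close>
  define k where "k = rec_nat (Zer T a A) (\<lambda>n f. Plus T f (\<iota> n \<cdot> s n))"
  have k: "k n \<in> Arr T \<and> Dom T (k n) = a \<and> Cod T (k n) = A" for n
    unfolding k_def by (induction n) (use aO i s in auto)
  have kS: "k (Suc n) = Plus T (k n) (\<iota> n \<cdot> s n)" for n unfolding k_def by simp
  have k1: "k (Suc 0) = \<iota> 0 \<cdot> s 0" unfolding k_def using aO i s by simp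
  have \<phi>s: "\<phi> \<cdot> (\<iota> n \<cdot> s n) = sub (\<iota> n \<cdot> s n) (\<iota> (Suc n) \<cdot> s (Suc n))" for n
  proof -
    have "\<phi> \<cdot> (\<iota> n \<cdot> s n) = sub (\<iota> n) (\<iota> (Suc n) \<cdot> (s (Suc n) \<cdot> b n)) \<cdot> s n"
      by (rule comp_reduce[OF \<phi>(4)]) (use i s \<phi>(1-3) in auto)
    then show ?thesis using i s b bs by simp
  qed
  have \<phi>k: "\<phi> \<cdot> k (Suc n) = sub (\<iota> 0 \<cdot> s 0) (\<iota> (Suc n) \<cdot> s (Suc n))" for n
  proof (induction n)
    case 0 show ?case unfolding k1 by (rule \<phi>s)
  next
    case (Suc n)
    let ?x = "\<iota> 0 \<cdot> s 0" and ?y = "\<iota> (Suc n) \<cdot> s (Suc n)" and ?z = "\<iota> (Suc (Suc n)) \<cdot> s (Suc (Suc n))"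
    have "\<phi> \<cdot> k (Suc (Suc n)) = Plus T (\<phi> \<cdot> k (Suc n)) (\<phi> \<cdot> ?y)"
      unfolding kS[of "Suc n"] by (rule comp_plus) (use k i s \<phi>(1-3) in auto)
    also have "\<dots> = Plus T (sub ?x ?y) (sub ?y ?z)" unfolding Suc.IH \<phi>s ..
    also have "\<dots> = Plus T (Plus T (sub ?x ?y) ?y) (neg_arr T ?z)"
      by (rule plus_ac(1)[symmetric]) (use i s in auto)
    also have "\<dots> = sub ?x ?z" using i s by simp
    finally show ?case .
  qed
  \<comment> \<open>correction by the partial sums makes \<open>r \<phi>\<close> telescope to the identity\<close>
  obtain r where r: "r \<in> Arr T" "Dom T r = A" "Cod T r = A"
      "\<And>n. r \<cdot> \<iota> n = sub (\<iota> n) (k (Suc n) \<cdot> b n)"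
    using coproduct_map[OF c i(1), of "\<lambda>n. sub (\<iota> n) (k (Suc n) \<cdot> b n)"] i k b by auto
  have r\<phi>: "r \<cdot> \<phi> = Ide T (Dom T \<phi>)"
  proof (rule coproduct_eq[OF c])
    fix n
    let ?D = "\<iota> (Suc n) \<cdot> (s (Suc n) \<cdot> b n)" and ?E = "k (Suc n) \<cdot> b n"
    have sb: "b (Suc n) \<cdot> (s (Suc n) \<cdot> b n) = b n"
      using comp_reduce[OF bs[of "Suc n"], of "b n"] b s aO by simp
    have "r \<cdot> ?D = sub (\<iota> (Suc n)) (k (Suc (Suc n)) \<cdot> b (Suc n)) \<cdot> (s (Suc n) \<cdot> b n)"
      by (rule comp_reduce[OF r(4)]) (use i s b r(1-3) in auto)
    also have "\<dots> = sub ?D (k (Suc (Suc n)) \<cdot> b n)"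
      using i s b k sb by simp
    also have "k (Suc (Suc n)) \<cdot> b n = Plus T ?E ?D"
      unfolding kS[of "Suc n"] using i s b k by simp
    also have "sub ?D (Plus T ?E ?D) = neg_arr T ?E"
      by (rule difference_identities(2)[where x = ?D]) (use i s b k in auto)
    finally have rD: "r \<cdot> ?D = neg_arr T ?E" .
    have "(r \<cdot> \<phi>) \<cdot> \<iota> n = r \<cdot> (\<phi> \<cdot> \<iota> n)" using r(1-3) \<phi>(1-3) i by simp
    also have "\<dots> = sub (r \<cdot> \<iota> n) (r \<cdot> ?D)" unfolding \<phi>(4) using r(1-3) i s b by simp
    also have "\<dots> = \<iota> n" unfolding rD r(4)
      by (rule difference_identities(3)[where d = ?D]) (use i s b k in auto)
    finally show "(r \<cdot> \<phi>) \<cdot> \<iota> n = Ide T (Dom T \<phi>) \<cdot> \<iota> n" using i \<phi>(1-3) by simp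
  qed (use r(1-3) \<phi>(1-3) i in auto)
  let ?s = "\<iota> 0 \<cdot> s 0" and ?p = "p \<cdot> g"
  have pi: "?p \<cdot> \<iota> n = b n" for n using p i ta \<phi>(1-3) by simp
  have "Plus T (\<phi> \<cdot> r) (?s \<cdot> ?p) = Ide T A"
  proof (rule coproduct_eq[OF c])
    fix n
    let ?D = "\<iota> (Suc n) \<cdot> (s (Suc n) \<cdot> b n)" and ?K = "(\<iota> 0 \<cdot> s 0) \<cdot> b n"
    have "\<phi> \<cdot> (k (Suc n) \<cdot> b n) = sub (\<iota> 0 \<cdot> s 0) (\<iota> (Suc n) \<cdot> s (Suc n)) \<cdot> b n"
      by (rule comp_reduce[OF \<phi>k]) (use k b \<phi>(1-3) in auto)
    also have "\<dots> = sub ?K ?D" using i s b by simp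
    finally have 1: "\<phi> \<cdot> (k (Suc n) \<cdot> b n) = sub ?K ?D" .
    have "\<phi> \<cdot> (r \<cdot> \<iota> n) = sub (\<phi> \<cdot> \<iota> n) (\<phi> \<cdot> (k (Suc n) \<cdot> b n))"
      unfolding r(4) using i k b \<phi>(1-3) by simp
    then have 2: "\<phi> \<cdot> (r \<cdot> \<iota> n) = sub (sub (\<iota> n) ?D) (sub ?K ?D)" unfolding 1 \<phi>(4) .
    have 3: "?s \<cdot> (?p \<cdot> \<iota> n) = ?K" unfolding pi ..
    have "Plus T (\<phi> \<cdot> r) (?s \<cdot> ?p) \<cdot> \<iota> n = Plus T (\<phi> \<cdot> (r \<cdot> \<iota> n)) (?s \<cdot> (?p \<cdot> \<iota> n))"
      using \<phi>(1-3) r(1-3) i s p(1-3) ta by simp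
    also have "\<dots> = \<iota> n" unfolding 2 3
      by (rule difference_identities(1)) (use i s b in auto)
    finally show "Plus T (\<phi> \<cdot> r) (?s \<cdot> ?p) \<cdot> \<iota> n = Ide T A \<cdot> \<iota> n" using i by simp
  qed (use \<phi>(1-3) r(1-3) i s p(1-3) ta in auto)
  moreover have "?p \<cdot> ?s = Ide T (Cod T ?p)"
    using comp_reduce[OF pi, of 0 "s 0"] i s p(1-3) ta \<phi>(1-3) bs by simp
  ultimately show ?thesis
    by (intro cone_of_split[OF t r(1), of ?p ?s p]) (use r(1-3) r\<phi> \<phi>(1-3) i s p(1-3) ta in auto)
qed

text \<open>
  The retract is the homotopy colimit of the sequence in which every map is the idempotent
  \<open>i r\<close> of \<open>y\<close>.
\<close>

lemma localizing_retract:
  assumes S: "localizing U T S" and y: "y \<in> S" and r: "is_retract T x y"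
  shows "x \<in> S"
proof -
  obtain i r where ir: "i \<in> Arr T" "Dom T i = x" "Cod T i = y" "r \<in> Arr T" "Dom T r = y"
      "Cod T r = x" "r \<cdot> i = Ide T x" using r by (rule is_retractE)
  have O: "x \<in> Ob T" "y \<in> Ob T" using ir by auto
  obtain A \<iota> where c: "is_coproduct T (UNIV :: nat set) (\<lambda>n. y) A \<iota>"
    using ex_coproduct[OF small_nat[OF universe], of "\<lambda>n. y"] O by blast
  note a = coproduct_arr[OF c, simplified]
  have AS: "A \<in> S" using localizing_coproduct[OF S small_nat[OF universe] _ c] y by blast
  obtain \<phi> where \<phi>: "\<phi> \<in> Arr T" "Dom T \<phi> = A" "Cod T \<phi> = A"
      "\<And>n. \<phi> \<cdot> \<iota> n = sub (\<iota> n) (\<iota> (Suc n) \<cdot> (i \<cdot> r))"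
    using telescope_map[OF c, of "\<lambda>n. i \<cdot> r"] ir by auto
  obtain g h where t: "(\<phi>, g, h) \<in> Tri T" using ex_tri \<phi>(1) by blast
  note ta = tri_arr[OF t]
  obtain q where q: "q \<in> Arr T" "Dom T q = A" "Cod T q = x" "\<And>n. q \<cdot> \<iota> n = r"
    using coproduct_map[OF c O(1), of "\<lambda>n. r"] ir by auto
  \<comment> \<open>the map \<open>r\<close> on every term is compatible with the sequence, so that it extends to the colimit\<close>
  have "q \<cdot> \<phi> = Zer T A x"
  proof (rule coproduct_eq[OF c])
    fix n
    have 1: "q \<cdot> (\<iota> (Suc n) \<cdot> (i \<cdot> r)) = r"
      using comp_reduce[OF q(4), of "Suc n" "i \<cdot> r"] comp_reduce[OF ir(7), of r] a ir q(1-3) O by simp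
    have "(q \<cdot> \<phi>) \<cdot> \<iota> n = q \<cdot> (\<phi> \<cdot> \<iota> n)" using q(1-3) \<phi>(1-3) a by simp
    also have "\<dots> = sub (q \<cdot> \<iota> n) (q \<cdot> (\<iota> (Suc n) \<cdot> (i \<cdot> r)))"
      unfolding \<phi>(4) using q(1-3) a ir(1-6) by simp
    also have "\<dots> = Zer T A x \<cdot> \<iota> n" unfolding 1 q(4) using a ir(1-6) O by simp
    finally show "(q \<cdot> \<phi>) \<cdot> \<iota> n = Zer T A x \<cdot> \<iota> n" .
  qed (use q \<phi>(1-3) a O in auto)
  then obtain p where p: "p \<in> Arr T" "Dom T p = Cod T g" "Cod T p = x" "p \<cdot> g = q"
    using tri_extend[OF t, of q] q \<phi>(1-3) by auto
  have "p \<cdot> (g \<cdot> \<iota> n) = r" for n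
    using comp_reduce[OF p(4), of "\<iota> n"] q(4) p(1-3) ta \<phi>(1-3) a by simp
  then have "iso_arr T p"
    by (intro telescope_split[OF c, of "\<lambda>n. r" x "\<lambda>n. i" \<phi> g h]) (use ir \<phi> t p in auto)
  then have "isomorphic T (Cod T g) x" using isomorphicI[of p] p by simp
  moreover have "Cod T g \<in> S" using tri_subcatD(5)[OF localizing_tri[OF S] t] AS \<phi>(2,3) by simp
  ultimately show ?thesis using tri_subcatD(3)[OF localizing_tri[OF S]] by blast
qed

text \<open>
  For a sequence of maps \<open>t\<^sub>n\<close> from \<open>X\<^sub>n\<close> to \<open>X\<^sub>n\<^sub>+\<^sub>1\<close>, let \<open>M\<^sub>n\<close> be the cone of the composite from \<open>X\<^sub>0\<close> to
  \<open>X\<^sub>n\<close>. By the octahedral axiom the cone of \<open>M\<^sub>n \<rightarrow> M\<^sub>n\<^sub>+\<^sub>1\<close> is that of \<open>t\<^sub>n\<close>, so that all \<open>M\<^sub>n\<close> and their homotopy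
  colimit \<open>H\<close> lie in \<open>S\<close>. The connecting maps from \<open>M\<^sub>n\<close> to the suspension of \<open>X\<^sub>0\<close> induce \<open>\<pi>\<close>. If \<open>F\<close>
  kills the maps \<open>t\<^sub>n\<close>, then \<open>F(M\<^sub>n) \<rightarrow> F(\<Sigma>X\<^sub>0)\<close> is split for \<open>n > 0\<close>, and the transition map out of
  \<open>F(M\<^sub>n)\<close> factors through it: \<open>telescope_split\<close> applies. Morally \<open>\<pi>\<close> is the fibre of the
  map from the suspension of \<open>X\<^sub>0\<close> to that of the homotopy colimit of the \<open>X\<^sub>n\<close>, which \<open>F\<close> annihilates.
  The object \<open>M\<^sub>0\<close> is zero, so its connecting map has no section; the telescope is formed from \<open>M\<^sub>1\<close>
  onwards.
\<close>

lemma tower: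
  assumes S: "localizing U T S"
    and t: "\<And>n. t n \<in> Arr T" "\<And>n. Dom T (t n) = X n" "\<And>n. Cod T (t n) = X (Suc n)"
    and cone: "\<And>n. \<exists>j j'. (t n, j, j') \<in> Tri T \<and> Cod T j \<in> S"
  obtains H \<pi> where "H \<in> S" "\<pi> \<in> Arr T" "Dom T \<pi> = H" "Cod T \<pi> = Sh (X 0)"
    "\<And>F. exact_endo T F \<Longrightarrow> preserves_coproducts T F (UNIV :: nat set) \<Longrightarrow>
      (\<And>n. FA F (t n) = Zer T (FO F (X n)) (FO F (X (Suc n)))) \<Longrightarrow> iso_arr T (FA F \<pi>)"
proof -
  note S' = localizing_tri[OF S]
  have XO: "X n \<in> Ob T" for n using t(1,2) Dom_in_Ob by metis
  \<comment> \<open>the composites from \<open>X\<^sub>0\<close> to \<open>X\<^sub>n\<close>\<close>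
  define xs where "xs = rec_nat (Ide T (X 0)) (\<lambda>n f. t n \<cdot> f)"
  have xs: "xs n \<in> Arr T \<and> Dom T (xs n) = X 0 \<and> Cod T (xs n) = X n" for n
    unfolding xs_def by (induction n) (use XO t in auto)
  have xsS: "xs (Suc n) = t n \<cdot> xs n" and xs0: "xs 0 = Ide T (X 0)" for n unfolding xs_def by simp_all
  have "\<forall>n. \<exists>u v. (xs n, u, v) \<in> Tri T" using ex_tri xs by blast
  then obtain u v where uv: "\<And>n. (xs n, u n, v n) \<in> Tri T" by metis
  define M where "M n = Cod T (u n)" for n
  have u: "u n \<in> Arr T" "Dom T (u n) = X n" "Cod T (u n) = M n" for n
    using tri_arr[OF uv[of n]] xs[of n] unfolding M_def by auto
  have v: "v n \<in> Arr T" "Dom T (v n) = M n" "Cod T (v n) = Sh (X 0)" for n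
    using tri_arr[OF uv[of n]] xs[of n] unfolding M_def by auto
  have MO: "M n \<in> Ob T" for n using u(1,3)[of n] Cod_in_Ob by metis
  have "\<exists>p. p \<in> Arr T \<and> Dom T p = M n \<and> Cod T p = M (Suc n) \<and> p \<cdot> u n = u (Suc n) \<cdot> t n \<and>
      v (Suc n) \<cdot> p = v n \<and> (\<exists>q r. (p, q, r) \<in> Tri T \<and> Cod T q \<in> S)" for n
  proof -
    obtain j j' where j: "(t n, j, j') \<in> Tri T" "Cod T j \<in> S" using cone by blast
    have "(t n \<cdot> xs n, u (Suc n), v (Suc n)) \<in> Tri T" using uv[of "Suc n"] unfolding xsS .
    then obtain p q where "p \<in> Arr T" "Dom T p = Cod T (u n)" "Cod T p = Cod T (u (Suc n))"
      "(p, q, Sm (u n) \<cdot> j') \<in> Tri T" "Cod T q = Cod T j" "p \<cdot> u n = u (Suc n) \<cdot> t n" "v (Suc n) \<cdot> p = v n"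
      using octahedron[OF _ uv j(1)] xs t by metis
    then show ?thesis using j(2) unfolding M_def by metis
  qed
  then obtain p where p: "\<And>n. p n \<in> Arr T" "\<And>n. Dom T (p n) = M n" "\<And>n. Cod T (p n) = M (Suc n)"
      "\<And>n. p n \<cdot> u n = u (Suc n) \<cdot> t n" "\<And>n. v (Suc n) \<cdot> p n = v n"
      and pt: "\<And>n. \<exists>q r. (p n, q, r) \<in> Tri T \<and> Cod T q \<in> S"
    by metis
  have MS: "M n \<in> S" for n
  proof (induction n)
    case 0
    have "zero_ob T (M 0)" unfolding M_def
      by (rule cone_of_iso[OF uv]) (use xs0 iso_Ide XO in simp)
    then show ?case using tri_subcatD(2)[OF S'] by blast
  next
    case (Suc n)
    obtain q r where "(p n, q, r) \<in> Tri T" "Cod T q \<in> S" using pt by blast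
    then show ?case using tri_subcat_middle[OF S', of "p n" q r] Suc p by simp
  qed
  have SXO: "Sh (X 0) \<in> Ob T" using XO by simp
  obtain A \<kappa> where c: "is_coproduct T (UNIV :: nat set) (\<lambda>n. M (Suc n)) A \<kappa>"
    using ex_coproduct[OF small_nat[OF universe], of "\<lambda>n. M (Suc n)"] MO by blast
  note k = coproduct_arr[OF c, simplified]
  have AS: "A \<in> S" using localizing_coproduct[OF S small_nat[OF universe] _ c] MS by blast
  obtain \<phi> where \<phi>: "\<phi> \<in> Arr T" "Dom T \<phi> = A" "Cod T \<phi> = A"
      "\<And>n. \<phi> \<cdot> \<kappa> n = sub (\<kappa> n) (\<kappa> (Suc n) \<cdot> p (Suc n))"
    using telescope_map[OF c, of "\<lambda>n. p (Suc n)"] p by auto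
  obtain g h where tr: "(\<phi>, g, h) \<in> Tri T" using ex_tri \<phi>(1) by blast
  note ta = tri_arr[OF tr]
  obtain w where w: "w \<in> Arr T" "Dom T w = A" "Cod T w = Sh (X 0)" "\<And>n. w \<cdot> \<kappa> n = v (Suc n)"
    using coproduct_map[OF c SXO, of "\<lambda>n. v (Suc n)"] v by auto
  have "w \<cdot> \<phi> = Zer T A (Sh (X 0))"
  proof (rule coproduct_eq[OF c])
    fix n
    have 1: "w \<cdot> (\<kappa> (Suc n) \<cdot> p (Suc n)) = v (Suc n)"
      using comp_reduce[OF w(4), of "Suc n" "p (Suc n)"] p k w(1-3) by simp
    have "(w \<cdot> \<phi>) \<cdot> \<kappa> n = w \<cdot> (\<phi> \<cdot> \<kappa> n)" using w(1-3) \<phi>(1-3) k by simp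
    also have "\<dots> = sub (w \<cdot> \<kappa> n) (w \<cdot> (\<kappa> (Suc n) \<cdot> p (Suc n)))"
      unfolding \<phi>(4) using w(1-3) k p(1-3) by simp
    also have "\<dots> = Zer T A (Sh (X 0)) \<cdot> \<kappa> n" unfolding 1 w(4) using k v MO SXO by simp
    finally show "(w \<cdot> \<phi>) \<cdot> \<kappa> n = Zer T A (Sh (X 0)) \<cdot> \<kappa> n" .
  qed (use w \<phi>(1-3) k SXO in auto)
  then obtain \<pi> where \<pi>: "\<pi> \<in> Arr T" "Dom T \<pi> = Cod T g" "Cod T \<pi> = Sh (X 0)" "\<pi> \<cdot> g = w"
    using tri_extend[OF tr, of w] w \<phi>(1-3) by auto
  have \<pi>g: "\<pi> \<cdot> (g \<cdot> \<kappa> n) = v (Suc n)" for n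
    using comp_reduce[OF \<pi>(4), of "\<kappa> n"] w(4) \<pi>(1-3) ta \<phi>(1-3) k by simp
  have HS: "Cod T g \<in> S" using tri_subcatD(5)[OF S' tr] AS \<phi>(2,3) by simp
  have "iso_arr T (FA F \<pi>)"
    if F: "exact_endo T F" and Fc: "preserves_coproducts T F (UNIV :: nat set)"
      and Ft: "\<And>n. FA F (t n) = Zer T (FO F (X n)) (FO F (X (Suc n)))" for F
  proof -
    note add = exact_endo_additive[OF F]
    note Fa [simp] = additive_endo_arr[OF add]
    let ?a = "FO F (Sh (X 0))"
    have aO: "?a \<in> Ob T" using SXO by simp
    define b where "b n = FA F (v (Suc n))" for n
    define J where "J n = FA F (p (Suc n))" for n
    have b: "b n \<in> Arr T" "Dom T (b n) = FO F (M (Suc n))" "Cod T (b n) = ?a" for n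
      unfolding b_def using v by auto
    have J: "J n \<in> Arr T" "Dom T (J n) = FO F (M (Suc n))" "Cod T (J n) = FO F (M (Suc (Suc n)))" for n
      unfolding J_def using p by auto
    have bJ: "b (Suc n) \<cdot> J n = b n" for n
      unfolding b_def J_def by (rule additive_endo_comp[OF add p(5)]) (use v p in auto)
    \<comment> \<open>an arrow killed by \<open>b\<^sub>n\<close> comes from \<open>F(X\<^sub>n\<^sub>+\<^sub>1)\<close>, on which the transition map vanishes because \<open>F(t\<^sub>n\<^sub>+\<^sub>1) = 0\<close>\<close>
    have kill: "J n \<cdot> z = Zer T (Dom T z) (FO F (M (Suc (Suc n))))"
      if z: "z \<in> Arr T" "Cod T z = FO F (M (Suc n))" "b n \<cdot> z = Zer T (Dom T z) ?a" for n z
    proof -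
      obtain e where e: "iso_arr T e" "e \<in> Arr T" "Dom T e = FO F (Sh (Dom T (xs (Suc n))))"
        "Cod T e = Sh (FO F (Dom T (xs (Suc n))))" and
        tt: "(FA F (xs (Suc n)), FA F (u (Suc n)), e \<cdot> FA F (v (Suc n))) \<in> Tri T"
        using exact_endo_tri[OF F uv[of "Suc n"]] .
      have eD: "Dom T e = ?a" using e(3) xs by simp
      have "(e \<cdot> FA F (v (Suc n))) \<cdot> z = e \<cdot> (b n \<cdot> z)"
        unfolding b_def using e(2) eD v z(1,2) by simp
      also have "\<dots> = Zer T (Dom T z) (Cod T e)" unfolding z(3) using e(2) eD z(1) aO by simp
      finally have 1: "(e \<cdot> FA F (v (Suc n))) \<cdot> z = Zer T (Dom T z) (Cod T (e \<cdot> FA F (v (Suc n))))"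
        using e(2) eD v by simp
      have D: "Dom T (FA F (u (Suc n))) = FO F (X (Suc n))" "Cod T (FA F (u (Suc n))) = FO F (M (Suc n))"
        using u by auto
      obtain y where y: "y \<in> Arr T" "Dom T y = Dom T z" "Cod T y = FO F (X (Suc n))" "FA F (u (Suc n)) \<cdot> y = z"
        using tri_lift[OF tri_rotate[OF tt] z(1) _ 1] z(2) D by metis
      have "FA F (p (Suc n)) \<cdot> FA F (u (Suc n)) = FA F (u (Suc (Suc n)) \<cdot> t (Suc n))"
        by (rule additive_endo_comp[OF add p(4)]) (use u p in auto)
      also have "\<dots> = FA F (u (Suc (Suc n))) \<cdot> FA F (t (Suc n))" using u t by simp
      also have "\<dots> = Zer T (FO F (X (Suc n))) (FO F (M (Suc (Suc n))))"
        unfolding Ft using u XO MO by simp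
      finally have 2: "J n \<cdot> FA F (u (Suc n)) = Zer T (FO F (X (Suc n))) (FO F (M (Suc (Suc n))))"
        unfolding J_def .
      have "J n \<cdot> z = Zer T (FO F (X (Suc n))) (FO F (M (Suc (Suc n)))) \<cdot> y"
        unfolding y(4)[symmetric] by (rule comp_reduce[OF 2]) (use J u y in auto)
      then show ?thesis using y(1-3) XO MO by simp
    qed
    \<comment> \<open>the connecting map splits since the composite from \<open>X\<^sub>0\<close> to \<open>X\<^sub>1\<close> is killed by \<open>F\<close>\<close>
    have "\<exists>s. s \<in> Arr T \<and> Dom T s = ?a \<and> Cod T s = FO F (M (Suc 0)) \<and> b 0 \<cdot> s = Ide T ?a"
    proof -
      obtain e where e: "iso_arr T e" "e \<in> Arr T" "Dom T e = FO F (Sh (Dom T (xs (Suc 0))))"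
        "Cod T e = Sh (FO F (Dom T (xs (Suc 0))))" and
        tt: "(FA F (xs (Suc 0)), FA F (u (Suc 0)), e \<cdot> FA F (v (Suc 0))) \<in> Tri T"
        using exact_endo_tri[OF F uv[of "Suc 0"]] .
      have eD: "Dom T e = ?a" and eC: "Cod T e = Sh (FO F (X 0))" using e(3,4) xs by simp_all
      have "FA F (xs (Suc 0)) = FA F (t 0) \<cdot> FA F (xs 0)" unfolding xsS using t xs by simp
      also have "\<dots> = Zer T (FO F (X 0)) (FO F (X (Suc 0)))" unfolding Ft using xs XO by simp
      finally have z: "FA F (xs (Suc 0)) = Zer T (FO F (X 0)) (FO F (X (Suc 0)))" .
      have "neg_arr T (Sm (FA F (xs (Suc 0)))) \<cdot> Ide T (Cod T e) =
          Zer T (Dom T (Ide T (Cod T e))) (Cod T (neg_arr T (Sm (FA F (xs (Suc 0))))))"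
        unfolding z eC using XO by simp
      then obtain y where y: "y \<in> Arr T" "Dom T y = Cod T e" "Cod T y = FO F (M (Suc 0))"
          "(e \<cdot> FA F (v (Suc 0))) \<cdot> y = Ide T (Cod T e)"
        using tri_lift[OF tri_rotate[OF tri_rotate[OF tt]], of "Ide T (Cod T e)"] e(2) eD v u by auto
      obtain e' where e': "e' \<in> Arr T" "Dom T e' = Cod T e" "Cod T e' = Dom T e" "e' \<cdot> e = Ide T (Dom T e)"
        using e(1) by (rule iso_arrE)
      have ey: "e \<cdot> (b 0 \<cdot> y) = Ide T (Cod T e)" using y e(2) eD v unfolding b_def by simp
      have "b 0 \<cdot> y = e'" 
      proof -
        have "b 0 \<cdot> y = (e' \<cdot> e) \<cdot> (b 0 \<cdot> y)" unfolding e'(4) using b y eD by simp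
        also have "\<dots> = e' \<cdot> (e \<cdot> (b 0 \<cdot> y))" using b y(1-3) e'(1-3) e(2) eD by simp
        also have "\<dots> = e'" unfolding ey using e' by simp
        finally show ?thesis .
      qed
      then have "b 0 \<cdot> (y \<cdot> e) = Ide T ?a"
        using comp_reduce[of "b 0" y e' e] b y(1-3) e(2) eD e'(4) by simp
      then show ?thesis using y(1-3) e(2) eD by (intro exI[of _ "y \<cdot> e"]) simp
    qed
    then obtain s0 where s0: "s0 \<in> Arr T" "Dom T s0 = ?a" "Cod T s0 = FO F (M (Suc 0))" "b 0 \<cdot> s0 = Ide T ?a"
      by blast
    define s where "s = rec_nat s0 (\<lambda>n f. J n \<cdot> f)"
    have sS: "s (Suc n) = J n \<cdot> s n" and s00: "s 0 = s0" for n unfolding s_def by simp_all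
    have s': "s n \<in> Arr T \<and> Dom T (s n) = ?a \<and> Cod T (s n) = FO F (M (Suc n))" for n
    proof (induction n)
      case 0 show ?case using s0 s00 by simp
    next
      case (Suc n) then show ?case unfolding sS using J by simp
    qed
    have s: "\<And>n. s n \<in> Arr T" "\<And>n. Dom T (s n) = ?a" "\<And>n. Cod T (s n) = FO F (M (Suc n))"
      using s' by blast+
    have bs: "b n \<cdot> s n = Ide T ?a" for n
    proof (induction n)
      case 0 show ?case using s0(4) s00 by simp
    next
      case (Suc n)
      have "b (Suc n) \<cdot> (J n \<cdot> s n) = b n \<cdot> s n"
        by (rule comp_reduce[OF bJ]) (use b J s in auto)
      then show ?case unfolding sS Suc.IH .
    qed
    have Jsb: "J n = s (Suc n) \<cdot> b n" for n
    proof -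
      \<comment> \<open>the part of \<open>F(M\<^sub>n\<^sub>+\<^sub>1)\<close> complementary to the section does not contribute\<close>
      let ?z = "sub (Ide T (FO F (M (Suc n)))) (s n \<cdot> b n)"
      have z: "?z \<in> Arr T" "Dom T ?z = FO F (M (Suc n))" "Cod T ?z = FO F (M (Suc n))"
        using MO s b by auto
      have 1: "b n \<cdot> (s n \<cdot> b n) = b n" using comp_reduce[OF bs, of n "b n"] b s by simp
      have "b n \<cdot> ?z = sub (b n) (b n \<cdot> (s n \<cdot> b n))" using MO s b by simp
      then have "b n \<cdot> ?z = Zer T (Dom T ?z) ?a" unfolding 1 z(2) using b by simp
      from kill[OF z(1) z(3) this] have 2: "J n \<cdot> ?z = Zer T (FO F (M (Suc n))) (FO F (M (Suc (Suc n))))"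
        unfolding z(2) .
      have 3: "J n \<cdot> ?z = sub (J n) (s (Suc n) \<cdot> b n)" unfolding sS using MO s b J by simp
      show ?thesis
        by (rule minus_eq_zero[OF trans[OF 3[symmetric] 2]]) (use J s b in auto)
    qed
    have Fk: "is_coproduct T (UNIV :: nat set) (\<lambda>n. FO F (M (Suc n))) (FO F A) (\<lambda>n. FA F (\<kappa> n))"
      using Fc c unfolding preserves_coproducts_def by blast
    obtain h' where Ftr: "(FA F \<phi>, FA F g, h') \<in> Tri T" using exact_endo_tri[OF F tr] by metis
    show ?thesis
    proof (rule telescope_split[OF Fk b s bs, of "FA F \<phi>" "FA F g" h'])
      fix n
      have "FA F \<phi> \<cdot> FA F (\<kappa> n) = FA F (sub (\<kappa> n) (\<kappa> (Suc n) \<cdot> p (Suc n)))"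
        by (rule additive_endo_comp[OF add \<phi>(4)]) (use \<phi>(1-3) k in auto)
      also have "\<dots> = sub (FA F (\<kappa> n)) (FA F (\<kappa> (Suc n)) \<cdot> J n)"
        unfolding J_def using k p add by simp
      finally show "FA F \<phi> \<cdot> FA F (\<kappa> n) = sub (FA F (\<kappa> n)) (FA F (\<kappa> (Suc n)) \<cdot> (s (Suc n) \<cdot> b n))"
        unfolding Jsb .
      have "FA F \<pi> \<cdot> FA F (g \<cdot> \<kappa> n) = b n"
        unfolding b_def by (rule additive_endo_comp[OF add \<pi>g]) (use \<pi>(1-3) ta \<phi>(1-3) k in auto)
      then show "FA F \<pi> \<cdot> (FA F g \<cdot> FA F (\<kappa> n)) = b n" using ta \<phi>(1-3) k by simp
    qed (use \<phi>(1-3) \<pi>(1-3) Ftr ta in auto)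
  qed
  then show ?thesis using that[of "Cod T g" \<pi>] HS \<pi>(1-3) by blast
qed

end

section \<open>Rigidly-compactly generated tensor triangulated categories\<close>

locale rigidly_compactly_generated_category =
  fixes T :: "('o, 'm) ttcat" (structure) and U :: "'u set"
  assumes univ: "universe U" and rcg: "rigidly_compactly_generated U T"

sublocale rigidly_compactly_generated_category \<subseteq> cocomplete_triangulated
proof
  have "tt_category T" using rcg unfolding rigidly_compactly_generated_def by (elim conjE)
  then show t: "is_triangulated T" unfolding tt_category_def by (elim conjE)
  show "is_category T" using t unfolding is_triangulated_def by (elim conjE)
  show "is_additive T" using t unfolding is_triangulated_def by (elim conjE)
  show "universe U" by (rule univ)
  have *: "\<forall>I x. I \<subseteq> U \<longrightarrow> small U I \<longrightarrow> (\<forall>i\<in>I. x i \<in> Ob T) \<longrightarrow> (\<exists>s \<iota>. is_coproduct T I x s \<iota>)"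
    using rcg unfolding rigidly_compactly_generated_def by (elim conjE)
  show "\<exists>s \<iota>. is_coproduct T I x s \<iota>" if "I \<subseteq> U" "small U I" "\<forall>i\<in>I. x i \<in> Ob T" for I :: "'u set" and x
    using *[rule_format, of I x] that by blast
qed

context rigidly_compactly_generated_category
begin

lemma tt_category: "tt_category T"
  using rcg unfolding rigidly_compactly_generated_def by (elim conjE)

lemma monoidal: "is_monoidal T"
  using tt_category unfolding tt_category_def by (elim conjE)

lemma symmetric: "is_symmetric T"
  using tt_category unfolding tt_category_def by (elim conjE)

lemma Unit_Ob [simp]: "Unit T \<in> Ob T"
  using monoidal unfolding is_monoidal_def by (elim conjE)

lemma tensor_Ob [simp]: "x \<in> Ob T \<Longrightarrow> y \<in> Ob T \<Longrightarrow> x \<boxtimes> y \<in> Ob T"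
  and tensor_Ide [simp]: "x \<in> Ob T \<Longrightarrow> y \<in> Ob T \<Longrightarrow> Ide T x \<boxdot> Ide T y = Ide T (x \<boxtimes> y)"
proof -
  have "\<forall>x\<in>Ob T. \<forall>y\<in>Ob T. x \<boxtimes> y \<in> Ob T \<and> Ide T x \<boxdot> Ide T y = Ide T (x \<boxtimes> y)"
    using monoidal unfolding is_monoidal_def by (elim conjE)
  then show "x \<in> Ob T \<Longrightarrow> y \<in> Ob T \<Longrightarrow> x \<boxtimes> y \<in> Ob T"
    "x \<in> Ob T \<Longrightarrow> y \<in> Ob T \<Longrightarrow> Ide T x \<boxdot> Ide T y = Ide T (x \<boxtimes> y)" by simp_all
qed

lemma tensor_arr [simp]:
  assumes "f \<in> Arr T" "g \<in> Arr T"
  shows "f \<boxdot> g \<in> Arr T" "Dom T (f \<boxdot> g) = Dom T f \<boxtimes> Dom T g" "Cod T (f \<boxdot> g) = Cod T f \<boxtimes> Cod T g"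
proof -
  have "\<forall>f\<in>Arr T. \<forall>g\<in>Arr T. f \<boxdot> g \<in> Hom T (Dom T f \<boxtimes> Dom T g) (Cod T f \<boxtimes> Cod T g)"
    using monoidal unfolding is_monoidal_def by (elim conjE)
  then show "f \<boxdot> g \<in> Arr T" "Dom T (f \<boxdot> g) = Dom T f \<boxtimes> Dom T g" "Cod T (f \<boxdot> g) = Cod T f \<boxtimes> Cod T g"
    using assms by (simp_all add: Hom_iff)
qed

lemma tensor_comp [simp]:
  assumes "f \<in> Arr T" "f' \<in> Arr T" "g \<in> Arr T" "g' \<in> Arr T" "Cod T f = Dom T f'" "Cod T g = Dom T g'"
  shows "(f' \<boxdot> g') \<cdot> (f \<boxdot> g) = (f' \<cdot> f) \<boxdot> (g' \<cdot> g)"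
proof -
  have "\<forall>f\<in>Arr T. \<forall>f'\<in>Arr T. \<forall>g\<in>Arr T. \<forall>g'\<in>Arr T.
      Cod T f = Dom T f' \<longrightarrow> Cod T g = Dom T g' \<longrightarrow>
      (f' \<cdot> f) \<boxdot> (g' \<cdot> g) = (f' \<boxdot> g') \<cdot> (f \<boxdot> g)"
    using monoidal unfolding is_monoidal_def by (elim conjE)
  then show ?thesis using assms by simp
qed

lemma Assoc_arr [simp]:
  assumes "x \<in> Ob T" "y \<in> Ob T" "z \<in> Ob T"
  shows "iso_arr T (Assoc T x y z)" "Assoc T x y z \<in> Arr T"
    "Dom T (Assoc T x y z) = (x \<boxtimes> y) \<boxtimes> z" "Cod T (Assoc T x y z) = x \<boxtimes> (y \<boxtimes> z)"
proof -
  have "\<forall>x\<in>Ob T. \<forall>y\<in>Ob T. \<forall>z\<in>Ob T. iso_arr T (Assoc T x y z) \<and>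
      Assoc T x y z \<in> Hom T ((x \<boxtimes> y) \<boxtimes> z) (x \<boxtimes> (y \<boxtimes> z))"
    using monoidal unfolding is_monoidal_def by (elim conjE)
  then show "iso_arr T (Assoc T x y z)" "Assoc T x y z \<in> Arr T"
    "Dom T (Assoc T x y z) = (x \<boxtimes> y) \<boxtimes> z" "Cod T (Assoc T x y z) = x \<boxtimes> (y \<boxtimes> z)"
    using assms by (auto simp: Hom_iff)
qed

lemma Assoc_natural:
  assumes "f \<in> Arr T" "g \<in> Arr T" "h \<in> Arr T"
  shows "Assoc T (Cod T f) (Cod T g) (Cod T h) \<cdot> ((f \<boxdot> g) \<boxdot> h) =
      (f \<boxdot> (g \<boxdot> h)) \<cdot> Assoc T (Dom T f) (Dom T g) (Dom T h)"
proof -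
  have "\<forall>f\<in>Arr T. \<forall>g\<in>Arr T. \<forall>h\<in>Arr T.
      Assoc T (Cod T f) (Cod T g) (Cod T h) \<cdot> ((f \<boxdot> g) \<boxdot> h) =
      (f \<boxdot> (g \<boxdot> h)) \<cdot> Assoc T (Dom T f) (Dom T g) (Dom T h)"
    using monoidal unfolding is_monoidal_def by (elim conjE)
  then show ?thesis using assms by simp
qed

lemma pentagon:
  assumes "w \<in> Ob T" "x \<in> Ob T" "y \<in> Ob T" "z \<in> Ob T"
  shows "Assoc T w x (y \<boxtimes> z) \<cdot> Assoc T (w \<boxtimes> x) y z =
      (Ide T w \<boxdot> Assoc T x y z) \<cdot> (Assoc T w (x \<boxtimes> y) z \<cdot> (Assoc T w x y \<boxdot> Ide T z))"
proof -
  have "\<forall>w\<in>Ob T. \<forall>x\<in>Ob T. \<forall>y\<in>Ob T. \<forall>z\<in>Ob T.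
      Assoc T w x (y \<boxtimes> z) \<cdot> Assoc T (w \<boxtimes> x) y z =
      (Ide T w \<boxdot> Assoc T x y z) \<cdot> (Assoc T w (x \<boxtimes> y) z \<cdot> (Assoc T w x y \<boxdot> Ide T z))"
    using monoidal unfolding is_monoidal_def by (elim conjE)
  then show ?thesis using assms by simp
qed

lemma unit_triangle:
  assumes "x \<in> Ob T" "y \<in> Ob T"
  shows "(Ide T x \<boxdot> LUnit T y) \<cdot> Assoc T x (Unit T) y = RUnit T x \<boxdot> Ide T y"
proof -
  have "\<forall>x\<in>Ob T. \<forall>y\<in>Ob T. (Ide T x \<boxdot> LUnit T y) \<cdot> Assoc T x (Unit T) y = RUnit T x \<boxdot> Ide T y"
    using monoidal unfolding is_monoidal_def by (elim conjE)
  then show ?thesis using assms by simp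
qed

lemma unitors [simp]:
  assumes "x \<in> Ob T"
  shows "iso_arr T (LUnit T x)" "LUnit T x \<in> Arr T" "Dom T (LUnit T x) = Unit T \<boxtimes> x" "Cod T (LUnit T x) = x"
    "iso_arr T (RUnit T x)" "RUnit T x \<in> Arr T" "Dom T (RUnit T x) = x \<boxtimes> Unit T" "Cod T (RUnit T x) = x"
proof -
  have "\<forall>x\<in>Ob T. LUnit T x \<in> Hom T (Unit T \<boxtimes> x) x \<and> iso_arr T (LUnit T x) \<and>
      RUnit T x \<in> Hom T (x \<boxtimes> Unit T) x \<and> iso_arr T (RUnit T x)"
    using monoidal unfolding is_monoidal_def by (elim conjE)
  then show "iso_arr T (LUnit T x)" "LUnit T x \<in> Arr T" "Dom T (LUnit T x) = Unit T \<boxtimes> x" "Cod T (LUnit T x) = x"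
    "iso_arr T (RUnit T x)" "RUnit T x \<in> Arr T" "Dom T (RUnit T x) = x \<boxtimes> Unit T" "Cod T (RUnit T x) = x"
    using assms by (auto simp: Hom_iff)
qed

lemma unitors_natural:
  assumes "f \<in> Arr T"
  shows "LUnit T (Cod T f) \<cdot> (Ide T (Unit T) \<boxdot> f) = f \<cdot> LUnit T (Dom T f)"
    "RUnit T (Cod T f) \<cdot> (f \<boxdot> Ide T (Unit T)) = f \<cdot> RUnit T (Dom T f)"
proof -
  have "\<forall>f\<in>Arr T.
      LUnit T (Cod T f) \<cdot> (Ide T (Unit T) \<boxdot> f) = f \<cdot> LUnit T (Dom T f) \<and>
      RUnit T (Cod T f) \<cdot> (f \<boxdot> Ide T (Unit T)) = f \<cdot> RUnit T (Dom T f)"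
    using monoidal unfolding is_monoidal_def by (elim conjE)
  then show "LUnit T (Cod T f) \<cdot> (Ide T (Unit T) \<boxdot> f) = f \<cdot> LUnit T (Dom T f)"
    "RUnit T (Cod T f) \<cdot> (f \<boxdot> Ide T (Unit T)) = f \<cdot> RUnit T (Dom T f)" using assms by simp_all
qed

lemma tensor_lr_simps [simp]:
  "FO (tensor_l T a) x = a \<boxtimes> x" "FA (tensor_l T a) f = Ide T a \<boxdot> f"
  "FO (tensor_r T a) x = x \<boxtimes> a" "FA (tensor_r T a) f = f \<boxdot> Ide T a"
  unfolding tensor_l_def tensor_r_def by simp_all

lemma tensor_exact: "a \<in> Ob T \<Longrightarrow> exact_endo T (tensor_l T a)" "a \<in> Ob T \<Longrightarrow> exact_endo T (tensor_r T a)"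
proof -
  have "\<forall>a\<in>Ob T. exact_endo T (tensor_l T a) \<and> exact_endo T (tensor_r T a)"
    using tt_category unfolding tt_category_def by (elim conjE)
  then show "a \<in> Ob T \<Longrightarrow> exact_endo T (tensor_l T a)" "a \<in> Ob T \<Longrightarrow> exact_endo T (tensor_r T a)"
    by simp_all
qed

lemmas tensor_additive = tensor_exact[THEN exact_endo_additive]

text \<open>
  Left adjoints preserve coproducts. The right adjoint is given pointwise, by couniversal arrows, because
  this is the form in which internal homs are provided; the same form is easily verified for
  the suspension, whose adjoint is only available up to isomorphism.
\<close>

lemma couniversal_preserves_coproducts:
  assumes F: "is_functor T T F" and adj: "\<And>b. b \<in> Ob T \<Longrightarrow> \<exists>h e. couniversal_arrow T T F b h e"
  shows "preserves_coproducts T F I"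
  unfolding preserves_coproducts_def
proof (intro allI impI)
  fix x s \<iota> assume c: "is_coproduct T I x s \<iota>"
  note k = coproduct_arr[OF c]
  have Fa: "FO F y \<in> Ob T" if "y \<in> Ob T" for y using F that unfolding is_functor_def by blast
  have Ff: "FA F f \<in> Arr T" "Dom T (FA F f) = FO F (Dom T f)" "Cod T (FA F f) = FO F (Cod T f)" if "f \<in> Arr T" for f
    using F that unfolding is_functor_def Hom_iff by blast+
  have Fc: "FA F (g \<cdot> f) = FA F g \<cdot> FA F f" if "f \<in> Arr T" "g \<in> Arr T" "Cod T f = Dom T g" for f g
    using F that unfolding is_functor_def by blast
  show "is_coproduct T I (\<lambda>i. FO F (x i)) (FO F s) (\<lambda>i. FA F (\<iota> i))"
    unfolding is_coproduct_def
  proof (intro conjI ballI allI impI)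
    show "FO F s \<in> Ob T" "\<And>i. i \<in> I \<Longrightarrow> FO F (x i) \<in> Ob T" "\<And>i. i \<in> I \<Longrightarrow> FA F (\<iota> i) \<in> Hom T (FO F (x i)) (FO F s)"
      using k Fa Ff by (auto simp: Hom_iff)
    fix y f assume y: "y \<in> Ob T" and f: "\<forall>i\<in>I. f i \<in> Hom T (FO F (x i)) y"
    obtain h e where "couniversal_arrow T T F y h e" using adj[OF y] by blast
    then have hO: "h \<in> Ob T" and e: "e \<in> Arr T" "Dom T e = FO F h" "Cod T e = y"
      and un: "\<And>z u. z \<in> Ob T \<Longrightarrow> u \<in> Arr T \<Longrightarrow> Dom T u = FO F z \<Longrightarrow> Cod T u = y \<Longrightarrow>
        \<exists>!g. (g \<in> Arr T \<and> Dom T g = z \<and> Cod T g = h) \<and> e \<cdot> FA F g = u"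
      unfolding universal_arrow_def op_cat_def Hom_def by (auto simp: conj_commute conj_left_commute)
    have "\<forall>i\<in>I. \<exists>g. (g \<in> Arr T \<and> Dom T g = x i \<and> Cod T g = h) \<and> e \<cdot> FA F g = f i"
      using un k f by (metis Hom_iff)
    then obtain g where g: "\<And>i. i \<in> I \<Longrightarrow> g i \<in> Arr T" "\<And>i. i \<in> I \<Longrightarrow> Dom T (g i) = x i"
        "\<And>i. i \<in> I \<Longrightarrow> Cod T (g i) = h" "\<And>i. i \<in> I \<Longrightarrow> e \<cdot> FA F (g i) = f i" by metis
    obtain m where m: "m \<in> Arr T" "Dom T m = s" "Cod T m = h" "\<And>i. i \<in> I \<Longrightarrow> m \<cdot> \<iota> i = g i"
      using coproduct_map[OF c hO g(1-3)] by blast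
    show "\<exists>!g. g \<in> Hom T (FO F s) y \<and> (\<forall>i\<in>I. g \<cdot> FA F (\<iota> i) = f i)"
    proof (rule ex1I[of _ "e \<cdot> FA F m"])
      have "(e \<cdot> FA F m) \<cdot> FA F (\<iota> i) = f i" if "i \<in> I" for i
        using g(4)[OF that] Fc[of "\<iota> i" m] m k that e Ff by simp
      then show "e \<cdot> FA F m \<in> Hom T (FO F s) y \<and> (\<forall>i\<in>I. (e \<cdot> FA F m) \<cdot> FA F (\<iota> i) = f i)"
        using e m Ff by (simp add: Hom_iff)
      fix w assume w: "w \<in> Hom T (FO F s) y \<and> (\<forall>i\<in>I. w \<cdot> FA F (\<iota> i) = f i)"
      then have w': "w \<in> Arr T" "Dom T w = FO F s" "Cod T w = y" by (auto simp: Hom_iff)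
      obtain n where n: "n \<in> Arr T" "Dom T n = s" "Cod T n = h" "e \<cdot> FA F n = w"
        using un[OF k(1) w'] by blast
      have "n \<cdot> \<iota> i = m \<cdot> \<iota> i" if "i \<in> I" for i
      proof -
        have "e \<cdot> FA F (n \<cdot> \<iota> i) = w \<cdot> FA F (\<iota> i)"
          using n(4) Fc[of "\<iota> i" n] n(1-3) k that e Ff by (simp add: comp_reduce[OF n(4)])
        also have "\<dots> = e \<cdot> FA F (m \<cdot> \<iota> i)" using w that g(4)[OF that] m(4)[OF that] by simp
        finally have eq: "e \<cdot> FA F (n \<cdot> \<iota> i) = e \<cdot> FA F (m \<cdot> \<iota> i)" .
        have fi: "f i \<in> Arr T" "Dom T (f i) = FO F (x i)" "Cod T (f i) = y"
          using f that by (auto simp: Hom_iff)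
        have fm: "e \<cdot> FA F (m \<cdot> \<iota> i) = f i" using g(4)[OF that] m(4)[OF that] by simp
        have "\<exists>!g. (g \<in> Arr T \<and> Dom T g = x i \<and> Cod T g = h) \<and> e \<cdot> FA F g = f i"
          using un[OF k(2)[OF that] fi] .
        moreover have "(n \<cdot> \<iota> i \<in> Arr T \<and> Dom T (n \<cdot> \<iota> i) = x i \<and> Cod T (n \<cdot> \<iota> i) = h) \<and>
            e \<cdot> FA F (n \<cdot> \<iota> i) = f i"
          unfolding eq fm using n(1-3) k that by simp
        moreover have "(m \<cdot> \<iota> i \<in> Arr T \<and> Dom T (m \<cdot> \<iota> i) = x i \<and> Cod T (m \<cdot> \<iota> i) = h) \<and>
            e \<cdot> FA F (m \<cdot> \<iota> i) = f i"
          unfolding fm using m(1-3) k that by simp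
        ultimately show ?thesis by blast
      qed
      then have "n = m" using coproduct_eq[OF c, of n m] n m by simp
      then show "w = e \<cdot> FA F m" using n by simp
    qed
  qed
qed

lemma tensor_preserves_coproducts:
  assumes "a \<in> Ob T"
  shows "preserves_coproducts T (tensor_l T a) I" "preserves_coproducts T (tensor_r T a) I"
proof -
  have "biclosed T" using rcg unfolding rigidly_compactly_generated_def by (elim conjE)
  then have "\<exists>h e. couniversal_arrow T T (tensor_l T a) b h e" "\<exists>h e. couniversal_arrow T T (tensor_r T a) b h e"
    if "b \<in> Ob T" for b using assms that unfolding biclosed_def by simp_all
  then show "preserves_coproducts T (tensor_l T a) I" "preserves_coproducts T (tensor_r T a) I"
    using tensor_additive[OF assms] unfolding additive_endo_def
    by (auto intro!: couniversal_preserves_coproducts)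
qed

lemma localizing_tensor:
  assumes "localizing U T S" "a \<in> Ob T"
  shows "localizing U T {x \<in> Ob T. a \<boxtimes> x \<in> S}"
  using localizing_preimage[OF tensor_exact(1) tensor_preserves_coproducts(1) assms(1)] assms(2) by simp

lemma tensor_zero [simp]:
  assumes "f \<in> Arr T" "x \<in> Ob T" "y \<in> Ob T"
  shows "f \<boxdot> Zer T x y = Zer T (Dom T f \<boxtimes> x) (Cod T f \<boxtimes> y)"
    "Zer T x y \<boxdot> f = Zer T (x \<boxtimes> Dom T f) (y \<boxtimes> Cod T f)"
proof -
  have 1: "Ide T a \<boxdot> Zer T x y = Zer T (a \<boxtimes> x) (a \<boxtimes> y)" "Zer T x y \<boxdot> Ide T a = Zer T (x \<boxtimes> a) (y \<boxtimes> a)"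
    if "a \<in> Ob T" for a
    using additive_endo_zero[OF tensor_additive(1)[OF that] assms(2,3)]
      additive_endo_zero[OF tensor_additive(2)[OF that] assms(2,3)] by simp_all
  have "f \<boxdot> Zer T x y = (f \<boxdot> Ide T y) \<cdot> (Ide T (Dom T f) \<boxdot> Zer T x y)" using assms by simp
  also have "\<dots> = Zer T (Dom T f \<boxtimes> x) (Cod T f \<boxtimes> y)" using assms 1 by (simp del: tensor_comp)
  finally show "f \<boxdot> Zer T x y = Zer T (Dom T f \<boxtimes> x) (Cod T f \<boxtimes> y)" .
  have "Zer T x y \<boxdot> f = (Ide T y \<boxdot> f) \<cdot> (Zer T x y \<boxdot> Ide T (Dom T f))" using assms by simp
  also have "\<dots> = Zer T (x \<boxtimes> Dom T f) (y \<boxtimes> Cod T f)" using assms 1 by (simp del: tensor_comp)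
  finally show "Zer T x y \<boxdot> f = Zer T (x \<boxtimes> Dom T f) (y \<boxtimes> Cod T f)" .
qed

subsection \<open>Isomorphism classes of tensor products\<close>

text \<open>
  On isomorphism classes of objects the tensor product is a commutative and associative operation. Every
  rearrangement of a tensor product is thereby an instance of rewriting, without naming the
  coherence isomorphism.
\<close>

definition iso_class :: "'o \<Rightarrow> 'o set" where
  "iso_class x = {y. isomorphic T x y}"

definition class_mult :: "'o set \<Rightarrow> 'o set \<Rightarrow> 'o set" where
  "class_mult A B = {z. \<exists>x\<in>A. \<exists>y\<in>B. x \<in> Ob T \<and> y \<in> Ob T \<and> isomorphic T z (x \<boxtimes> y)}"

lemma isomorphic_iff_class:
  "x \<in> Ob T \<Longrightarrow> y \<in> Ob T \<Longrightarrow> isomorphic T x y \<longleftrightarrow> iso_class x = iso_class y"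
  unfolding iso_class_def using isomorphic_refl isomorphic_sym isomorphic_trans by blast

lemma tensor_isomorphic_left: "isomorphic T x x' \<Longrightarrow> y \<in> Ob T \<Longrightarrow> isomorphic T (x \<boxtimes> y) (x' \<boxtimes> y)"
  using additive_endo_isomorphic[OF tensor_additive(2)] by simp

lemma tensor_isomorphic_right: "isomorphic T y y' \<Longrightarrow> x \<in> Ob T \<Longrightarrow> isomorphic T (x \<boxtimes> y) (x \<boxtimes> y')"
  using additive_endo_isomorphic[OF tensor_additive(1)] by simp

lemma tensor_isomorphic:
  assumes "isomorphic T x x'" "isomorphic T y y'"
  shows "isomorphic T (x \<boxtimes> y) (x' \<boxtimes> y')"
  using isomorphic_trans[OF tensor_isomorphic_left[OF assms(1)] tensor_isomorphic_right[OF assms(2)]]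
    isomorphic_in_Ob assms by blast

lemma tensor_comm_isomorphic: "x \<in> Ob T \<Longrightarrow> y \<in> Ob T \<Longrightarrow> isomorphic T (x \<boxtimes> y) (y \<boxtimes> x)"
proof -
  assume O: "x \<in> Ob T" "y \<in> Ob T"
  have "\<forall>x\<in>Ob T. \<forall>y\<in>Ob T. Sym T x y \<in> Hom T (x \<boxtimes> y) (y \<boxtimes> x) \<and>
      Sym T y x \<cdot> Sym T x y = Ide T (x \<boxtimes> y)"
    using symmetric unfolding is_symmetric_def by (elim conjE)
  then have *: "Sym T x y \<in> Arr T" "Dom T (Sym T x y) = x \<boxtimes> y" "Cod T (Sym T x y) = y \<boxtimes> x"
    "Sym T y x \<cdot> Sym T x y = Ide T (x \<boxtimes> y)" if "x \<in> Ob T" "y \<in> Ob T" for x y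
    using that by (simp_all add: Hom_iff)
  have "iso_arr T (Sym T x y)"
    by (rule iso_arrI[of _ "Sym T y x"]) (use *[OF O] *[OF O(2,1)] in simp_all)
  then show ?thesis using isomorphicI[of "Sym T x y"] *[OF O] by simp
qed

lemma tensor_assoc_isomorphic:
  "x \<in> Ob T \<Longrightarrow> y \<in> Ob T \<Longrightarrow> z \<in> Ob T \<Longrightarrow> isomorphic T ((x \<boxtimes> y) \<boxtimes> z) (x \<boxtimes> (y \<boxtimes> z))"
  using isomorphicI[OF Assoc_arr(1)] by simp

lemma iso_class_tensor:
  assumes "x \<in> Ob T" "y \<in> Ob T"
  shows "iso_class (x \<boxtimes> y) = class_mult (iso_class x) (iso_class y)"
proof (intro subset_antisym subsetI)
  fix z assume "z \<in> iso_class (x \<boxtimes> y)"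
  then show "z \<in> class_mult (iso_class x) (iso_class y)"
    unfolding iso_class_def class_mult_def using assms isomorphic_refl isomorphic_sym by blast
next
  fix z assume "z \<in> class_mult (iso_class x) (iso_class y)"
  then obtain x' y' where *: "isomorphic T x x'" "isomorphic T y y'" "isomorphic T z (x' \<boxtimes> y')"
    unfolding iso_class_def class_mult_def by blast
  show "z \<in> iso_class (x \<boxtimes> y)"
    unfolding iso_class_def using isomorphic_trans[OF tensor_isomorphic[OF *(1,2)] isomorphic_sym[OF *(3)]]
    by blast
qed

lemma class_mult_comm: "class_mult A B = class_mult B A"
  unfolding class_mult_def using tensor_comm_isomorphic isomorphic_trans by blast

lemma class_mult_assoc: "class_mult (class_mult A B) C = class_mult A (class_mult B C)"
proof (intro subset_antisym subsetI)
  fix z assume "z \<in> class_mult (class_mult A B) C"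
  then obtain w c a b where *: "w \<in> Ob T" "c \<in> C" "c \<in> Ob T" "isomorphic T z (w \<boxtimes> c)" "a \<in> A" "a \<in> Ob T"
    "b \<in> B" "b \<in> Ob T" "isomorphic T w (a \<boxtimes> b)" unfolding class_mult_def by blast
  have "isomorphic T z (a \<boxtimes> (b \<boxtimes> c))"
    using isomorphic_trans[OF *(4) isomorphic_trans[OF tensor_isomorphic_left[OF *(9) *(3)]
        tensor_assoc_isomorphic[OF *(6,8,3)]]] .
  then show "z \<in> class_mult A (class_mult B C)"
    unfolding class_mult_def using * isomorphic_refl[of "b \<boxtimes> c"] tensor_Ob by blast
next
  fix z assume "z \<in> class_mult A (class_mult B C)"
  then obtain w c a b where *: "w \<in> Ob T" "a \<in> A" "a \<in> Ob T" "isomorphic T z (a \<boxtimes> w)" "b \<in> B" "b \<in> Ob T"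
    "c \<in> C" "c \<in> Ob T" "isomorphic T w (b \<boxtimes> c)" unfolding class_mult_def by blast
  have "isomorphic T z ((a \<boxtimes> b) \<boxtimes> c)"
    using isomorphic_trans[OF *(4) isomorphic_trans[OF tensor_isomorphic_right[OF *(9) *(3)]
        isomorphic_sym[OF tensor_assoc_isomorphic[OF *(3,6,8)]]]] .
  then show "z \<in> class_mult (class_mult A B) C"
    unfolding class_mult_def using * isomorphic_refl[of "a \<boxtimes> b"] tensor_Ob by blast
qed

lemma class_mult_left_comm: "class_mult A (class_mult B C) = class_mult B (class_mult A C)"
  using class_mult_assoc class_mult_comm by metis

lemmas class_mult_ac = class_mult_assoc class_mult_comm class_mult_left_comm

lemma tensor_unit_isomorphic: "x \<in> Ob T \<Longrightarrow> isomorphic T (x \<boxtimes> Unit T) x"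
  "x \<in> Ob T \<Longrightarrow> isomorphic T (Unit T \<boxtimes> x) x"
  using isomorphicI[OF unitors(5), of x] isomorphicI[OF unitors(1), of x] by simp_all

lemma zero_ob_tensor: "zero_ob T x \<Longrightarrow> y \<in> Ob T \<Longrightarrow> zero_ob T (x \<boxtimes> y)"
  "zero_ob T x \<Longrightarrow> y \<in> Ob T \<Longrightarrow> zero_ob T (y \<boxtimes> x)"
  using additive_endo_zero_ob[OF tensor_additive(2)] additive_endo_zero_ob[OF tensor_additive(1)] by simp_all

lemma tensor_retract: "is_retract T x y \<Longrightarrow> z \<in> Ob T \<Longrightarrow> is_retract T (x \<boxtimes> z) (y \<boxtimes> z)"
  and tensor_retract': "is_retract T x y \<Longrightarrow> z \<in> Ob T \<Longrightarrow> is_retract T (z \<boxtimes> x) (z \<boxtimes> y)"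
proof -
  assume r: "is_retract T x y" and z: "z \<in> Ob T"
  obtain i r where ir: "i \<in> Arr T" "Dom T i = x" "Cod T i = y" "r \<in> Arr T" "Dom T r = y"
      "Cod T r = x" "r \<cdot> i = Ide T x" using r by (rule is_retractE)
  show "is_retract T (x \<boxtimes> z) (y \<boxtimes> z)"
    using is_retractI[of "i \<boxdot> Ide T z" "r \<boxdot> Ide T z"] ir z by auto
  show "is_retract T (z \<boxtimes> x) (z \<boxtimes> y)"
    using is_retractI[of "Ide T z \<boxdot> i" "Ide T z \<boxdot> r"] ir z by auto
qed

subsection \<open>Rigid objects\<close>

text \<open>
  A triangle identity is used mostly through the following consequence: the tensored evaluation
  \<open>e\<close> has a section, since it becomes invertible after composition with other arrows. In this
  form the unit and associativity constraints are absorbed into \<open>R\<close>, \<open>X\<close> and \<open>L\<close>.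
\<close>

lemma section_of_iso_comp:
  assumes eq: "R \<cdot> (e \<cdot> X) = L" and R: "iso_arr T R" and L: "iso_arr T L"
    and ar: "e \<in> Arr T" "X \<in> Arr T" "Cod T X = Dom T e" "Cod T e = Dom T R"
  obtains s where "s \<in> Arr T" "Dom T s = Cod T e" "Cod T s = Dom T e" "e \<cdot> s = Ide T (Cod T e)"
proof -
  obtain R' where R': "R \<in> Arr T" "R' \<in> Arr T" "Dom T R' = Cod T R" "Cod T R' = Dom T R"
    "R' \<cdot> R = Ide T (Dom T R)" using R by (rule iso_arrE)
  obtain L' where L': "L \<in> Arr T" "L' \<in> Arr T" "Dom T L' = Cod T L" "Cod T L' = Dom T L"
    "L \<cdot> L' = Ide T (Cod T L)" using L by (rule iso_arrE)
  have dL: "Dom T L = Dom T X" "Cod T L = Cod T R" using eq[symmetric] ar R' by simp_all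
  have "e \<cdot> X = R' \<cdot> (R \<cdot> (e \<cdot> X))" using comp_reduce[OF R'(5), of "e \<cdot> X"] ar R'(1-4) by simp
  then have eX: "e \<cdot> X = R' \<cdot> L" unfolding eq .
  have "e \<cdot> (X \<cdot> (L' \<cdot> R)) = (R' \<cdot> L) \<cdot> (L' \<cdot> R)"
    by (rule comp_reduce[OF eX]) (use ar R' L' dL in simp_all)
  also have "\<dots> = R' \<cdot> (L \<cdot> (L' \<cdot> R))" using ar R'(1-4) L'(1-4) dL by simp
  also have "L \<cdot> (L' \<cdot> R) = R" using comp_reduce[OF L'(5), of R] R'(1-4) L'(1-4) dL by simp
  also have "R' \<cdot> R = Ide T (Cod T e)" using R'(5) ar by simp
  finally show ?thesis using ar R'(1-4) L'(1-4) dL by (intro that[of "X \<cdot> (L' \<cdot> R)"]) simp_all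
qed

lemma inv_arr:
  assumes "iso_arr T f"
  shows "inv_arr T f \<in> Arr T" "Dom T (inv_arr T f) = Cod T f" "Cod T (inv_arr T f) = Dom T f"
    "inv_arr T f \<cdot> f = Ide T (Dom T f)" "f \<cdot> inv_arr T f = Ide T (Cod T f)"
proof -
  obtain g where g: "is_inverse T f g" using assms unfolding iso_arr_def by blast
  have "g' = g" if "is_inverse T f g'" for g'
  proof -
    have "g' = g' \<cdot> (f \<cdot> g)" using g that unfolding is_inverse_iff by simp
    also have "\<dots> = g" using comp_reduce[of g' f _ g] g that unfolding is_inverse_iff by simp
    finally show ?thesis .
  qed
  then have "inv_arr T f = g" unfolding inv_arr_def using g by blast
  then show "inv_arr T f \<in> Arr T" "Dom T (inv_arr T f) = Cod T f" "Cod T (inv_arr T f) = Dom T f"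
    "inv_arr T f \<cdot> f = Ide T (Dom T f)" "f \<cdot> inv_arr T f = Ide T (Cod T f)"
    using g unfolding is_inverse_iff by simp_all
qed

lemma compacts_rigid: "compacts U T = {x. rigid_ob T x}"
  using rcg unfolding rigidly_compactly_generated_def by (elim conjE)

lemma compacts_Ob [simp]: "a \<in> compacts U T \<Longrightarrow> a \<in> Ob T"
  unfolding compacts_def compact_ob_def by simp

lemma rigidE:
  assumes "a \<in> compacts U T"
  obtains d \<eta> \<epsilon> where "d \<in> Ob T" "\<eta> \<in> Arr T" "Dom T \<eta> = Unit T" "Cod T \<eta> = a \<boxtimes> d"
    "\<epsilon> \<in> Arr T" "Dom T \<epsilon> = d \<boxtimes> a" "Cod T \<epsilon> = Unit T"
    "RUnit T a \<cdot> ((Ide T a \<boxdot> \<epsilon>) \<cdot> (Assoc T a d a \<cdot> (\<eta> \<boxdot> Ide T a))) = LUnit T a"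
    "LUnit T d \<cdot> ((\<epsilon> \<boxdot> Ide T d) \<cdot> (inv_arr T (Assoc T d a d) \<cdot> (Ide T d \<boxdot> \<eta>))) = RUnit T d"
proof -
  have "rigid_ob T a" using assms compacts_rigid by blast
  then obtain d \<eta> \<epsilon> where "d \<in> Ob T" "\<eta> \<in> Hom T (Unit T) (a \<boxtimes> d)" "\<epsilon> \<in> Hom T (d \<boxtimes> a) (Unit T)"
    "RUnit T a \<cdot> ((Ide T a \<boxdot> \<epsilon>) \<cdot> (Assoc T a d a \<cdot> (\<eta> \<boxdot> Ide T a))) = LUnit T a"
    "LUnit T d \<cdot> ((\<epsilon> \<boxdot> Ide T d) \<cdot> (inv_arr T (Assoc T d a d) \<cdot> (Ide T d \<boxdot> \<eta>))) = RUnit T d"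
    unfolding rigid_ob_def by blast
  then show ?thesis by (intro that[of d \<eta> \<epsilon>]) (simp_all add: Hom_iff)
qed

lemma rigid_evaluation:
  assumes a: "a \<in> compacts U T"
  obtains d \<epsilon> s s' where "d \<in> Ob T" "\<epsilon> \<in> Arr T" "Dom T \<epsilon> = d \<boxtimes> a" "Cod T \<epsilon> = Unit T"
    "s \<in> Arr T" "Dom T s = a \<boxtimes> Unit T" "Cod T s = a \<boxtimes> (d \<boxtimes> a)" "(Ide T a \<boxdot> \<epsilon>) \<cdot> s = Ide T (a \<boxtimes> Unit T)"
    "s' \<in> Arr T" "Dom T s' = Unit T \<boxtimes> d" "Cod T s' = (d \<boxtimes> a) \<boxtimes> d" "(\<epsilon> \<boxdot> Ide T d) \<cdot> s' = Ide T (Unit T \<boxtimes> d)"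
proof -
  have aO: "a \<in> Ob T" using a by simp
  obtain d \<eta> \<epsilon> where d: "d \<in> Ob T" "\<eta> \<in> Arr T" "Dom T \<eta> = Unit T" "Cod T \<eta> = a \<boxtimes> d"
    "\<epsilon> \<in> Arr T" "Dom T \<epsilon> = d \<boxtimes> a" "Cod T \<epsilon> = Unit T" and
    1: "RUnit T a \<cdot> ((Ide T a \<boxdot> \<epsilon>) \<cdot> (Assoc T a d a \<cdot> (\<eta> \<boxdot> Ide T a))) = LUnit T a" and
    2: "LUnit T d \<cdot> ((\<epsilon> \<boxdot> Ide T d) \<cdot> (inv_arr T (Assoc T d a d) \<cdot> (Ide T d \<boxdot> \<eta>))) = RUnit T d"
    using rigidE[OF a] .
  note A = inv_arr[OF Assoc_arr(1)[OF d(1) aO d(1)]]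
  obtain s where s: "s \<in> Arr T" "Dom T s = Cod T (Ide T a \<boxdot> \<epsilon>)" "Cod T s = Dom T (Ide T a \<boxdot> \<epsilon>)"
    "(Ide T a \<boxdot> \<epsilon>) \<cdot> s = Ide T (Cod T (Ide T a \<boxdot> \<epsilon>))"
    by (rule section_of_iso_comp[OF 1]) (use aO d(1-7) in simp_all)
  obtain s' where s': "s' \<in> Arr T" "Dom T s' = Cod T (\<epsilon> \<boxdot> Ide T d)" "Cod T s' = Dom T (\<epsilon> \<boxdot> Ide T d)"
    "(\<epsilon> \<boxdot> Ide T d) \<cdot> s' = Ide T (Cod T (\<epsilon> \<boxdot> Ide T d))"
    by (rule section_of_iso_comp[OF 2]) (use aO d(1-7) A(1-3) in simp_all)
  show ?thesis by (rule that[of d \<epsilon> s s']) (use aO d(1-7) s s' in simp_all)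
qed

lemma rigid_retract:
  assumes a: "a \<in> compacts U T"
  obtains d where "d \<in> Ob T" "is_retract T a (a \<boxtimes> (d \<boxtimes> a))"
proof -
  have aO: "a \<in> Ob T" using a by simp
  obtain d \<epsilon> s s' where *: "d \<in> Ob T" "\<epsilon> \<in> Arr T" "Dom T \<epsilon> = d \<boxtimes> a" "Cod T \<epsilon> = Unit T"
    "s \<in> Arr T" "Dom T s = a \<boxtimes> Unit T" "Cod T s = a \<boxtimes> (d \<boxtimes> a)" "(Ide T a \<boxdot> \<epsilon>) \<cdot> s = Ide T (a \<boxtimes> Unit T)"
    using rigid_evaluation[OF a] by metis
  have "is_retract T (a \<boxtimes> Unit T) (a \<boxtimes> (d \<boxtimes> a))"
    using is_retractI[of s "Ide T a \<boxdot> \<epsilon>"] * aO by simp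
  then show ?thesis
    using that[OF *(1)] is_retract_trans isomorphic_is_retract[OF isomorphic_sym[OF tensor_unit_isomorphic(1)[OF aO]]]
    by blast
qed

text \<open>
  If \<open>y \<otimes> a = 0\<close> then \<open>f \<otimes> (a\<^sup>* \<otimes> a) = 0\<close>. As \<open>a \<otimes> \<epsilon>\<close> is a split epimorphism,
  naturality of the evaluation \<open>\<epsilon>\<close> gives \<open>f \<otimes> \<one> = 0\<close>.
\<close>

lemma map_from_rigid_zero:
  assumes a: "a \<in> compacts U T" and z: "zero_ob T (y \<boxtimes> a)"
    and y: "y \<in> Ob T" and f: "f \<in> Arr T" "Dom T f = a" "Cod T f = y"
  shows "f = Zer T a y"
proof -
  have aO: "a \<in> Ob T" using a by simp
  obtain d \<epsilon> s s' where d: "d \<in> Ob T" "\<epsilon> \<in> Arr T" "Dom T \<epsilon> = d \<boxtimes> a" "Cod T \<epsilon> = Unit T"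
    "s \<in> Arr T" "Dom T s = a \<boxtimes> Unit T" "Cod T s = a \<boxtimes> (d \<boxtimes> a)" "(Ide T a \<boxdot> \<epsilon>) \<cdot> s = Ide T (a \<boxtimes> Unit T)"
    using rigid_evaluation[OF a] by metis
  have "isomorphic T ((y \<boxtimes> a) \<boxtimes> d) (y \<boxtimes> (d \<boxtimes> a))"
    using aO y d(1) by (simp add: isomorphic_iff_class iso_class_tensor class_mult_ac)
  then have "zero_ob T (y \<boxtimes> (d \<boxtimes> a))" using zero_ob_isomorphic zero_ob_tensor(1)[OF z d(1)] by blast
  then have "f \<boxdot> Ide T (d \<boxtimes> a) = Zer T (a \<boxtimes> (d \<boxtimes> a)) (y \<boxtimes> (d \<boxtimes> a))"
    using to_zero[of "y \<boxtimes> (d \<boxtimes> a)" "f \<boxdot> Ide T (d \<boxtimes> a)"] f aO d(1) y by simp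
  then have 1: "(Ide T y \<boxdot> \<epsilon>) \<cdot> (f \<boxdot> Ide T (d \<boxtimes> a)) = Zer T (a \<boxtimes> (d \<boxtimes> a)) (y \<boxtimes> Unit T)"
    using f aO d(1-4) y by (simp del: tensor_comp)
  have "(Ide T y \<boxdot> \<epsilon>) \<cdot> (f \<boxdot> Ide T (d \<boxtimes> a)) = (f \<boxdot> Ide T (Unit T)) \<cdot> (Ide T a \<boxdot> \<epsilon>)"
    using f aO d(1-4) y by simp
  then have 2: "(f \<boxdot> Ide T (Unit T)) \<cdot> (Ide T a \<boxdot> \<epsilon>) = Zer T (a \<boxtimes> (d \<boxtimes> a)) (y \<boxtimes> Unit T)"
    unfolding 1 ..
  have "f \<boxdot> Ide T (Unit T) = (f \<boxdot> Ide T (Unit T)) \<cdot> ((Ide T a \<boxdot> \<epsilon>) \<cdot> s)"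
    unfolding d(8) using f aO by simp
  also have "\<dots> = Zer T (a \<boxtimes> (d \<boxtimes> a)) (y \<boxtimes> Unit T) \<cdot> s"
    by (rule comp_reduce[OF 2]) (use f aO d(1-7) in simp_all)
  also have "\<dots> = Zer T (a \<boxtimes> Unit T) (y \<boxtimes> Unit T)" using d(1-7) aO y by simp
  finally have "f \<boxdot> Ide T (Unit T) = Zer T (a \<boxtimes> Unit T) (y \<boxtimes> Unit T)" .
  then have 3: "f \<cdot> RUnit T a = Zer T (a \<boxtimes> Unit T) y"
    using unitors_natural(2)[OF f(1)] f aO y by simp
  obtain r where r: "r \<in> Arr T" "Dom T r = a" "Cod T r = a \<boxtimes> Unit T" "RUnit T a \<cdot> r = Ide T a"
    using iso_arrE[OF unitors(5)[OF aO]] aO by (metis unitors(7,8))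
  have "f = f \<cdot> (RUnit T a \<cdot> r)" unfolding r(4) using f aO by simp
  also have "\<dots> = Zer T (a \<boxtimes> Unit T) y \<cdot> r"
    by (rule comp_reduce[OF 3]) (use f aO r(1-3) in simp_all)
  also have "\<dots> = Zer T a y" using r(1-3) aO y by simp
  finally show ?thesis .
qed

text \<open>
  Rigidity turns a vanishing of arrows into a vanishing of objects. Apply the hypothesis to
  \<open>L \<otimes> \<epsilon>\<close>, whose source is \<open>L \<otimes> a\<^sup>* \<otimes> a\<close>. Tensored with \<open>a\<^sup>*\<close> it is a split epimorphism onto
  \<open>L \<otimes> a\<^sup>*\<close>, which is therefore zero; so is \<open>L \<otimes> a\<close>, a retract of \<open>L \<otimes> a \<otimes> a\<^sup>* \<otimes> a\<close>.
\<close>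

lemma tensor_rigid_zero:
  assumes a: "a \<in> compacts U T" and L: "L \<in> Ob T"
    and 0: "\<And>d f. d \<in> Ob T \<Longrightarrow> f \<in> Arr T \<Longrightarrow> Dom T f = d \<boxtimes> a \<Longrightarrow> Cod T f = L \<Longrightarrow> f = Zer T (d \<boxtimes> a) L"
  shows "zero_ob T (L \<boxtimes> a)"
proof -
  have aO: "a \<in> Ob T" using a by simp
  obtain d \<epsilon> s s' where d: "d \<in> Ob T" "\<epsilon> \<in> Arr T" "Dom T \<epsilon> = d \<boxtimes> a" "Cod T \<epsilon> = Unit T"
    and s: "s \<in> Arr T" "Dom T s = a \<boxtimes> Unit T" "Cod T s = a \<boxtimes> (d \<boxtimes> a)" "(Ide T a \<boxdot> \<epsilon>) \<cdot> s = Ide T (a \<boxtimes> Unit T)"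
    and s': "s' \<in> Arr T" "Dom T s' = Unit T \<boxtimes> d" "Cod T s' = (d \<boxtimes> a) \<boxtimes> d" "(\<epsilon> \<boxdot> Ide T d) \<cdot> s' = Ide T (Unit T \<boxtimes> d)"
    using rigid_evaluation[OF a] .
  let ?A = "Assoc T L d a"
  let ?g = "(RUnit T L \<cdot> (Ide T L \<boxdot> \<epsilon>)) \<cdot> ?A"
  have g: "?g \<in> Arr T" "Dom T ?g = (L \<boxtimes> d) \<boxtimes> a" "Cod T ?g = L" using L d aO by simp_all
  have g0: "?g = Zer T ((L \<boxtimes> d) \<boxtimes> a) L" using 0[OF _ g] L d by simp
  obtain A' where A': "A' \<in> Arr T" "Dom T A' = Cod T ?A" "Cod T A' = Dom T ?A" "?A \<cdot> A' = Ide T (Cod T ?A)"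
    using iso_arrE[OF Assoc_arr(1)[OF L d(1) aO]] by metis
  obtain R' where R': "R' \<in> Arr T" "Dom T R' = L" "Cod T R' = L \<boxtimes> Unit T" "R' \<cdot> RUnit T L = Ide T (L \<boxtimes> Unit T)"
    using iso_arrE[OF unitors(5)[OF L]] L by (metis unitors(7,8))
  have "(R' \<cdot> ?g) \<cdot> A' = R' \<cdot> (RUnit T L \<cdot> ((Ide T L \<boxdot> \<epsilon>) \<cdot> (?A \<cdot> A')))"
    using L d aO A'(1-3) R'(1-3) by simp
  also have "\<dots> = Ide T L \<boxdot> \<epsilon>"
    unfolding A'(4) using L d aO comp_reduce[OF R'(4), of "Ide T L \<boxdot> \<epsilon>"] R'(1-3) by simp
  finally have "Ide T L \<boxdot> \<epsilon> = (R' \<cdot> Zer T ((L \<boxtimes> d) \<boxtimes> a) L) \<cdot> A'" unfolding g0 ..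
  then have e0: "Ide T L \<boxdot> \<epsilon> = Zer T (L \<boxtimes> (d \<boxtimes> a)) (L \<boxtimes> Unit T)" using L d aO A'(1-3) R'(1-3) by simp
  let ?B = "Assoc T L (d \<boxtimes> a) d" and ?C = "Assoc T L (Unit T) d"
  have nat: "?C \<cdot> ((Ide T L \<boxdot> \<epsilon>) \<boxdot> Ide T d) = (Ide T L \<boxdot> (\<epsilon> \<boxdot> Ide T d)) \<cdot> ?B"
    using Assoc_natural[of "Ide T L" \<epsilon> "Ide T d"] L d by simp
  have "?C \<cdot> ((Ide T L \<boxdot> \<epsilon>) \<boxdot> Ide T d) = Zer T ((L \<boxtimes> (d \<boxtimes> a)) \<boxtimes> d) (L \<boxtimes> (Unit T \<boxtimes> d))"
    unfolding e0 using L d aO by simp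
  then have n0: "(Ide T L \<boxdot> (\<epsilon> \<boxdot> Ide T d)) \<cdot> ?B = Zer T ((L \<boxtimes> (d \<boxtimes> a)) \<boxtimes> d) (L \<boxtimes> (Unit T \<boxtimes> d))"
    unfolding nat .
  obtain B' where B': "B' \<in> Arr T" "Dom T B' = Cod T ?B" "Cod T B' = Dom T ?B" "?B \<cdot> B' = Ide T (Cod T ?B)"
    using iso_arrE[OF Assoc_arr(1)[OF L _ d(1), of "d \<boxtimes> a"]] d(1) aO by (metis tensor_Ob)
  let ?E = "Ide T L \<boxdot> (\<epsilon> \<boxdot> Ide T d)"
  have "?E = ?E \<cdot> (?B \<cdot> B')" unfolding B'(4) using L d aO by simp
  also have "\<dots> = Zer T ((L \<boxtimes> (d \<boxtimes> a)) \<boxtimes> d) (L \<boxtimes> (Unit T \<boxtimes> d)) \<cdot> B'"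
    by (rule comp_reduce[OF n0]) (use L d aO B'(1-3) in simp_all)
  also have "\<dots> = Zer T (L \<boxtimes> ((d \<boxtimes> a) \<boxtimes> d)) (L \<boxtimes> (Unit T \<boxtimes> d))" using L d aO B'(1-3) by simp
  finally have E0: "?E = Zer T (L \<boxtimes> ((d \<boxtimes> a) \<boxtimes> d)) (L \<boxtimes> (Unit T \<boxtimes> d))" .
  have "?E \<cdot> (Ide T L \<boxdot> s') = Ide T L \<boxdot> ((\<epsilon> \<boxdot> Ide T d) \<cdot> s')" using L d s' by simp
  then have "?E \<cdot> (Ide T L \<boxdot> s') = Ide T (L \<boxtimes> (Unit T \<boxtimes> d))" unfolding s'(4) using L d by simp
  then have "Ide T (L \<boxtimes> (Unit T \<boxtimes> d)) = Zer T (L \<boxtimes> (Unit T \<boxtimes> d)) (L \<boxtimes> (Unit T \<boxtimes> d))"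
    unfolding E0 using L d aO s'(1-3) by simp
  then have "zero_ob T (L \<boxtimes> (Unit T \<boxtimes> d))" using L d by (simp add: zero_ob_iff)
  then have "zero_ob T (L \<boxtimes> d)"
    using zero_ob_isomorphic tensor_isomorphic_right[OF tensor_unit_isomorphic(2)[OF d(1)] L] by blast
  then have z: "zero_ob T ((L \<boxtimes> d) \<boxtimes> (a \<boxtimes> a))" using zero_ob_tensor(1) aO by simp
  have "is_retract T (a \<boxtimes> Unit T) (a \<boxtimes> (d \<boxtimes> a))"
    using is_retractI[of s "Ide T a \<boxdot> \<epsilon>"] d s aO by simp
  then have "is_retract T (L \<boxtimes> (a \<boxtimes> Unit T)) (L \<boxtimes> (a \<boxtimes> (d \<boxtimes> a)))" using tensor_retract' L by blast
  moreover have "isomorphic T ((L \<boxtimes> d) \<boxtimes> (a \<boxtimes> a)) (L \<boxtimes> (a \<boxtimes> (d \<boxtimes> a)))"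
    using L d(1) aO by (simp add: isomorphic_iff_class iso_class_tensor class_mult_ac)
  ultimately have "zero_ob T (L \<boxtimes> (a \<boxtimes> Unit T))" using z zero_ob_isomorphic zero_ob_retract by blast
  then show ?thesis
    using zero_ob_isomorphic tensor_isomorphic_right[OF tensor_unit_isomorphic(1)[OF aO] L] by blast
qed

section \<open>Compact objects\<close>

text \<open>
  The idempotent of a coproduct \<open>s\<close>, with inclusions \<open>\<iota>\<close>, that projects onto the summands indexed by \<open>J\<close>.
  Saying that an arrow \<open>f\<close> into \<open>s\<close> has finite support by the equation \<open>e f = f\<close>, for the idempotent \<open>e\<close> of
  a finite set \<open>J\<close>, keeps sums over \<open>J\<close> out of the arguments: the equation is stable under
  composition and under additive functors.
\<close>

definition is_part :: "'i set \<Rightarrow> 'o \<Rightarrow> ('i \<Rightarrow> 'm) \<Rightarrow> 'i set \<Rightarrow> 'm \<Rightarrow> bool" where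
  "is_part I s \<iota> J e \<longleftrightarrow> e \<in> Arr T \<and> Dom T e = s \<and> Cod T e = s \<and>
    (\<forall>i\<in>I. e \<cdot> \<iota> i = (if i \<in> J then \<iota> i else Zer T (Dom T (\<iota> i)) s))"

definition finitely_supported :: "'i set \<Rightarrow> 'o \<Rightarrow> ('i \<Rightarrow> 'm) \<Rightarrow> 'm \<Rightarrow> bool" where
  "finitely_supported I s \<iota> f \<longleftrightarrow> (\<exists>J e. finite J \<and> J \<subseteq> I \<and> is_part I s \<iota> J e \<and> e \<cdot> f = f)"

lemma ex_part:
  assumes c: "is_coproduct T I x s \<iota>" obtains e where "is_part I s \<iota> J e"
proof -
  note k = coproduct_arr[OF c]
  let ?f = "\<lambda>i. if i \<in> J then \<iota> i else Zer T (Dom T (\<iota> i)) s"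
  have "\<exists>e. is_part I s \<iota> J e"
    by (rule coproduct_map[OF c k(1), of ?f]) (use k in \<open>auto simp: is_part_def\<close>)
  then show ?thesis using that by blast
qed

lemma part_arr: "is_part I s \<iota> J e \<Longrightarrow> e \<in> Arr T" "is_part I s \<iota> J e \<Longrightarrow> Dom T e = s"
  "is_part I s \<iota> J e \<Longrightarrow> Cod T e = s"
  unfolding is_part_def by auto

lemma part_comp:
  assumes "is_part I s \<iota> J e" "i \<in> I"
  shows "i \<in> J \<Longrightarrow> e \<cdot> \<iota> i = \<iota> i" "i \<notin> J \<Longrightarrow> e \<cdot> \<iota> i = Zer T (Dom T (\<iota> i)) s"
  using assms unfolding is_part_def by simp_all

lemma part_unique:
  assumes c: "is_coproduct T I x s \<iota>" and e: "is_part I s \<iota> J e" "is_part I s \<iota> J e'"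
  shows "e = e'"
proof (rule coproduct_eq[OF c])
  show "e \<cdot> \<iota> i = e' \<cdot> \<iota> i" if "i \<in> I" for i
    using that e unfolding is_part_def by simp
qed (use e[THEN part_arr(1)] e[THEN part_arr(2)] e[THEN part_arr(3)] in simp_all)

lemma part_mono:
  assumes c: "is_coproduct T I x s \<iota>" and e: "is_part I s \<iota> J e" and k: "is_part I s \<iota> K k" and "J \<subseteq> K"
  shows "k \<cdot> e = e"
proof (rule part_unique[OF c _ e])
  note ea = part_arr[OF e] note ka = part_arr[OF k] note c' = coproduct_arr[OF c]
  show "is_part I s \<iota> J (k \<cdot> e)"
    unfolding is_part_def
  proof (intro conjI ballI)
    fix i assume i: "i \<in> I"
    have "(k \<cdot> e) \<cdot> \<iota> i = k \<cdot> (e \<cdot> \<iota> i)" using ea ka c' i by simp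
    also have "\<dots> = (if i \<in> J then \<iota> i else Zer T (Dom T (\<iota> i)) s)"
    proof (cases "i \<in> J")
      case True
      then show ?thesis using part_comp(1)[OF e i] part_comp(1)[OF k i] \<open>J \<subseteq> K\<close> by auto
    next
      case False
      then show ?thesis unfolding part_comp(2)[OF e i False] using ka c' i by simp
    qed
    finally show "(k \<cdot> e) \<cdot> \<iota> i = (if i \<in> J then \<iota> i else Zer T (Dom T (\<iota> i)) s)" .
  qed (use ea ka in simp_all)
qed

lemma coproduct_projections:
  assumes c: "is_coproduct T I x s \<iota>"
  obtains \<pi> where "\<And>i. i \<in> I \<Longrightarrow> \<pi> i \<in> Arr T" "\<And>i. i \<in> I \<Longrightarrow> Dom T (\<pi> i) = s" "\<And>i. i \<in> I \<Longrightarrow> Cod T (\<pi> i) = x i"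
    "\<And>i. i \<in> I \<Longrightarrow> \<pi> i \<cdot> \<iota> i = Ide T (x i)"
    "\<And>i j. i \<in> I \<Longrightarrow> j \<in> I \<Longrightarrow> i \<noteq> j \<Longrightarrow> \<pi> i \<cdot> \<iota> j = Zer T (x j) (x i)"
proof -
  note k = coproduct_arr[OF c]
  have "\<forall>i\<in>I. \<exists>p. p \<in> Arr T \<and> Dom T p = s \<and> Cod T p = x i \<and>
      (\<forall>j\<in>I. p \<cdot> \<iota> j = (if i = j then Ide T (x i) else Zer T (x j) (x i)))"
  proof
    fix i assume i: "i \<in> I"
    let ?f = "\<lambda>j. if i = j then Ide T (x i) else Zer T (x j) (x i)"
    show "\<exists>p. p \<in> Arr T \<and> Dom T p = s \<and> Cod T p = x i \<and> (\<forall>j\<in>I. p \<cdot> \<iota> j = ?f j)"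
      by (rule coproduct_map[OF c k(2)[OF i], of ?f]) (use k i in auto)
  qed
  then obtain \<pi> where "\<forall>i\<in>I. \<pi> i \<in> Arr T \<and> Dom T (\<pi> i) = s \<and> Cod T (\<pi> i) = x i \<and>
      (\<forall>j\<in>I. \<pi> i \<cdot> \<iota> j = (if i = j then Ide T (x i) else Zer T (x j) (x i)))" by metis
  then show ?thesis by (intro that[of \<pi>]) auto
qed

lemma part_insert:
  assumes c: "is_coproduct T I x s \<iota>" and e: "is_part I s \<iota> J e" and k: "k \<in> I" "k \<notin> J"
    and p: "p \<in> Arr T" "Dom T p = s" "Cod T p = x k" "p \<cdot> \<iota> k = Ide T (x k)"
      "\<And>j. j \<in> I \<Longrightarrow> k \<noteq> j \<Longrightarrow> p \<cdot> \<iota> j = Zer T (x j) (x k)"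
  shows "is_part I s \<iota> (insert k J) (Plus T e (\<iota> k \<cdot> p))"
  unfolding is_part_def
proof (intro conjI ballI)
  note ea = part_arr[OF e] note c' = coproduct_arr[OF c]
  fix i assume i: "i \<in> I"
  have "Plus T e (\<iota> k \<cdot> p) \<cdot> \<iota> i = Plus T (e \<cdot> \<iota> i) (\<iota> k \<cdot> (p \<cdot> \<iota> i))"
    using ea c' i k p(1-3) by simp
  also have "\<dots> = (if i \<in> insert k J then \<iota> i else Zer T (Dom T (\<iota> i)) s)"
  proof (cases "i = k")
    case True
    then show ?thesis using part_comp(2)[OF e i] k p(4) c' by simp
  next
    case False
    then have "p \<cdot> \<iota> i = Zer T (x i) (x k)" using p(5) i by simp
    then show ?thesis using False c' i k part_comp[OF e i] by simp
  qed
  finally show "Plus T e (\<iota> k \<cdot> p) \<cdot> \<iota> i = (if i \<in> insert k J then \<iota> i else Zer T (Dom T (\<iota> i)) s)" .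
qed (use part_arr[OF e] coproduct_arr[OF c] k p(1-3) in simp_all)

lemma part_empty: "is_part I s \<iota> {} e \<Longrightarrow> is_coproduct T I x s \<iota> \<Longrightarrow> e = Zer T s s"
proof -
  assume e: "is_part I s \<iota> {} e" and c: "is_coproduct T I x s \<iota>"
  have "is_part I s \<iota> {} (Zer T s s)" unfolding is_part_def using coproduct_arr[OF c] by simp
  then show ?thesis using part_unique[OF c e] by blast
qed

lemma comp_finprod:
  assumes "finite J" "e \<in> Arr T" "c \<in> Ob T" "\<And>i. i \<in> J \<Longrightarrow> h i \<in> Hom T c (Dom T e)"
  shows "e \<cdot> finprod (hom_group T c (Dom T e)) h J = finprod (hom_group T c (Cod T e)) (\<lambda>i. e \<cdot> h i) J \<and>
    finprod (hom_group T c (Dom T e)) h J \<in> Hom T c (Dom T e)"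
  using assms(1,4)
proof (induction J)
  case empty
  interpret A: comm_group "hom_group T c (Dom T e)" using hom_group assms by simp
  interpret B: comm_group "hom_group T c (Cod T e)" using hom_group assms by simp
  show ?case using assms(2,3) A.finprod_empty[of h] B.finprod_empty[of "\<lambda>i. e \<cdot> h i"] by (simp add: Hom_iff)
next
  case (insert j J)
  interpret A: comm_group "hom_group T c (Dom T e)" using hom_group assms by simp
  interpret B: comm_group "hom_group T c (Cod T e)" using hom_group assms by simp
  have j: "h j \<in> Hom T c (Dom T e)" and J: "h \<in> J \<rightarrow> Hom T c (Dom T e)" using insert.prems by auto
  have IH: "e \<cdot> finprod (hom_group T c (Dom T e)) h J = finprod (hom_group T c (Cod T e)) (\<lambda>i. e \<cdot> h i) J"
    "finprod (hom_group T c (Dom T e)) h J \<in> Hom T c (Dom T e)" using insert by auto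
  have eh: "e \<cdot> h i \<in> Hom T c (Cod T e)" if "i \<in> insert j J" for i
    using insert.prems[OF that] assms by (simp add: Hom_iff)
  have 1: "finprod (hom_group T c (Dom T e)) h (insert j J) = Plus T (h j) (finprod (hom_group T c (Dom T e)) h J)"
    using A.finprod_insert[OF insert.hyps, of h] j J by simp
  have 2: "finprod (hom_group T c (Cod T e)) (\<lambda>i. e \<cdot> h i) (insert j J) =
      Plus T (e \<cdot> h j) (finprod (hom_group T c (Cod T e)) (\<lambda>i. e \<cdot> h i) J)"
    using B.finprod_insert[OF insert.hyps, of "\<lambda>i. e \<cdot> h i"] eh by simp
  have 3: "e \<cdot> Plus T (h j) (finprod (hom_group T c (Dom T e)) h J) =
      Plus T (e \<cdot> h j) (e \<cdot> finprod (hom_group T c (Dom T e)) h J)"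
    using j IH(2) assms(2) by (intro comp_plus) (simp_all add: Hom_iff)
  show ?case unfolding 1 2 3 IH(1)[symmetric] using j IH(2) by (simp add: Hom_iff)
qed

text \<open>
  The idempotent of a finite set is the sum of the idempotents \<open>\<iota>\<^sub>i p\<^sub>i\<close> of its members.
\<close>

lemma part_finprod:
  assumes c: "is_coproduct T I x s \<iota>" and f: "f \<in> Arr T" "Cod T f = s"
    and p: "\<And>i. i \<in> I \<Longrightarrow> p i \<in> Arr T" "\<And>i. i \<in> I \<Longrightarrow> Dom T (p i) = s" "\<And>i. i \<in> I \<Longrightarrow> Cod T (p i) = x i"
    "\<And>i. i \<in> I \<Longrightarrow> p i \<cdot> \<iota> i = Ide T (x i)"
    "\<And>i j. i \<in> I \<Longrightarrow> j \<in> I \<Longrightarrow> i \<noteq> j \<Longrightarrow> p i \<cdot> \<iota> j = Zer T (x j) (x i)"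
    and J: "finite J" "J \<subseteq> I"
  shows "\<exists>e. is_part I s \<iota> J e \<and> e \<cdot> f = finprod (hom_group T (Dom T f) s) (\<lambda>i. \<iota> i \<cdot> (p i \<cdot> f)) J"
  using J
proof (induction J)
  case empty
  obtain e where e: "is_part I s \<iota> {} e" using ex_part[OF c] .
  note c' = coproduct_arr[OF c]
  interpret A: comm_group "hom_group T (Dom T f) s" using hom_group f c' by simp
  show ?case
    by (rule exI[of _ e]) (use e part_empty[OF e c] f c' A.finprod_empty[of "\<lambda>i. \<iota> i \<cdot> (p i \<cdot> f)"] in simp)
next
  case (insert j J)
  note c' = coproduct_arr[OF c]
  interpret A: comm_group "hom_group T (Dom T f) s" using hom_group f c' by simp
  obtain e where e: "is_part I s \<iota> J e" "e \<cdot> f = finprod (hom_group T (Dom T f) s) (\<lambda>i. \<iota> i \<cdot> (p i \<cdot> f)) J"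
    using insert by auto
  have h: "\<iota> i \<cdot> (p i \<cdot> f) \<in> Hom T (Dom T f) s" if "i \<in> I" for i
    using that p(1-3) c' f by (simp add: Hom_iff)
  have J: "(\<lambda>i. \<iota> i \<cdot> (p i \<cdot> f)) \<in> J \<rightarrow> Hom T (Dom T f) s" "\<iota> j \<cdot> (p j \<cdot> f) \<in> Hom T (Dom T f) s" "j \<in> I"
    using h insert.prems by auto
  have "finprod (hom_group T (Dom T f) s) (\<lambda>i. \<iota> i \<cdot> (p i \<cdot> f)) (insert j J) = Plus T (\<iota> j \<cdot> (p j \<cdot> f)) (e \<cdot> f)"
    unfolding e(2) using A.finprod_insert[OF insert.hyps, of "\<lambda>i. \<iota> i \<cdot> (p i \<cdot> f)"] J by simp
  also have "\<dots> = Plus T (e \<cdot> f) (\<iota> j \<cdot> (p j \<cdot> f))"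
    by (rule plus_comm) (use J(2,3) part_arr[OF e(1)] f in \<open>simp_all add: Hom_iff\<close>)
  also have "\<dots> = Plus T e (\<iota> j \<cdot> p j) \<cdot> f" using part_arr[OF e(1)] f c' p(1-3) J(3) by simp
  finally show ?case using part_insert[OF c e(1) J(3) insert.hyps(2) p(1-3)[OF J(3)] p(4)[OF J(3)] p(5)[OF J(3)]]
    by (intro exI[of _ "Plus T e (\<iota> j \<cdot> p j)"]) auto
qed

text \<open>
  Surjectivity of the canonical map is the existence of finite supports; its injectivity holds for every
  object, by composing with the projections of the coproduct.
\<close>

lemma compact_iff:
  "c \<in> compacts U T \<longleftrightarrow> c \<in> Ob T \<and> (\<forall>I x s \<iota>. I \<subseteq> U \<longrightarrow> small U I \<longrightarrow> is_coproduct T I x s \<iota> \<longrightarrow>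
    (\<forall>f. f \<in> Arr T \<longrightarrow> Dom T f = c \<longrightarrow> Cod T f = s \<longrightarrow> finitely_supported I s \<iota> f))"
proof -
  have main: "bij_betw
        (\<lambda>f. finprod (hom_group T c s) (\<lambda>i. \<iota> i \<cdot> f i) {i \<in> I. f i \<noteq> Zer T c (x i)})
        {f \<in> (\<Pi>\<^sub>E i\<in>I. Hom T c (x i)). finite {i \<in> I. f i \<noteq> Zer T c (x i)}}
        (Hom T c s) \<longleftrightarrow> (\<forall>f. f \<in> Arr T \<longrightarrow> Dom T f = c \<longrightarrow> Cod T f = s \<longrightarrow> finitely_supported I s \<iota> f)"
    (is "bij_betw ?V ?P ?H \<longleftrightarrow> ?F")
    if c: "is_coproduct T I x s \<iota>" and cO: "c \<in> Ob T" for I :: "'u set" and x s \<iota>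
  proof
    note k = coproduct_arr[OF c]
    interpret G: comm_group "hom_group T c s" using hom_group cO k(1) .
    assume b: "bij_betw ?V ?P ?H"
    show ?F
    proof (intro allI impI)
      fix f assume f: "f \<in> Arr T" "Dom T f = c" "Cod T f = s"
      then have "f \<in> ?H" by (simp add: Hom_iff)
      then have "f \<in> ?V ` ?P" using bij_betw_imp_surj_on[OF b] by (simp only:)
      then obtain a where a: "a \<in> ?P" "f = ?V a" by (rule imageE)
      let ?J = "{i \<in> I. a i \<noteq> Zer T c (x i)}"
      obtain e where e: "is_part I s \<iota> ?J e" using ex_part[OF c] .
      note ea = part_arr[OF e]
      have fin: "finite ?J" using a(1) by (simp only: mem_Collect_eq)
      have ai: "a i \<in> Arr T" "Dom T (a i) = c" "Cod T (a i) = x i" if "i \<in> I" for i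
        using a(1) that by (auto simp: Hom_iff dest: PiE_mem)
      have h: "\<iota> i \<cdot> a i \<in> Hom T c s" if "i \<in> ?J" for i using that ai k by (simp add: Hom_iff)
      have "e \<cdot> f = finprod (hom_group T c s) (\<lambda>i. e \<cdot> (\<iota> i \<cdot> a i)) ?J"
        unfolding a(2) using comp_finprod[OF fin ea(1) cO, of "\<lambda>i. \<iota> i \<cdot> a i"] h ea by simp
      also have "\<dots> = finprod (hom_group T c s) (\<lambda>i. \<iota> i \<cdot> a i) ?J"
      proof (rule G.finprod_cong')
        fix i assume i: "i \<in> ?J"
        then have "e \<cdot> \<iota> i = \<iota> i" using part_comp(1)[OF e] by blast
        then show "e \<cdot> (\<iota> i \<cdot> a i) = \<iota> i \<cdot> a i"
          using comp_reduce[of e "\<iota> i" "\<iota> i" "a i"] i ea k ai by simp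
      qed (use h in auto)
      also have "\<dots> = f" using a(2) by (rule sym)
      finally have "e \<cdot> f = f" .
      then show "finitely_supported I s \<iota> f" unfolding finitely_supported_def using e fin by blast
    qed
  next
    note k = coproduct_arr[OF c]
    interpret G: comm_group "hom_group T c s" using hom_group cO k(1) .
    assume F: ?F
    obtain p where p: "\<And>i. i \<in> I \<Longrightarrow> p i \<in> Arr T" "\<And>i. i \<in> I \<Longrightarrow> Dom T (p i) = s" "\<And>i. i \<in> I \<Longrightarrow> Cod T (p i) = x i"
      "\<And>i. i \<in> I \<Longrightarrow> p i \<cdot> \<iota> i = Ide T (x i)"
      "\<And>i j. i \<in> I \<Longrightarrow> j \<in> I \<Longrightarrow> i \<noteq> j \<Longrightarrow> p i \<cdot> \<iota> j = Zer T (x j) (x i)"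
      by (rule coproduct_projections[OF c], rule that; blast)
    have am: "a i \<in> Arr T" "Dom T (a i) = c" "Cod T (a i) = x i" if "a \<in> ?P" "i \<in> I" for a i
      using that by (auto simp: Hom_iff dest: PiE_mem)
    have VH: "?V a \<in> ?H" if a: "a \<in> ?P" for a
      using G.finprod_closed[of "\<lambda>i. \<iota> i \<cdot> a i"] am[OF a] k by (simp add: Hom_iff Pi_def)
    have pV: "p j \<cdot> ?V a = a j" if a: "a \<in> ?P" and j: "j \<in> I" for a j
    proof -
      let ?J = "{i \<in> I. a i \<noteq> Zer T c (x i)}"
      have fin: "finite ?J" using a by (simp only: mem_Collect_eq)
      interpret B: comm_group "hom_group T c (x j)" using hom_group cO k(2)[OF j] .
      have h: "\<iota> i \<cdot> a i \<in> Hom T c s" if "i \<in> ?J" for i using that am[OF a] k by (simp add: Hom_iff)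
      have "p j \<cdot> ?V a = finprod (hom_group T c (x j)) (\<lambda>i. p j \<cdot> (\<iota> i \<cdot> a i)) ?J"
        using comp_finprod[OF fin p(1)[OF j] cO, of "\<lambda>i. \<iota> i \<cdot> a i"] h p(2,3)[OF j] by simp
      also have "\<dots> = finprod (hom_group T c (x j)) (\<lambda>i. if j = i then a i else \<one>\<^bsub>hom_group T c (x j)\<^esub>) ?J"
      proof (rule B.finprod_cong')
        fix i assume i: "i \<in> ?J"
        show "p j \<cdot> (\<iota> i \<cdot> a i) = (if j = i then a i else \<one>\<^bsub>hom_group T c (x j)\<^esub>)"
        proof (cases "j = i")
          case True
          have "p j \<cdot> (\<iota> j \<cdot> a j) = Ide T (x j) \<cdot> a j"
            by (rule comp_reduce[OF p(4)[OF j]]) (use p(1-3)[OF j] k am[OF a] j in simp_all)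
          then show ?thesis using True am[OF a j] by simp
        next
          case False
          have iI: "i \<in> I" using i by blast
          have "p j \<cdot> (\<iota> i \<cdot> a i) = Zer T (x i) (x j) \<cdot> a i"
            by (rule comp_reduce[OF p(5)[OF j iI False]]) (use p(1-3)[OF j] k am[OF a] iI in simp_all)
          then show ?thesis using False am[OF a iI] k(2)[OF j] k(2)[OF iI] by simp
        qed
      next
        show "(\<lambda>i. if j = i then a i else \<one>\<^bsub>hom_group T c (x j)\<^esub>) \<in> ?J \<rightarrow> carrier (hom_group T c (x j))"
          using am[OF a] k(2)[OF j] cO by (auto simp: Hom_iff)
      qed simp
      also have "\<dots> = a j"
      proof (cases "j \<in> ?J")
        case True
        let ?a = "\<lambda>i. if j = i then a i else Zer T c (x j)"
        have "finprod (hom_group T c (x j)) (\<lambda>i. if j = i then ?a i else \<one>\<^bsub>hom_group T c (x j)\<^esub>) ?J = ?a j"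
          by (rule B.finprod_singleton[OF True fin]) (use am[OF a j] k(2)[OF j] cO in \<open>auto simp: Hom_iff\<close>)
        moreover have "(\<lambda>i. if j = i then ?a i else \<one>\<^bsub>hom_group T c (x j)\<^esub>) =
          (\<lambda>i. if j = i then a i else \<one>\<^bsub>hom_group T c (x j)\<^esub>)" by auto
        ultimately show ?thesis by simp
      next
        case False
        then have "a j = Zer T c (x j)" using j by blast
        moreover have "finprod (hom_group T c (x j)) (\<lambda>i. if j = i then a i else \<one>\<^bsub>hom_group T c (x j)\<^esub>) ?J
            = \<one>\<^bsub>hom_group T c (x j)\<^esub>"
          by (rule B.finprod_one_eqI) (use False in auto)
        ultimately show ?thesis by simp
      qed
      finally show ?thesis .
    qed
    show "bij_betw ?V ?P ?H"
      unfolding bij_betw_def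
    proof (intro conjI)
      show "inj_on ?V ?P"
      proof (rule inj_onI)
        fix a b assume ab: "a \<in> ?P" "b \<in> ?P" "?V a = ?V b"
        have "a i = b i" if "i \<in> I" for i using pV[OF ab(1) that] pV[OF ab(2) that] ab(3) by simp
        then show "a = b" using ab(1,2) by (intro PiE_ext[of a I "\<lambda>i. Hom T c (x i)" b]) blast+
      qed
      show "?V ` ?P = ?H"
      proof (intro subset_antisym subsetI)
        show "f \<in> ?H" if "f \<in> ?V ` ?P" for f using that VH by blast
        fix f assume "f \<in> ?H"
        then have f: "f \<in> Arr T" "Dom T f = c" "Cod T f = s" by (auto simp: Hom_iff)
        then obtain J e where J: "finite J" "J \<subseteq> I" "is_part I s \<iota> J e" "e \<cdot> f = f"
          using F unfolding finitely_supported_def by blast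
        obtain e' where "is_part I s \<iota> J e'" and
          e': "e' \<cdot> f = finprod (hom_group T (Dom T f) s) (\<lambda>i. \<iota> i \<cdot> (p i \<cdot> f)) J"
          using part_finprod[OF c f(1,3) p J(1,2)] by blast
        then have "e' = e" using part_unique[OF c _ J(3)] by blast
        then have fJ: "f = finprod (hom_group T c s) (\<lambda>i. \<iota> i \<cdot> (p i \<cdot> f)) J" using e' J(4) f(2) by simp
        define a where "a = (\<lambda>i\<in>I. if i \<in> J then p i \<cdot> f else Zer T c (x i))"
        have aI: "a i = (if i \<in> J then p i \<cdot> f else Zer T c (x i))" if "i \<in> I" for i
          unfolding a_def using that by simp
        have sub: "{i \<in> I. a i \<noteq> Zer T c (x i)} \<subseteq> J" using aI by (auto split: if_splits)
        have ah: "a i \<in> Hom T c (x i)" if "i \<in> I" for i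
          using aI[OF that] p(1-3)[OF that] f cO k(2)[OF that] by (auto simp: Hom_iff)
        have aP: "a \<in> ?P"
          using ah finite_subset[OF sub J(1)] unfolding a_def by (auto simp: PiE_def Pi_def)
        have "?V a = finprod (hom_group T c s) (\<lambda>i. \<iota> i \<cdot> (p i \<cdot> f)) J"
        proof (rule G.finprod_mono_neutral_cong_left[OF J(1) sub])
          fix i assume "i \<in> J - {i \<in> I. a i \<noteq> Zer T c (x i)}"
          then have i: "i \<in> J" "i \<in> I" "a i = Zer T c (x i)" using J(2) by auto
          then have "p i \<cdot> f = Zer T c (x i)" using aI[OF i(2)] by simp
          then show "\<iota> i \<cdot> (p i \<cdot> f) = \<one>\<^bsub>hom_group T c s\<^esub>" using k i(2) cO by simp
        next
          show "(\<lambda>i. \<iota> i \<cdot> (p i \<cdot> f)) \<in> J \<rightarrow> carrier (hom_group T c s)"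
            using p(1-3) f k J(2) by (auto simp: Hom_iff)
        next
          fix i assume "i \<in> {i \<in> I. a i \<noteq> Zer T c (x i)}"
          then have "i \<in> I" "i \<in> J" using sub by auto
          then show "\<iota> i \<cdot> a i = \<iota> i \<cdot> (p i \<cdot> f)" using aI by simp
        qed
        then show "f \<in> ?V ` ?P" using fJ aP by (intro image_eqI[of _ _ a]) simp_all
      qed
    qed
  qed
  show ?thesis unfolding compacts_def mem_Collect_eq compact_ob_def by (simp only: main cong: conj_cong imp_cong)
qed

lemma compactI:
  assumes "c \<in> Ob T"
    "\<And>(I :: 'u set) x s \<iota> f. is_coproduct T I x s \<iota> \<Longrightarrow> small U I \<Longrightarrow> I \<subseteq> U \<Longrightarrow>
      f \<in> Arr T \<Longrightarrow> Dom T f = c \<Longrightarrow> Cod T f = s \<Longrightarrow> finitely_supported I s \<iota> f"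
  shows "c \<in> compacts U T"
  using assms compact_iff by blast

lemma compactD:
  assumes "c \<in> compacts U T" "I \<subseteq> U" "small U I" "is_coproduct T I x s \<iota>"
    "f \<in> Arr T" "Dom T f = c" "Cod T f = s"
  obtains J e where "finite J" "J \<subseteq> I" "is_part I s \<iota> J e" "e \<cdot> f = f"
proof -
  have "finitely_supported I s \<iota> f" using assms compact_iff by blast
  then show ?thesis using that unfolding finitely_supported_def by blast
qed

text \<open>
  Used for coproducts \<open>s\<close> and \<open>s'\<close> of termwise isomorphic families, where \<open>m\<close> and \<open>n\<close> are the
  induced maps.
\<close>

lemma part_transport:
  assumes e: "is_part I s \<iota> J e" and m: "m \<in> Arr T" "Dom T m = s" "Cod T m = s'"
    and n: "n \<in> Arr T" "Dom T n = s'" "Cod T n = s"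
    and \<iota>: "\<And>i. i \<in> I \<Longrightarrow> \<iota> i \<in> Arr T" "\<And>i. i \<in> I \<Longrightarrow> Cod T (\<iota> i) = s"
    and r: "\<And>i. i \<in> I \<Longrightarrow> r i \<in> Arr T" "\<And>i. i \<in> I \<Longrightarrow> Cod T (r i) = Dom T (\<iota> i)"
    and n\<iota>: "\<And>i. i \<in> I \<Longrightarrow> \<iota>' i \<in> Arr T" "\<And>i. i \<in> I \<Longrightarrow> Cod T (\<iota>' i) = s'" "\<And>i. i \<in> I \<Longrightarrow> n \<cdot> \<iota>' i = \<iota> i \<cdot> r i"
    and mn: "m \<cdot> n = Ide T s'"
  shows "is_part I s' \<iota>' J (m \<cdot> (e \<cdot> n))"
  unfolding is_part_def
proof (intro conjI ballI)
  note ea = part_arr[OF e]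
  fix i assume i: "i \<in> I"
  have dr: "Dom T (r i) = Dom T (\<iota>' i)" using arg_cong[OF n\<iota>(3)[OF i], of "Dom T"] n n\<iota>(1,2)[OF i] r[OF i] \<iota>[OF i] by simp
  have 1: "(m \<cdot> (e \<cdot> n)) \<cdot> \<iota>' i = m \<cdot> (e \<cdot> (n \<cdot> \<iota>' i))" using m n ea n\<iota>(1,2)[OF i] by simp
  show "(m \<cdot> (e \<cdot> n)) \<cdot> \<iota>' i = (if i \<in> J then \<iota>' i else Zer T (Dom T (\<iota>' i)) s')"
  proof (cases "i \<in> J")
    case True
    have "e \<cdot> (\<iota> i \<cdot> r i) = \<iota> i \<cdot> r i"
      by (rule comp_reduce[OF part_comp(1)[OF e i True]]) (use ea \<iota>[OF i] r[OF i] in simp_all)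
    then have "(m \<cdot> (e \<cdot> n)) \<cdot> \<iota>' i = m \<cdot> (n \<cdot> \<iota>' i)" unfolding 1 n\<iota>(3)[OF i] by simp
    also have "\<dots> = \<iota>' i" using comp_reduce[OF mn, of "\<iota>' i"] m n n\<iota>(1,2)[OF i] by simp
    finally show ?thesis using True by simp
  next
    case False
    have "e \<cdot> (\<iota> i \<cdot> r i) = Zer T (Dom T (\<iota> i)) s \<cdot> r i"
      by (rule comp_reduce[OF part_comp(2)[OF e i False]]) (use ea \<iota>[OF i] r[OF i] in simp_all)
    also have "\<dots> = Zer T (Dom T (\<iota>' i)) s" using r[OF i] \<iota>[OF i] dr m n by auto
    finally have "e \<cdot> (\<iota> i \<cdot> r i) = Zer T (Dom T (\<iota>' i)) s" .
    then show ?thesis unfolding 1 n\<iota>(3)[OF i] using False m n n\<iota>(1)[OF i] by auto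
  qed
qed (use m n part_arr[OF e] in simp_all)

lemma part_image:
  assumes F: "additive_endo T F" and c: "is_coproduct T I x s \<iota>" and e: "is_part I s \<iota> J e"
  shows "is_part I (FO F s) (\<lambda>i. FA F (\<iota> i)) J (FA F e)"
  unfolding is_part_def
proof (intro conjI ballI)
  note ea = part_arr[OF e] note k = coproduct_arr[OF c]
  fix i assume i: "i \<in> I"
  have "FA F e \<cdot> FA F (\<iota> i) = FA F (if i \<in> J then \<iota> i else Zer T (Dom T (\<iota> i)) s)"
    by (rule additive_endo_comp[OF F]) (use e i ea k in \<open>auto simp: is_part_def\<close>)
  then show "FA F e \<cdot> FA F (\<iota> i) = (if i \<in> J then FA F (\<iota> i) else Zer T (Dom T (FA F (\<iota> i))) (FO F s))"
    using F k i by simp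
qed (use F part_arr[OF e] in simp_all)

text \<open>
  An isomorphism from the suspension of \<open>w\<close> to \<open>b\<close> is a couniversal arrow because the suspension is
  fully faithful.
\<close>

lemma Shift_preserves_coproducts: "preserves_coproducts T (Shift T) I"
proof (rule couniversal_preserves_coproducts)
  show "is_functor T T (Shift T)" using Shift_additive unfolding additive_endo_def by blast
  fix b assume b: "b \<in> Ob T"
  obtain w where w: "w \<in> Ob T" "isomorphic T (Sh w) b" using desuspension[OF b] .
  obtain e where e: "iso_arr T e" "e \<in> Arr T" "Dom T e = Sh w" "Cod T e = b" using w(2) by (rule isomorphicE)
  obtain e' where e': "e' \<in> Arr T" "Dom T e' = b" "Cod T e' = Sh w" "e' \<cdot> e = Ide T (Sh w)" "e \<cdot> e' = Ide T b"
    using iso_arrE[OF e(1)] e(3,4) by metis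
  have "\<exists>!g. (g \<in> Arr T \<and> Dom T g = y \<and> Cod T g = w) \<and> e \<cdot> Sm g = f"
    if y: "y \<in> Ob T" and f: "f \<in> Arr T" "Dom T f = Sh y" "Cod T f = b" for y f
  proof -
    have "e' \<cdot> f \<in> Arr T" "Dom T (e' \<cdot> f) = Sh y" "Cod T (e' \<cdot> f) = Sh w" using e' f by simp_all
    then obtain g where g: "g \<in> Arr T" "Dom T g = y" "Cod T g = w" "e' \<cdot> f = Sm g"
      using Shift_full[OF y w(1)] by metis
    have "e \<cdot> Sm g = f" unfolding g(4)[symmetric] using comp_reduce[OF e'(5), of f] e e' f by simp
    moreover have "h = g" if h: "(h \<in> Arr T \<and> Dom T h = y \<and> Cod T h = w) \<and> e \<cdot> Sm h = f" for h
    proof (rule Shift_faithful)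
      have hh: "h \<in> Arr T" "Dom T h = y" "Cod T h = w" "e \<cdot> Sm h = f" using h by auto
      have "Sm h = e' \<cdot> (e \<cdot> Sm h)" using comp_reduce[OF e'(4), of "Sm h"] e(2-4) e'(1-3) hh(1-3) by simp
      then show "Sm h = Sm g" unfolding hh(4) g(4) .
    qed (use h g in simp_all)
    ultimately show ?thesis using g by blast
  qed
  then have "couniversal_arrow T T (Shift T) b w e"
    unfolding universal_arrow_def op_cat_def Hom_def using b w(1) e
    by (simp add: conj_commute conj_left_commute)
  then show "\<exists>h e. couniversal_arrow T T (Shift T) b h e" by blast
qed

lemma compact_retract:
  assumes c: "c \<in> compacts U T" and r: "is_retract T c' c"
  shows "c' \<in> compacts U T"
proof -
  obtain i r where ir: "i \<in> Arr T" "Dom T i = c'" "Cod T i = c" "r \<in> Arr T" "Dom T r = c"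
      "Cod T r = c'" "r \<cdot> i = Ide T c'" using r by (rule is_retractE)
  show ?thesis
  proof (rule compactI)
    show "c' \<in> Ob T" using ir by auto
    fix I :: "'u set" and x s \<iota> f
    assume cp: "is_coproduct T I x s \<iota>" and I: "small U I" "I \<subseteq> U" and f: "f \<in> Arr T" "Dom T f = c'" "Cod T f = s"
    obtain J e where J: "finite J" "J \<subseteq> I" "is_part I s \<iota> J e" "e \<cdot> (f \<cdot> r) = f \<cdot> r"
      using compactD[OF c I(2,1) cp, of "f \<cdot> r"] f ir by auto
    note ea = part_arr[OF J(3)]
    have "e \<cdot> f = (e \<cdot> (f \<cdot> r)) \<cdot> i" using ea f ir by simp
    also have "\<dots> = f" unfolding J(4) using f ir by simp
    finally show "finitely_supported I s \<iota> f" unfolding finitely_supported_def using J by blast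
  qed
qed

lemma compact_isomorphic: "c \<in> compacts U T \<Longrightarrow> isomorphic T c c' \<Longrightarrow> c' \<in> compacts U T"
  using compact_retract isomorphic_is_retract isomorphic_sym by blast

lemma compact_zero:
  assumes "zero_ob T z" shows "z \<in> compacts U T"
proof (rule compactI)
  show "z \<in> Ob T" using assms by simp
  fix I :: "'u set" and x s \<iota> f
  assume cp: "is_coproduct T I x s \<iota>" and f: "f \<in> Arr T" "Dom T f = z" "Cod T f = s"
  obtain e where e: "is_part I s \<iota> {} e" using ex_part[OF cp] .
  have f0: "f = Zer T z s" using from_zero[OF assms f(1,2)] f(3) by simp
  have "e \<cdot> f = f" unfolding f0 using part_arr[OF e] coproduct_arr(1)[OF cp] assms by simp
  then show "finitely_supported I s \<iota> f" unfolding finitely_supported_def using e by blast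
qed

text \<open>
  Desuspending the terms of a coproduct \<open>s\<close> identifies \<open>s\<close> with the suspension of a coproduct \<open>s'\<close>. An
  arrow from the suspension of \<open>c\<close> to \<open>s\<close> is then the suspension of an arrow from \<open>c\<close> to \<open>s'\<close>.
\<close>

lemma compact_Shift:
  assumes c: "c \<in> compacts U T" shows "Sh c \<in> compacts U T"
proof (rule compactI)
  have cO: "c \<in> Ob T" using c by simp
  show "Sh c \<in> Ob T" using cO by simp
  fix I :: "'u set" and x s \<iota> f
  assume cp: "is_coproduct T I x s \<iota>" and I: "small U I" "I \<subseteq> U" and f: "f \<in> Arr T" "Dom T f = Sh c" "Cod T f = s"
  note k = coproduct_arr[OF cp]
  have "\<forall>i\<in>I. \<exists>w e e'. w \<in> Ob T \<and> e \<in> Arr T \<and> Dom T e = Sh w \<and> Cod T e = x i \<and>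
      e' \<in> Arr T \<and> Dom T e' = x i \<and> Cod T e' = Sh w \<and> e' \<cdot> e = Ide T (Sh w) \<and> e \<cdot> e' = Ide T (x i)"
  proof
    fix i assume i: "i \<in> I"
    obtain w where w: "w \<in> Ob T" "isomorphic T (Sh w) (x i)" using desuspension[OF k(2)[OF i]] .
    obtain e where e: "iso_arr T e" "e \<in> Arr T" "Dom T e = Sh w" "Cod T e = x i" using w(2) by (rule isomorphicE)
    show "\<exists>w e e'. w \<in> Ob T \<and> e \<in> Arr T \<and> Dom T e = Sh w \<and> Cod T e = x i \<and>
      e' \<in> Arr T \<and> Dom T e' = x i \<and> Cod T e' = Sh w \<and> e' \<cdot> e = Ide T (Sh w) \<and> e \<cdot> e' = Ide T (x i)"
      using iso_arrE[OF e(1)] w(1) e(3,4) by metis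
  qed
  then obtain w a b where wab: "\<forall>i\<in>I. w i \<in> Ob T \<and> a i \<in> Arr T \<and> Dom T (a i) = Sh (w i) \<and> Cod T (a i) = x i \<and>
      b i \<in> Arr T \<and> Dom T (b i) = x i \<and> Cod T (b i) = Sh (w i) \<and> b i \<cdot> a i = Ide T (Sh (w i)) \<and> a i \<cdot> b i = Ide T (x i)"
    by metis
  obtain s' \<iota>' where cp': "is_coproduct T I w s' \<iota>'" using ex_coproduct[OF I(1), of w] wab by blast
  note k' = coproduct_arr[OF cp']
  have Scp: "is_coproduct T I (\<lambda>i. Sh (w i)) (Sh s') (\<lambda>i. Sm (\<iota>' i))"
    using Shift_preserves_coproducts cp' unfolding preserves_coproducts_def by blast
  have "\<exists>m. m \<in> Arr T \<and> Dom T m = Sh s' \<and> Cod T m = s \<and> (\<forall>i\<in>I. m \<cdot> Sm (\<iota>' i) = \<iota> i \<cdot> a i)"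
    by (rule coproduct_map[OF Scp k(1), of "\<lambda>i. \<iota> i \<cdot> a i"]) (use wab k in auto)
  then obtain m where m: "m \<in> Arr T" "Dom T m = Sh s'" "Cod T m = s" "\<And>i. i \<in> I \<Longrightarrow> m \<cdot> Sm (\<iota>' i) = \<iota> i \<cdot> a i"
    by blast
  have "\<exists>n. n \<in> Arr T \<and> Dom T n = s \<and> Cod T n = Sh s' \<and> (\<forall>i\<in>I. n \<cdot> \<iota> i = Sm (\<iota>' i) \<cdot> b i)"
    by (rule coproduct_map[OF cp, of "Sh s'" "\<lambda>i. Sm (\<iota>' i) \<cdot> b i"]) (use wab k' in auto)
  then obtain n where n: "n \<in> Arr T" "Dom T n = s" "Cod T n = Sh s'" "\<And>i. i \<in> I \<Longrightarrow> n \<cdot> \<iota> i = Sm (\<iota>' i) \<cdot> b i"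
    by blast
  have mn: "m \<cdot> n = Ide T s"
  proof (rule coproduct_eq[OF cp])
    fix i assume i: "i \<in> I"
    have "(m \<cdot> n) \<cdot> \<iota> i = m \<cdot> (Sm (\<iota>' i) \<cdot> b i)" unfolding n(4)[OF i, symmetric] using m(1-3) n(1-3) k i by simp
    also have "\<dots> = (\<iota> i \<cdot> a i) \<cdot> b i"
      by (rule comp_reduce[OF m(4)[OF i]]) (use m(1-3) wab i k' in simp_all)
    also have "\<dots> = \<iota> i" using wab i k by simp
    finally show "(m \<cdot> n) \<cdot> \<iota> i = Ide T s \<cdot> \<iota> i" using k i by simp
  qed (use m n k in simp_all)
  have nf: "n \<cdot> f \<in> Arr T" "Dom T (n \<cdot> f) = Sh c" "Cod T (n \<cdot> f) = Sh s'" using n(1-3) f by simp_all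
  obtain f' where f': "f' \<in> Arr T" "Dom T f' = c" "Cod T f' = s'" "n \<cdot> f = Sm f'"
    using Shift_full[OF cO k'(1) nf] .
  obtain J e where J: "finite J" "J \<subseteq> I" "is_part I s' \<iota>' J e" "e \<cdot> f' = f'"
    using compactD[OF c I(2,1) cp' f'(1-3)] .
  note ea = part_arr[OF J(3)]
  have SJ: "is_part I (Sh s') (\<lambda>i. Sm (\<iota>' i)) J (Sm e)" by (rule part_image[OF Shift_additive cp' J(3)])
  have P: "is_part I s \<iota> J (m \<cdot> (Sm e \<cdot> n))"
    by (rule part_transport[OF SJ m(1-3) n(1-3), of b]) (use wab k k' n(4) mn in simp_all)
  have "Sm e \<cdot> (n \<cdot> f) = n \<cdot> f"
    unfolding f'(4) by (rule additive_endo_comp[OF Shift_additive J(4)]) (use ea f' in simp_all)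
  then have "(m \<cdot> (Sm e \<cdot> n)) \<cdot> f = m \<cdot> (n \<cdot> f)" using m(1-3) n(1-3) f ea by simp
  also have "\<dots> = f" using comp_reduce[OF mn, of f] m(1-3) n(1-3) f by simp
  finally show "finitely_supported I s \<iota> f" unfolding finitely_supported_def using P J by blast
qed

lemma compact_Shift_iff: 
  assumes cO: "c \<in> Ob T" shows "Sh c \<in> compacts U T \<longleftrightarrow> c \<in> compacts U T"
proof
  assume c: "Sh c \<in> compacts U T"
  show "c \<in> compacts U T"
  proof (rule compactI[OF cO])
    fix I :: "'u set" and x s \<iota> f
    assume cp: "is_coproduct T I x s \<iota>" and I: "small U I" "I \<subseteq> U" and f: "f \<in> Arr T" "Dom T f = c" "Cod T f = s"
    have Scp: "is_coproduct T I (\<lambda>i. Sh (x i)) (Sh s) (\<lambda>i. Sm (\<iota> i))"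
      using Shift_preserves_coproducts cp unfolding preserves_coproducts_def by blast
    obtain J e where J: "finite J" "J \<subseteq> I" "is_part I (Sh s) (\<lambda>i. Sm (\<iota> i)) J e" "e \<cdot> Sm f = Sm f"
      using compactD[OF c I(2,1) Scp, of "Sm f"] f by auto
    obtain e' where e': "is_part I s \<iota> J e'" using ex_part[OF cp] .
    note ea = part_arr[OF e']
    have "e = Sm e'" by (rule part_unique[OF Scp J(3) part_image[OF Shift_additive cp e']])
    then have "Sm (e' \<cdot> f) = Sm f" using J(4) ea f by simp
    then have "e' \<cdot> f = f" by (rule Shift_faithful[rotated -1]) (use ea f in simp_all)
    then show "finitely_supported I s \<iota> f" unfolding finitely_supported_def using J e' by blast
  qed
qed (rule compact_Shift)

text \<open>
  For an arrow \<open>q\<close> from the cone, \<open>q g\<close> has finite support \<open>J\<close>. What remains of \<open>q\<close> outside \<open>J\<close> is killed by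
  \<open>g\<close>, hence factors through the suspension of the first object and has finite support as well.
\<close>

lemma compact_cone:
  assumes t: "(f, g, h) \<in> Tri T" and c: "Dom T f \<in> compacts U T" "Cod T f \<in> compacts U T"
  shows "Cod T g \<in> compacts U T"
proof (rule compactI)
  note ta = tri_arr[OF t]
  show "Cod T g \<in> Ob T" using ta by simp
  fix I :: "'u set" and x s \<iota> q
  assume cp: "is_coproduct T I x s \<iota>" and I: "small U I" "I \<subseteq> U" and q: "q \<in> Arr T" "Dom T q = Cod T g" "Cod T q = s"
  obtain J e where J: "finite J" "J \<subseteq> I" "is_part I s \<iota> J e" "e \<cdot> (q \<cdot> g) = q \<cdot> g"
    using compactD[OF c(2) I(2,1) cp, of "q \<cdot> g"] q ta by auto
  note ea = part_arr[OF J(3)]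
  define d where "d = sub q (e \<cdot> q)"
  have d: "d \<in> Arr T" "Dom T d = Cod T g" "Cod T d = s" unfolding d_def using ea q by simp_all
  have "d \<cdot> g = sub (q \<cdot> g) (e \<cdot> (q \<cdot> g))" unfolding d_def using ea q ta by simp
  then have "d \<cdot> g = Zer T (Dom T g) (Cod T d)" unfolding J(4) using q ta d by simp
  then obtain m where m: "m \<in> Arr T" "Dom T m = Cod T h" "Cod T m = s" "m \<cdot> h = d"
    using tri_extend[OF tri_rotate[OF t] d(1,2)] d(3) by metis
  have "Sh (Dom T f) \<in> compacts U T" using compact_Shift[OF c(1)] .
  then obtain K e' where K: "finite K" "K \<subseteq> I" "is_part I s \<iota> K e'" "e' \<cdot> m = m"
    using compactD[OF _ I(2,1) cp, of _ m] m ta by metis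
  note ea' = part_arr[OF K(3)]
  obtain e'' where L: "is_part I s \<iota> (J \<union> K) e''" using ex_part[OF cp] .
  note ea'' = part_arr[OF L]
  have 1: "e'' \<cdot> e = e" "e'' \<cdot> e' = e'" using part_mono[OF cp _ L] J(3) K(3) by auto
  have "e'' \<cdot> m = e'' \<cdot> (e' \<cdot> m)" unfolding K(4) ..
  also have "\<dots> = e' \<cdot> m" by (rule comp_reduce[OF 1(2)]) (use ea' ea'' m in simp_all)
  finally have em: "e'' \<cdot> m = m" unfolding K(4) .
  have ed: "e'' \<cdot> d = d" using comp_reduce[OF em, of h] m ta ea'' by simp
  have ee: "e'' \<cdot> (e \<cdot> q) = e \<cdot> q" by (rule comp_reduce[OF 1(1)]) (use ea ea'' q in simp_all)
  have qd: "q = Plus T d (e \<cdot> q)" unfolding d_def using ea q by simp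
  have "e'' \<cdot> Plus T d (e \<cdot> q) = Plus T (e'' \<cdot> d) (e'' \<cdot> (e \<cdot> q))" using ea ea'' q d by simp
  then have "e'' \<cdot> q = q" unfolding ed ee qd[symmetric] .
  then show "finitely_supported I s \<iota> q" unfolding finitely_supported_def using L J(1,2) K(1,2)
    by (intro exI[of _ "J \<union> K"] exI[of _ e'']) auto
qed

lemma tri_subcat_compacts: "tri_subcat T (compacts U T)"
  unfolding tri_subcat_def
  using compacts_Ob compact_zero compact_isomorphic compact_Shift_iff compact_cone by blast

text \<open>
  For \<open>a\<close> rigid, tensoring with \<open>a\<close> is left adjoint to tensoring with its dual. What matters is that an arrow
  out of \<open>x \<otimes> a\<close> can be recovered from its adjunct, which is a triangle identity; here it is
  proved only up to an endomorphism \<open>v\<close> of \<open>x \<otimes> a\<close>, as this needs no coherence law for the unit beyond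
  the triangle axiom.
\<close>

lemma rigid_counit_section:
  assumes aO: "a \<in> Ob T" and xO: "x \<in> Ob T" and d: "d \<in> Ob T"
    and \<eta>: "\<eta> \<in> Arr T" "Dom T \<eta> = Unit T" "Cod T \<eta> = a \<boxtimes> d"
    and \<epsilon>: "\<epsilon> \<in> Arr T" "Dom T \<epsilon> = d \<boxtimes> a" "Cod T \<epsilon> = Unit T"
    and eq: "RUnit T a \<cdot> ((Ide T a \<boxdot> \<epsilon>) \<cdot> (Assoc T a d a \<cdot> (\<eta> \<boxdot> Ide T a))) = LUnit T a"
    and u: "u \<in> Arr T" "Dom T u = x" "Cod T u = (x \<boxtimes> a) \<boxtimes> d"
      "Assoc T x a d \<cdot> (u \<cdot> RUnit T x) = Ide T x \<boxdot> \<eta>"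
  shows "\<exists>v. v \<in> Arr T \<and> Dom T v = x \<boxtimes> a \<and> Cod T v = x \<boxtimes> a \<and>
    (RUnit T (x \<boxtimes> a) \<cdot> ((Ide T (x \<boxtimes> a) \<boxdot> \<epsilon>) \<cdot> Assoc T (x \<boxtimes> a) d a)) \<cdot> ((u \<boxdot> Ide T a) \<cdot> v) = Ide T (x \<boxtimes> a)"
proof -
  let ?unit = "Unit T"
  note O = aO xO d
  let ?k = "(Ide T (x \<boxtimes> a) \<boxdot> \<epsilon>) \<cdot> Assoc T (x \<boxtimes> a) d a"
  let ?A1 = "Assoc T x a ?unit"
  have nat1: "?A1 \<cdot> (Ide T (x \<boxtimes> a) \<boxdot> \<epsilon>) = (Ide T x \<boxdot> (Ide T a \<boxdot> \<epsilon>)) \<cdot> Assoc T x a (d \<boxtimes> a)"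
    using Assoc_natural[of "Ide T x" "Ide T a" \<epsilon>] O \<epsilon> by simp
  have nat2: "Assoc T x (a \<boxtimes> d) a \<cdot> ((Ide T x \<boxdot> \<eta>) \<boxdot> Ide T a) = (Ide T x \<boxdot> (\<eta> \<boxdot> Ide T a)) \<cdot> Assoc T x ?unit a"
    using Assoc_natural[of "Ide T x" \<eta> "Ide T a"] O \<eta> by simp
  let ?w = "(u \<cdot> RUnit T x) \<boxdot> Ide T a"
  have w: "?w \<in> Arr T" "Dom T ?w = (x \<boxtimes> ?unit) \<boxtimes> a" "Cod T ?w = ((x \<boxtimes> a) \<boxtimes> d) \<boxtimes> a" using O u(1-3) by simp_all
  have p: "Assoc T x a (d \<boxtimes> a) \<cdot> Assoc T (x \<boxtimes> a) d a =
      (Ide T x \<boxdot> Assoc T a d a) \<cdot> (Assoc T x (a \<boxtimes> d) a \<cdot> (Assoc T x a d \<boxdot> Ide T a))"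
    by (rule pentagon) (use O in simp_all)
  have q: "(Assoc T x a d \<boxdot> Ide T a) \<cdot> ?w = (Ide T x \<boxdot> \<eta>) \<boxdot> Ide T a"
    unfolding u(4)[symmetric] using O u(1-3) by simp
  have X: "Assoc T x a (d \<boxtimes> a) \<cdot> (Assoc T (x \<boxtimes> a) d a \<cdot> ?w) =
      (Ide T x \<boxdot> (Assoc T a d a \<cdot> (\<eta> \<boxdot> Ide T a))) \<cdot> Assoc T x ?unit a"
  proof -
    have "Assoc T x a (d \<boxtimes> a) \<cdot> (Assoc T (x \<boxtimes> a) d a \<cdot> ?w) =
        ((Ide T x \<boxdot> Assoc T a d a) \<cdot> (Assoc T x (a \<boxtimes> d) a \<cdot> (Assoc T x a d \<boxdot> Ide T a))) \<cdot> ?w"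
      by (rule comp_reduce[OF p]) (use O w in simp_all)
    also have "\<dots> = (Ide T x \<boxdot> Assoc T a d a) \<cdot> (Assoc T x (a \<boxtimes> d) a \<cdot> ((Assoc T x a d \<boxdot> Ide T a) \<cdot> ?w))"
      using O w by (simp del: tensor_comp)
    also have "\<dots> = (Ide T x \<boxdot> Assoc T a d a) \<cdot> ((Ide T x \<boxdot> (\<eta> \<boxdot> Ide T a)) \<cdot> Assoc T x ?unit a)"
      unfolding q nat2 ..
    also have "\<dots> = ((Ide T x \<boxdot> Assoc T a d a) \<cdot> (Ide T x \<boxdot> (\<eta> \<boxdot> Ide T a))) \<cdot> Assoc T x ?unit a"
      by (rule comp_assoc[symmetric]) (use O \<eta> in simp_all)
    also have "(Ide T x \<boxdot> Assoc T a d a) \<cdot> (Ide T x \<boxdot> (\<eta> \<boxdot> Ide T a)) = Ide T x \<boxdot> (Assoc T a d a \<cdot> (\<eta> \<boxdot> Ide T a))"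
      using O \<eta> by simp
    finally show ?thesis .
  qed
  let ?y = "(Ide T a \<boxdot> \<epsilon>) \<cdot> (Assoc T a d a \<cdot> (\<eta> \<boxdot> Ide T a))"
  have y: "?y \<in> Arr T" "Dom T ?y = ?unit \<boxtimes> a" "Cod T ?y = a \<boxtimes> ?unit" using O \<epsilon> \<eta> by simp_all
  have main: "?A1 \<cdot> (?k \<cdot> ?w) = (Ide T x \<boxdot> ?y) \<cdot> Assoc T x ?unit a"
  proof -
    have "?A1 \<cdot> (?k \<cdot> ?w) = ?A1 \<cdot> ((Ide T (x \<boxtimes> a) \<boxdot> \<epsilon>) \<cdot> (Assoc T (x \<boxtimes> a) d a \<cdot> ?w))"
      using O w \<epsilon> by (simp del: tensor_comp)
    also have "\<dots> = ((Ide T x \<boxdot> (Ide T a \<boxdot> \<epsilon>)) \<cdot> Assoc T x a (d \<boxtimes> a)) \<cdot> (Assoc T (x \<boxtimes> a) d a \<cdot> ?w)"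
      by (rule comp_reduce[OF nat1]) (use O w \<epsilon> in simp_all)
    also have "\<dots> = (Ide T x \<boxdot> (Ide T a \<boxdot> \<epsilon>)) \<cdot> (Assoc T x a (d \<boxtimes> a) \<cdot> (Assoc T (x \<boxtimes> a) d a \<cdot> ?w))"
      by (rule comp_assoc) (use O w \<epsilon> in simp_all)
    also have "\<dots> = (Ide T x \<boxdot> (Ide T a \<boxdot> \<epsilon>)) \<cdot> ((Ide T x \<boxdot> (Assoc T a d a \<cdot> (\<eta> \<boxdot> Ide T a))) \<cdot> Assoc T x ?unit a)"
      unfolding X ..
    also have "\<dots> = ((Ide T x \<boxdot> (Ide T a \<boxdot> \<epsilon>)) \<cdot> (Ide T x \<boxdot> (Assoc T a d a \<cdot> (\<eta> \<boxdot> Ide T a)))) \<cdot> Assoc T x ?unit a"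
      by (rule comp_assoc[symmetric]) (use O \<epsilon> \<eta> in simp_all)
    also have "(Ide T x \<boxdot> (Ide T a \<boxdot> \<epsilon>)) \<cdot> (Ide T x \<boxdot> (Assoc T a d a \<cdot> (\<eta> \<boxdot> Ide T a))) = Ide T x \<boxdot> ?y"
      using O \<epsilon> \<eta> by simp
    finally show ?thesis .
  qed
  have "(Ide T x \<boxdot> RUnit T a) \<cdot> ((Ide T x \<boxdot> ?y) \<cdot> Assoc T x ?unit a) = (Ide T x \<boxdot> LUnit T a) \<cdot> Assoc T x ?unit a"
  proof (rule comp_reduce)
    show "(Ide T x \<boxdot> RUnit T a) \<cdot> (Ide T x \<boxdot> ?y) = Ide T x \<boxdot> LUnit T a"
      unfolding eq[symmetric] using O y by (subst tensor_comp) simp_all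
  qed (use O y in simp_all)
  also have "\<dots> = RUnit T x \<boxdot> Ide T a" using unit_triangle O by simp
  finally have Z: "(Ide T x \<boxdot> RUnit T a) \<cdot> (?A1 \<cdot> (?k \<cdot> ?w)) = RUnit T x \<boxdot> Ide T a" unfolding main .
  have k: "?k \<in> Arr T" "Dom T ?k = ((x \<boxtimes> a) \<boxtimes> d) \<boxtimes> a" "Cod T ?k = (x \<boxtimes> a) \<boxtimes> ?unit" using O \<epsilon> by simp_all
  let ?K = "RUnit T (x \<boxtimes> a) \<cdot> ?k"
  have isoB: "iso_arr T ((Ide T x \<boxdot> RUnit T a) \<cdot> ?A1)"
  proof (rule iso_comp)
    show "iso_arr T (Ide T x \<boxdot> RUnit T a)" using additive_endo_iso[OF tensor_additive(1)[OF xO] unitors(5)[OF aO]] by simp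
  qed (use O in simp_all)
  have isoR: "iso_arr T (RUnit T x \<boxdot> Ide T a)" using additive_endo_iso[OF tensor_additive(2)[OF aO] unitors(5)[OF xO]] by simp
  have Z': "((Ide T x \<boxdot> RUnit T a) \<cdot> ?A1) \<cdot> (?k \<cdot> ?w) = RUnit T x \<boxdot> Ide T a"
    using Z O k w by (simp del: tensor_comp)
  obtain v where v: "v \<in> Arr T" "Dom T v = Cod T ?k" "Cod T v = Dom T ?w" "(?k \<cdot> ?w) \<cdot> v = Ide T (Cod T ?k)"
  proof -
    obtain s where s: "s \<in> Arr T" "Dom T s = Cod T (?k \<cdot> ?w)" "Cod T s = Dom T (?k \<cdot> ?w)"
        "(?k \<cdot> ?w) \<cdot> s = Ide T (Cod T (?k \<cdot> ?w))"
    proof (rule section_of_iso_comp[of "(Ide T x \<boxdot> RUnit T a) \<cdot> ?A1" "?k \<cdot> ?w" "Ide T (Dom T ?w)" "RUnit T x \<boxdot> Ide T a"])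
      show "((Ide T x \<boxdot> RUnit T a) \<cdot> ?A1) \<cdot> ((?k \<cdot> ?w) \<cdot> Ide T (Dom T ?w)) = RUnit T x \<boxdot> Ide T a"
        unfolding Z'[symmetric] using k w by simp
    qed (use isoB isoR O k w in simp_all)
    have "Cod T (?k \<cdot> ?w) = Cod T ?k" "Dom T (?k \<cdot> ?w) = Dom T ?w" using k w by simp_all
    then show ?thesis using that s by metis
  qed
  obtain R' where R': "R' \<in> Arr T" "Dom T R' = x \<boxtimes> a" "Cod T R' = (x \<boxtimes> a) \<boxtimes> ?unit" "RUnit T (x \<boxtimes> a) \<cdot> R' = Ide T (x \<boxtimes> a)"
    using iso_arrE[OF unitors(5)[of "x \<boxtimes> a"]] O by (metis unitors(7,8) tensor_Ob)
  have w2: "?w = (u \<boxdot> Ide T a) \<cdot> (RUnit T x \<boxdot> Ide T a)" using O u(1-3) by simp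
  let ?v = "(RUnit T x \<boxdot> Ide T a) \<cdot> (v \<cdot> R')"
  have "?K \<cdot> ((u \<boxdot> Ide T a) \<cdot> ?v) = RUnit T (x \<boxtimes> a) \<cdot> (((?k \<cdot> ?w) \<cdot> v) \<cdot> R')"
    unfolding w2 using O u(1-3) k v(1-3) w R'(1-3) by (simp del: tensor_comp)
  also have "\<dots> = Ide T (x \<boxtimes> a)" unfolding v(4) using R' k by simp
  finally show ?thesis using O v(1-3) k w R'(1-3) by (intro exI[of _ ?v]) simp
qed

text \<open>
  The adjunct of an arrow from \<open>x \<otimes> a\<close> to a coproduct \<open>s\<close> is an arrow from \<open>x\<close> to \<open>s \<otimes> a\<^sup>*\<close>, again a
  coproduct. It has finite support since \<open>x\<close> is compact, and the arrow is recovered from it.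
\<close>

lemma compact_tensor:
  assumes x: "x \<in> compacts U T" and a: "a \<in> compacts U T"
  shows "x \<boxtimes> a \<in> compacts U T"
proof (rule compactI)
  have aO: "a \<in> Ob T" and xO: "x \<in> Ob T" using a x by simp_all
  then show "x \<boxtimes> a \<in> Ob T" by simp
  fix I :: "'u set" and y s \<iota> f
  assume cp: "is_coproduct T I y s \<iota>" and I: "small U I" "I \<subseteq> U" and f: "f \<in> Arr T" "Dom T f = x \<boxtimes> a" "Cod T f = s"
  have sO: "s \<in> Ob T" using coproduct_arr(1)[OF cp] .
  obtain d \<eta> \<epsilon> where d: "d \<in> Ob T" and \<eta>: "\<eta> \<in> Arr T" "Dom T \<eta> = Unit T" "Cod T \<eta> = a \<boxtimes> d"
    and \<epsilon>: "\<epsilon> \<in> Arr T" "Dom T \<epsilon> = d \<boxtimes> a" "Cod T \<epsilon> = Unit T"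
    and eq: "RUnit T a \<cdot> ((Ide T a \<boxdot> \<epsilon>) \<cdot> (Assoc T a d a \<cdot> (\<eta> \<boxdot> Ide T a))) = LUnit T a"
    using rigidE[OF a] .
  let ?A = "Assoc T x a d" and ?R = "RUnit T x"
  obtain A' where A': "A' \<in> Arr T" "Dom T A' = x \<boxtimes> (a \<boxtimes> d)" "Cod T A' = (x \<boxtimes> a) \<boxtimes> d" "?A \<cdot> A' = Ide T (x \<boxtimes> (a \<boxtimes> d))"
    using iso_arrE[OF Assoc_arr(1)[OF xO aO d]] Assoc_arr(3,4)[OF xO aO d] by metis
  obtain R' where R': "R' \<in> Arr T" "Dom T R' = x" "Cod T R' = x \<boxtimes> Unit T" "R' \<cdot> ?R = Ide T (x \<boxtimes> Unit T)"
    using iso_arrE[OF unitors(5)[OF xO]] unitors(7,8)[OF xO] by metis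
  let ?u = "A' \<cdot> ((Ide T x \<boxdot> \<eta>) \<cdot> R')"
  have u: "?u \<in> Arr T" "Dom T ?u = x" "Cod T ?u = (x \<boxtimes> a) \<boxtimes> d" using A' R' \<eta> aO xO d by simp_all
  have "?A \<cdot> (?u \<cdot> ?R) = (?A \<cdot> A') \<cdot> ((Ide T x \<boxdot> \<eta>) \<cdot> (R' \<cdot> ?R))"
    using A'(1-3) R'(1-3) \<eta> aO xO d by (simp del: tensor_comp)
  also have "\<dots> = Ide T x \<boxdot> \<eta>" unfolding A'(4) R'(4) using \<eta> aO xO d by simp
  finally have uA: "?A \<cdot> (?u \<cdot> ?R) = Ide T x \<boxdot> \<eta>" .
  let ?K = "\<lambda>y. RUnit T y \<cdot> ((Ide T y \<boxdot> \<epsilon>) \<cdot> Assoc T y d a)"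
  obtain v where v: "v \<in> Arr T" "Dom T v = x \<boxtimes> a" "Cod T v = x \<boxtimes> a"
    "?K (x \<boxtimes> a) \<cdot> ((?u \<boxdot> Ide T a) \<cdot> v) = Ide T (x \<boxtimes> a)"
    using rigid_counit_section[OF aO xO d \<eta> \<epsilon> eq u uA] by blast
  have K: "?K y \<in> Arr T" "Dom T (?K y) = (y \<boxtimes> d) \<boxtimes> a" "Cod T (?K y) = y" if "y \<in> Ob T" for y
    using that aO d \<epsilon> by simp_all
  have Knat: "?K s \<cdot> ((g \<boxdot> Ide T d) \<boxdot> Ide T a) = g \<cdot> ?K (x \<boxtimes> a)" if g: "g \<in> Arr T" "Dom T g = x \<boxtimes> a" "Cod T g = s" for g
  proof -
    have 1: "Assoc T s d a \<cdot> ((g \<boxdot> Ide T d) \<boxdot> Ide T a) = (g \<boxdot> Ide T (d \<boxtimes> a)) \<cdot> Assoc T (x \<boxtimes> a) d a"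
      using Assoc_natural[of g "Ide T d" "Ide T a"] g aO d by simp
    have 2: "RUnit T s \<cdot> (g \<boxdot> Ide T (Unit T)) = g \<cdot> RUnit T (x \<boxtimes> a)"
      using unitors_natural(2)[OF g(1)] g by simp
    have "?K s \<cdot> ((g \<boxdot> Ide T d) \<boxdot> Ide T a) = RUnit T s \<cdot> ((Ide T s \<boxdot> \<epsilon>) \<cdot> (Assoc T s d a \<cdot> ((g \<boxdot> Ide T d) \<boxdot> Ide T a)))"
      using g sO aO xO d \<epsilon> by (simp del: tensor_comp)
    also have "\<dots> = RUnit T s \<cdot> (((Ide T s \<boxdot> \<epsilon>) \<cdot> (g \<boxdot> Ide T (d \<boxtimes> a))) \<cdot> Assoc T (x \<boxtimes> a) d a)"
      unfolding 1 using g sO aO xO d \<epsilon> by (simp del: tensor_comp)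
    also have "(Ide T s \<boxdot> \<epsilon>) \<cdot> (g \<boxdot> Ide T (d \<boxtimes> a)) = (g \<boxdot> Ide T (Unit T)) \<cdot> (Ide T (x \<boxtimes> a) \<boxdot> \<epsilon>)"
      using g sO aO xO d \<epsilon> by simp
    also have "RUnit T s \<cdot> (((g \<boxdot> Ide T (Unit T)) \<cdot> (Ide T (x \<boxtimes> a) \<boxdot> \<epsilon>)) \<cdot> Assoc T (x \<boxtimes> a) d a) =
        (RUnit T s \<cdot> (g \<boxdot> Ide T (Unit T))) \<cdot> ((Ide T (x \<boxtimes> a) \<boxdot> \<epsilon>) \<cdot> Assoc T (x \<boxtimes> a) d a)"
      using g sO aO xO d \<epsilon> by (simp del: tensor_comp)
    also have "\<dots> = g \<cdot> ?K (x \<boxtimes> a)" unfolding 2 using g sO aO xO d \<epsilon> by (simp del: tensor_comp)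
    finally show ?thesis .
  qed
  have recover: "?K s \<cdot> ((((g \<boxdot> Ide T d) \<cdot> ?u) \<boxdot> Ide T a) \<cdot> v) = g"
    if g: "g \<in> Arr T" "Dom T g = x \<boxtimes> a" "Cod T g = s" for g
  proof -
    have gd: "g \<boxdot> Ide T d \<in> Arr T" "Dom T (g \<boxdot> Ide T d) = (x \<boxtimes> a) \<boxtimes> d" "Cod T (g \<boxdot> Ide T d) = s \<boxtimes> d"
      using g d by simp_all
    have "((g \<boxdot> Ide T d) \<cdot> ?u) \<boxdot> Ide T a = ((g \<boxdot> Ide T d) \<boxdot> Ide T a) \<cdot> (?u \<boxdot> Ide T a)"
      by (subst tensor_comp) (use gd u aO in simp_all)
    then have "?K s \<cdot> ((((g \<boxdot> Ide T d) \<cdot> ?u) \<boxdot> Ide T a) \<cdot> v) =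
        (?K s \<cdot> ((g \<boxdot> Ide T d) \<boxdot> Ide T a)) \<cdot> ((?u \<boxdot> Ide T a) \<cdot> v)"
      using gd u aO v(1-3) K[OF sO] by (simp del: tensor_comp comp_assoc add: comp_assoc[of v])
        (simp del: tensor_comp)
    also have "\<dots> = g \<cdot> (?K (x \<boxtimes> a) \<cdot> ((?u \<boxdot> Ide T a) \<cdot> v))"
      unfolding Knat[OF g] by (rule comp_assoc) (use g u aO xO v(1-3) K[of "x \<boxtimes> a"] in simp_all)
    also have "\<dots> = g" unfolding v(4) using g by simp
    finally show ?thesis .
  qed
  have dcp: "is_coproduct T I (\<lambda>i. y i \<boxtimes> d) (s \<boxtimes> d) (\<lambda>i. \<iota> i \<boxdot> Ide T d)"
    using tensor_preserves_coproducts(2)[OF d, of I] cp unfolding preserves_coproducts_def by simp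
  let ?f = "(f \<boxdot> Ide T d) \<cdot> ?u"
  have f': "?f \<in> Arr T" "Dom T ?f = x" "Cod T ?f = s \<boxtimes> d" using f u d by simp_all
  obtain J e where J: "finite J" "J \<subseteq> I" "is_part I (s \<boxtimes> d) (\<lambda>i. \<iota> i \<boxdot> Ide T d) J e" "e \<cdot> ?f = ?f"
    using compactD[OF x I(2,1) dcp f'] .
  obtain e' where e': "is_part I s \<iota> J e'" using ex_part[OF cp] .
  note ea = part_arr[OF e']
  have "is_part I (s \<boxtimes> d) (\<lambda>i. \<iota> i \<boxdot> Ide T d) J (e' \<boxdot> Ide T d)"
    using part_image[OF tensor_additive(2)[OF d] cp e'] by simp
  then have "e = e' \<boxdot> Ide T d" using part_unique[OF dcp J(3)] by blast
  then have "((e' \<cdot> f) \<boxdot> Ide T d) \<cdot> ?u = ?f"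
    using J(4) comp_reduce[of "e' \<boxdot> Ide T d" "f \<boxdot> Ide T d" _ ?u] ea f u d by simp
  then have "e' \<cdot> f = f"
    using recover[of "e' \<cdot> f"] recover[OF f] ea f by simp
  then show "finitely_supported I s \<iota> f" unfolding finitely_supported_def using J e' by blast
qed

section \<open>Compact objects in localizing subcategories\<close>

definition factors_through :: "'o set \<Rightarrow> 'm \<Rightarrow> bool" where
  "factors_through S f \<longleftrightarrow> (\<exists>u v. u \<in> Arr T \<and> v \<in> Arr T \<and> Cod T u = Dom T v \<and> Cod T u \<in> S \<and> f = v \<cdot> u)"

lemma factors_comp_left:
  assumes "factors_through S f" "w \<in> Arr T" "Dom T w = Cod T f" shows "factors_through S (w \<cdot> f)"
proof -
  obtain u v where uv: "u \<in> Arr T" "v \<in> Arr T" "Cod T u = Dom T v" "Cod T u \<in> S" "f = v \<cdot> u"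
    using assms(1) unfolding factors_through_def by blast
  show ?thesis unfolding factors_through_def
    by (rule exI[of _ u], rule exI[of _ "w \<cdot> v"]) (use uv assms(2,3) in simp)
qed

lemma factors_comp_right:
  assumes "factors_through S f" "w \<in> Arr T" "Cod T w = Dom T f" shows "factors_through S (f \<cdot> w)"
proof -
  obtain u v where uv: "u \<in> Arr T" "v \<in> Arr T" "Cod T u = Dom T v" "Cod T u \<in> S" "f = v \<cdot> u"
    using assms(1) unfolding factors_through_def by blast
  show ?thesis unfolding factors_through_def
    by (rule exI[of _ "u \<cdot> w"], rule exI[of _ v]) (use uv assms(2,3) in simp)
qed

lemma factors_through_member: 
  "f \<in> Arr T \<Longrightarrow> Cod T f \<in> S \<Longrightarrow> factors_through S f" "f \<in> Arr T \<Longrightarrow> Dom T f \<in> S \<Longrightarrow> factors_through S f"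
  unfolding factors_through_def
   apply (rule exI[of _ f], rule exI[of _ "Ide T (Cod T f)"], simp)
  apply (rule exI[of _ "Ide T (Dom T f)"], rule exI[of _ f], simp)
  done

lemma factors_zero:
  assumes S: "tri_subcat T S" and "x \<in> Ob T" "y \<in> Ob T" shows "factors_through S (Zer T x y)"
proof -
  obtain z where z: "zero_ob T z" using ex_zero_ob by blast
  have "factors_through S (Zer T z y \<cdot> Zer T x z)"
    by (rule factors_comp_left[OF factors_through_member(1)])
      (use z tri_subcatD(2)[OF S z] assms(2,3) in simp_all)
  then show ?thesis using z assms(2,3) by simp
qed

lemma factors_neg: 
  assumes "factors_through S f" shows "factors_through S (neg_arr T f)"
proof -
  obtain u v where uv: "u \<in> Arr T" "v \<in> Arr T" "Cod T u = Dom T v" "Cod T u \<in> S" "f = v \<cdot> u"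
    using assms(1) unfolding factors_through_def by blast
  show ?thesis unfolding factors_through_def
    by (rule exI[of _ u], rule exI[of _ "neg_arr T v"]) (use uv in simp)
qed

lemma factors_plus:
  assumes S: "tri_subcat T S" and f: "factors_through S f" and g: "factors_through S g"
    and fg: "Dom T f = Dom T g" "Cod T f = Cod T g"
  shows "factors_through S (Plus T f g)"
proof -
  obtain u v where uv: "u \<in> Arr T" "v \<in> Arr T" "Cod T u = Dom T v" "Cod T u \<in> S" "f = v \<cdot> u"
    using f unfolding factors_through_def by blast
  obtain a b where ab: "a \<in> Arr T" "b \<in> Arr T" "Cod T a = Dom T b" "Cod T a \<in> S" "g = b \<cdot> a"
    using g unfolding factors_through_def by blast
  have D: "Dom T u = Dom T a" "Cod T v = Cod T b" using fg uv ab by simp_all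
  obtain s i j p q where s: "s \<in> S" "i \<in> Hom T (Cod T u) s" "j \<in> Hom T (Cod T a) s" "p \<in> Hom T s (Cod T u)"
      "q \<in> Hom T s (Cod T a)" "p \<cdot> i = Ide T (Cod T u)" "q \<cdot> j = Ide T (Cod T a)"
      "q \<cdot> i = Zer T (Cod T u) (Cod T a)" "p \<cdot> j = Zer T (Cod T a) (Cod T u)"
    using tri_subcat_biproduct[OF S uv(4) ab(4)] .
  then have ar: "i \<in> Arr T" "j \<in> Arr T" "p \<in> Arr T" "q \<in> Arr T" "Dom T i = Cod T u" "Dom T j = Cod T a"
    "Dom T p = s" "Dom T q = s" "Cod T i = s" "Cod T j = s" "Cod T p = Cod T u" "Cod T q = Cod T a"
    by (auto simp: Hom_iff)
  let ?u = "Plus T (i \<cdot> u) (j \<cdot> a)" and ?v = "Plus T (v \<cdot> p) (b \<cdot> q)"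
  have ua: "?u \<in> Arr T" "Dom T ?u = Dom T a" "Cod T ?u = s" using ar uv(1-3) ab(1-3) D by simp_all
  have pu: "p \<cdot> ?u = u" 
    using comp_reduce[OF s(6), of u] comp_reduce[OF s(9), of a] ar uv(1-3) ab(1-3) D by simp
  have qu: "q \<cdot> ?u = a" 
    using comp_reduce[OF s(7), of a] comp_reduce[OF s(8), of u] ar uv(1-3) ab(1-3) D by simp
  have "?v \<cdot> ?u = Plus T (v \<cdot> (p \<cdot> ?u)) (b \<cdot> (q \<cdot> ?u))"
    using ar(1-4,7,8,11,12) uv(1-3) ab(1-3) D ua by (simp del: comp_plus)
  then have "Plus T f g = ?v \<cdot> ?u" unfolding pu qu uv(5) ab(5) ..
  then show ?thesis unfolding factors_through_def
    using ua ar uv(1-3) ab(1-3) D s(1) by (intro exI[of _ ?u] exI[of _ ?v]) simp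
qed

lemma factors_Shift_iff:
  assumes S: "tri_subcat T S" and f: "f \<in> Arr T"
  shows "factors_through S (Sm f) \<longleftrightarrow> factors_through S f"
proof
  assume "factors_through S f"
  then obtain u v where uv: "u \<in> Arr T" "v \<in> Arr T" "Cod T u = Dom T v" "Cod T u \<in> S" "f = v \<cdot> u"
    unfolding factors_through_def by blast
  have "Sh (Cod T u) \<in> S" using tri_subcatD(4)[OF S, of "Cod T u"] uv by simp
  then show "factors_through S (Sm f)" unfolding factors_through_def
    using uv by (intro exI[of _ "Sm u"] exI[of _ "Sm v"]) simp
next
  assume "factors_through S (Sm f)"
  then obtain u v where uv: "u \<in> Arr T" "v \<in> Arr T" "Cod T u = Dom T v" "Cod T u \<in> S" "Sm f = v \<cdot> u"
    unfolding factors_through_def by blast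
  have D: "Dom T u = Sh (Dom T f)" "Cod T v = Sh (Cod T f)"
    using uv(1-3) arg_cong[OF uv(5), of "Dom T"] arg_cong[OF uv(5), of "Cod T"] f by simp_all
  obtain w where w: "w \<in> Ob T" "isomorphic T (Sh w) (Cod T u)" using desuspension[of "Cod T u"] uv(1) by auto
  have wS: "w \<in> S" using tri_subcatD(3)[OF S uv(4) isomorphic_sym[OF w(2)]] tri_subcatD(4)[OF S w(1)] by blast
  obtain e where e: "iso_arr T e" "e \<in> Arr T" "Dom T e = Sh w" "Cod T e = Cod T u" using w(2) by (rule isomorphicE)
  obtain e' where e': "e' \<in> Arr T" "Dom T e' = Cod T u" "Cod T e' = Sh w" "e \<cdot> e' = Ide T (Cod T u)"
    using iso_arrE[OF e(1)] e(3,4) by metis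
  have "e' \<cdot> u \<in> Arr T" "Dom T (e' \<cdot> u) = Sh (Dom T f)" "Cod T (e' \<cdot> u) = Sh w" using e' uv(1) D by simp_all
  then obtain u' where u': "u' \<in> Arr T" "Dom T u' = Dom T f" "Cod T u' = w" "e' \<cdot> u = Sm u'"
    using Shift_full[of "Dom T f" w] f w(1) by (metis Dom_in_Ob)
  have "v \<cdot> e \<in> Arr T" "Dom T (v \<cdot> e) = Sh w" "Cod T (v \<cdot> e) = Sh (Cod T f)" using e uv(1-3) D by simp_all
  then obtain v' where v': "v' \<in> Arr T" "Dom T v' = w" "Cod T v' = Cod T f" "v \<cdot> e = Sm v'"
    using Shift_full[of w "Cod T f"] f w(1) by (metis Cod_in_Ob)
  have "Sm (v' \<cdot> u') = (v \<cdot> e) \<cdot> (e' \<cdot> u)" unfolding u'(4) v'(4) using u' v' by simp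
  also have "\<dots> = v \<cdot> (e \<cdot> (e' \<cdot> u))" by (rule comp_assoc) (use e(2-4) e'(1-3) uv(1-3) in simp_all)
  also have "\<dots> = Sm f" using comp_reduce[OF e'(4), of u] e(2-4) e'(1-3) uv by simp
  finally have "v' \<cdot> u' = f" by (rule Shift_faithful[rotated -1]) (use u'(1-3) v'(1-3) f in simp_all)
  then show "factors_through S f" unfolding factors_through_def
    using u' v' wS by (intro exI[of _ u'] exI[of _ v']) simp
qed

text \<open>
  The objects that are seen by compact objects only through \<open>S\<close>. Neeman's theorem is obtained by showing
  that they form a localizing subcategory, for a triangulated subcategory \<open>S\<close> of compact objects.
\<close>

definition compactly_reached :: "'o set \<Rightarrow> 'o set" where
  "compactly_reached S = {x \<in> Ob T. \<forall>f. f \<in> Arr T \<longrightarrow> Dom T f \<in> compacts U T \<longrightarrow> Cod T f = x \<longrightarrow> factors_through S f}"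

lemma compactly_reachedD:
  "x \<in> compactly_reached S \<Longrightarrow> f \<in> Arr T \<Longrightarrow> Dom T f \<in> compacts U T \<Longrightarrow> Cod T f = x \<Longrightarrow> factors_through S f"
  unfolding compactly_reached_def by blast

lemma compactly_reached_isomorphic:
  assumes x: "x \<in> compactly_reached S" and i: "isomorphic T x y"
  shows "y \<in> compactly_reached S"
proof -
  obtain e where e: "iso_arr T e" "e \<in> Arr T" "Dom T e = x" "Cod T e = y" using i by (rule isomorphicE)
  obtain e' where e': "e' \<in> Arr T" "Dom T e' = y" "Cod T e' = x" "e \<cdot> e' = Ide T y"
    using iso_arrE[OF e(1)] e(3,4) by metis
  have "factors_through S f" if f: "f \<in> Arr T" "Dom T f \<in> compacts U T" "Cod T f = y" for f
  proof -
    have "factors_through S (e \<cdot> (e' \<cdot> f))"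
      by (rule factors_comp_left[OF compactly_reachedD[OF x]]) (use e e' f in simp_all)
    then show ?thesis using comp_reduce[OF e'(4), of f] e e' f by simp
  qed
  then show ?thesis unfolding compactly_reached_def using isomorphic_in_Ob[OF i] by blast
qed

lemma compactly_reached_Shift:
  assumes S: "tri_subcat T S" and x: "x \<in> Ob T"
  shows "Sh x \<in> compactly_reached S \<longleftrightarrow> x \<in> compactly_reached S"
proof
  assume Sx: "Sh x \<in> compactly_reached S"
  have "factors_through S f" if f: "f \<in> Arr T" "Dom T f \<in> compacts U T" "Cod T f = x" for f
  proof -
    have "factors_through S (Sm f)"
      by (rule compactly_reachedD[OF Sx]) (use f compact_Shift in simp_all)
    then show ?thesis using factors_Shift_iff[OF S f(1)] by blast
  qed
  then show "x \<in> compactly_reached S" unfolding compactly_reached_def using x by blast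
next
  assume Rx: "x \<in> compactly_reached S"
  have "factors_through S f" if f: "f \<in> Arr T" "Dom T f \<in> compacts U T" "Cod T f = Sh x" for f
  proof -
    obtain w where w: "w \<in> Ob T" "isomorphic T (Sh w) (Dom T f)" using desuspension[of "Dom T f"] f(1) by auto
    have wc: "w \<in> compacts U T"
      using compact_isomorphic[OF f(2) isomorphic_sym[OF w(2)]] compact_Shift_iff[OF w(1)] by blast
    obtain e where e: "iso_arr T e" "e \<in> Arr T" "Dom T e = Sh w" "Cod T e = Dom T f" using w(2) by (rule isomorphicE)
    obtain e' where e': "e' \<in> Arr T" "Dom T e' = Dom T f" "Cod T e' = Sh w" "e \<cdot> e' = Ide T (Dom T f)"
      using iso_arrE[OF e(1)] e(3,4) by metis
    have "f \<cdot> e \<in> Arr T" "Dom T (f \<cdot> e) = Sh w" "Cod T (f \<cdot> e) = Sh x" using e f by simp_all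
    then obtain g where g: "g \<in> Arr T" "Dom T g = w" "Cod T g = x" "f \<cdot> e = Sm g"
      using Shift_full[OF w(1) x] by metis
    have "factors_through S g" using compactly_reachedD[OF Rx g(1) _ g(3)] g(2) wc by simp
    then have "factors_through S (f \<cdot> e)" unfolding g(4) using factors_Shift_iff[OF S g(1)] by blast
    then have "factors_through S ((f \<cdot> e) \<cdot> e')" by (rule factors_comp_right) (use e e' f in simp_all)
    moreover have "(f \<cdot> e) \<cdot> e' = f" using e(2-4) e' f by simp
    ultimately show ?thesis by simp
  qed
  then show "Sh x \<in> compactly_reached S" unfolding compactly_reached_def using x by simp
qed

text \<open>
  The heart of Neeman's theorem. Let \<open>q\<close> be an arrow from a compact object to the middle term. Its image
  under \<open>g\<close> factors as \<open>b a\<close> through \<open>S\<close>, and \<open>h b\<close> factors through \<open>S\<close> as well. If \<open>b\<close> lifted along \<open>g\<close>,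
  subtracting the lift composed with \<open>a\<close> from \<open>q\<close> would leave an arrow through the first term. The
  obstruction \<open>h b\<close> becomes irrelevant once it is written as \<open>b4 a5\<close>, with target of \<open>a5\<close> in \<open>S\<close> and
  \<open>a5 a = 0\<close>: then \<open>a\<close> factors through the fibre of \<open>a5\<close>, which lies in \<open>S\<close> and on which \<open>b\<close> does lift.
\<close>

lemma compactly_reached_middle:
  assumes S: "tri_subcat T S" and Sc: "S \<subseteq> compacts U T" and t: "(f, g, h) \<in> Tri T"
    and x: "Dom T f \<in> compactly_reached S" and z: "Cod T g \<in> compactly_reached S"
  shows "Cod T f \<in> compactly_reached S"
proof -
  note ta = tri_arr[OF t]
  have xO: "Dom T f \<in> Ob T" using ta by simp
  have Sx: "Sh (Dom T f) \<in> compactly_reached S" using compactly_reached_Shift[OF S xO] x by blast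
  have "factors_through S q" if q: "q \<in> Arr T" "Dom T q \<in> compacts U T" "Cod T q = Cod T f" for q
  proof -
    have "factors_through S (g \<cdot> q)" by (rule compactly_reachedD[OF z]) (use q ta in simp_all)
    then obtain a b where ab: "a \<in> Arr T" "b \<in> Arr T" "Cod T a = Dom T b" "Cod T a \<in> S" "g \<cdot> q = b \<cdot> a"
      unfolding factors_through_def by blast
    have D: "Dom T a = Dom T q" "Cod T b = Cod T g"
      using ab(1-3) arg_cong[OF ab(5), of "Dom T"] arg_cong[OF ab(5), of "Cod T"] q ta by simp_all
    have "factors_through S (h \<cdot> b)"
      by (rule compactly_reachedD[OF Sx]) (use ab(1-4) Sc D ta in auto)
    then obtain a2 b2 where ab2: "a2 \<in> Arr T" "b2 \<in> Arr T" "Cod T a2 = Dom T b2" "Cod T a2 \<in> S" "h \<cdot> b = b2 \<cdot> a2"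
      unfolding factors_through_def by blast
    have D2: "Dom T a2 = Cod T a" "Cod T b2 = Sh (Dom T f)"
      using ab2(1-3) arg_cong[OF ab2(5), of "Dom T"] arg_cong[OF ab2(5), of "Cod T"] ab(1-3) D ta by simp_all
    let ?w = "a2 \<cdot> a"
    have w: "?w \<in> Arr T" "Dom T ?w = Dom T q" "Cod T ?w = Cod T a2" using ab(1) ab2(1) D D2 by simp_all
    \<comment> \<open>\<open>b2\<close> kills \<open>a2 a\<close> since \<open>h g = 0\<close>; so it extends to the cone of \<open>a2 a\<close>, which is compact, and the
        extension factors through \<open>S\<close> again. This yields the factorization of \<open>h b\<close> whose first arrow kills \<open>a\<close>.\<close>
    obtain k k' where tk: "(?w, k, k') \<in> Tri T" using ex_tri w(1) by blast
    note ka = tri_arr[OF tk]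
    have kc: "Cod T k \<in> compacts U T" by (rule compact_cone[OF tk]) (use w q ab2(4) Sc in auto)
    have "b2 \<cdot> ?w = (h \<cdot> b) \<cdot> a" unfolding ab2(5) using ab(1-3) ab2(1-3) D2 by simp
    also have "\<dots> = h \<cdot> (b \<cdot> a)" by (rule comp_assoc) (use ab(1-3) D ta in simp_all)
    also have "\<dots> = h \<cdot> (g \<cdot> q)" unfolding ab(5) ..
    also have "\<dots> = Zer T (Cod T f) (Sh (Dom T f)) \<cdot> q"
      by (rule comp_reduce[OF tri_comp_zero(2)[OF t]]) (use q ta in simp_all)
    also have "\<dots> = Zer T (Dom T ?w) (Cod T b2)" using q w D2 ta by simp
    finally obtain b3 where b3: "b3 \<in> Arr T" "Dom T b3 = Cod T k" "Cod T b3 = Cod T b2" "b3 \<cdot> k = b2"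
      using tri_extend[OF tk ab2(2)] w ab2(3) by metis
    have "factors_through S b3" by (rule compactly_reachedD[OF Sx]) (use b3 kc D2 in simp_all)
    then obtain a4 b4 where ab4: "a4 \<in> Arr T" "b4 \<in> Arr T" "Cod T a4 = Dom T b4" "Cod T a4 \<in> S" "b3 = b4 \<cdot> a4"
      unfolding factors_through_def by blast
    have D4: "Dom T a4 = Cod T k" "Cod T b4 = Sh (Dom T f)"
      using ab4(1-3) arg_cong[OF ab4(5), of "Dom T"] arg_cong[OF ab4(5), of "Cod T"] b3(1-3) D2 by simp_all
    let ?a5 = "a4 \<cdot> (k \<cdot> a2)"
    have a5: "?a5 \<in> Arr T" "Dom T ?a5 = Cod T a" "Cod T ?a5 = Cod T a4" using ab4(1) ka w ab2(1) D2 D4 by simp_all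
    have "b4 \<cdot> ?a5 = (b4 \<cdot> a4) \<cdot> (k \<cdot> a2)" using ab4(1-3) ka w ab2(1) D2 D4 by simp
    also have "\<dots> = (b3 \<cdot> k) \<cdot> a2" unfolding ab4(5)[symmetric] using b3(1-3) ka w ab2(1) by simp
    also have "\<dots> = h \<cdot> b" unfolding b3(4) ab2(5) ..
    finally have b4a5: "h \<cdot> b = b4 \<cdot> ?a5" by (rule sym)
    have "?a5 \<cdot> a = a4 \<cdot> (k \<cdot> ?w)" using ab4(1) ka w ab2(1) D2 D4 ab(1) by simp
    then have a5a: "?a5 \<cdot> a = Zer T (Dom T q) (Cod T a4)"
      unfolding tri_comp_zero(1)[OF tk] using ab4(1) ka w D4 q by simp
    obtain a6 a7 where t5: "(?a5, a6, a7) \<in> Tri T" using ex_tri a5(1) by blast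
    note a67 = tri_arr[OF t5]
    have eS: "Cod T a6 \<in> S" by (rule tri_subcatD(5)[OF S t5]) (use a5 ab(4) ab4(4) in simp_all)
    \<comment> \<open>the lift of \<open>b\<close>, on the suspension of the fibre of \<open>a5\<close>; rotating the triangles introduces a sign\<close>
    obtain \<theta> where \<theta>: "\<theta> \<in> Arr T" "Dom T \<theta> = Cod T a6" "Cod T \<theta> = Cod T (neg_arr T (Sm f))"
        "Sm b \<cdot> a7 = neg_arr T (Sm g) \<cdot> \<theta>"
      using tri_morphism[OF t5 tri_rotate[OF tri_rotate[OF t]] ab(2) _ _ ab4(2) _ _ b4a5[symmetric]]
        a5 ab(3) D ab4(3) D4 ta by (metis)
    have \<theta>c: "Cod T \<theta> = Sh (Cod T f)" using \<theta>(3) ta by simp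
    have Sa: "Sm a \<in> Arr T" "Dom T (Sm a) = Sh (Dom T q)" "Cod T (Sm a) = Sh (Cod T a)" using ab(1) D by simp_all
    have "Sm ?a5 \<cdot> Sm a = Sm (Zer T (Dom T q) (Cod T a4))"
      by (rule additive_endo_comp[OF Shift_additive a5a]) (use a5 ab(1) in simp_all)
    then have s0: "Sm ?a5 \<cdot> Sm a = Zer T (Sh (Dom T q)) (Sh (Cod T a4))" using q ab4(1) by simp
    have S5: "Sm ?a5 \<in> Arr T" "Dom T (Sm ?a5) = Sh (Cod T a)" "Cod T (Sm ?a5) = Sh (Cod T a4)"
      using additive_endo_arr(3-5)[OF Shift_additive a5(1)] a5 by simp_all
    have "neg_arr T (Sm ?a5) \<cdot> Sm a = neg_arr T (Sm ?a5 \<cdot> Sm a)" by (rule comp_neg(2)) (use S5 Sa in simp_all)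
    then have "neg_arr T (Sm ?a5) \<cdot> Sm a = Zer T (Dom T (Sm a)) (Cod T (neg_arr T (Sm ?a5)))"
      unfolding s0 using S5 Sa q(1) ab4(1) by simp
    moreover have "Cod T (Sm a) = Cod T a7" using Sa a67 a5 by simp
    ultimately obtain l where l: "l \<in> Arr T" "Dom T l = Dom T (Sm a)" "Cod T l = Dom T a7" "a7 \<cdot> l = Sm a"
      using tri_lift[OF tri_rotate[OF tri_rotate[OF t5]] Sa(1)] by metis
    have \<theta>l: "\<theta> \<cdot> l \<in> Arr T" "Dom T (\<theta> \<cdot> l) = Sh (Dom T q)" "Cod T (\<theta> \<cdot> l) = Sh (Cod T f)"
      using \<theta>(1,2) \<theta>c l(1-3) Sa a67 by simp_all
    obtain m' where m': "m' \<in> Arr T" "Dom T m' = Dom T q" "Cod T m' = Cod T f" "\<theta> \<cdot> l = Sm m'"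
      using Shift_full[OF _ _ \<theta>l] q(1) ta by (metis Dom_in_Ob Cod_in_Ob)
    have "factors_through S (Sm m')" unfolding m'(4)[symmetric]
      by (rule factors_comp_left[OF factors_through_member(1)]) (use l \<theta>(1,2) eS a67 in simp_all)
    then have fm': "factors_through S m'" using factors_Shift_iff[OF S m'(1)] by blast
    \<comment> \<open>because of that sign the sum, not the difference, is killed by \<open>g\<close>\<close>
    let ?m = "Plus T m' q"
    have m: "?m \<in> Arr T" "Dom T ?m = Dom T q" "Cod T ?m = Cod T f" using m'(1-3) q by simp_all
    have "neg_arr T (Sm (g \<cdot> m')) = neg_arr T (Sm g) \<cdot> (\<theta> \<cdot> l)"
      unfolding m'(4) using m'(1-3) ta by simp
    also have "\<dots> = (Sm b \<cdot> a7) \<cdot> l"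
      unfolding \<theta>(4) by (rule comp_assoc[symmetric]) (use \<theta>(1,2) \<theta>c l(1-3) ta a67 in simp_all)
    also have "\<dots> = Sm b \<cdot> (a7 \<cdot> l)" by (rule comp_assoc) (use ab(1-3) l(1-3) a67 a5 in simp_all)
    also have "\<dots> = Sm (b \<cdot> a)" unfolding l(4) using ab(1-3) by simp
    also have "\<dots> = Sm (g \<cdot> q)" unfolding ab(5) ..
    finally have "Sm (neg_arr T (g \<cdot> m')) = Sm (g \<cdot> q)" using m'(1-3) ta by simp
    then have n: "neg_arr T (g \<cdot> m') = g \<cdot> q" by (rule Shift_faithful[rotated -1]) (use m'(1-3) q ta in simp_all)
    have "g \<cdot> ?m = Plus T (g \<cdot> m') (g \<cdot> q)" using m'(1-3) q ta by simp
    then have "g \<cdot> ?m = Zer T (Dom T ?m) (Cod T g)" unfolding n[symmetric] using m'(1-3) q ta m by simp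
    then obtain y where y: "y \<in> Arr T" "Dom T y = Dom T ?m" "Cod T y = Dom T f" "f \<cdot> y = ?m"
      using tri_lift[OF t m(1,3)] by metis
    have "factors_through S y" by (rule compactly_reachedD[OF x]) (use y m q in simp_all)
    then have fm: "factors_through S ?m" unfolding y(4)[symmetric] by (rule factors_comp_left) (use y ta in simp_all)
    have "factors_through S (sub ?m m')"
      by (rule factors_plus[OF S fm factors_neg[OF fm']]) (use m m' in simp_all)
    moreover have "sub ?m m' = q" using m'(1-3) q by simp
    ultimately show ?thesis by simp
  qed
  then show ?thesis unfolding compactly_reached_def using ta by simp
qed

text \<open>
  By compactness only a finite part of the coproduct matters, and sums of arrows that factor through \<open>S\<close>
  do so through a biproduct.
\<close>

lemma compactly_reached_coproduct:
  assumes S: "tri_subcat T S" and cp: "is_coproduct T (I :: 'u set) x s \<iota>" and I: "small U I" "I \<subseteq> U"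
    and x: "\<And>i. i \<in> I \<Longrightarrow> x i \<in> compactly_reached S"
  shows "s \<in> compactly_reached S"
proof -
  note k = coproduct_arr[OF cp]
  obtain p where p: "\<And>i. i \<in> I \<Longrightarrow> p i \<in> Arr T" "\<And>i. i \<in> I \<Longrightarrow> Dom T (p i) = s" "\<And>i. i \<in> I \<Longrightarrow> Cod T (p i) = x i"
      "\<And>i. i \<in> I \<Longrightarrow> p i \<cdot> \<iota> i = Ide T (x i)"
      "\<And>i j. i \<in> I \<Longrightarrow> j \<in> I \<Longrightarrow> i \<noteq> j \<Longrightarrow> p i \<cdot> \<iota> j = Zer T (x j) (x i)"
    by (rule coproduct_projections[OF cp], rule that; blast)
  have "factors_through S f" if f: "f \<in> Arr T" "Dom T f \<in> compacts U T" "Cod T f = s" for f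
  proof -
    have *: "\<exists>e. is_part I s \<iota> J e \<and> factors_through S (e \<cdot> f)" if "finite J" "J \<subseteq> I" for J
      using that
    proof (induction J)
      case empty
      obtain e where e: "is_part I s \<iota> {} e" using ex_part[OF cp] .
      have "e \<cdot> f = Zer T (Dom T f) s" using part_empty[OF e cp] f k by simp
      then show ?case using e factors_zero[OF S, of "Dom T f" s] f k by auto
    next
      case (insert j J)
      then obtain e where e: "is_part I s \<iota> J e" "factors_through S (e \<cdot> f)" by auto
      have j: "j \<in> I" using insert by blast
      note ea = part_arr[OF e(1)]
      have "factors_through S (p j \<cdot> f)" by (rule compactly_reachedD[OF x[OF j]]) (use f p(1-3)[OF j] in simp_all)
      then have 1: "factors_through S (\<iota> j \<cdot> (p j \<cdot> f))" by (rule factors_comp_left) (use f p(1-3)[OF j] k j in simp_all)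
      have "factors_through S (Plus T (e \<cdot> f) (\<iota> j \<cdot> (p j \<cdot> f)))"
        by (rule factors_plus[OF S e(2) 1]) (use ea f p(1-3)[OF j] k j in simp_all)
      then have "factors_through S (Plus T e (\<iota> j \<cdot> p j) \<cdot> f)" using ea f p(1-3)[OF j] k j by simp
      then show ?case
        using part_insert[OF cp e(1) j insert.hyps(2) p(1-3)[OF j] p(4)[OF j] p(5)[OF j]] by blast
    qed
    obtain J e where J: "finite J" "J \<subseteq> I" "is_part I s \<iota> J e" "e \<cdot> f = f" using compactD[OF f(2) I(2,1) cp f(1) refl f(3)] .
    then show ?thesis using *[OF J(1,2)] part_unique[OF cp J(3)] by metis
  qed
  then show ?thesis unfolding compactly_reached_def using k by simp
qed

lemma compactly_reached_localizing:
  assumes S: "tri_subcat T S" and Sc: "S \<subseteq> compacts U T"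
  shows "localizing U T (compactly_reached S)"
  unfolding localizing_def tri_subcat_def
proof (intro conjI allI impI ballI)
  show "compactly_reached S \<subseteq> Ob T" unfolding compactly_reached_def by blast
  show "z \<in> compactly_reached S" if "zero_ob T z" for z
    using tri_subcatD(2)[OF S that] that factors_through_member(1) unfolding compactly_reached_def by auto
  show "y \<in> compactly_reached S" if "x \<in> compactly_reached S" "isomorphic T x y" for x y
    using compactly_reached_isomorphic that by blast
  show "Sh x \<in> compactly_reached S \<longleftrightarrow> x \<in> compactly_reached S" if "x \<in> Ob T" for x
    using compactly_reached_Shift[OF S that] .
  show "Cod T g \<in> compactly_reached S"
    if t: "(f, g, h) \<in> Tri T" and "Dom T f \<in> compactly_reached S" "Cod T f \<in> compactly_reached S" for f g h
    using compactly_reached_middle[OF S Sc tri_rotate[OF t]] that tri_arr[OF t]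
      compactly_reached_Shift[OF S, of "Dom T f"] by simp
  show "s \<in> compactly_reached S"
    if "I \<subseteq> U" "small U I" "\<forall>i\<in>I. x i \<in> compactly_reached S" "is_coproduct T I x s \<iota>" for I x s \<iota>
    using compactly_reached_coproduct[OF S that(4,2,1)] that(3) by blast
qed

text \<open>Neeman's theorem, applied to the identity of \<open>c\<close>.\<close>

lemma compact_in_Loc:
  assumes S: "tri_subcat T S" "S \<subseteq> compacts U T" and A: "A \<subseteq> S"
    and c: "c \<in> compacts U T" "c \<in> Loc U T A"
  obtains s where "s \<in> S" "is_retract T c s"
proof -
  have "A \<subseteq> compactly_reached S"
    using A tri_subcatD(1)[OF S(1)] factors_through_member(1) unfolding compactly_reached_def by blast
  then have "c \<in> compactly_reached S" using Loc_least[OF compactly_reached_localizing[OF S]] c(2) by blast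
  then have "factors_through S (Ide T c)" using compactly_reachedD[of c S "Ide T c"] c(1) by simp
  then obtain u v where uv: "u \<in> Arr T" "v \<in> Arr T" "Cod T u = Dom T v" "Cod T u \<in> S" "Ide T c = v \<cdot> u"
    unfolding factors_through_def by blast
  have D: "Dom T u = c" "Cod T v = c"
    using uv(1-3) arg_cong[OF uv(5), of "Dom T"] arg_cong[OF uv(5), of "Cod T"] c(1) by simp_all
  then show ?thesis using that[OF uv(4)] is_retractI[of u v] uv by simp
qed

lemma generators:
  obtains G where "G \<subseteq> compacts U T" "small U G" "Loc U T G = Ob T"
proof -
  have "\<exists>G. G \<subseteq> compacts U T \<and> small U G \<and> Loc U T G = Ob T"
    using rcg unfolding rigidly_compactly_generated_def by (elim conjE)
  then show ?thesis using that by blast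
qed

lemma small_Hom: "x \<in> Ob T \<Longrightarrow> y \<in> Ob T \<Longrightarrow> small U (Hom T x y)"
proof -
  have "\<forall>x\<in>Ob T. \<forall>y\<in>Ob T. small U (Hom T x y)"
    using rcg unfolding rigidly_compactly_generated_def by (elim conjE)
  then show "x \<in> Ob T \<Longrightarrow> y \<in> Ob T \<Longrightarrow> small U (Hom T x y)" by simp
qed

text \<open>
  Close a small set of objects countably many times under suspensions, chosen desuspensions and chosen
  cones of all arrows between objects obtained so far. The set stays small because hom-sets are small.
\<close>

lemma small_skeleton_of_tri_subcat:
  assumes G: "small U G" "G \<subseteq> S0" and S0: "tri_subcat T S0"
  obtains R where "small U R" "R \<subseteq> S0" "tri_subcat T {x. \<exists>r\<in>R. isomorphic T x r}"
    "G \<subseteq> {x. \<exists>r\<in>R. isomorphic T x r}"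
proof -
  have "\<forall>y\<in>Ob T. \<exists>x. x \<in> Ob T \<and> isomorphic T (Sh x) y" using desuspension by metis
  then obtain ds where ds: "\<And>y. y \<in> Ob T \<Longrightarrow> ds y \<in> Ob T \<and> isomorphic T (Sh (ds y)) y" by metis
  have "\<forall>f\<in>Arr T. \<exists>c g h. (f, g, h) \<in> Tri T \<and> Cod T g = c" using ex_tri by blast
  then have "\<exists>cn. \<forall>f\<in>Arr T. \<exists>g h. (f, g, h) \<in> Tri T \<and> Cod T g = cn f" by (rule bchoice)
  then obtain cn where cn: "\<And>f. f \<in> Arr T \<Longrightarrow> \<exists>g h. (f, g, h) \<in> Tri T \<and> Cod T g = cn f" by blast
  obtain z where z: "zero_ob T z" using ex_zero_ob by blast
  define step where "step A = A \<union> (Sh ` A \<union> (ds ` A \<union> cn ` (\<Union>x\<in>A. \<Union>y\<in>A. Hom T x y)))" for A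
  define Rn where "Rn = rec_nat (insert z G) (\<lambda>n A. step A)"
  have Rn0: "Rn 0 = insert z G" and RnS: "Rn (Suc n) = step (Rn n)" for n unfolding Rn_def by simp_all
  have S0O: "S0 \<subseteq> Ob T" using tri_subcatD(1)[OF S0] .
  have Rsub: "Rn n \<subseteq> S0" for n
  proof (induction n)
    case 0 show ?case unfolding Rn0 using G(2) tri_subcatD(2)[OF S0 z] by blast
  next
    case (Suc n)
    have "Sh x \<in> S0" "ds x \<in> S0" if "x \<in> Rn n" for x
    proof -
      have x: "x \<in> S0" "x \<in> Ob T" using that Suc S0O by auto
      show "Sh x \<in> S0" using tri_subcatD(4)[OF S0 x(2)] x by blast
      have "Sh (ds x) \<in> S0" using tri_subcatD(3)[OF S0 x(1)] isomorphic_sym ds[OF x(2)] by blast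
      then show "ds x \<in> S0" using tri_subcatD(4)[OF S0] ds[OF x(2)] by blast
    qed
    moreover have "cn f \<in> S0" if "x \<in> Rn n" "y \<in> Rn n" "f \<in> Hom T x y" for x y f
    proof -
      have f: "f \<in> Arr T" "Dom T f = x" "Cod T f = y" using that by (auto simp: Hom_iff)
      obtain g h where t: "(f, g, h) \<in> Tri T" "Cod T g = cn f" using cn[OF f(1)] by blast
      have "Cod T g \<in> S0" by (rule tri_subcatD(5)[OF S0 t(1)]) (use f(2,3) that Suc in auto)
      then show ?thesis using t(2) by simp
    qed
    ultimately show ?case unfolding RnS step_def using Suc by blast
  qed
  have Rsm: "small U (Rn n)" for n
  proof (induction n)
    case 0
    have "small U ({z} \<union> G)" by (rule small_Un[OF universe small_finite[OF universe] G(1)]) simp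
    then show ?case unfolding Rn0 by simp
  next
    case (Suc n)
    have O: "x \<in> Ob T" if "x \<in> Rn n" for x using that Rsub S0O by blast
    have "small U (\<Union>x\<in>Rn n. \<Union>y\<in>Rn n. Hom T x y)"
      by (rule small_UN[OF universe Suc], rule small_UN[OF universe Suc], rule small_Hom) (use O in auto)
    then show ?case unfolding RnS step_def
      by (intro small_Un[OF universe] small_image Suc)
  qed
  define R where "R = (\<Union>n. Rn n)"
  let ?S = "{x. \<exists>r\<in>R. isomorphic T x r}"
  have RS0: "R \<subseteq> S0" unfolding R_def using Rsub by blast
  have Rsmall: "small U R" unfolding R_def by (rule small_UN[OF universe small_nat[OF universe] Rsm])
  have up: "Rn n \<subseteq> Rn (Suc n)" for n unfolding RnS step_def by blast
  have mono: "Rn n \<subseteq> Rn m" if "n \<le> m" for n m using lift_Suc_mono_le[of Rn, OF up that] .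
  have RSh: "Sh r \<in> R" "ds r \<in> R" if r: "r \<in> R" for r
  proof -
    obtain n where "r \<in> Rn n" using r unfolding R_def by blast
    then have "Sh r \<in> Rn (Suc n)" "ds r \<in> Rn (Suc n)" unfolding RnS step_def by blast+
    then show "Sh r \<in> R" "ds r \<in> R" unfolding R_def by blast+
  qed
  have Rcn: "cn f \<in> R" if f: "f \<in> Arr T" "Dom T f \<in> R" "Cod T f \<in> R" for f
  proof -
    obtain n m where "Dom T f \<in> Rn n" "Cod T f \<in> Rn m" using f unfolding R_def by blast
    then have "Dom T f \<in> Rn (max n m)" "Cod T f \<in> Rn (max n m)"
      using mono[of n "max n m"] mono[of m "max n m"] by auto
    moreover have "f \<in> Hom T (Dom T f) (Cod T f)" using f by (simp add: Hom_iff)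
    ultimately have "cn f \<in> Rn (Suc (max n m))" unfolding RnS step_def by blast
    then show ?thesis unfolding R_def by blast
  qed
  have RO: "R \<subseteq> Ob T" using RS0 S0O by blast
  have "tri_subcat T ?S"
    unfolding tri_subcat_def
  proof (intro conjI allI impI ballI)
    show "?S \<subseteq> Ob T" using isomorphic_in_Ob by blast
    have "z \<in> R" unfolding R_def using Rn0 by blast
    then show "z' \<in> ?S" if "zero_ob T z'" for z' using isomorphic_zero_ob[OF that z] by blast
    show "y \<in> ?S" if "x \<in> ?S" "isomorphic T x y" for x y
      using that isomorphic_trans isomorphic_sym by blast
    show "Sh x \<in> ?S \<longleftrightarrow> x \<in> ?S" if x: "x \<in> Ob T" for x
    proof
      assume "x \<in> ?S"
      then obtain r where "r \<in> R" "isomorphic T x r" by blast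
      then show "Sh x \<in> ?S" using RSh(1) additive_endo_isomorphic[OF Shift_additive] by blast
    next
      assume "Sh x \<in> ?S"
      then obtain r where r: "r \<in> R" "isomorphic T (Sh x) r" by blast
      then have "r \<in> Ob T" using RO by blast
      then have "isomorphic T (Sh x) (Sh (ds r))" using r ds isomorphic_sym isomorphic_trans by blast
      then have "isomorphic T x (ds r)" using Shift_reflects_isomorphic x ds \<open>r \<in> Ob T\<close> by blast
      then show "x \<in> ?S" using RSh(2)[OF r(1)] by blast
    qed
    show "Cod T g \<in> ?S" if t: "(f, g, h) \<in> Tri T" and fS: "Dom T f \<in> ?S" "Cod T f \<in> ?S" for f g h
    proof -
      note ta = tri_arr[OF t]
      obtain r r' where r: "r \<in> R" "isomorphic T (Dom T f) r" "r' \<in> R" "isomorphic T (Cod T f) r'"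
        using fS by blast
      obtain a where a: "iso_arr T a" "a \<in> Arr T" "Dom T a = Dom T f" "Cod T a = r" using r(2) by (rule isomorphicE)
      obtain b where b: "iso_arr T b" "b \<in> Arr T" "Dom T b = Cod T f" "Cod T b = r'" using r(4) by (rule isomorphicE)
      obtain a' where a': "a' \<in> Arr T" "Dom T a' = r" "Cod T a' = Dom T f" "a' \<cdot> a = Ide T (Dom T f)"
        using iso_arrE[OF a(1)] a(3,4) by metis
      let ?f = "b \<cdot> (f \<cdot> a')"
      have f': "?f \<in> Arr T" "Dom T ?f = r" "Cod T ?f = r'" using ta a' b by simp_all
      obtain g' h' where t': "(?f, g', h') \<in> Tri T" "Cod T g' = cn ?f" using cn[OF f'(1)] by blast
      have "isomorphic T (Cod T g) (Cod T g')"
      proof (rule cone_isomorphic[OF t t'(1) a(1,3) _ b(1,3)])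
        show "b \<cdot> f = ?f \<cdot> a" using ta a(2-4) a' b(2-4) by simp
      qed (use a b f' in simp_all)
      moreover have "cn ?f \<in> R" using Rcn[OF f'(1)] f'(2,3) r by simp
      ultimately show ?thesis using t'(2) by auto
    qed
  qed
  moreover have "G \<subseteq> ?S"
  proof
    fix x assume "x \<in> G"
    then have "x \<in> R" unfolding R_def using Rn0 by blast
    then show "x \<in> ?S" using isomorphic_refl RO by blast
  qed
  ultimately show ?thesis using that[OF Rsmall RS0] by blast
qed

lemma isomorphic_of_same_idempotent:
  assumes i: "i \<in> Arr T" "Dom T i = c" "Cod T i = r" and p: "p \<in> Arr T" "Dom T p = r" "Cod T p = c"
    and pi: "p \<cdot> i = Ide T c"
    and j: "j \<in> Arr T" "Dom T j = d" "Cod T j = r" and q: "q \<in> Arr T" "Dom T q = r" "Cod T q = d"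
    and qj: "q \<cdot> j = Ide T d" and e: "i \<cdot> p = j \<cdot> q"
  shows "isomorphic T c d"
proof -
  have "(p \<cdot> j) \<cdot> (q \<cdot> i) = p \<cdot> ((j \<cdot> q) \<cdot> i)" using i p j q by simp
  also have "\<dots> = p \<cdot> (i \<cdot> (p \<cdot> i))" unfolding e[symmetric] using i p by simp
  also have "\<dots> = Ide T c" unfolding pi using i pi by simp
  finally have 1: "(p \<cdot> j) \<cdot> (q \<cdot> i) = Ide T c" .
  have "(q \<cdot> i) \<cdot> (p \<cdot> j) = q \<cdot> ((i \<cdot> p) \<cdot> j)" using i p j q by simp
  also have "\<dots> = q \<cdot> (j \<cdot> (q \<cdot> j))" unfolding e using j q by simp
  also have "\<dots> = Ide T d" unfolding qj using j qj by simp
  finally have 2: "(q \<cdot> i) \<cdot> (p \<cdot> j) = Ide T d" .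
  have "iso_arr T (q \<cdot> i)" by (rule iso_arrI[of _ "p \<cdot> j"]) (use 1 2 i p j q in simp_all)
  then show ?thesis using isomorphicI[of "q \<cdot> i"] i q by simp
qed

text \<open>
  Every compact object is a retract of an object of a small skeleton of the triangulated subcategory
  generated by the generators, and is determined up to isomorphism by the corresponding
  idempotent; there is only a small set of those.
\<close>

lemma compacts_essentially_small:
  obtains K where "K \<subseteq> compacts U T" "small U K" "\<And>c. c \<in> compacts U T \<Longrightarrow> \<exists>k\<in>K. isomorphic T c k"
proof -
  obtain G where G: "G \<subseteq> compacts U T" "small U G" "Loc U T G = Ob T" using generators .
  obtain R where R: "small U R" "R \<subseteq> compacts U T" "tri_subcat T {x. \<exists>r\<in>R. isomorphic T x r}"
    "G \<subseteq> {x. \<exists>r\<in>R. isomorphic T x r}"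
    using small_skeleton_of_tri_subcat[OF G(2,1) tri_subcat_compacts] .
  let ?S = "{x. \<exists>r\<in>R. isomorphic T x r}"
  have Sc: "?S \<subseteq> compacts U T" using R(2) compact_isomorphic isomorphic_sym by blast
  \<comment> \<open>\<open>e\<close> is an idempotent of \<open>r\<close> with image the compact object \<open>c\<close>\<close>
  define splits where "splits c r e \<longleftrightarrow> c \<in> compacts U T \<and> (\<exists>i p. i \<in> Arr T \<and> Dom T i = c \<and> Cod T i = r \<and>
    p \<in> Arr T \<and> Dom T p = r \<and> Cod T p = c \<and> p \<cdot> i = Ide T c \<and> e = i \<cdot> p)" for c r e
  define E where "E = {e \<in> (\<Union>r\<in>R. Hom T r r). \<exists>c. splits c (Dom T e) e}"
  define rep where "rep e = (SOME c. splits c (Dom T e) e)" for e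
  have rep: "splits (rep e) (Dom T e) e" if "e \<in> E" for e
    using that unfolding E_def rep_def by (metis (mono_tags, lifting) mem_Collect_eq someI_ex)
  have "small U (\<Union>r\<in>R. Hom T r r)"
    by (rule small_UN[OF universe R(1)], rule small_Hom) (use R(2) compacts_Ob in auto)
  then have "small U (rep ` E)" using small_image small_subset[of U _ E] unfolding E_def by blast
  moreover have "rep ` E \<subseteq> compacts U T" using rep unfolding splits_def by blast
  moreover have "\<exists>k\<in>rep ` E. isomorphic T c k" if c: "c \<in> compacts U T" for c
  proof -
    have "c \<in> Loc U T G" using c G(3) by simp
    then obtain s where s: "s \<in> ?S" "is_retract T c s" using compact_in_Loc[OF R(3) Sc R(4) c] by blast
    then obtain r where r: "r \<in> R" "isomorphic T s r" by blast
    have "is_retract T c r" using is_retract_trans[OF s(2) isomorphic_is_retract[OF r(2)]] .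
    then obtain i p where ip: "i \<in> Arr T" "Dom T i = c" "Cod T i = r" "p \<in> Arr T" "Dom T p = r"
      "Cod T p = c" "p \<cdot> i = Ide T c" by (rule is_retractE)
    let ?e = "i \<cdot> p"
    have e: "?e \<in> Arr T" "Dom T ?e = r" "Cod T ?e = r" using ip by simp_all
    have "splits c (Dom T ?e) ?e" unfolding splits_def e(2) using c ip by blast
    then have eE: "?e \<in> E" unfolding E_def using r(1) e by (auto simp: Hom_iff)
    obtain j q where jq: "j \<in> Arr T" "Dom T j = rep ?e" "Cod T j = r" "q \<in> Arr T" "Dom T q = r"
      "Cod T q = rep ?e" "q \<cdot> j = Ide T (rep ?e)" "?e = j \<cdot> q"
      using rep[OF eE] unfolding splits_def e(2) by blast
    have "isomorphic T c (rep ?e)"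
      by (rule isomorphic_of_same_idempotent[OF ip jq])
    then show ?thesis using eE by blast
  qed
  ultimately show ?thesis using that by blast
qed

section \<open>Existence of Rickard triangles\<close>

lemma localizing_tensor_right:
  assumes "localizing U T S" "a \<in> Ob T"
  shows "localizing U T {x \<in> Ob T. x \<boxtimes> a \<in> S}"
  using localizing_preimage[OF tensor_exact(2) tensor_preserves_coproducts(2) assms(1)] assms(2) by simp

text \<open>
  The objects \<open>x\<close> with \<open>c \<otimes> x\<close> in a localizing subcategory form a localizing subcategory. This is
  applied first in the second variable, for a compact \<open>c\<close>, and then in the first one, where the
  compact objects generate everything.
\<close>

lemma Loc_tensor_ideal:
  assumes A: "A \<subseteq> Ob T" and ideal: "\<And>c a. c \<in> compacts U T \<Longrightarrow> a \<in> A \<Longrightarrow> c \<boxtimes> a \<in> Loc U T A"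
    and x: "x \<in> Loc U T A" and y: "y \<in> Ob T"
  shows "y \<boxtimes> x \<in> Loc U T A"
proof -
  note L = localizing_Loc[OF A]
  have xO: "x \<in> Ob T" using x tri_subcatD(1)[OF localizing_tri[OF L]] by blast
  obtain G where G: "G \<subseteq> compacts U T" "Loc U T G = Ob T" using generators by metis
  have "c \<boxtimes> x \<in> Loc U T A" if c: "c \<in> compacts U T" for c
  proof -
    have "A \<subseteq> {x \<in> Ob T. c \<boxtimes> x \<in> Loc U T A}" using A ideal c by blast
    then have "Loc U T A \<subseteq> {x \<in> Ob T. c \<boxtimes> x \<in> Loc U T A}"
      using Loc_least localizing_tensor[OF L] c by simp
    then show ?thesis using x by blast
  qed
  then have "G \<subseteq> {y \<in> Ob T. y \<boxtimes> x \<in> Loc U T A}" using G(1) by auto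
  then have "Loc U T G \<subseteq> {y \<in> Ob T. y \<boxtimes> x \<in> Loc U T A}"
    using Loc_least localizing_tensor_right[OF L xO] by blast
  then show ?thesis using G(2) y by blast
qed

lemma thick_idealD:
  assumes "thick_ideal U T J"
  shows "J \<subseteq> compacts U T" "tri_subcat T J" "y \<in> J \<Longrightarrow> x \<in> compacts U T \<Longrightarrow> is_retract T x y \<Longrightarrow> x \<in> J"
    "a \<in> compacts U T \<Longrightarrow> x \<in> J \<Longrightarrow> a \<boxtimes> x \<in> J"
  using assms unfolding thick_ideal_def by blast+

lemma Loc_thick_ideal:
  assumes J: "thick_ideal U T J" and x: "x \<in> Loc U T J" and y: "y \<in> Ob T"
  shows "y \<boxtimes> x \<in> Loc U T J" "x \<boxtimes> y \<in> Loc U T J"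
proof -
  have JO: "J \<subseteq> Ob T" using thick_idealD(1)[OF J] by auto
  show 1: "y \<boxtimes> x \<in> Loc U T J"
    by (rule Loc_tensor_ideal[OF JO _ x y]) (use thick_idealD(4)[OF J] Loc_incl in blast)
  have L: "tri_subcat T (Loc U T J)" using localizing_Loc[OF JO] localizing_tri by blast
  have "x \<in> Ob T" using x tri_subcatD(1)[OF L] by blast
  then show "x \<boxtimes> y \<in> Loc U T J" using tri_subcatD(3)[OF L 1] tensor_comm_isomorphic y by blast
qed

lemma compact_in_Loc_thick_ideal:
  assumes J: "thick_ideal U T J" and c: "c \<in> compacts U T" "c \<in> Loc U T J"
  shows "c \<in> J"
proof -
  obtain s where "s \<in> J" "is_retract T c s"
    using compact_in_Loc[OF thick_idealD(2)[OF J] thick_idealD(1)[OF J] subset_refl c] .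
  then show ?thesis using thick_idealD(3)[OF J] c(1) by blast
qed

lemma left_orthogonal_localizing:
  assumes NO: "N \<subseteq> Ob T" and iso: "\<And>x y. x \<in> N \<Longrightarrow> isomorphic T x y \<Longrightarrow> y \<in> N"
    and Sh: "\<And>x. x \<in> Ob T \<Longrightarrow> Sh x \<in> N \<longleftrightarrow> x \<in> N"
  shows "localizing U T {x \<in> Ob T. \<forall>f. f \<in> Arr T \<longrightarrow> Dom T f = x \<longrightarrow> Cod T f \<in> N \<longrightarrow> f = Zer T x (Cod T f)}"
    (is "localizing U T ?S")
proof -
  have SD: "f = Zer T x (Cod T f)" if "x \<in> ?S" "f \<in> Arr T" "Dom T f = x" "Cod T f \<in> N" for x f using that by blast
  have ShS: "Sh x \<in> ?S \<longleftrightarrow> x \<in> ?S" if x: "x \<in> Ob T" for x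
  proof
    assume S: "Sh x \<in> ?S"
    have "f = Zer T x (Cod T f)" if f: "f \<in> Arr T" "Dom T f = x" "Cod T f \<in> N" for f
    proof -
      have "Sm f = Zer T (Sh x) (Cod T (Sm f))" by (rule SD[OF S]) (use f Sh in simp_all)
      then have "Sm f = Sm (Zer T x (Cod T f))" using f x by simp
      then show ?thesis by (rule Shift_faithful[rotated -1]) (use f x in simp_all)
    qed
    then show "x \<in> ?S" using x by blast
  next
    assume S: "x \<in> ?S"
    have "f = Zer T (Sh x) (Cod T f)" if f: "f \<in> Arr T" "Dom T f = Sh x" "Cod T f \<in> N" for f
    proof -
      obtain w where w: "w \<in> Ob T" "isomorphic T (Sh w) (Cod T f)" using desuspension[of "Cod T f"] f(1) by auto
      have wN: "w \<in> N" using iso[OF f(3) isomorphic_sym[OF w(2)]] Sh[OF w(1)] by blast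
      obtain e where e: "iso_arr T e" "e \<in> Arr T" "Dom T e = Sh w" "Cod T e = Cod T f" using w(2) by (rule isomorphicE)
      obtain e' where e': "e' \<in> Arr T" "Dom T e' = Cod T f" "Cod T e' = Sh w" "e \<cdot> e' = Ide T (Cod T f)"
        using iso_arrE[OF e(1)] e(3,4) by metis
      have "e' \<cdot> f \<in> Arr T" "Dom T (e' \<cdot> f) = Sh x" "Cod T (e' \<cdot> f) = Sh w" using e' f by simp_all
      then obtain g where g: "g \<in> Arr T" "Dom T g = x" "Cod T g = w" "e' \<cdot> f = Sm g" using Shift_full[OF x w(1)] by metis
      have g0: "g = Zer T x w" using SD[OF S g(1,2)] g(3) wN by simp
      have "f = e \<cdot> (e' \<cdot> f)" using comp_reduce[OF e'(4), of f] e(2-4) e'(1-3) f by simp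
      also have "\<dots> = Zer T (Sh x) (Cod T f)" unfolding g(4) g0 using x w(1) e(2-4) by simp
      finally show ?thesis .
    qed
    then show "Sh x \<in> ?S" using x by simp
  qed
  show ?thesis
    unfolding localizing_def tri_subcat_def
  proof (intro conjI allI impI ballI)
    show "?S \<subseteq> Ob T" by blast
    show "z \<in> ?S" if "zero_ob T z" for z using from_zero[OF that] that by auto
    show "y \<in> ?S" if xS: "x \<in> ?S" and xy': "isomorphic T x y" for x y
    proof -
      obtain e where e: "iso_arr T e" "e \<in> Arr T" "Dom T e = x" "Cod T e = y" using xy' by (rule isomorphicE)
      obtain e' where e': "e' \<in> Arr T" "Dom T e' = y" "Cod T e' = x" "e \<cdot> e' = Ide T y"
        using iso_arrE[OF e(1)] e(3,4) by metis
      have xy: "x \<in> Ob T" "y \<in> Ob T" using isomorphic_in_Ob[OF xy'] by auto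
      have "f = Zer T y (Cod T f)" if f: "f \<in> Arr T" "Dom T f = y" "Cod T f \<in> N" for f
      proof -
        have f0: "f \<cdot> e = Zer T x (Cod T f)" using SD[OF xS, of "f \<cdot> e"] f e by simp
        have "f = (f \<cdot> e) \<cdot> e'" using e(2-4) e' f by simp
        also have "\<dots> = Zer T y (Cod T f)" unfolding f0 using e' f xy by simp
        finally show ?thesis .
      qed
      then show ?thesis using xy by blast
    qed
    show "Sh x \<in> ?S \<longleftrightarrow> x \<in> ?S" if "x \<in> Ob T" for x using ShS[OF that] .
    show "Cod T g \<in> ?S" if t: "(f, g, h) \<in> Tri T" and S: "Dom T f \<in> ?S" "Cod T f \<in> ?S" for f g h
    proof -
      note ta = tri_arr[OF t]
      have "q = Zer T (Cod T g) (Cod T q)" if q: "q \<in> Arr T" "Dom T q = Cod T g" "Cod T q \<in> N" for q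
      proof -
        have "q \<cdot> g = Zer T (Dom T g) (Cod T q)" using SD[OF S(2), of "q \<cdot> g"] q ta by simp
        then obtain v where v: "v \<in> Arr T" "Dom T v = Cod T h" "Cod T v = Cod T q" "v \<cdot> h = q"
          using tri_extend[OF tri_rotate[OF t] q(1,2)] by metis
        have "Sh (Dom T f) \<in> ?S" using ShS[of "Dom T f"] S ta by blast
        then have v0: "v = Zer T (Sh (Dom T f)) (Cod T q)" using SD[of "Sh (Dom T f)" v] v q ta by simp
        have "q = Zer T (Sh (Dom T f)) (Cod T q) \<cdot> h" using v(4) unfolding v0 by simp
        also have "\<dots> = Zer T (Cod T g) (Cod T q)" using ta q by simp
        finally show ?thesis .
      qed
      then show ?thesis using ta by simp
    qed
    show "s \<in> ?S" if I: "I \<subseteq> U" "small U I" "\<forall>i\<in>I. x i \<in> ?S" and cp: "is_coproduct T I x s \<iota>" for I x s \<iota>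
    proof -
      note k = coproduct_arr[OF cp]
      have "f = Zer T s (Cod T f)" if f: "f \<in> Arr T" "Dom T f = s" "Cod T f \<in> N" for f
      proof (rule coproduct_eq[OF cp])
        fix i assume i: "i \<in> I"
        have "f \<cdot> \<iota> i = Zer T (x i) (Cod T f)" using SD[of "x i" "f \<cdot> \<iota> i"] I(3) i f k by simp
        then show "f \<cdot> \<iota> i = Zer T s (Cod T f) \<cdot> \<iota> i" using i k f by simp
      qed (use f k in simp_all)
      then show ?thesis using k(1) by blast
    qed
  qed
qed

text \<open>
  All objects annihilated by \<open>J\<close> receive only zero arrows from \<open>J\<close>, by rigidity. They are stable under
  suspension, so the objects without nonzero arrows to them form a localizing subcategory.
\<close>

lemma annihilated_right_orth:
  assumes J: "thick_ideal U T J" and L: "L \<in> Ob T" and ann: "\<And>a. a \<in> J \<Longrightarrow> zero_ob T (a \<boxtimes> L)"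
  shows "L \<in> right_orth T (Loc U T J)"
proof -
  define N where "N = {y \<in> Ob T. \<forall>a\<in>J. zero_ob T (a \<boxtimes> y)}"
  have JO: "a \<in> Ob T" if "a \<in> J" for a using that thick_idealD(1)[OF J] by auto
  have "localizing U T {x \<in> Ob T. \<forall>f. f \<in> Arr T \<longrightarrow> Dom T f = x \<longrightarrow> Cod T f \<in> N \<longrightarrow> f = Zer T x (Cod T f)}"
    (is "localizing U T ?S")
  proof (rule left_orthogonal_localizing)
    show "N \<subseteq> Ob T" unfolding N_def by blast
    show "y \<in> N" if "x \<in> N" "isomorphic T x y" for x y
      using that tensor_isomorphic_right[OF that(2)] JO zero_ob_isomorphic isomorphic_in_Ob unfolding N_def by blast
    show "Sh x \<in> N \<longleftrightarrow> x \<in> N" if x: "x \<in> Ob T" for x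
    proof -
      have "zero_ob T (a \<boxtimes> Sh x) \<longleftrightarrow> zero_ob T (a \<boxtimes> x)" if a: "a \<in> J" for a
      proof -
        have i: "isomorphic T (a \<boxtimes> Sh x) (Sh (a \<boxtimes> x))"
          using exact_endo_Shift[OF tensor_exact(1)[OF JO[OF a]] x] by simp
        have O: "a \<boxtimes> x \<in> Ob T" using JO[OF a] x by simp
        have "zero_ob T (Sh (a \<boxtimes> x)) \<longleftrightarrow> zero_ob T (a \<boxtimes> x)" using zero_ob_Shift_iff[OF O] .
        then show ?thesis using zero_ob_isomorphic i isomorphic_sym by blast
      qed
      then show ?thesis unfolding N_def using x by simp
    qed
  qed
  moreover have "J \<subseteq> ?S"
  proof
    fix a assume a: "a \<in> J"
    have "f = Zer T a (Cod T f)" if f: "f \<in> Arr T" "Dom T f = a" "Cod T f \<in> N" for f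
    proof -
      have y: "Cod T f \<in> Ob T" "zero_ob T (a \<boxtimes> Cod T f)" using f(3) a unfolding N_def by blast+
      then have "zero_ob T (Cod T f \<boxtimes> a)" using zero_ob_isomorphic tensor_comm_isomorphic JO[OF a] by blast
      then show ?thesis using map_from_rigid_zero[of a "Cod T f" f] a thick_idealD(1)[OF J] y(1) f(1,2) by blast
    qed
    then show "a \<in> ?S" using JO[OF a] by blast
  qed
  ultimately have sub: "Loc U T J \<subseteq> ?S" by (rule Loc_least)
  have "L \<in> N" unfolding N_def using L ann by blast
  then have "f = Zer T x L" if "x \<in> Loc U T J" "f \<in> Arr T" "Dom T f = x" "Cod T f = L" for x f
    using sub that by blast
  moreover have "Zer T x L \<in> Hom T x L" if "x \<in> Loc U T J" for x
    using sub that L by (auto simp: Hom_iff)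
  ultimately have "Hom T x L = {Zer T x L}" if "x \<in> Loc U T J" for x using that by (auto simp: Hom_iff)
  then show ?thesis unfolding right_orth_def using L by blast
qed

lemma tensor_zero_rotate:
  assumes u: "u \<in> Arr T" and x: "x \<in> Ob T" and a: "a \<in> Ob T"
    and z: "Ide T a \<boxdot> u = Zer T (a \<boxtimes> Dom T u) (a \<boxtimes> Cod T u)"
  shows "Ide T a \<boxdot> (u \<boxdot> Ide T x) = Zer T (a \<boxtimes> (Dom T u \<boxtimes> x)) (a \<boxtimes> (Cod T u \<boxtimes> x))"
proof -
  let ?A = "Assoc T a (Dom T u) x" and ?B = "Assoc T a (Cod T u) x" and ?e = "Ide T a \<boxdot> (u \<boxdot> Ide T x)"
  have O: "Dom T u \<in> Ob T" "Cod T u \<in> Ob T" using u by simp_all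
  have "?B \<cdot> ((Ide T a \<boxdot> u) \<boxdot> Ide T x) = ?e \<cdot> ?A"
    using Assoc_natural[of "Ide T a" u "Ide T x"] u x a by simp
  then have eA: "?e \<cdot> ?A = Zer T ((a \<boxtimes> Dom T u) \<boxtimes> x) (a \<boxtimes> (Cod T u \<boxtimes> x))"
    unfolding z using O x a by simp
  obtain A' where A': "A' \<in> Arr T" "Dom T A' = a \<boxtimes> (Dom T u \<boxtimes> x)" "Cod T A' = (a \<boxtimes> Dom T u) \<boxtimes> x"
    "?A \<cdot> A' = Ide T (a \<boxtimes> (Dom T u \<boxtimes> x))"
    using iso_arrE[OF Assoc_arr(1)[OF a O(1) x]] Assoc_arr(3,4)[OF a O(1) x] by metis
  have "?e = ?e \<cdot> (?A \<cdot> A')" unfolding A'(4) using u x a by simp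
  also have "\<dots> = Zer T ((a \<boxtimes> Dom T u) \<boxtimes> x) (a \<boxtimes> (Cod T u \<boxtimes> x)) \<cdot> A'"
    by (rule comp_reduce[OF eA]) (use u x a A'(1-3) O in simp_all)
  also have "\<dots> = Zer T (a \<boxtimes> (Dom T u \<boxtimes> x)) (a \<boxtimes> (Cod T u \<boxtimes> x))" using A'(1-3) O x a by simp
  finally show ?thesis .
qed

lemma cone_of_tensored_unit_map:
  assumes t: "(e, u, w) \<in> Tri T" and u1: "Cod T e = Unit T" and x: "x \<in> Ob T"
    and l: "l \<in> Arr T" "Dom T l = x" "Cod T l = Unit T \<boxtimes> x" "l \<cdot> LUnit T x = Ide T (Unit T \<boxtimes> x)"
  shows "\<exists>j j'. ((u \<boxdot> Ide T x) \<cdot> l, j, j') \<in> Tri T \<and> Cod T j = Sh (Dom T e \<boxtimes> x)"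
proof -
  note ta = tri_arr[OF t]
  obtain q where q: "q \<in> Arr T" "Dom T q = FO (tensor_r T x) (Sh (Dom T e))" "Cod T q = Sh (FO (tensor_r T x) (Dom T e))"
    "(FA (tensor_r T x) e, FA (tensor_r T x) u, q \<cdot> FA (tensor_r T x) w) \<in> Tri T"
    using exact_endo_tri[OF tensor_exact(2)[OF x] t] by metis
  let ?u = "u \<boxdot> Ide T x" and ?e = "e \<boxdot> Ide T x" and ?w = "q \<cdot> (w \<boxdot> Ide T x)"
  have tr: "(?u, ?w, neg_arr T (Sm ?e)) \<in> Tri T" using tri_rotate[OF q(4)] by simp
  note tra = tri_arr[OF tr]
  have D: "Dom T ?u = Unit T \<boxtimes> x" "Cod T ?w = Sh (Dom T e \<boxtimes> x)" using ta u1 x q(1-3) by simp_all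
  have DO: "Dom T e \<in> Ob T" using ta by simp
  have "(?u \<cdot> l, ?w, Sm (LUnit T x) \<cdot> neg_arr T (Sm ?e)) \<in> Tri T"
  proof (rule tri_iso[OF tr, where a = "LUnit T x" and b = "Ide T (Cod T ?u)" and c = "Ide T (Cod T ?w)"])
    show "cand_triangle T (?u \<cdot> l) ?w (Sm (LUnit T x) \<cdot> neg_arr T (Sm ?e))"
      unfolding cand_triangle_def using tra D l(1-3) x by simp
    show "Ide T (Cod T ?u) \<cdot> ?u = (?u \<cdot> l) \<cdot> LUnit T x"
      using comp_assoc[of "LUnit T x" l ?u] l tra(1) D(1) x by (simp del: comp_assoc)
  qed (use tra D DO l(1-3) x iso_Ide in simp_all)
  then show ?thesis using D(2) by blast
qed

text \<open>
  Let \<open>C\<close> be the cone of the sum of the evaluations \<open>a\<^sup>* \<otimes> a \<rightarrow> \<one>\<close>, for \<open>a\<close> in a small skeleton of \<open>J\<close>.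
  Tensored with \<open>a\<close>, its evaluation splits, so the map \<open>\<one> \<rightarrow> C\<close> becomes zero. Apply \<open>tower\<close> to the
  sequence of tensor powers of \<open>C\<close>, whose transition maps have cones in the localizing ideal generated by
  \<open>J\<close>: the resulting arrow \<open>\<pi>\<close> becomes invertible after tensoring with \<open>a\<close>, so its cone is annihilated by
  \<open>J\<close>. The sequence starts at a desuspension of the unit because the target of \<open>\<pi>\<close> is the
  suspension of its first term.
\<close>

lemma ex_idempotent_triangle:
  assumes J: "thick_ideal U T J"
  obtains f g h where "(f, g, h) \<in> Tri T" "Cod T f = Unit T" "Dom T f \<in> Loc U T J"
    "Cod T g \<in> right_orth T (Loc U T J)"
proof -
  let ?unit = "Unit T" and ?L = "Loc U T J"
  have JO: "J \<subseteq> Ob T" using thick_idealD(1)[OF J] by auto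
  note L = localizing_Loc[OF JO] note Lt = localizing_tri[OF L]
  obtain R where R: "R \<subseteq> compacts U T" "small U R" "\<And>c. c \<in> compacts U T \<Longrightarrow> \<exists>k\<in>R. isomorphic T c k"
    by (rule compacts_essentially_small, rule that; blast)
  define K where "K = R \<inter> J"
  have K: "small U K" "K \<subseteq> J" using small_subset[OF R(2)] unfolding K_def by auto
  have KJ: "\<exists>k\<in>K. isomorphic T a k" if "a \<in> J" for a
    using R(3)[of a] that thick_idealD(1)[OF J] tri_subcatD(3)[OF thick_idealD(2)[OF J]] unfolding K_def by blast
  have Kc: "a \<in> compacts U T" "a \<in> Ob T" if "a \<in> K" for a using that K(2) thick_idealD(1)[OF J] JO by auto
  have "\<forall>a\<in>K. \<exists>d \<epsilon> s. d \<in> Ob T \<and> \<epsilon> \<in> Arr T \<and> Dom T \<epsilon> = d \<boxtimes> a \<and> Cod T \<epsilon> = ?unit \<and>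
    s \<in> Arr T \<and> Dom T s = a \<boxtimes> ?unit \<and> Cod T s = a \<boxtimes> (d \<boxtimes> a) \<and> (Ide T a \<boxdot> \<epsilon>) \<cdot> s = Ide T (a \<boxtimes> ?unit)"
  proof
    fix a assume "a \<in> K"
    then have a: "a \<in> compacts U T" using Kc by blast
    show "\<exists>d \<epsilon> s. d \<in> Ob T \<and> \<epsilon> \<in> Arr T \<and> Dom T \<epsilon> = d \<boxtimes> a \<and> Cod T \<epsilon> = ?unit \<and>
      s \<in> Arr T \<and> Dom T s = a \<boxtimes> ?unit \<and> Cod T s = a \<boxtimes> (d \<boxtimes> a) \<and> (Ide T a \<boxdot> \<epsilon>) \<cdot> s = Ide T (a \<boxtimes> ?unit)"
      by (rule rigid_evaluation[OF a]) blast
  qed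
  then obtain d \<epsilon> s where ev: "\<forall>a\<in>K. d a \<in> Ob T \<and> \<epsilon> a \<in> Arr T \<and> Dom T (\<epsilon> a) = d a \<boxtimes> a \<and> Cod T (\<epsilon> a) = ?unit \<and>
    s a \<in> Arr T \<and> Dom T (s a) = a \<boxtimes> ?unit \<and> Cod T (s a) = a \<boxtimes> (d a \<boxtimes> a) \<and> (Ide T a \<boxdot> \<epsilon> a) \<cdot> s a = Ide T (a \<boxtimes> ?unit)"
    by metis
  obtain P \<kappa> where cp: "is_coproduct T K (\<lambda>a. d a \<boxtimes> a) P \<kappa>"
    using ex_coproduct[OF K(1), of "\<lambda>a. d a \<boxtimes> a"] ev Kc by (metis tensor_Ob)
  note k = coproduct_arr[OF cp]
  have PL: "P \<in> ?L"
    by (rule localizing_coproduct[OF L K(1) _ cp]) (use Loc_thick_ideal(1)[OF J] Loc_incl[of J] K(2) ev in blast)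
  have "\<exists>e. e \<in> Arr T \<and> Dom T e = P \<and> Cod T e = ?unit \<and> (\<forall>a\<in>K. e \<cdot> \<kappa> a = \<epsilon> a)"
    by (rule coproduct_map[OF cp Unit_Ob, of \<epsilon>]) (use ev in blast)+
  then obtain e where e: "e \<in> Arr T" "Dom T e = P" "Cod T e = ?unit" "\<And>a. a \<in> K \<Longrightarrow> e \<cdot> \<kappa> a = \<epsilon> a" by blast
  obtain u w where t: "(e, u, w) \<in> Tri T" using ex_tri e(1) by blast
  note ta = tri_arr[OF t]
  define C where "C = Cod T u"
  have CO: "C \<in> Ob T" using ta unfolding C_def by simp
  have u: "u \<in> Arr T" "Dom T u = ?unit" "Cod T u = C" using ta e(3) unfolding C_def by simp_all
  \<comment> \<open>\<open>u\<close> kills the evaluation of \<open>a\<close>, which is a split epimorphism after tensoring with \<open>a\<close>\<close>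
  have au: "Ide T a \<boxdot> u = Zer T (a \<boxtimes> ?unit) (a \<boxtimes> C)" if a: "a \<in> K" for a
  proof -
    have aO: "a \<in> Ob T" using Kc a by blast
    have eva: "d a \<in> Ob T" "\<epsilon> a \<in> Arr T" "Dom T (\<epsilon> a) = d a \<boxtimes> a" "Cod T (\<epsilon> a) = ?unit"
      "s a \<in> Arr T" "Dom T (s a) = a \<boxtimes> ?unit" "Cod T (s a) = a \<boxtimes> (d a \<boxtimes> a)" "(Ide T a \<boxdot> \<epsilon> a) \<cdot> s a = Ide T (a \<boxtimes> ?unit)"
      using ev a by blast+
    note ka = k(3-5)[OF a]
    have "u \<cdot> \<epsilon> a = (u \<cdot> e) \<cdot> \<kappa> a" unfolding e(4)[OF a, symmetric] using u e(1-3) ka by simp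
    also have "\<dots> = Zer T (d a \<boxtimes> a) C" unfolding tri_comp_zero(1)[OF t] using ka e(1-3) u k(1) CO by simp
    finally have ue: "u \<cdot> \<epsilon> a = Zer T (d a \<boxtimes> a) C" .
    have "(Ide T a \<boxdot> u) \<cdot> (Ide T a \<boxdot> \<epsilon> a) = Ide T a \<boxdot> (u \<cdot> \<epsilon> a)" using aO u eva(1-4) by simp
    also have "\<dots> = Zer T (a \<boxtimes> (d a \<boxtimes> a)) (a \<boxtimes> C)" unfolding ue using aO eva(1) CO by simp
    finally have 1: "(Ide T a \<boxdot> u) \<cdot> (Ide T a \<boxdot> \<epsilon> a) = Zer T (a \<boxtimes> (d a \<boxtimes> a)) (a \<boxtimes> C)" .
    have "Ide T a \<boxdot> u = (Ide T a \<boxdot> u) \<cdot> ((Ide T a \<boxdot> \<epsilon> a) \<cdot> s a)" unfolding eva(8) using aO u by simp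
    also have "\<dots> = Zer T (a \<boxtimes> (d a \<boxtimes> a)) (a \<boxtimes> C) \<cdot> s a"
      by (rule comp_reduce[OF 1]) (use aO u eva(1-7) in simp_all)
    also have "\<dots> = Zer T (a \<boxtimes> ?unit) (a \<boxtimes> C)" using aO eva(1-7) CO by simp
    finally show ?thesis .
  qed
  obtain x0 where x0: "x0 \<in> Ob T" "isomorphic T (Sh x0) ?unit" using desuspension[OF Unit_Ob] .
  define X where "X = rec_nat x0 (\<lambda>n x. C \<boxtimes> x)"
  have X0: "X 0 = x0" and XS: "X (Suc n) = C \<boxtimes> X n" for n unfolding X_def by simp_all
  have XO: "X n \<in> Ob T" for n by (induction n) (use X0 XS x0 CO in simp_all)
  have "\<forall>n. \<exists>l. l \<in> Arr T \<and> Dom T l = X n \<and> Cod T l = ?unit \<boxtimes> X n \<and> l \<cdot> LUnit T (X n) = Ide T (?unit \<boxtimes> X n)"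
    using iso_arrE[OF unitors(1)[OF XO]] unitors(3,4)[OF XO] by metis
  then obtain l where l: "\<And>n. l n \<in> Arr T" "\<And>n. Dom T (l n) = X n" "\<And>n. Cod T (l n) = ?unit \<boxtimes> X n"
    "\<And>n. l n \<cdot> LUnit T (X n) = Ide T (?unit \<boxtimes> X n)" by metis
  define tt where "tt n = (u \<boxdot> Ide T (X n)) \<cdot> l n" for n
  have tt: "tt n \<in> Arr T" "Dom T (tt n) = X n" "Cod T (tt n) = X (Suc n)" for n
    unfolding tt_def XS using l[of n] u XO[of n] by simp_all
  \<comment> \<open>the cone of the transition map is a suspension of \<open>P \<otimes> X\<^sub>n\<close>\<close>
  have cone: "\<exists>j j'. (tt n, j, j') \<in> Tri T \<and> Cod T j \<in> ?L" for n
  proof -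
    have "P \<boxtimes> X n \<in> ?L" using Loc_thick_ideal(2)[OF J PL XO] .
    then have "Sh (P \<boxtimes> X n) \<in> ?L" using tri_subcatD(4)[OF Lt, of "P \<boxtimes> X n"] k(1) XO by simp
    then show ?thesis using cone_of_tensored_unit_map[OF t e(3) XO l(1-4)[of n]] e(2) unfolding tt_def by auto
  qed
  obtain H \<pi> where H: "H \<in> ?L" "\<pi> \<in> Arr T" "Dom T \<pi> = H" "Cod T \<pi> = Sh (X 0)"
    and Hiso: "\<And>F. exact_endo T F \<Longrightarrow> preserves_coproducts T F (UNIV :: nat set) \<Longrightarrow>
      (\<And>n. FA F (tt n) = Zer T (FO F (X n)) (FO F (X (Suc n)))) \<Longrightarrow> iso_arr T (FA F \<pi>)"
  proof (rule tower[where t = tt and X = X, OF L tt cone])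
    fix H \<pi> assume *: "H \<in> ?L" "\<pi> \<in> Arr T" "Dom T \<pi> = H" "Cod T \<pi> = Sh (X 0)"
      and **: "\<And>F. exact_endo T F \<Longrightarrow> preserves_coproducts T F (UNIV :: nat set) \<Longrightarrow>
        (\<And>n. FA F (tt n) = Zer T (FO F (X n)) (FO F (X (Suc n)))) \<Longrightarrow> iso_arr T (FA F \<pi>)"
    show thesis by (rule that[OF * **])
  qed
  obtain i where i: "iso_arr T i" "i \<in> Arr T" "Dom T i = Sh x0" "Cod T i = ?unit" using x0(2) by (rule isomorphicE)
  let ?f = "i \<cdot> \<pi>"
  have f: "?f \<in> Arr T" "Dom T ?f = H" "Cod T ?f = ?unit" using i H X0 by simp_all
  obtain g h where tf: "(?f, g, h) \<in> Tri T" using ex_tri f(1) by blast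
  note tfa = tri_arr[OF tf]
  have gO: "Cod T g \<in> Ob T" using tfa by simp
  have annK: "zero_ob T (a \<boxtimes> Cod T g)" if a: "a \<in> K" for a
  proof -
    have aO: "a \<in> Ob T" using Kc a by blast
    have "iso_arr T (FA (tensor_l T a) \<pi>)"
    proof (rule Hiso[OF tensor_exact(1)[OF aO] tensor_preserves_coproducts(1)[OF aO]])
      fix n
      have z: "Ide T a \<boxdot> (u \<boxdot> Ide T (X n)) = Zer T (a \<boxtimes> (?unit \<boxtimes> X n)) (a \<boxtimes> (C \<boxtimes> X n))"
        using tensor_zero_rotate[OF u(1) XO aO] au[OF a] u(2,3) by simp
      have "Ide T a \<boxdot> tt n = (Ide T a \<boxdot> (u \<boxdot> Ide T (X n))) \<cdot> (Ide T a \<boxdot> l n)"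
        unfolding tt_def using aO u l[of n] XO by simp
      also have "\<dots> = Zer T (a \<boxtimes> X n) (a \<boxtimes> X (Suc n))"
        unfolding z XS using aO l[of n] XO CO by simp
      finally show "FA (tensor_l T a) (tt n) = Zer T (FO (tensor_l T a) (X n)) (FO (tensor_l T a) (X (Suc n)))" by simp
    qed
    moreover have "FA (tensor_l T a) ?f = FA (tensor_l T a) i \<cdot> FA (tensor_l T a) \<pi>"
      by (rule additive_endo_arr(6)[OF tensor_additive(1)[OF aO]]) (use i H X0 in simp_all)
    moreover have "iso_arr T (FA (tensor_l T a) i)" by (rule additive_endo_iso[OF tensor_additive(1)[OF aO] i(1)])
    ultimately have iso: "iso_arr T (FA (tensor_l T a) ?f)"
      using iso_comp[of "FA (tensor_l T a) \<pi>" "FA (tensor_l T a) i"] i H X0 aO by simp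
    obtain h' where "(FA (tensor_l T a) ?f, FA (tensor_l T a) g, h') \<in> Tri T"
      using exact_endo_tri[OF tensor_exact(1)[OF aO] tf] by metis
    from cone_of_iso[OF this iso] show ?thesis using aO tfa by simp
  qed
  have "zero_ob T (a \<boxtimes> Cod T g)" if "a \<in> J" for a
    using KJ[OF that] annK tensor_isomorphic_left[OF _ gO] zero_ob_isomorphic isomorphic_sym by blast
  then have "Cod T g \<in> right_orth T ?L" by (rule annihilated_right_orth[OF J gO])
  then show ?thesis using that[OF tf f(3)] f(2) H(1) by simp
qed

section \<open>The spectrum\<close>

lemma thick_ideal_Inter:
  assumes "\<And>P. P \<in> \<P> \<Longrightarrow> thick_ideal U T P"
  shows "thick_ideal U T {a \<in> compacts U T. \<forall>P\<in>\<P>. a \<in> P}"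
proof -
  have eq: "{a \<in> compacts U T. \<forall>P\<in>\<P>. a \<in> P} = \<Inter>(insert (compacts U T) \<P>)" by blast
  have "tri_subcat T (\<Inter>(insert (compacts U T) \<P>))"
    by (rule tri_subcat_Inter) (use assms thick_idealD(2) tri_subcat_compacts in auto)
  then have tri: "tri_subcat T {a \<in> compacts U T. \<forall>P\<in>\<P>. a \<in> P}" unfolding eq .
  have "x \<in> P" if "P \<in> \<P>" "y \<in> P" "x \<in> compacts U T" "is_retract T x y" for x y P
    using thick_idealD(3)[OF assms[OF that(1)] that(2-4)] .
  moreover have "a \<boxtimes> x \<in> P" if "P \<in> \<P>" "a \<in> compacts U T" "x \<in> P" for a x P
    using thick_idealD(4)[OF assms[OF that(1)] that(2,3)] .
  ultimately show ?thesis
    unfolding thick_ideal_def using tri compact_tensor by simp blast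
qed

text \<open>
  These ideal quotients replace the ideals generated by two elements in the proof that maximal elements
  are prime: they require no description of generated ideals.
\<close>

lemma thick_ideal_colon:
  assumes P: "thick_ideal U T P" and b: "b \<in> compacts U T"
  shows "thick_ideal U T {c \<in> compacts U T. c \<boxtimes> b \<in> P}"
proof -
  have bO: "b \<in> Ob T" using b by simp
  have eq: "{c \<in> compacts U T. c \<boxtimes> b \<in> P} = \<Inter>{compacts U T, {x \<in> Ob T. FO (tensor_r T b) x \<in> P}}" by auto
  have "tri_subcat T {c \<in> compacts U T. c \<boxtimes> b \<in> P}"
    unfolding eq using tri_subcat_preimage[OF tensor_exact(2)[OF bO] thick_idealD(2)[OF P]] tri_subcat_compacts
    by (intro tri_subcat_Inter) auto
  moreover have "x \<boxtimes> b \<in> P" if "y \<boxtimes> b \<in> P" "x \<in> compacts U T" "is_retract T x y" for x y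
    using thick_idealD(3)[OF P that(1) compact_tensor[OF that(2) b] tensor_retract[OF that(3) bO]] .
  moreover have "(a \<boxtimes> x) \<boxtimes> b \<in> P" if "a \<in> compacts U T" "x \<in> compacts U T" "x \<boxtimes> b \<in> P" for a x
    using tri_subcatD(3)[OF thick_idealD(2)[OF P] thick_idealD(4)[OF P that(1,3)]]
      isomorphic_sym[OF tensor_assoc_isomorphic[of a x b]] that bO by simp
  ultimately show ?thesis unfolding thick_ideal_def using compact_tensor by blast
qed

lemma thick_ideal_comm:
  assumes "thick_ideal U T P" "a \<in> Ob T" "b \<in> Ob T" "a \<boxtimes> b \<in> P" shows "b \<boxtimes> a \<in> P"
  using tri_subcatD(3)[OF thick_idealD(2)[OF assms(1)] assms(4)] tensor_comm_isomorphic assms(2,3) by blast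

lemma thick_ideal_Union_chain:
  assumes ne: "\<C> \<noteq> {}" and th: "\<And>J. J \<in> \<C> \<Longrightarrow> thick_ideal U T J"
    and ch: "\<And>J K. J \<in> \<C> \<Longrightarrow> K \<in> \<C> \<Longrightarrow> J \<subseteq> K \<or> K \<subseteq> J"
  shows "thick_ideal U T (\<Union>\<C>)"
proof -
  have "tri_subcat T (\<Union>\<C>)"
    unfolding tri_subcat_def
  proof (intro conjI allI impI ballI)
    show "\<Union>\<C> \<subseteq> Ob T" using tri_subcatD(1)[OF thick_idealD(2)[OF th]] by blast
    show "z \<in> \<Union>\<C>" if "zero_ob T z" for z
      using tri_subcatD(2)[OF thick_idealD(2)[OF th] that] ne by blast
    show "y \<in> \<Union>\<C>" if "x \<in> \<Union>\<C>" "isomorphic T x y" for x y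
      using tri_subcatD(3)[OF thick_idealD(2)[OF th]] that by blast
    show "Sh x \<in> \<Union>\<C> \<longleftrightarrow> x \<in> \<Union>\<C>" if "x \<in> Ob T" for x
      using tri_subcatD(4)[OF thick_idealD(2)[OF th] that] by blast
    show "Cod T g \<in> \<Union>\<C>" if t: "(f, g, h) \<in> Tri T" and fC: "Dom T f \<in> \<Union>\<C>" "Cod T f \<in> \<Union>\<C>" for f g h
    proof -
      obtain J where J: "J \<in> \<C>" "Dom T f \<in> J" using fC(1) by (rule UnionE)
      obtain K where K: "K \<in> \<C>" "Cod T f \<in> K" using fC(2) by (rule UnionE)
      obtain M where "M \<in> \<C>" "Dom T f \<in> M" "Cod T f \<in> M" using ch[OF J(1) K(1)] J K by blast
      then show ?thesis using tri_subcatD(5)[OF thick_idealD(2)[OF th] t] by blast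
    qed
  qed
  moreover have "\<Union>\<C> \<subseteq> compacts U T" using thick_idealD(1)[OF th] by blast
  ultimately show ?thesis unfolding thick_ideal_def using thick_idealD(3,4)[OF th] by (intro conjI) blast+
qed

lemma primesD:
  assumes "P \<in> primes U T"
  shows "thick_ideal U T P" "P \<noteq> compacts U T"
    "a \<in> compacts U T \<Longrightarrow> b \<in> compacts U T \<Longrightarrow> a \<boxtimes> b \<in> P \<Longrightarrow> a \<in> P \<or> b \<in> P"
  using assms unfolding primes_def by blast+

lemma prime_tensor_iff:
  assumes P: "P \<in> primes U T" and ab: "a \<in> compacts U T" "b \<in> compacts U T"
  shows "a \<boxtimes> b \<in> P \<longleftrightarrow> a \<in> P \<or> b \<in> P"
  using primesD(3)[OF P ab] thick_idealD(4)[OF primesD(1)[OF P]] thick_ideal_comm[OF primesD(1)[OF P]] ab compacts_Ob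
  by blast

text \<open>
  As for commutative rings, an ideal that is maximal among those disjoint from \<open>M\<close> is prime. If
  \<open>a \<otimes> b\<close> lies in it, either the quotient by \<open>b\<close> is still disjoint from \<open>M\<close>, and contains \<open>a\<close>, or it contains
  some \<open>m \<in> M\<close>, and the quotient by \<open>m\<close> contains \<open>b\<close>.
\<close>

lemma ex_prime:
  assumes I: "thick_ideal U T I" and M: "M \<subseteq> compacts U T" "M \<noteq> {}" "\<And>a b. a \<in> M \<Longrightarrow> b \<in> M \<Longrightarrow> a \<boxtimes> b \<in> M"
    and disj: "I \<inter> M = {}"
  obtains P where "P \<in> primes U T" "I \<subseteq> P" "P \<inter> M = {}"
proof -
  let ?\<A> = "{J. thick_ideal U T J \<and> I \<subseteq> J \<and> J \<inter> M = {}}"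
  have "\<exists>P\<in>?\<A>. \<forall>X\<in>?\<A>. P \<subseteq> X \<longrightarrow> X = P"
  proof (rule subset_Zorn_nonempty)
    show "?\<A> \<noteq> {}" using I disj by blast
    fix \<C> assume ne: "\<C> \<noteq> {}" and ch: "subset.chain ?\<A> \<C>"
    have "thick_ideal U T (\<Union>\<C>)"
      by (rule thick_ideal_Union_chain[OF ne]) (use ch in \<open>auto simp: subset_chain_def\<close>)
    moreover have "I \<subseteq> \<Union>\<C>" "\<Union>\<C> \<inter> M = {}" using ne ch unfolding subset_chain_def by blast+
    ultimately show "\<Union>\<C> \<in> ?\<A>" by blast
  qed
  then obtain P where PA: "P \<in> ?\<A>" and max0: "\<forall>X\<in>?\<A>. P \<subseteq> X \<longrightarrow> X = P" by (rule bexE)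
  have P: "thick_ideal U T P" "I \<subseteq> P" "P \<inter> M = {}" using PA by simp_all
  have max: "X = P" if X: "thick_ideal U T X" "P \<subseteq> X" "X \<inter> M = {}" for X
  proof -
    have "X \<in> ?\<A>" using X P(2) by simp
    then show ?thesis using max0 X(2) by simp
  qed
  have Pc: "P \<subseteq> compacts U T" using thick_idealD(1)[OF P(1)] .
  have colon: "P \<subseteq> {c \<in> compacts U T. c \<boxtimes> b \<in> P}" if b: "b \<in> compacts U T" for b
    using thick_idealD(4)[OF P(1) b] thick_ideal_comm[OF P(1)] Pc b compacts_Ob by blast
  have "a \<in> P \<or> b \<in> P" if a: "a \<in> compacts U T" and b: "b \<in> compacts U T" and ab: "a \<boxtimes> b \<in> P" for a b
  proof (cases "{c \<in> compacts U T. c \<boxtimes> b \<in> P} \<inter> M = {}")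
    case True
    then show ?thesis using max[OF thick_ideal_colon[OF P(1) b] colon[OF b]] a ab by blast
  next
    case False
    then obtain m where m: "m \<in> M" "m \<boxtimes> b \<in> P" by blast
    then have mc: "m \<in> compacts U T" using M(1) by blast
    have bm: "b \<boxtimes> m \<in> P" using thick_ideal_comm[OF P(1) _ _ m(2)] mc b by simp
    have "{c \<in> compacts U T. c \<boxtimes> m \<in> P} \<inter> M = {}" using M(3) m(1) P(3) by blast
    then show ?thesis using max[OF thick_ideal_colon[OF P(1) mc] colon[OF mc]] b bm by blast
  qed
  moreover have "P \<noteq> compacts U T" using P(3) M(1,2) by blast
  ultimately have "P \<in> primes U T" unfolding primes_def using P(1) by blast
  then show ?thesis using that P by blast
qed

text \<open>
  The multiplicative set generated by \<open>A\<close>, without the unit: tensor words of positive length.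
\<close>

inductive_set tensor_closure :: "'o set \<Rightarrow> 'o set" for A where
  tensor_closure_base: "a \<in> A \<Longrightarrow> a \<in> tensor_closure A"
| tensor_closure_step: "a \<in> tensor_closure A \<Longrightarrow> b \<in> tensor_closure A \<Longrightarrow> a \<boxtimes> b \<in> tensor_closure A"

lemma tensor_closure_compact:
  assumes "A \<subseteq> compacts U T" shows "tensor_closure A \<subseteq> compacts U T"
proof
  fix x assume "x \<in> tensor_closure A"
  then show "x \<in> compacts U T" by induction (use assms compact_tensor in auto)
qed

text \<open>
  For rigid \<open>a\<close>, tensor nilpotence is invisible to localizing ideals: \<open>a\<close> is a retract of \<open>a \<otimes> a\<^sup>* \<otimes> a\<close>.
\<close>

lemma cancel_rigid_square:
  assumes L: "localizing U T L" "\<And>x y. x \<in> L \<Longrightarrow> y \<in> Ob T \<Longrightarrow> x \<boxtimes> y \<in> L"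
    and a: "a \<in> compacts U T" and w: "w \<in> Ob T" and aaw: "a \<boxtimes> (a \<boxtimes> w) \<in> L"
  shows "a \<boxtimes> w \<in> L"
proof -
  have aO: "a \<in> Ob T" using a by simp
  obtain d where d: "d \<in> Ob T" "is_retract T a (a \<boxtimes> (d \<boxtimes> a))" using rigid_retract[OF a] .
  have "(a \<boxtimes> (a \<boxtimes> w)) \<boxtimes> d \<in> L" using L(2)[OF aaw d(1)] .
  moreover have "isomorphic T ((a \<boxtimes> (a \<boxtimes> w)) \<boxtimes> d) ((a \<boxtimes> (d \<boxtimes> a)) \<boxtimes> w)"
    using aO d(1) w by (simp add: isomorphic_iff_class iso_class_tensor class_mult_ac)
  ultimately have "(a \<boxtimes> (d \<boxtimes> a)) \<boxtimes> w \<in> L" using tri_subcatD(3)[OF localizing_tri[OF L(1)]] by blast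
  then show ?thesis using localizing_retract[OF L(1)] tensor_retract[OF d(2) w] by blast
qed

text \<open>
  The primes containing \<open>J\<close> all contain \<open>a\<close>, so that some tensor word in \<open>a\<close> lies in \<open>J\<close>. Its factors are cancelled one after the
  other by rigidity, inside the localizing ideal generated by \<open>J\<close>; there every object may serve as a
  further tensor factor, which the induction on words needs. Neeman's theorem leads
  back from that ideal to \<open>J\<close>.
\<close>

lemma thick_ideal_eq_Inter_primes:
  assumes J: "thick_ideal U T J" and a: "a \<in> compacts U T"
    and P: "\<And>P. P \<in> primes U T \<Longrightarrow> J \<subseteq> P \<Longrightarrow> a \<in> P"
  shows "a \<in> J"
proof -
  let ?M = "tensor_closure {a}"
  have aO: "a \<in> Ob T" using a by simp
  have Mc: "?M \<subseteq> compacts U T" using tensor_closure_compact a by simp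
  have aM: "a \<in> ?M" by (rule tensor_closure_base) simp
  have "J \<inter> ?M \<noteq> {}"
  proof
    assume "J \<inter> ?M = {}"
    then obtain P where "P \<in> primes U T" "J \<subseteq> P" "P \<inter> ?M = {}"
      using ex_prime[OF J Mc _ tensor_closure_step] aM by (metis empty_iff)
    then show False using P aM by blast
  qed
  then obtain m where m: "m \<in> J" "m \<in> ?M" by blast
  have JO: "J \<subseteq> Ob T" using thick_idealD(1)[OF J] by auto
  note L = localizing_Loc[OF JO]
  note Lt = tri_subcatD(3)[OF localizing_tri[OF L]]
  \<comment> \<open>quantifying over \<open>w\<close> allows the factors of a word to be cancelled from either side\<close>
  have key: "\<forall>w\<in>Ob T. m \<boxtimes> w \<in> Loc U T J \<longrightarrow> a \<boxtimes> w \<in> Loc U T J" if "m \<in> ?M" for m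
    using that
  proof induction
    case (tensor_closure_base b)
    then show ?case by simp
  next
    case (tensor_closure_step x y)
    have O: "x \<in> Ob T" "y \<in> Ob T" using tensor_closure_step.hyps Mc by auto
    show ?case
    proof (intro ballI impI)
      fix w assume w: "w \<in> Ob T" and xyw: "(x \<boxtimes> y) \<boxtimes> w \<in> Loc U T J"
      have "x \<boxtimes> (y \<boxtimes> w) \<in> Loc U T J" using Lt[OF xyw] tensor_assoc_isomorphic O w by blast
      then have 1: "a \<boxtimes> (y \<boxtimes> w) \<in> Loc U T J" using tensor_closure_step.IH(1) O w by simp
      have "isomorphic T (a \<boxtimes> (y \<boxtimes> w)) (y \<boxtimes> (a \<boxtimes> w))"
        using aO O w by (simp add: isomorphic_iff_class iso_class_tensor class_mult_ac)
      then have "y \<boxtimes> (a \<boxtimes> w) \<in> Loc U T J" using Lt[OF 1] by blast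
      then have "a \<boxtimes> (a \<boxtimes> w) \<in> Loc U T J" using tensor_closure_step.IH(2) aO w by simp
      then show "a \<boxtimes> w \<in> Loc U T J" using cancel_rigid_square[OF L Loc_thick_ideal(2)[OF J] a w] by blast
    qed
  qed
  have "m \<boxtimes> Unit T \<in> Loc U T J" using Loc_thick_ideal(2)[OF J _ Unit_Ob] m(1) Loc_incl by blast
  then have "a \<boxtimes> Unit T \<in> Loc U T J" using key[OF m(2)] by simp
  then have "a \<in> Loc U T J" using Lt tensor_unit_isomorphic(1)[OF aO] by blast
  then show ?thesis using compact_in_Loc_thick_ideal[OF J a] by blast
qed

lemma primes_minus_supp: "primes U T - supp U T a = {P \<in> primes U T. a \<in> P}"
  unfolding supp_def by blast

lemma zero_in_prime: "P \<in> primes U T \<Longrightarrow> zero_ob T z \<Longrightarrow> z \<in> P"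
  using primesD(1) thick_idealD(2) tri_subcatD(2) by blast

lemma topspace_Spc [simp]: "topspace (Spc U T) = primes U T"
proof -
  obtain z where z: "zero_ob T z" using ex_zero_ob by blast
  have "\<Union>{primes U T - supp U T a | a. a \<in> compacts U T} = primes U T"
    using zero_in_prime[OF _ z] compact_zero[OF z] unfolding primes_minus_supp by blast
  then show ?thesis unfolding Spc_def topology_generated_by_topspace by simp
qed

lemma openin_Spc_basic: "a \<in> compacts U T \<Longrightarrow> openin (Spc U T) (primes U T - supp U T a)"
  unfolding Spc_def by (intro topology_generated_by_Basis) blast

lemma supp_subset_primes: "supp U T a \<subseteq> primes U T"
  unfolding supp_def by blast

lemma closedin_supp: "a \<in> compacts U T \<Longrightarrow> closedin (Spc U T) (supp U T a)"
  unfolding closedin_def using openin_Spc_basic supp_subset_primes by simp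

text \<open>
  The generating open sets form a basis: a prime contains \<open>b\<close> and \<open>c\<close> if and only if it contains
  their biproduct.
\<close>

lemma openin_SpcD:
  assumes "openin (Spc U T) V" "P \<in> V"
  shows "\<exists>b\<in>compacts U T. b \<in> P \<and> primes U T - supp U T b \<subseteq> V"
proof -
  have "generate_topology_on {primes U T - supp U T a | a. a \<in> compacts U T} V"
    using assms(1) unfolding Spc_def openin_topology_generated_by_iff .
  then have "V \<subseteq> primes U T \<and> (\<forall>P\<in>V. \<exists>b\<in>compacts U T. b \<in> P \<and> primes U T - supp U T b \<subseteq> V)"
  proof induction
    case Empty
    then show ?case by simp
  next
    case (Int V W)
    have "\<exists>b\<in>compacts U T. b \<in> P \<and> primes U T - supp U T b \<subseteq> V \<inter> W" if P: "P \<in> V \<inter> W" for P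
    proof -
      have V: "V \<subseteq> primes U T" "\<forall>P\<in>V. \<exists>b\<in>compacts U T. b \<in> P \<and> primes U T - supp U T b \<subseteq> V"
        and W: "\<forall>P\<in>W. \<exists>b\<in>compacts U T. b \<in> P \<and> primes U T - supp U T b \<subseteq> W"
        using Int.IH by simp_all
      have "\<exists>b\<in>compacts U T. b \<in> P \<and> primes U T - supp U T b \<subseteq> V" using V(2) P by simp
      then obtain b where b: "b \<in> compacts U T" "b \<in> P" "primes U T - supp U T b \<subseteq> V" by blast
      have "\<exists>c\<in>compacts U T. c \<in> P \<and> primes U T - supp U T c \<subseteq> W" using W P by simp
      then obtain c where c: "c \<in> compacts U T" "c \<in> P" "primes U T - supp U T c \<subseteq> W" by blast
      note bc = b c
      have PP: "P \<in> primes U T" using V(1) P by blast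
      obtain s i j p q where s: "s \<in> P" "i \<in> Hom T b s" "j \<in> Hom T c s" "p \<in> Hom T s b" "q \<in> Hom T s c"
        "p \<cdot> i = Ide T b" "q \<cdot> j = Ide T c"
        by (rule tri_subcat_biproduct[OF thick_idealD(2)[OF primesD(1)[OF PP]] bc(2,5)])
      have "is_retract T b s" "is_retract T c s" unfolding is_retract_def using s by blast+
      then have "b \<in> Q \<and> c \<in> Q" if "Q \<in> primes U T" "s \<in> Q" for Q
        using thick_idealD(3)[OF primesD(1)[OF that(1)] that(2)] bc by blast
      then have "primes U T - supp U T s \<subseteq> V \<inter> W" using bc(3,6) unfolding primes_minus_supp by blast
      moreover have "s \<in> compacts U T" using s(1) thick_idealD(1)[OF primesD(1)[OF PP]] by blast
      ultimately show ?thesis using s(1) by blast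
    qed
    moreover have "V \<inter> W \<subseteq> primes U T" using Int.IH by blast
    ultimately show ?case by simp
  next
    case (UN \<K>)
    have "\<exists>b\<in>compacts U T. b \<in> P \<and> primes U T - supp U T b \<subseteq> \<Union>\<K>" if P: "P \<in> \<Union>\<K>" for P
    proof -
      obtain V where V: "V \<in> \<K>" "P \<in> V" using P by (rule UnionE)
      then have "\<exists>b\<in>compacts U T. b \<in> P \<and> primes U T - supp U T b \<subseteq> V" using UN.IH[OF V(1)] by simp
      then show ?thesis using V(1) by blast
    qed
    moreover have "\<Union>\<K> \<subseteq> primes U T" using UN.IH by blast
    ultimately show ?case by simp
  next
    case (Basis V)
    then show ?case unfolding primes_minus_supp by blast
  qed
  then show ?thesis using assms(2) by blast
qed

lemma finite_union_basic:
  assumes "finite F" "F \<noteq> {}" "F \<subseteq> compacts U T"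
  shows "\<exists>m\<in>compacts U T. primes U T - supp U T m = (\<Union>b\<in>F. primes U T - supp U T b)"
  using assms
proof (induction F rule: finite_ne_induct)
  case (singleton x)
  then show ?case by auto
next
  case (insert x F)
  then obtain m where m: "m \<in> compacts U T" "primes U T - supp U T m = (\<Union>b\<in>F. primes U T - supp U T b)" by auto
  have x: "x \<in> compacts U T" using insert by blast
  have "primes U T - supp U T (x \<boxtimes> m) = (primes U T - supp U T x) \<union> (primes U T - supp U T m)"
    unfolding primes_minus_supp using prime_tensor_iff[OF _ x m(1)] by blast
  then show ?case using compact_tensor[OF x m(1)] m(2) by auto
qed

lemma tensor_closure_finite_cover:
  assumes B: "B \<subseteq> compacts U T" and m: "m \<in> tensor_closure B"
  shows "\<exists>F\<subseteq>B. finite F \<and> primes U T - supp U T m \<subseteq> (\<Union>b\<in>F. primes U T - supp U T b)"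
  using m
proof induction
  case (tensor_closure_base a)
  then show ?case by (intro exI[of _ "{a}"]) auto
next
  case (tensor_closure_step a b)
  then obtain F G where F: "F \<subseteq> B" "finite F" "primes U T - supp U T a \<subseteq> (\<Union>b\<in>F. primes U T - supp U T b)"
    "G \<subseteq> B" "finite G" "primes U T - supp U T b \<subseteq> (\<Union>b\<in>G. primes U T - supp U T b)" by blast
  have "a \<in> compacts U T" "b \<in> compacts U T" using tensor_closure_step.hyps tensor_closure_compact[OF B] by auto
  then have "primes U T - supp U T (a \<boxtimes> b) \<subseteq> (primes U T - supp U T a) \<union> (primes U T - supp U T b)"
    unfolding primes_minus_supp using prime_tensor_iff by blast
  also have "\<dots> \<subseteq> (\<Union>b\<in>F. primes U T - supp U T b) \<union> (\<Union>b\<in>G. primes U T - supp U T b)"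
    using F(3,6) by (rule Un_mono)
  also have "\<dots> = (\<Union>b\<in>F \<union> G. primes U T - supp U T b)" by (simp only: UN_Un)
  finally have "primes U T - supp U T (a \<boxtimes> b) \<subseteq> (\<Union>b\<in>F \<union> G. primes U T - supp U T b)" .
  moreover have "F \<union> G \<subseteq> B" "finite (F \<union> G)" using F(1,2,4,5) by auto
  ultimately show ?case by blast
qed

text \<open>
  Let \<open>B\<close> consist of the objects whose basic open set lies in a member of the cover. If no tensor word in
  \<open>B\<close> belonged to the ideal generated by \<open>a\<close>, some prime would contain \<open>a\<close> but no object of \<open>B\<close>, and so be
  missed by the cover. The finitely many letters of a word in that ideal yield a finite subcover.
\<close>

lemma compactin_basic:
  assumes a: "a \<in> compacts U T"
  shows "compactin (Spc U T) (primes U T - supp U T a)"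
  unfolding compactin_def topspace_Spc
proof (intro conjI allI impI)
  show "primes U T - supp U T a \<subseteq> primes U T" by blast
  fix \<U> assume \<U>: "Ball \<U> (openin (Spc U T)) \<and> primes U T - supp U T a \<subseteq> \<Union>\<U>"
  show "\<exists>\<F>. finite \<F> \<and> \<F> \<subseteq> \<U> \<and> primes U T - supp U T a \<subseteq> \<Union>\<F>"
  proof (cases "primes U T - supp U T a = {}")
    case True
    then show ?thesis by (intro exI[of _ "{}"]) simp
  next
    case False
    define B where "B = {b \<in> compacts U T. \<exists>V\<in>\<U>. primes U T - supp U T b \<subseteq> V}"
    have B: "B \<subseteq> compacts U T" unfolding B_def by blast
    have cover: "\<exists>b\<in>B. b \<in> P" if P: "P \<in> primes U T" "a \<in> P" for P
    proof -
      obtain V where V: "V \<in> \<U>" "P \<in> V" using \<U> P unfolding primes_minus_supp by blast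
      then obtain b where "b \<in> compacts U T" "b \<in> P" "primes U T - supp U T b \<subseteq> V"
        using openin_SpcD[of V P] \<U> by blast
      then show ?thesis unfolding B_def using V(1) by blast
    qed
    define I where "I = {c \<in> compacts U T. \<forall>Q\<in>{Q. thick_ideal U T Q \<and> a \<in> Q}. c \<in> Q}"
    have I: "thick_ideal U T I" unfolding I_def by (rule thick_ideal_Inter) blast
    have aI: "a \<in> I" unfolding I_def using a by blast
    let ?M = "tensor_closure B"
    have "B \<noteq> {}" using cover False unfolding primes_minus_supp by blast
    then have ne: "?M \<noteq> {}" using tensor_closure_base by blast
    have "I \<inter> ?M \<noteq> {}"
    proof
      assume "I \<inter> ?M = {}"
      then obtain P where P: "P \<in> primes U T" "I \<subseteq> P" "P \<inter> ?M = {}"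
        using ex_prime[OF I tensor_closure_compact[OF B] ne tensor_closure_step] by metis
      then show False using cover[of P] aI tensor_closure_base by blast
    qed
    then obtain m where m: "m \<in> I" "m \<in> ?M" by blast
    obtain F where F: "F \<subseteq> B" "finite F" "primes U T - supp U T m \<subseteq> (\<Union>b\<in>F. primes U T - supp U T b)"
      using tensor_closure_finite_cover[OF B m(2)] by blast
    have "primes U T - supp U T a \<subseteq> primes U T - supp U T m"
      unfolding primes_minus_supp using m(1) primesD(1) unfolding I_def by blast
    then have aF: "primes U T - supp U T a \<subseteq> (\<Union>b\<in>F. primes U T - supp U T b)" using F(3) by blast
    have "\<forall>b\<in>F. \<exists>V. V \<in> \<U> \<and> primes U T - supp U T b \<subseteq> V" using F(1) unfolding B_def by blast
    then have "\<exists>v. \<forall>b\<in>F. v b \<in> \<U> \<and> primes U T - supp U T b \<subseteq> v b" by (rule bchoice)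
    then obtain v where v: "\<forall>b\<in>F. v b \<in> \<U> \<and> primes U T - supp U T b \<subseteq> v b" by blast
    show ?thesis
    proof (intro exI[of _ "v ` F"] conjI)
      show "finite (v ` F)" using F(2) by simp
      show "v ` F \<subseteq> \<U>" using v by blast
      show "primes U T - supp U T a \<subseteq> \<Union>(v ` F)" using aF v by blast
    qed
  qed
qed

lemma thomason_Union_supp:
  assumes "A \<subseteq> compacts U T" shows "thomason (Spc U T) (\<Union>a\<in>A. supp U T a)"
  unfolding thomason_def
  by (rule exI[of _ "supp U T ` A"]) (use assms closedin_supp compactin_basic in auto)

lemma thomason_supp: "a \<in> compacts U T \<Longrightarrow> thomason (Spc U T) (supp U T a)"
  using thomason_Union_supp[of "{a}"] by simp

lemma thomason_empty: "thomason (Spc U T) {}"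
  using thomason_Union_supp[of "{}"] by simp

lemma thomason_primes: "thomason (Spc U T) (primes U T)"
  unfolding thomason_def
  by (rule exI[of _ "{primes U T}"]) (use closedin_topspace[of "Spc U T"] in simp)

lemma thomason_subset_primes: "thomason (Spc U T) Y \<Longrightarrow> Y \<subseteq> primes U T"
  unfolding thomason_def using closedin_subset[of "Spc U T"] by fastforce

text \<open>
  A closed set with quasi-compact complement is the support of one compact object: the complement is a
  finite union of basic open sets, which is the basic open set of a tensor product.
\<close>

lemma thomason_point:
  assumes Y: "thomason (Spc U T) Y" and P: "P \<in> Y"
  shows "\<exists>a\<in>compacts_on U T Y. a \<notin> P"
proof -
  obtain C where C: "closedin (Spc U T) C" "compactin (Spc U T) (primes U T - C)" "P \<in> C" "C \<subseteq> Y"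
    using Y P unfolding thomason_def by auto
  have Cp: "C \<subseteq> primes U T" using closedin_subset[OF C(1)] by simp
  have PP: "P \<in> primes U T" using C(3) Cp by blast
  define B where "B = {b \<in> compacts U T. primes U T - supp U T b \<subseteq> primes U T - C}"
  have op: "openin (Spc U T) (primes U T - C)" using C(1) unfolding closedin_def by simp
  let ?\<B> = "(\<lambda>b. primes U T - supp U T b) ` B"
  have "primes U T - C \<subseteq> \<Union>?\<B>"
  proof
    fix Q assume Q: "Q \<in> primes U T - C"
    obtain b where b: "b \<in> compacts U T" "b \<in> Q" "primes U T - supp U T b \<subseteq> primes U T - C"
      using openin_SpcD[OF op Q] by (elim bexE conjE)
    then have "b \<in> B" unfolding B_def by simp
    moreover have "Q \<in> primes U T - supp U T b" using Q b(2) unfolding primes_minus_supp by simp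
    ultimately show "Q \<in> \<Union>?\<B>" by (rule UN_I)
  qed
  moreover have "\<forall>V\<in>?\<B>. openin (Spc U T) V" using openin_Spc_basic unfolding B_def by auto
  moreover have "\<forall>\<U>. Ball \<U> (openin (Spc U T)) \<and> primes U T - C \<subseteq> \<Union>\<U> \<longrightarrow>
      (\<exists>\<F>. finite \<F> \<and> \<F> \<subseteq> \<U> \<and> primes U T - C \<subseteq> \<Union>\<F>)"
    using C(2) unfolding compactin_def by (elim conjE)
  ultimately have "\<exists>\<F>. finite \<F> \<and> \<F> \<subseteq> ?\<B> \<and> primes U T - C \<subseteq> \<Union>\<F>" by (elim allE[of _ ?\<B>]) simp
  then obtain \<F> where \<F>: "finite \<F>" "\<F> \<subseteq> ?\<B>" "primes U T - C \<subseteq> \<Union>\<F>" by (elim exE conjE)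
  obtain F where F: "F \<subseteq> B" "finite F" "\<F> = (\<lambda>b. primes U T - supp U T b) ` F"
    using finite_subset_image[OF \<F>(1,2)] by blast
  have U: "(\<Union>b\<in>F. primes U T - supp U T b) = primes U T - C"
  proof
    show "(\<Union>b\<in>F. primes U T - supp U T b) \<subseteq> primes U T - C" using F(1) unfolding B_def by blast
    show "primes U T - C \<subseteq> (\<Union>b\<in>F. primes U T - supp U T b)" using \<F>(3) F(3) by simp
  qed
  show ?thesis
  proof (cases "F = {}")
    \<comment> \<open>there is no empty tensor word to represent an empty union, but in this case \<open>C\<close> is everything\<close>
    case True
    then have "C = primes U T" using U Cp by auto
    moreover obtain a where "a \<in> compacts U T" "a \<notin> P" using primesD(2)[OF PP] thick_idealD(1)[OF primesD(1)[OF PP]] by blast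
    ultimately show ?thesis unfolding compacts_on_def using supp_subset_primes C(4) by blast
  next
    case False
    then obtain m where m: "m \<in> compacts U T" "primes U T - supp U T m = primes U T - C"
      using finite_union_basic[OF F(2)] F(1) U unfolding B_def by auto
    then have "supp U T m = C" using supp_subset_primes Cp by blast
    then show ?thesis unfolding compacts_on_def using m(1) C(3,4) by (intro bexI[of _ m]) (auto simp: supp_def)
  qed
qed

text \<open>
  The compact objects supported on \<open>Y\<close> are those that belong to all primes outside \<open>Y\<close>.
\<close>

lemma thick_ideal_compacts_on: "thick_ideal U T (compacts_on U T Y)"
proof -
  have "compacts_on U T Y = {a \<in> compacts U T. \<forall>P\<in>primes U T - Y. a \<in> P}"
    unfolding compacts_on_def supp_def by blast
  then show ?thesis using thick_ideal_Inter[of "primes U T - Y"] primesD(1) by simp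
qed

lemma compacts_onD: "a \<in> compacts_on U T Y \<Longrightarrow> a \<in> compacts U T" "a \<in> compacts_on U T Y \<Longrightarrow> supp U T a \<subseteq> Y"
  unfolding compacts_on_def by auto

section \<open>Tensor triangular support\<close>

lemma rickard_triangle:
  obtains f g h where "(f, g, h) \<in> Tri T" "Dom T f = RickG U T Y" "Cod T f = Unit T" "Cod T g = RickL U T Y"
    "RickG U T Y \<in> Loc U T (compacts_on U T Y)" "RickL U T Y \<in> right_orth T (Loc U T (compacts_on U T Y))"
proof -
  have "\<exists>t. rickard_triangle U T Y t"
  proof (rule ex_idempotent_triangle[OF thick_ideal_compacts_on[of Y]])
    fix f g h assume "(f, g, h) \<in> Tri T" "Cod T f = Unit T" "Dom T f \<in> Loc U T (compacts_on U T Y)"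
      "Cod T g \<in> right_orth T (Loc U T (compacts_on U T Y))"
    then show ?thesis unfolding rickard_triangle_def by (intro exI[of _ "(f, g, h)"]) simp
  qed
  then have r: "rickard_triangle U T Y (SOME t. rickard_triangle U T Y t)" by (rule someI_ex)
  obtain f g h where t: "(SOME t. rickard_triangle U T Y t) = (f, g, h)" by (rule prod_cases3)
  have GL: "RickG U T Y = Dom T f" "RickL U T Y = Cod T g" unfolding RickG_def RickL_def t by simp_all
  have "rickard_triangle U T Y (f, g, h)" using r unfolding t .
  then have "(f, g, h) \<in> Tri T" "Cod T f = Unit T" "Dom T f \<in> Loc U T (compacts_on U T Y)"
    "Cod T g \<in> right_orth T (Loc U T (compacts_on U T Y))"
    unfolding rickard_triangle_def by simp_all
  then show ?thesis using that[of f g h] GL by simp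
qed

lemma Rick_Ob [simp]: "RickG U T Y \<in> Ob T" "RickL U T Y \<in> Ob T"
proof -
  obtain f g h where t: "(f, g, h) \<in> Tri T" "Dom T f = RickG U T Y" "Cod T g = RickL U T Y"
    using rickard_triangle by metis
  then show "RickG U T Y \<in> Ob T" "RickL U T Y \<in> Ob T"
    using Dom_in_Ob[OF tri_arr(1)[OF t(1)]] Cod_in_Ob[OF tri_arr(2)[OF t(1)]] by simp_all
qed

lemma RickG_Loc: "RickG U T Y \<in> Loc U T (compacts_on U T Y)"
  by (rule rickard_triangle)

text \<open>
  All arrows to \<open>L\<one>\<close> from the localizing ideal generated by \<open>a\<close> are zero.
\<close>

lemma tensor_RickL_zero:
  assumes a: "a \<in> compacts_on U T Y" shows "zero_ob T (RickL U T Y \<boxtimes> a)"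
proof (rule tensor_rigid_zero)
  show "a \<in> compacts U T" using compacts_onD(1)[OF a] .
  fix d f assume d: "d \<in> Ob T" and f: "f \<in> Arr T" "Dom T f = d \<boxtimes> a" "Cod T f = RickL U T Y"
  have "d \<boxtimes> a \<in> Loc U T (compacts_on U T Y)"
    using Loc_thick_ideal(1)[OF thick_ideal_compacts_on _ d] Loc_incl a by blast
  moreover have "RickL U T Y \<in> right_orth T (Loc U T (compacts_on U T Y))" by (rule rickard_triangle)
  ultimately have "Hom T (d \<boxtimes> a) (RickL U T Y) = {Zer T (d \<boxtimes> a) (RickL U T Y)}"
    unfolding right_orth_def by simp
  moreover have "f \<in> Hom T (d \<boxtimes> a) (RickL U T Y)" using f by (simp add: Hom_iff)
  ultimately show "f = Zer T (d \<boxtimes> a) (RickL U T Y)" by simp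
qed simp

lemma tri_subcat_tensor_Rick:
  assumes S: "tri_subcat T S" and x: "x \<in> Ob T"
    and G: "x \<boxtimes> RickG U T Y \<in> S" and L: "x \<boxtimes> RickL U T Y \<in> S"
  shows "x \<in> S"
proof -
  obtain f g h where t: "(f, g, h) \<in> Tri T" "Dom T f = RickG U T Y" "Cod T f = Unit T" "Cod T g = RickL U T Y"
    using rickard_triangle by metis
  note ta = tri_arr[OF t(1)]
  obtain h' where t': "(FA (tensor_l T x) f, FA (tensor_l T x) g, h') \<in> Tri T"
    using exact_endo_tri[OF tensor_exact(1)[OF x] t(1)] by metis
  have "Cod T (FA (tensor_l T x) f) \<in> S"
    by (rule tri_subcat_middle[OF S t']) (use ta t(2-4) x G L in simp_all)
  then have "x \<boxtimes> Unit T \<in> S" using ta t(3) x by simp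
  then show ?thesis using tri_subcatD(3)[OF S] tensor_unit_isomorphic(1)[OF x] by blast
qed

lemma localizing_zero_obs: "localizing U T {x. zero_ob T x}"
  unfolding localizing_def tri_subcat_def
proof (intro conjI allI impI ballI)
  show "{x. zero_ob T x} \<subseteq> Ob T" by auto
  show "z \<in> {x. zero_ob T x}" if "zero_ob T z" for z using that by simp
  show "y \<in> {x. zero_ob T x}" if "x \<in> {x. zero_ob T x}" "isomorphic T x y" for x y
    using that zero_ob_isomorphic by simp
  show "Sh x \<in> {x. zero_ob T x} \<longleftrightarrow> x \<in> {x. zero_ob T x}" if "x \<in> Ob T" for x
    using zero_ob_Shift_iff[OF that] by simp
  show "Cod T g \<in> {x. zero_ob T x}"
    if t: "(f, g, h) \<in> Tri T" and z: "Dom T f \<in> {x. zero_ob T x}" "Cod T f \<in> {x. zero_ob T x}" for f g h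
  proof -
    have z': "zero_ob T (Dom T f)" "zero_ob T (Cod T f)" using z by simp_all
    note ta = tri_arr[OF t]
    have f0: "f = Zer T (Dom T f) (Cod T f)" by (rule to_zero[OF z'(2) ta(1) refl])
    have O: "Dom T f \<in> Ob T" "Cod T f \<in> Ob T" using ta by simp_all
    have 1: "Zer T (Cod T f) (Dom T f) \<cdot> f = Ide T (Dom T f)"
      using z'(1) O ta(1) by (simp add: zero_ob_iff)
    have 2: "f \<cdot> Zer T (Cod T f) (Dom T f) = Ide T (Cod T f)"
      using z'(2) O ta(1) by (simp add: zero_ob_iff)
    have "iso_arr T f"
      by (rule iso_arrI[OF ta(1) Zer_arr(1)[OF O(2,1)] _ _ 1 2]) (use O in simp_all)
    then show ?thesis using cone_of_iso[OF t] by simp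
  qed
  show "s \<in> {x. zero_ob T x}"
    if "I \<subseteq> U" "small U I" and z: "\<forall>i\<in>I. x i \<in> {x. zero_ob T x}" and c: "is_coproduct T I x s \<iota>" for I x s \<iota>
  proof -
    note k = coproduct_arr[OF c]
    have "Ide T s = Zer T s s"
    proof (rule coproduct_eq[OF c])
      fix i assume i: "i \<in> I"
      have "\<iota> i = Zer T (x i) s" using from_zero[of "x i" "\<iota> i"] z k i by simp
      then show "Ide T s \<cdot> \<iota> i = Zer T s s \<cdot> \<iota> i" using k i by simp
    qed (use k in simp_all)
    then show ?thesis using k by (simp add: zero_ob_iff)
  qed
qed

definition tensor_ideal :: "'o set \<Rightarrow> bool" where
  "tensor_ideal S \<longleftrightarrow> (\<forall>a\<in>Ob T. \<forall>x\<in>S. a \<boxtimes> x \<in> S)"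

lemma tensor_ideal_zero_obs: "tensor_ideal {x. zero_ob T x}"
  unfolding tensor_ideal_def using zero_ob_tensor(2) by simp

lemma thick_ideal_of_localizing:
  assumes S: "localizing U T S" "tensor_ideal S" and z: "z \<in> Ob T"
  shows "thick_ideal U T {c \<in> compacts U T. z \<boxtimes> c \<in> S}"
proof -
  have eq: "{c \<in> compacts U T. z \<boxtimes> c \<in> S} = \<Inter>{compacts U T, {x \<in> Ob T. z \<boxtimes> x \<in> S}}" by auto
  have "tri_subcat T {c \<in> compacts U T. z \<boxtimes> c \<in> S}"
    unfolding eq using localizing_tri[OF localizing_tensor[OF S(1) z]] tri_subcat_compacts
    by (intro tri_subcat_Inter) auto
  moreover have "z \<boxtimes> x \<in> S" if "z \<boxtimes> y \<in> S" "is_retract T x y" for x y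
    using localizing_retract[OF S(1) that(1) tensor_retract'[OF that(2) z]] .
  moreover have "z \<boxtimes> (a \<boxtimes> x) \<in> S" if a: "a \<in> compacts U T" and x: "x \<in> compacts U T" and zx: "z \<boxtimes> x \<in> S" for a x
  proof -
    have "a \<boxtimes> (z \<boxtimes> x) \<in> S" using S(2) zx a unfolding tensor_ideal_def by simp
    moreover have "isomorphic T (a \<boxtimes> (z \<boxtimes> x)) (z \<boxtimes> (a \<boxtimes> x))"
      using a x z by (simp add: isomorphic_iff_class iso_class_tensor class_mult_ac)
    ultimately show ?thesis using tri_subcatD(3)[OF localizing_tri[OF S(1)]] by blast
  qed
  ultimately show ?thesis unfolding thick_ideal_def using compact_tensor by simp blast
qed

lemma zero_tensor_Loc:
  assumes "\<And>a. a \<in> A \<Longrightarrow> a \<in> Ob T" "\<And>a. a \<in> A \<Longrightarrow> zero_ob T (z \<boxtimes> a)" "z \<in> Ob T" "x \<in> Loc U T A"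
  shows "zero_ob T (z \<boxtimes> x)"
proof -
  have "A \<subseteq> {x \<in> Ob T. z \<boxtimes> x \<in> {x. zero_ob T x}}" using assms by blast
  then have "Loc U T A \<subseteq> {x \<in> Ob T. z \<boxtimes> x \<in> {x. zero_ob T x}}"
    using Loc_least localizing_tensor[OF localizing_zero_obs assms(3)] by blast
  then show ?thesis using assms(4) by blast
qed

lemma vis_idem:
  assumes "weakly_visible U T W"
  obtains Y1 Y2 where "thomason (Spc U T) Y1" "thomason (Spc U T) Y2" "W = Y1 \<inter> (primes U T - Y2)"
    "vis_idem U T W = RickG U T Y1 \<boxtimes> RickL U T Y2"
proof -
  have "\<exists>w Y1 Y2. thomason (Spc U T) Y1 \<and> thomason (Spc U T) Y2 \<and>
    W = Y1 \<inter> (topspace (Spc U T) - Y2) \<and> w = RickG U T Y1 \<boxtimes> RickL U T Y2"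
    using assms unfolding weakly_visible_def by blast
  then have "\<exists>Y1 Y2. thomason (Spc U T) Y1 \<and> thomason (Spc U T) Y2 \<and>
    W = Y1 \<inter> (topspace (Spc U T) - Y2) \<and> vis_idem U T W = RickG U T Y1 \<boxtimes> RickL U T Y2"
    unfolding vis_idem_def by (rule someI_ex)
  then show ?thesis using that unfolding topspace_Spc by blast
qed

lemma weakly_visibleI:
  "thomason (Spc U T) Y1 \<Longrightarrow> thomason (Spc U T) Y2 \<Longrightarrow> weakly_visible U T (Y1 \<inter> (primes U T - Y2))"
  unfolding weakly_visible_def topspace_Spc by blast

lemma Supp_subset_primes: "Supp U T t \<subseteq> primes U T"
  unfolding Supp_def by auto

lemma vis_idem_Ob:
  assumes "weakly_visible U T W" shows "vis_idem U T W \<in> Ob T"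
  by (rule vis_idem[OF assms]) simp

lemma not_in_Supp:
  assumes "weakly_visible U T W" "P \<in> W" "zero_ob T (t \<boxtimes> vis_idem U T W)"
  shows "P \<notin> Supp U T t"
  using assms unfolding Supp_def by blast

lemma Supp_tensor_subset:
  assumes x: "x \<in> Ob T" and y: "y \<in> Ob T" and i: "isomorphic T t (x \<boxtimes> y)"
  shows "Supp U T t \<subseteq> Supp U T x"
proof
  fix P assume P: "P \<in> Supp U T t"
  have "\<not> zero_ob T (x \<boxtimes> vis_idem U T W)" if W: "weakly_visible U T W" "P \<in> W" for W
  proof
    assume z: "zero_ob T (x \<boxtimes> vis_idem U T W)"
    note vO = vis_idem_Ob[OF W(1)]
    have "zero_ob T ((x \<boxtimes> vis_idem U T W) \<boxtimes> y)" using zero_ob_tensor(1)[OF z y] .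
    moreover have "isomorphic T ((x \<boxtimes> vis_idem U T W) \<boxtimes> y) ((x \<boxtimes> y) \<boxtimes> vis_idem U T W)"
      using x y vO by (simp add: isomorphic_iff_class iso_class_tensor class_mult_ac)
    ultimately have "zero_ob T ((x \<boxtimes> y) \<boxtimes> vis_idem U T W)" using zero_ob_isomorphic by blast
    then have "zero_ob T (t \<boxtimes> vis_idem U T W)"
      using zero_ob_isomorphic tensor_isomorphic_left[OF isomorphic_sym[OF i] vO] by blast
    then show False using not_in_Supp[OF W] P by blast
  qed
  then show "P \<in> Supp U T x" using P unfolding Supp_def by blast
qed

lemma zero_tensor_vis_idem:
  assumes z: "z \<in> Ob T" and 0: "\<And>c. c \<in> compacts_on U T Y1 \<Longrightarrow> zero_ob T ((z \<boxtimes> RickL U T Y2) \<boxtimes> c)"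
  shows "zero_ob T (z \<boxtimes> (RickG U T Y1 \<boxtimes> RickL U T Y2))"
proof -
  have "zero_ob T ((z \<boxtimes> RickL U T Y2) \<boxtimes> RickG U T Y1)"
    by (rule zero_tensor_Loc[OF _ 0 _ RickG_Loc]) (use z compacts_onD(1) in auto)
  moreover have "isomorphic T ((z \<boxtimes> RickL U T Y2) \<boxtimes> RickG U T Y1) (z \<boxtimes> (RickG U T Y1 \<boxtimes> RickL U T Y2))"
    using z by (simp add: isomorphic_iff_class iso_class_tensor class_mult_ac)
  ultimately show ?thesis using zero_ob_isomorphic by blast
qed

text \<open>
  The set \<open>W = Y\<close> is weakly visible, and shows that \<open>P\<close> is not in the support. As \<open>g(W)\<close> is formed with some
  pair of Thomason subsets \<open>Y1\<close>, \<open>Y2\<close> whose difference is \<open>Y\<close>, not necessarily \<open>(Y, \<emptyset>)\<close>, the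
  vanishing of \<open>L\<one> \<otimes> g(W)\<close> is proved by means of primes: the compact objects that annihilate the
  product of the Rickard objects of \<open>Y\<close> and \<open>Y2\<close> form a thick ideal, which contains everything
  supported on \<open>Y\<close> or on \<open>Y2\<close>. Therefore it contains everything supported on \<open>Y1\<close>, a subset of
  \<open>Y \<union> Y2\<close>.
\<close>

lemma Supp_RickL:
  assumes Y: "thomason (Spc U T) Y" and P: "P \<in> Y"
  shows "P \<notin> Supp U T (RickL U T Y)"
proof -
  let ?W = "Y \<inter> (primes U T - {})"
  have W: "weakly_visible U T ?W" by (rule weakly_visibleI[OF Y thomason_empty])
  have PW: "P \<in> ?W" using P thomason_subset_primes[OF Y] by blast
  obtain Y1 Y2 where Y12: "thomason (Spc U T) Y1" "thomason (Spc U T) Y2" "?W = Y1 \<inter> (primes U T - Y2)"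
    "vis_idem U T ?W = RickG U T Y1 \<boxtimes> RickL U T Y2" using vis_idem[OF W] .
  let ?z = "RickL U T Y \<boxtimes> RickL U T Y2"
  let ?J = "{c \<in> compacts U T. ?z \<boxtimes> c \<in> {x. zero_ob T x}}"
  have J: "thick_ideal U T ?J" by (rule thick_ideal_of_localizing[OF localizing_zero_obs tensor_ideal_zero_obs]) simp
  have J1: "a \<in> ?J" if a: "a \<in> compacts_on U T Y" for a
  proof -
    have ac: "a \<in> compacts U T" using compacts_onD(1)[OF a] .
    have "zero_ob T ((RickL U T Y \<boxtimes> a) \<boxtimes> RickL U T Y2)"
      using zero_ob_tensor(1)[OF tensor_RickL_zero[OF a]] by simp
    moreover have "isomorphic T ((RickL U T Y \<boxtimes> a) \<boxtimes> RickL U T Y2) (?z \<boxtimes> a)"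
      using ac by (simp add: isomorphic_iff_class iso_class_tensor class_mult_ac)
    ultimately show ?thesis using zero_ob_isomorphic ac by blast
  qed
  have J2: "a \<in> ?J" if a: "a \<in> compacts_on U T Y2" for a
  proof -
    have ac: "a \<in> compacts U T" using compacts_onD(1)[OF a] .
    have "zero_ob T ((RickL U T Y2 \<boxtimes> a) \<boxtimes> RickL U T Y)"
      using zero_ob_tensor(1)[OF tensor_RickL_zero[OF a]] by simp
    moreover have "isomorphic T ((RickL U T Y2 \<boxtimes> a) \<boxtimes> RickL U T Y) (?z \<boxtimes> a)"
      using ac by (simp add: isomorphic_iff_class iso_class_tensor class_mult_ac)
    ultimately show ?thesis using zero_ob_isomorphic ac by blast
  qed
  have "zero_ob T (?z \<boxtimes> c)" if c: "c \<in> compacts_on U T Y1" for c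
  proof -
    have "c \<in> ?J"
    proof (rule thick_ideal_eq_Inter_primes[OF J compacts_onD(1)[OF c]])
      fix Q assume Q: "Q \<in> primes U T" "?J \<subseteq> Q"
      have "Q \<notin> Y" using thomason_point[OF Y, of Q] J1 Q(2) by blast
      moreover have "Q \<notin> Y2" using thomason_point[OF Y12(2), of Q] J2 Q(2) by blast
      ultimately have "Q \<notin> Y1" using Y12(3) Q(1) by blast
      then have "Q \<notin> supp U T c" using compacts_onD(2)[OF c] by blast
      then show "c \<in> Q" using Q(1) unfolding supp_def by blast
    qed
    then show ?thesis by blast
  qed
  then have "zero_ob T (RickL U T Y \<boxtimes> vis_idem U T ?W)"
    unfolding Y12(4) by (intro zero_tensor_vis_idem) simp_all
  then show ?thesis using not_in_Supp[OF W PW] by blast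
qed

lemma compacts_on_tensor:
  assumes b: "b \<in> compacts_on U T Y" and c: "c \<in> compacts_on U T Y'" and sub: "Y \<inter> Y' \<subseteq> Y2"
  shows "b \<boxtimes> c \<in> compacts_on U T Y2"
proof -
  note bc = compacts_onD(1)[OF b] compacts_onD(1)[OF c]
  have "supp U T (b \<boxtimes> c) \<subseteq> supp U T b \<inter> supp U T c"
    unfolding supp_def using prime_tensor_iff[OF _ bc] by blast
  then have "supp U T (b \<boxtimes> c) \<subseteq> Y2" using compacts_onD(2)[OF b] compacts_onD(2)[OF c] sub by blast
  then show ?thesis unfolding compacts_on_def using compact_tensor[OF bc] by blast
qed

text \<open>
  Test with the complement of \<open>Y\<close>, a weakly visible set. If it is written as the difference of \<open>Y1\<close> and
  \<open>Y2\<close>, then \<open>Y \<inter> Y1 \<subseteq> Y2\<close>, so that \<open>b \<otimes> c\<close> annihilates the Rickard object of \<open>Y2\<close> for all \<open>b\<close> supported on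
  \<open>Y\<close> and \<open>c\<close> supported on \<open>Y1\<close>.
\<close>

lemma Supp_Loc_compacts_on:
  assumes Y: "thomason (Spc U T) Y" and z: "z \<in> Loc U T (compacts_on U T Y)"
  shows "Supp U T z \<subseteq> Y"
proof
  fix P assume PS: "P \<in> Supp U T z"
  show "P \<in> Y"
  proof (rule ccontr)
    assume PY: "P \<notin> Y"
    let ?W = "primes U T \<inter> (primes U T - Y)"
    have W: "weakly_visible U T ?W" by (rule weakly_visibleI[OF thomason_primes Y])
    have PW: "P \<in> ?W" using PS PY Supp_subset_primes by blast
    obtain Y1 Y2 where Y12: "thomason (Spc U T) Y1" "thomason (Spc U T) Y2" "?W = Y1 \<inter> (primes U T - Y2)"
      "vis_idem U T ?W = RickG U T Y1 \<boxtimes> RickL U T Y2" using vis_idem[OF W] .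
    have sub: "Y \<inter> Y1 \<subseteq> Y2" using Y12(3) thomason_subset_primes[OF Y] by blast
    have zO: "z \<in> Ob T"
      using z tri_subcatD(1)[OF localizing_tri[OF localizing_Loc[of "compacts_on U T Y"]]] compacts_onD(1) compacts_Ob by blast
    have "zero_ob T ((z \<boxtimes> RickL U T Y2) \<boxtimes> c)" if c: "c \<in> compacts_on U T Y1" for c
    proof -
      have cO: "c \<in> Ob T" using compacts_onD(1)[OF c] by simp
      have "zero_ob T ((RickL U T Y2 \<boxtimes> c) \<boxtimes> b)" if b: "b \<in> compacts_on U T Y" for b
      proof -
        have bO: "b \<in> Ob T" using compacts_onD(1)[OF b] by simp
        have "isomorphic T (RickL U T Y2 \<boxtimes> (b \<boxtimes> c)) ((RickL U T Y2 \<boxtimes> c) \<boxtimes> b)"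
          using bO cO by (simp add: isomorphic_iff_class iso_class_tensor class_mult_ac)
        then show ?thesis using tensor_RickL_zero[OF compacts_on_tensor[OF b c sub]] zero_ob_isomorphic by blast
      qed
      then have "zero_ob T ((RickL U T Y2 \<boxtimes> c) \<boxtimes> z)"
        by (intro zero_tensor_Loc[OF _ _ _ z]) (use cO compacts_onD(1) in auto)
      moreover have "isomorphic T ((RickL U T Y2 \<boxtimes> c) \<boxtimes> z) ((z \<boxtimes> RickL U T Y2) \<boxtimes> c)"
        using zO cO by (simp add: isomorphic_iff_class iso_class_tensor class_mult_ac)
      ultimately show ?thesis using zero_ob_isomorphic by blast
    qed
    then have "zero_ob T (z \<boxtimes> vis_idem U T ?W)"
      unfolding Y12(4) using zO by (intro zero_tensor_vis_idem) simp_all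
    then show False using not_in_Supp[OF W PW] PS by blast
  qed
qed

lemma noetherian_space_maximal:
  assumes X: "noetherian_space X" and ne: "\<O> \<noteq> {}" and op: "\<And>V. V \<in> \<O> \<Longrightarrow> openin X V"
  shows "\<exists>V\<in>\<O>. \<forall>V'\<in>\<O>. V \<subseteq> V' \<longrightarrow> V' = V"
proof (rule ccontr)
  assume "\<not> ?thesis"
  then have *: "\<exists>V'. V' \<in> \<O> \<and> V \<subset> V'" if "V \<in> \<O>" for V using that by blast
  have "\<exists>V. \<forall>n :: nat. V n \<in> \<O> \<and> V n \<subset> V (Suc n)"
  proof (rule dependent_nat_choice[of "\<lambda>_ V. V \<in> \<O>" "\<lambda>_ V V'. V \<subset> V'"])
    show "\<exists>V. V \<in> \<O>" using ne by blast
    show "\<exists>V'. V' \<in> \<O> \<and> V \<subset> V'" if "V \<in> \<O>" for V and n :: nat using *[OF that] .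
  qed
  then obtain V where V0: "\<forall>n :: nat. V n \<in> \<O> \<and> V n \<subset> V (Suc n)" by (rule exE)
  have V: "V n \<in> \<O>" "V n \<subset> V (Suc n)" for n using V0 by simp_all
  have "openin X (V n) \<and> V n \<subseteq> V (Suc n)" for n using op[OF V(1)] V(2)[of n] by simp
  then have "\<exists>N. \<forall>n\<ge>N. V n = V N" using X[unfolded noetherian_space_def, rule_format, of V] by simp
  then obtain N where N: "\<forall>n\<ge>N. V n = V N" by (rule exE)
  have "V (Suc N) = V N" by (rule N[rule_format]) simp
  then show False using V(2)[of N] by simp
qed

lemma tensor_permute:
  assumes "x \<in> Ob T" "y \<in> Ob T" "z \<in> Ob T" "w \<in> Ob T"
  shows "isomorphic T (((x \<boxtimes> y) \<boxtimes> z) \<boxtimes> w) (x \<boxtimes> ((y \<boxtimes> z) \<boxtimes> w))"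
    and "isomorphic T (((x \<boxtimes> y) \<boxtimes> z) \<boxtimes> w) (y \<boxtimes> ((x \<boxtimes> z) \<boxtimes> w))"
    and "isomorphic T (((x \<boxtimes> y) \<boxtimes> z) \<boxtimes> w) (z \<boxtimes> ((x \<boxtimes> y) \<boxtimes> w))"
    and "isomorphic T ((x \<boxtimes> y) \<boxtimes> z) ((x \<boxtimes> z) \<boxtimes> y)"
    and "isomorphic T (x \<boxtimes> (y \<boxtimes> z)) ((y \<boxtimes> x) \<boxtimes> z)"
  using assms by (simp_all add: isomorphic_iff_class iso_class_tensor class_mult_ac)

lemma tensor_permute_five:
  assumes "x \<in> Ob T" "y \<in> Ob T" "z \<in> Ob T" "w \<in> Ob T" "v \<in> Ob T"
  shows "isomorphic T ((y \<boxtimes> z) \<boxtimes> (x \<boxtimes> (w \<boxtimes> v))) ((((x \<boxtimes> y) \<boxtimes> z) \<boxtimes> w) \<boxtimes> v)"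
  using assms by (simp add: isomorphic_iff_class iso_class_tensor class_mult_ac)

text \<open>
  The argument sketched at the beginning, for an arbitrary localizing tensor ideal \<open>S\<close> as in the
  definition of the generated one.
\<close>

lemma local_to_global_noetherian_Supp:
  assumes detection: "detection_property U T" and t: "t \<in> Ob T"
    and noeth: "noetherian_space (subtopology (Spc U T) (Supp U T t))"
  shows "local_to_global U T t"
  unfolding local_to_global_def
proof (intro allI impI)
  fix \<W> assume \<W>: "\<forall>W\<in>\<W>. weakly_visible U T W" and cover: "\<Union>\<W> = topspace (Spc U T)"
  have detect: "zero_ob T x" if "x \<in> Ob T" "Supp U T x = {}" for x
    using detection that unfolding detection_property_def by blast
  have "t \<in> S" if S: "localizing U T S" and ideal: "tensor_ideal S"
    and incl: "{t \<boxtimes> vis_idem U T W | W. W \<in> \<W>} \<subseteq> S" for S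
  proof (rule ccontr)
    assume tS: "t \<notin> S"
    note S' = localizing_tri[OF S]
    note Siso = tri_subcatD(3)[OF S']
    define J where "J = {c \<in> compacts U T. t \<boxtimes> c \<in> S}"
    have J: "thick_ideal U T J" unfolding J_def by (rule thick_ideal_of_localizing[OF S ideal t])
    have Jc: "J \<subseteq> compacts U T" unfolding J_def by blast
    define Y where "Y = (\<Union>a\<in>J. supp U T a)"
    have Y: "thomason (Spc U T) Y" unfolding Y_def by (rule thomason_Union_supp[OF Jc])
    have "compacts_on U T Y \<subseteq> J"
    proof
      fix c assume c: "c \<in> compacts_on U T Y"
      show "c \<in> J"
      proof (rule thick_ideal_eq_Inter_primes[OF J compacts_onD(1)[OF c]])
        fix Q assume Q: "Q \<in> primes U T" "J \<subseteq> Q"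
        then have "Q \<notin> Y" unfolding Y_def supp_def by blast
        then show "c \<in> Q" using compacts_onD(2)[OF c] Q(1) unfolding supp_def by blast
      qed
    qed
    then have "compacts_on U T Y \<subseteq> {x \<in> Ob T. t \<boxtimes> x \<in> S}" unfolding J_def by auto
    then have tG: "t \<boxtimes> RickG U T Y \<in> S"
      using Loc_least[OF localizing_tensor[OF S t]] RickG_Loc[of Y] by blast
    define Z where "Z = Supp U T t - Y"
    have u: "\<not> zero_ob T (t \<boxtimes> RickL U T Y)"
      using tri_subcat_tensor_Rick[OF S' t tG] tri_subcatD(2)[OF S'] tS by blast
    obtain P0 where P0: "P0 \<in> Supp U T (t \<boxtimes> RickL U T Y)" using detect[of "t \<boxtimes> RickL U T Y"] u t by auto
    have "P0 \<in> Supp U T t"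
      using Supp_tensor_subset[OF t Rick_Ob(2)[of Y] isomorphic_refl] P0 t by auto
    moreover have "P0 \<in> Supp U T (RickL U T Y)"
      using Supp_tensor_subset[OF Rick_Ob(2)[of Y] t tensor_comm_isomorphic[OF t Rick_Ob(2)]] P0 by blast
    ultimately have P0Z: "P0 \<in> Z" unfolding Z_def using Supp_RickL[OF Y] by blast
    have ZP: "P \<in> primes U T" if "P \<in> Z" for P using that Supp_subset_primes unfolding Z_def by blast
    \<comment> \<open>the noetherian hypothesis concerns the open subsets of \<open>Supp(t)\<close>, the complements of \<open>supp(a)\<close>\<close>
    let ?O = "\<lambda>a. Supp U T t \<inter> (primes U T - supp U T a)"
    let ?A = "{a \<in> compacts U T. supp U T a \<inter> Z \<noteq> {}}"
    have "\<exists>V\<in>?O ` ?A. \<forall>V'\<in>?O ` ?A. V \<subseteq> V' \<longrightarrow> V' = V"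
    proof (rule noetherian_space_maximal[OF noeth])
      note P = ZP[OF P0Z]
      obtain a where "a \<in> compacts U T" "a \<notin> P0"
        using primesD(2)[OF P] thick_idealD(1)[OF primesD(1)[OF P]] by blast
      then have "a \<in> ?A" using P0Z P unfolding supp_def by blast
      then show "?O ` ?A \<noteq> {}" by blast
      fix V assume "V \<in> ?O ` ?A"
      then obtain a where a: "V = ?O a" "a \<in> ?A" by (rule imageE)
      have "openin (Spc U T) (primes U T - supp U T a)" using openin_Spc_basic a(2) by simp
      then have "openin (subtopology (Spc U T) (Supp U T t)) ((primes U T - supp U T a) \<inter> Supp U T t)"
        by (rule openin_subtopology_Int)
      then show "openin (subtopology (Spc U T) (Supp U T t)) V" unfolding a(1) by (simp only: Int_commute)
    qed
    then obtain V where VO: "V \<in> ?O ` ?A" and Vmax: "\<forall>V'\<in>?O ` ?A. V \<subseteq> V' \<longrightarrow> V' = V" by (rule bexE)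
    obtain a where Va: "V = ?O a" and aA: "a \<in> ?A" using VO by (rule imageE)
    have a: "a \<in> compacts U T" and aZ: "supp U T a \<inter> Z \<noteq> {}" using aA by simp_all
    have amax: "?O b = ?O a" if b: "b \<in> compacts U T" "supp U T b \<inter> Z \<noteq> {}" "?O a \<subseteq> ?O b" for b
    proof -
      have "b \<in> ?A" using b(1,2) by simp
      then have "?O b \<in> ?O ` ?A" by (rule imageI)
      from Vmax[rule_format, OF this] b(3) show ?thesis unfolding Va by (rule mp[OF impI])
    qed
    \<comment> \<open>if \<open>b\<close> is outside \<open>Q\<close>, then \<open>supp(a \<otimes> b)\<close> still meets \<open>Z\<close>, so maximality applies to \<open>a \<otimes> b\<close>\<close>
    have sub: "b \<notin> Q'" if Q: "Q \<in> supp U T a \<inter> Z" "Q' \<in> supp U T a \<inter> Z" and b: "b \<in> compacts U T" "b \<notin> Q" for Q Q' b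
    proof -
      have QP: "Q \<in> primes U T" "Q' \<in> primes U T" using Q ZP by blast+
      have aQ: "a \<notin> Q" "a \<notin> Q'" using Q unfolding supp_def by blast+
      have ab: "a \<boxtimes> b \<in> compacts U T" using compact_tensor[OF a b(1)] .
      have "a \<boxtimes> b \<notin> Q" using prime_tensor_iff[OF QP(1) a b(1)] aQ(1) b(2) by blast
      then have 1: "supp U T (a \<boxtimes> b) \<inter> Z \<noteq> {}" using Q(1) QP(1) unfolding supp_def by blast
      have 2: "supp U T (a \<boxtimes> b) \<subseteq> supp U T a" unfolding supp_def using prime_tensor_iff[OF _ a b(1)] by blast
      have "Supp U T t \<inter> (primes U T - supp U T (a \<boxtimes> b)) = Supp U T t \<inter> (primes U T - supp U T a)"
        by (rule amax[OF ab 1]) (use 2 in blast)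
      moreover have "Q' \<in> Supp U T t" "Q' \<in> supp U T a" using Q(2) unfolding Z_def by blast+
      ultimately have "Q' \<in> supp U T (a \<boxtimes> b)" using QP(2) by blast
      then show ?thesis using prime_tensor_iff[OF QP(2) a b(1)] unfolding supp_def by blast
    qed
    obtain Q where Q: "Q \<in> supp U T a \<inter> Z" using aZ by blast
    have QP: "Q \<in> primes U T" using Q ZP by blast
    have uniq: "Q' = Q" if Q': "Q' \<in> supp U T a \<inter> Z" for Q'
    proof -
      have "Q \<subseteq> compacts U T" "Q' \<subseteq> compacts U T"
        using thick_idealD(1)[OF primesD(1)] QP ZP Q' by blast+
      then show ?thesis using sub[OF Q Q'] sub[OF Q' Q] by blast
    qed
    have aO: "a \<in> Ob T" using a by simp
    define v where "v = (t \<boxtimes> a) \<boxtimes> RickL U T Y"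
    have vO: "v \<in> Ob T" unfolding v_def using t aO by simp
    have Suppv: "Supp U T (v \<boxtimes> y) \<subseteq> {Q}" if y: "y \<in> Ob T" for y
    proof
      fix P assume P: "P \<in> Supp U T (v \<boxtimes> y)"
      have O: "(a \<boxtimes> RickL U T Y) \<boxtimes> y \<in> Ob T" "(t \<boxtimes> RickL U T Y) \<boxtimes> y \<in> Ob T" "(t \<boxtimes> a) \<boxtimes> y \<in> Ob T"
        using t aO y by simp_all
      note perm = tensor_permute[OF t aO Rick_Ob(2)[of Y] y, folded v_def]
      have 1: "P \<in> Supp U T t" using Supp_tensor_subset[OF t O(1) perm(1)] P by blast
      have "P \<in> Supp U T a" using Supp_tensor_subset[OF aO O(2) perm(2)] P by blast
      moreover have "a \<in> compacts_on U T (supp U T a)" unfolding compacts_on_def using a by blast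
      ultimately have 2: "P \<in> supp U T a"
        using Supp_Loc_compacts_on[OF thomason_supp[OF a]] Loc_incl by blast
      have "P \<in> Supp U T (RickL U T Y)"
        using Supp_tensor_subset[OF Rick_Ob(2) O(3) perm(3)] P by blast
      then have 3: "P \<notin> Y" using Supp_RickL[OF Y] by blast
      show "P \<in> {Q}" using uniq 1 2 3 unfolding Z_def by blast
    qed
    obtain W where W: "W \<in> \<W>" "Q \<in> W" using cover QP by auto
    obtain Y1 Y2 where Y12: "thomason (Spc U T) Y1" "thomason (Spc U T) Y2" "W = Y1 \<inter> (primes U T - Y2)"
      "vis_idem U T W = RickG U T Y1 \<boxtimes> RickL U T Y2" using vis_idem \<W> W(1) by metis
    have QY: "Q \<in> Y1" "Q \<notin> Y2" using W(2) Y12(3) by blast+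
    \<comment> \<open>the two parts of \<open>v\<close> that vanish by detection: off \<open>Y1\<close>, and on \<open>Y2\<close>\<close>
    have "Supp U T (v \<boxtimes> RickL U T Y1) \<subseteq> Supp U T (RickL U T Y1)"
      using Supp_tensor_subset[OF Rick_Ob(2) vO tensor_comm_isomorphic[OF vO Rick_Ob(2)]] .
    then have "Supp U T (v \<boxtimes> RickL U T Y1) = {}"
      using Suppv[OF Rick_Ob(2)] Supp_RickL[OF Y12(1) QY(1)] by blast
    then have z1: "zero_ob T (v \<boxtimes> RickL U T Y1)" using detect vO by simp
    have "Supp U T (v \<boxtimes> RickG U T Y2) \<subseteq> Supp U T (RickG U T Y2)"
      using Supp_tensor_subset[OF Rick_Ob(1) vO tensor_comm_isomorphic[OF vO Rick_Ob(1)]] .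
    then have "Supp U T (v \<boxtimes> RickG U T Y2) = {}"
      using Suppv[OF Rick_Ob(1)] Supp_Loc_compacts_on[OF Y12(2) RickG_Loc] QY(2) by blast
    then have "zero_ob T (v \<boxtimes> RickG U T Y2)" using detect vO by simp
    then have "zero_ob T ((v \<boxtimes> RickG U T Y2) \<boxtimes> RickG U T Y1)" by (rule zero_ob_tensor(1)) simp
    moreover have "isomorphic T ((v \<boxtimes> RickG U T Y2) \<boxtimes> RickG U T Y1) ((v \<boxtimes> RickG U T Y1) \<boxtimes> RickG U T Y2)"
      using tensor_permute(4)[OF vO Rick_Ob(1) Rick_Ob(1) Unit_Ob] .
    ultimately have "zero_ob T ((v \<boxtimes> RickG U T Y1) \<boxtimes> RickG U T Y2)" using zero_ob_isomorphic by blast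
    then have g2: "(v \<boxtimes> RickG U T Y1) \<boxtimes> RickG U T Y2 \<in> S" using tri_subcatD(2)[OF S'] by blast
    have "t \<boxtimes> (RickG U T Y1 \<boxtimes> RickL U T Y2) \<in> S" using incl W(1) Y12(4) by force
    then have "(a \<boxtimes> RickL U T Y) \<boxtimes> (t \<boxtimes> (RickG U T Y1 \<boxtimes> RickL U T Y2)) \<in> S"
      using ideal aO unfolding tensor_ideal_def by simp
    moreover have "isomorphic T ((a \<boxtimes> RickL U T Y) \<boxtimes> (t \<boxtimes> (RickG U T Y1 \<boxtimes> RickL U T Y2)))
        ((v \<boxtimes> RickG U T Y1) \<boxtimes> RickL U T Y2)"
      unfolding v_def using tensor_permute_five[OF t aO Rick_Ob(2) Rick_Ob(1) Rick_Ob(2)] .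
    ultimately have l2: "(v \<boxtimes> RickG U T Y1) \<boxtimes> RickL U T Y2 \<in> S" using Siso by blast
    \<comment> \<open>reassemble \<open>v\<close> by the Rickard triangles of \<open>Y2\<close> and \<open>Y1\<close>, then \<open>t \<otimes> a\<close> by that of \<open>Y\<close>\<close>
    have "v \<boxtimes> RickG U T Y1 \<in> S" by (rule tri_subcat_tensor_Rick[OF S' _ g2 l2]) (use vO in simp)
    moreover have "v \<boxtimes> RickL U T Y1 \<in> S" using z1 tri_subcatD(2)[OF S'] by blast
    ultimately have vS: "v \<in> S" using tri_subcat_tensor_Rick[OF S' vO] by blast
    have "a \<boxtimes> (t \<boxtimes> RickG U T Y) \<in> S" using ideal tG aO unfolding tensor_ideal_def by simp
    moreover have "isomorphic T (a \<boxtimes> (t \<boxtimes> RickG U T Y)) ((t \<boxtimes> a) \<boxtimes> RickG U T Y)"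
      using tensor_permute(5)[OF aO t Rick_Ob(1) Unit_Ob] .
    ultimately have "(t \<boxtimes> a) \<boxtimes> RickG U T Y \<in> S" using Siso by blast
    then have "t \<boxtimes> a \<in> S" using tri_subcat_tensor_Rick[OF S'] vS t aO unfolding v_def by simp
    then have "a \<in> J" unfolding J_def using a by blast
    then have "Q \<in> Y" unfolding Y_def using Q by blast
    then show False using Q unfolding Z_def by blast
  qed
  then show "t \<in> Locid U T {t \<boxtimes> vis_idem U T W | W. W \<in> \<W>}"
    unfolding Locid_def tensor_ideal_def by blast
qed

end

theorem corollary3p8:
  fixes U :: "'u set"
    and T :: "('o, 'm) ttcat"
    and M :: "('u, 'mo, 'mm, 's, 'do, 'dm) tt_model"
    and t :: 'o
  assumes "universe U"
    and "rigidly_compactly_generated U T"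
    and "detection_property U T"
    and "is_model_for U M T"
    and "t \<in> Ob T"
    and "noetherian_space (subtopology (Spc U T) (Supp U T t))"
  shows "local_to_global U T t"
proof -
  interpret rigidly_compactly_generated_category T U
    using assms(1,2) by unfold_locales
  show ?thesis
    using local_to_global_noetherian_Supp[OF assms(3,5,6)] .
qed

end
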